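(* Let $n\ge 1$ be an integer, let $\ell\ge 1$, $\alpha,\beta,\gamma>0$ and $\rho,\eta\in\mathbb{R}$. For $1\le p,q\le\infty$, the Bergman projection $P_\alpha$ maps $L^{p}_{\beta,\rho}$ boundedly to $L^{q}_{\gamma,\eta}$ if and only if one of the following conditions holds: (i) $0<\alpha^2/(2\alpha-\beta)<\gamma$; (ii) $\alpha^2/(2\alpha-\beta)=\gamma$, $p\le q$ and $\rho-\eta\ge 2n(\ell-1)\left(\frac1p-\frac1q\right)$; (iii) $\alpha^2/(2\alpha-\beta)=\gamma$, $q<p$ and $\rho-\eta>2n\left(\frac1q-\frac1p\right)$.
   Context: $dV$ is Lebesgue measure on $\mathbb{C}^n$ normalized so that the unit ball has measure 1, and $1/\infty=0$. For $1\le p<\infty$, $\alpha>0$, $\rho\in\mathbb{R}$, $L^p_{\alpha,\rho}$ (depending also on $\ell$) is the space of measurable functions $f$ on $\mathbb{C}^n$ with $\|f\|^p_{L^p_{\alpha,\rho}}=\int_{\mathbb{C}^n}\bigl|f(z)(1+|z|)^{\rho}e^{-\frac{\alpha}{2}|z|^{2\ell}}\bigr|^p\,dV(z)<\infty$; $L^\infty_{\alpha,\rho}$ is the space of measurable $f$ with $\|f\|_{L^\infty_{\alpha,\rho}}=\operatorname{ess\,sup}_{z}|f(z)|(1+|z|)^\rho e^{-\frac{\alpha}{2}|z|^{2\ell}}<\infty$. Put $L^2_\alpha=L^2_{\alpha,0}$ with inner product $\langle f,g\rangle_\alpha=\int_{\mathbb{C}^n}f\overline{g}e^{-\alpha|z|^{2\ell}}dV$;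 $F^2_\alpha$ is its closed subspace of entire functions. The Bergman projection $P_\alpha$ is the orthogonal projection of $L^2_\alpha$ onto $F^2_\alpha$; it is given by $P_\alpha f(z)=\int_{\mathbb{C}^n}f(w)K_\alpha(z,w)e^{-\alpha|w|^{2\ell}}dV(w)$, where $K_\alpha(z,w)=H_\alpha\bigl(\sum_j z_j\overline{w}_j\bigr)$ is the reproducing (Bergman) kernel of $F^2_\alpha$, with $H_\alpha(\lambda)=\frac{\ell\alpha^{n/\ell}}{n!}\sum_{k\ge0}\frac{(n-1+k)!}{k!}\frac{\alpha^{k/\ell}\lambda^k}{\Gamma((k+n)/\ell)}$. "$P_\alpha$ maps $L^p_{\beta,\rho}$ boundedly to $L^q_{\gamma,\eta}$" means that for every $f\in L^p_{\beta,\rho}$ this integral converges absolutely for every $z\in\mathbb{C}^n$ and $\|P_\alpha f\|_{L^q_{\gamma,\eta}}\le C\|f\|_{L^p_{\beta,\rho}}$ with $C$ independent of $f$. When $\beta=2\alpha$ none of the conditions (i)–(iii) is considered to hold. *)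

theory Defs
  imports "HOL-Probability.Essential_Supremum"
begin

text \<open>
  The space \<open>\<complex>\<^sup>n\<close> is \<open>complex ^ 'n\<close> with \<open>n = CARD('n)\<close>; its norm is the Euclidean one.
  The exponents \<open>p\<close>, \<open>q\<close> range over \<open>ennreal\<close>, so that \<open>\<infinity>\<close> is allowed.
\<close>

definition dV :: "(complex ^ 'n) measure" where
  "dV = scale_measure (1 / emeasure lebesgue (ball (0 :: complex ^ 'n) 1)) lebesgue"

definition wt :: "real \<Rightarrow> real \<Rightarrow> real \<Rightarrow> complex ^ 'n \<Rightarrow> real" where
  "wt l \<alpha> \<rho> z = (1 + norm z) powr \<rho> * exp (- (\<alpha> / 2) * norm z powr (2 * l))"

text \<open>
  The finiteness condition and the norm are kept apart: \<open>L_norm\<close> is the norm only for members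
  of \<open>L_space\<close>, since \<open>enn2real \<infinity> = 0\<close>.
\<close>

definition L_space :: "ennreal \<Rightarrow> real \<Rightarrow> real \<Rightarrow> real \<Rightarrow> (complex ^ 'n \<Rightarrow> complex) set" where
  "L_space p l \<alpha> \<rho> = {f \<in> borel_measurable lebesgue.
     if p = \<infinity> then esssup dV (\<lambda>z. ennreal (norm (f z) * wt l \<alpha> \<rho> z)) < \<infinity>
     else (\<integral>\<^sup>+z. ennreal ((norm (f z) * wt l \<alpha> \<rho> z) powr enn2real p) \<partial>dV) < \<infinity>}"

definition L_norm :: "ennreal \<Rightarrow> real \<Rightarrow> real \<Rightarrow> real \<Rightarrow> (complex ^ 'n \<Rightarrow> complex) \<Rightarrow> real" where
  "L_norm p l \<alpha> \<rho> f =
     (if p = \<infinity> then enn2real (esssup dV (\<lambda>z. ennreal (norm (f z) * wt l \<alpha> \<rho> z)))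
      else enn2real (\<integral>\<^sup>+z. ennreal ((norm (f z) * wt l \<alpha> \<rho> z) powr enn2real p) \<partial>dV)
             powr (1 / enn2real p))"

definition bergman_H :: "nat \<Rightarrow> real \<Rightarrow> real \<Rightarrow> complex \<Rightarrow> complex" where
  "bergman_H n l \<alpha> t = complex_of_real (l * \<alpha> powr (n / l) / fact n) *
     (\<Sum>k. complex_of_real (fact (n - 1 + k) / fact k * \<alpha> powr (k / l) / Gamma ((k + n) / l)) * t ^ k)"

definition bergman_kernel :: "real \<Rightarrow> real \<Rightarrow> complex ^ 'n \<Rightarrow> complex ^ 'n \<Rightarrow> complex" where
  "bergman_kernel l \<alpha> z w = bergman_H CARD('n) l \<alpha> (\<Sum>j\<in>UNIV. z $ j * cnj (w $ j))"

definition bergman_integrand ::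
  "real \<Rightarrow> real \<Rightarrow> (complex ^ 'n \<Rightarrow> complex) \<Rightarrow> complex ^ 'n \<Rightarrow> complex ^ 'n \<Rightarrow> complex" where
  "bergman_integrand l \<alpha> f z w =
     f w * bergman_kernel l \<alpha> z w * complex_of_real (exp (- \<alpha> * norm w powr (2 * l)))"

text \<open>
  The orthogonal projection of \<open>L\<^sup>2\<^sub>\<alpha>\<close> onto \<open>F\<^sup>2\<^sub>\<alpha>\<close> in its integral form; the latter is what
  makes sense on spaces other than \<open>L\<^sup>2\<^sub>\<alpha>\<close>.
\<close>

definition bergman_projection ::
  "real \<Rightarrow> real \<Rightarrow> (complex ^ 'n \<Rightarrow> complex) \<Rightarrow> complex ^ 'n \<Rightarrow> complex" where
  "bergman_projection l \<alpha> f z = (\<integral>w. bergman_integrand l \<alpha> f z w \<partial>dV)"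

text \<open>
  Bochner integrability of the integrand is absolute convergence of the integral.  The type
  argument selects the dimension, which the remaining arguments do not determine.
\<close>

definition maps_boundedly ::
  "'n::finite itself \<Rightarrow> real \<Rightarrow> real \<Rightarrow> ennreal \<Rightarrow> real \<Rightarrow> real \<Rightarrow> ennreal \<Rightarrow> real \<Rightarrow> real \<Rightarrow> bool" where
  "maps_boundedly (_ :: 'n::finite itself) l \<alpha> p \<beta> \<rho> q \<gamma> \<eta> \<longleftrightarrow>
     (\<exists>C::real. \<forall>f :: complex ^ 'n \<Rightarrow> complex. f \<in> L_space p l \<beta> \<rho> \<longrightarrow>
        (\<forall>z. integrable dV (bergman_integrand l \<alpha> f z)) \<and>
        bergman_projection l \<alpha> f \<in> L_space q l \<gamma> \<eta> \<and>
        L_norm q l \<gamma> \<eta> (bergman_projection l \<alpha> f) \<le> C * L_norm p l \<beta> \<rho> f)"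

text \<open>\<open>1/p\<close> as a real number, with \<open>1/\<infinity> = 0\<close>.\<close>

definition recip :: "ennreal \<Rightarrow> real" where
  "recip p = enn2real (1 / p)"

end

theory Submission
  imports Defs "HOL-Real_Asymp.Real_Asymp"
begin

text \<open>
  Write \<open>g = \<alpha>\<^sup>2 / (2\<alpha> - \<beta>)\<close>.  For \<open>\<beta> < 2\<alpha>\<close>, rescaling the two variables by \<open>g\<close> and \<open>2\<alpha> - \<beta>\<close> turns the
  projection, with the exponential weights \<open>\<beta>\<close> and \<open>g\<close> absorbed, into the integral operator whose kernel is
  the Bergman kernel \<open>k\<close> normalized by Gaussian-type factors.  This kernel satisfies
  \<open>\<bar>k(z, w)\<bar> \<le> C R powr (2 n (l - 1)) (1 + R powr (l - 1) \<bar>z - w\<bar>) powr (- M)\<close> with \<open>R = 1 + \<bar>z\<bar>\<close>, for every \<open>M\<close>:  the entire function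
  \<open>H\<close> is dominated by its values at \<open>max 0 (Re \<lambda>)\<close>, where it grows like \<open>\<lambda> powr (n (l - 1)) exp (\<lambda> powr l)\<close>.
  Schur's test, the pointwise bound, interpolation between the two and Hoelder's inequality give the sufficiency
  for \<open>\<gamma> = g\<close>, and a larger \<open>\<gamma>\<close> absorbs every polynomial weight.

  For the necessity, a kernel function at \<open>\<zeta>\<close>, cut off to a tube of radius \<open>R powr (1 - l)\<close>, has a projection
  which is large in the mean on such a tube, by the reproducing formula.  One such function as \<open>\<bar>\<zeta>\<bar> \<rightarrow> \<infinity>\<close> gives
  the condition for \<open>p \<le> q\<close>; for \<open>q < p\<close> one takes sums with random signs over disjoint tubes in many dyadic shells.
  As polynomial weights do not help if \<open>\<gamma> < g\<close>, this case is excluded as well.  For \<open>\<beta> \<ge> 2\<alpha>\<close> the function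
  \<open>exp (\<beta>/2 \<bar>w\<bar> powr (2 l)) (1 + \<bar>w\<bar>) powr (- N)\<close> belongs to the space, but its projection integral converges absolutely
  only if \<open>H\<close> is a polynomial, as its high Taylor coefficients show.
\<close>

section \<open>Growth of the kernel series\<close>

text \<open>The obstacle is the phase of \<open>cinner z w\<close>. As the Taylor coefficients of H
  are positive, termwise estimates bound \<open>bH\<close> at t only by its value at the modulus of
  t, and this shows no decay when w is near a unimodular multiple of z. Decay in the distance of z
  and w needs the real part of t in place of the modulus; it comes from a recurrence,
  \<open>ml_disc_rec\<close>, whose coefficients have the right sign because 1/l \<le> 1. The
  exponents come from volumes. At a point with R = 1 + |z| the kernel has height about R^(2n(l-1))
  and lives on a ball of radius about R^(1-l), whose volume is the reciprocal of that height. Hence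
  row and column integrals are uniformly bounded, and passing from p to a larger q costs
  R^(2n(l-1)(1/p - 1/q)). A shell of radius r holds about r^(2nl) such balls, of total volume r^(2n)
  whatever l is; this is why l is absent from the condition for q < p.\<close>

lemma Gamma_log_convex:
  fixes x y t :: real
  assumes "x > 0" "y > 0" "0 \<le> t" "t \<le> 1"
  shows "Gamma ((1 - t) * x + t * y) \<le> Gamma x powr (1 - t) * Gamma y powr t"
proof -
  have pos: "(1 - t) * x + t * y > 0"
  proof (cases "t = 1")
    case False
    then have "(1 - t) * x > 0" using assms by simp
    then show ?thesis using assms by (simp add: add_pos_nonneg)
  qed (use assms in simp)
  have "ln (Gamma ((1 - t) * x + t * y)) \<le> (1 - t) * ln (Gamma x) + t * ln (Gamma y)"
    using convex_onD[OF log_convex_Gamma_real, of t x y] assms by (simp add: o_def)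
  then have "exp (ln (Gamma ((1 - t) * x + t * y))) \<le> exp ((1 - t) * ln (Gamma x) + t * ln (Gamma y))"
    by simp
  then show ?thesis
    using Gamma_real_pos[OF pos] Gamma_real_pos[of x] Gamma_real_pos[of y] assms
    by (simp add: exp_add powr_def less_imp_neq[THEN not_sym] del: Gamma_real_pos)
qed

text \<open>Log-convexity at m + 2, which lies between x = m + 1 + f and x + 1, combined with Gamma
  (x + 1) = x Gamma x. The factorial is the value at m + 2.\<close>

lemma Gamma_lower_fact:
  fixes f :: real
  assumes "0 \<le> f" "f \<le> 1"
  shows "fact (m + 1) \<le> Gamma (real m + 1 + f) * (real m + 1 + f) powr (1 - f)"
proof -
  let ?x = "real m + 1 + f"
  have x: "?x > 0" using assms by simp
  have "Gamma ((1 - (1 - f)) * ?x + (1 - f) * (?x + 1)) \<le> Gamma ?x powr (1 - (1 - f)) * Gamma (?x + 1) powr (1 - f)"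
    using assms x by (intro Gamma_log_convex) auto
  also have "(1 - (1 - f)) * ?x + (1 - f) * (?x + 1) = 1 + real (m + 1)"
    by (simp add: algebra_simps)
  also have "Gamma (1 + real (m + 1)) = fact (m + 1)" by (rule Gamma_fact)
  also have "Gamma (?x + 1) = ?x * Gamma ?x"
    using x by (intro Gamma_plus1) (auto elim!: nonpos_Ints_cases)
  also have "Gamma ?x powr (1 - (1 - f)) * (?x * Gamma ?x) powr (1 - f)
      = (Gamma ?x powr f * Gamma ?x powr (1 - f)) * ?x powr (1 - f)"
    using x Gamma_real_pos[OF x] by (simp add: powr_mult mult_ac)
  also have "Gamma ?x powr f * Gamma ?x powr (1 - f) = Gamma ?x"
    using Gamma_real_pos[OF x] by (simp flip: powr_add)
  finally show ?thesis .
qed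

text \<open>The opposite direction interpolates between the integer arguments m + 1 and m +
  2.\<close>

lemma Gamma_upper_fact:
  fixes f :: real
  assumes "0 \<le> f" "f \<le> 1"
  shows "Gamma (real m + 1 + f) \<le> fact m * (real m + 1) powr f"
proof -
  have "Gamma ((1 - f) * (1 + real m) + f * (1 + real (m + 1))) \<le> Gamma (1 + real m) powr (1 - f) * Gamma (1 + real (m + 1)) powr f"
    using assms by (intro Gamma_log_convex) auto
  also have "(1 - f) * (1 + real m) + f * (1 + real (m + 1)) = real m + 1 + f"
    by (simp add: algebra_simps)
  also have "Gamma (1 + real m) = fact m" by (rule Gamma_fact)
  also have "Gamma (1 + real (m + 1)) = fact m * (real m + 1)" by (subst Gamma_fact) simp
  also have "fact m powr (1 - f) * (fact m * (real m + 1)) powr f = (fact m powr (1 - f) * fact m powr f) * (real m + 1) powr f"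
    by (simp add: powr_mult mult_ac)
  also have "fact m powr (1 - f) * fact m powr f = (fact m :: real)"
    by (simp flip: powr_add)
  finally show ?thesis .
qed

text \<open>A term of the exponential series at a real index is controlled by the terms at the two
  neighbouring integers. This allows a series over the non-integer indices \<tau> of
  \<open>ml_partial_sum_bound\<close> to be compared with exp y.\<close>

lemma powr_div_Gamma_upper:
  fixes \<tau> y :: real
  assumes "\<tau> \<ge> 0" "y > 0"
  defines "m \<equiv> nat \<lfloor>\<tau>\<rfloor>"
  shows "y powr \<tau> / Gamma (\<tau> + 1) \<le> 2 * (y ^ m / fact m + y ^ (m + 1) / fact (m + 1))"
proof -
  define f where "f = \<tau> - m"
  have f: "0 \<le> f" "f \<le> 1" and tau: "\<tau> = real m + f"
    using assms unfolding f_def m_def by (auto simp: le_floor_iff) linarith+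
  let ?M = "real m + 1"
  have G: "Gamma (\<tau> + 1) > 0" using assms by simp
  have L: "fact (m + 1) \<le> Gamma (\<tau> + 1) * (?M + f) powr (1 - f)"
    using Gamma_lower_fact[OF f, of m] by (simp add: tau add_ac)
  have "(?M + f) powr (1 - f) \<le> (2 * ?M) powr (1 - f)"
    using f by (intro powr_mono2) auto
  also have "\<dots> = 2 powr (1 - f) * ?M powr (1 - f)" by (rule powr_mult)
  also have "\<dots> \<le> 2 * ?M powr (1 - f)"
    using f powr_mono[of "1 - f" 1 2] by (intro mult_right_mono) auto
  finally have "fact (m + 1) \<le> Gamma (\<tau> + 1) * (2 * ?M powr (1 - f))"
    using L G by (meson mult_left_mono less_imp_le order_trans)
  then have A: "1 / Gamma (\<tau> + 1) \<le> 2 * ?M powr (1 - f) / fact (m + 1)"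
    using G divide_right_mono[of "fact (m + 1)" "Gamma (\<tau> + 1) * (2 * ?M powr (1 - f))" "Gamma (\<tau> + 1) * fact (m + 1)"]
    by (simp del: fact_Suc of_nat_Suc)
  \<comment> \<open>A weighted geometric mean is at most the sum. The summands y and m + 1 then
    produce the terms of index m + 1 and m.\<close>
  have B: "y powr f * ?M powr (1 - f) \<le> y + ?M"
  proof -
    have "y powr f * ?M powr (1 - f) \<le> (y + ?M) powr f * (y + ?M) powr (1 - f)"
      using f assms(2) by (intro mult_mono powr_mono2) auto
    also have "\<dots> = y + ?M" using assms(2) by (simp flip: powr_add)
    finally show ?thesis .
  qed
  have "y powr \<tau> / Gamma (\<tau> + 1) = y powr \<tau> * (1 / Gamma (\<tau> + 1))" by simp
  also have "\<dots> \<le> y powr \<tau> * (2 * ?M powr (1 - f) / fact (m + 1))"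
    by (intro mult_left_mono A) simp
  also have "\<dots> = 2 * (y ^ m / fact (m + 1)) * (y powr f * ?M powr (1 - f))"
  proof -
    have "y powr \<tau> = y ^ m * y powr f"
      using assms(2) by (subst tau) (simp add: powr_add powr_realpow)
    then show ?thesis by simp
  qed
  also have "\<dots> \<le> 2 * (y ^ m / fact (m + 1)) * (y + ?M)"
    using assms(2) by (intro mult_left_mono B) auto
  also have "\<dots> = 2 * (y ^ m / fact m + y ^ (m + 1) / fact (m + 1))"
    by (simp add: divide_simps) (simp add: algebra_simps)
  finally show ?thesis .
qed

text \<open>The minimum covers both regimes: for y \<ge> m + 1 nothing is lost against the term of
  index m, otherwise at most the factor y / (m + 1) that leads to the next term.\<close>

lemma powr_div_Gamma_lower:
  fixes \<tau> y :: real
  assumes "\<tau> \<ge> 0" "y > 0" "real m \<le> \<tau>" "\<tau> \<le> real m + 1"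
  shows "y ^ m / fact m * min 1 (y / (real m + 1)) \<le> y powr \<tau> / Gamma (\<tau> + 1)"
proof -
  define f where "f = \<tau> - m"
  have f: "0 \<le> f" "f \<le> 1" and tau: "\<tau> = real m + f"
    using assms unfolding f_def by auto
  let ?M = "real m + 1"
  have G: "Gamma (\<tau> + 1) > 0" using assms by simp
  have L: "Gamma (\<tau> + 1) \<le> fact m * ?M powr f"
    using Gamma_upper_fact[OF f, of m] by (simp add: tau add_ac)
  have q: "min 1 (y / ?M) \<le> (y / ?M) powr f"
  proof (cases "y / ?M \<le> 1")
    case True
    then have "(y / ?M) powr 1 \<le> (y / ?M) powr f"
      using assms f by (intro powr_mono') auto
    then show ?thesis using assms by simp
  next
    case False
    then show ?thesis using f ge_one_powr_ge_zero[of "y / ?M" f] by auto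
  qed
  have "y ^ m / fact m * min 1 (y / ?M) \<le> y ^ m / fact m * (y / ?M) powr f"
    using assms by (intro mult_left_mono q) auto
  also have "\<dots> = y powr \<tau> / (fact m * ?M powr f)"
    using assms by (simp add: tau powr_add powr_realpow powr_divide)
  also have "\<dots> \<le> y powr \<tau> / Gamma (\<tau> + 1)"
    using L G by (intro divide_left_mono) auto
  finally show ?thesis .
qed

text \<open>Cutting by the minimum costs at most a factor 3. Terms whose index plus 1 is at most y
  are not cut. Any other term is compared with the cut predecessor b': from index y on it equals b',
  and the single term just below y is at most twice b'.\<close>

lemma exp_le_truncated_sum:
  fixes y :: real
  assumes "y \<ge> 1"
  defines "b \<equiv> \<lambda>m. y ^ m / fact m * min 1 (y / (real m + 1))"
  shows "summable b" "exp y \<le> 3 * suminf b"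
proof -
  let ?a = "\<lambda>m. y ^ m / fact m"
  have sa: "?a sums exp y"
    using exp_converges[of y] by (simp add: field_simps)
  have b0: "b m \<ge> 0" for m using assms(1) by (simp add: b_def)
  have ba: "b m \<le> ?a m" for m
    using assms(1) unfolding b_def by (intro mult_left_le) auto
  show sb: "summable b"
    by (rule summable_comparison_test'[OF sums_summable[OF sa], of 0]) (use b0 ba in auto)
  define b' where "b' m = (case m of 0 \<Rightarrow> 0 | Suc j \<Rightarrow> b j)" for m
  have "?a j \<le> b j + 2 * b' j" for j
  proof (cases "real j + 1 \<le> y")
    case True
    then have "b j = ?a j" by (simp add: b_def)
    moreover have "b' j \<ge> 0" using b0 by (auto simp: b'_def split: nat.split)
    ultimately show ?thesis by simp
  next
    case False
    then obtain i where j: "j = Suc i" using assms(1) by (cases j) auto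
    have s: "?a j = ?a i * (y / j)" by (simp add: j mult_ac)
    have a0: "?a i \<ge> 0" using assms(1) by simp
    have "?a j \<le> 2 * b' j"
    proof (cases "y \<le> real j")
      case True
      then have "b i = ?a j" unfolding s by (simp add: b_def j field_simps)
      then have "b' j = ?a j" by (simp add: b'_def j)
      moreover have "?a j \<ge> 0" using assms(1) by simp
      ultimately show ?thesis by linarith
    next
      case F: False
      then have "b i = ?a i" by (simp add: b_def j field_simps)
      moreover have "y / j \<le> 2" using False j by (simp add: field_simps)
      ultimately show ?thesis unfolding s using mult_left_mono[OF _ a0, of "y / j" 2]
        by (simp add: b'_def j mult_ac)
    qed
    then show ?thesis using b0[of j] by simp
  qed
  moreover have sb': "b' sums suminf b"
    using sums_Suc_iff[of b' "suminf b"] summable_sums[OF sb] by (simp add: b'_def)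
  ultimately have "exp y \<le> suminf b + 2 * suminf b"
    using sums_le[OF _ sa sums_add[OF summable_sums[OF sb] sums_mult[OF sb', of 2]]] by simp
  then show "exp y \<le> 3 * suminf b" by simp
qed

section \<open>Kernel coefficients and the growth of the series on the positive axis\<close>

lemma pochhammer_ge_power: "(x::real) \<ge> 0 \<Longrightarrow> x ^ j \<le> pochhammer x j"
  unfolding pochhammer_prod using prod_mono[of "{0..<j}" "\<lambda>_. x" "\<lambda>i. x + real i"] by simp

lemma pochhammer_le_power: "(x::real) \<ge> 0 \<Longrightarrow> pochhammer x j \<le> (x + real j - 1) ^ j"
  unfolding pochhammer_prod using prod_mono[of "{0..<j}" "\<lambda>i. x + real i" "\<lambda>_. x + real j - 1"] by simp

text \<open>The coefficients of \<open>H\<^sub>\<alpha>\<close> for \<open>\<alpha> = 1\<close>, up to the constant factor.\<close>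

definition ml_coeff :: "nat \<Rightarrow> real \<Rightarrow> nat \<Rightarrow> real" where
  "ml_coeff n l k = fact (n - 1 + k) / fact k / Gamma ((real k + real n) / l)"

lemma ml_coeff_pos: "n \<ge> 1 \<Longrightarrow> l > 0 \<Longrightarrow> ml_coeff n l k > 0"
  by (auto simp: ml_coeff_def intro!: divide_pos_pos Gamma_real_pos)

lemma ml_coeff_nonneg: "n \<ge> 1 \<Longrightarrow> l \<ge> 1 \<Longrightarrow> ml_coeff n l k \<ge> 0"
  using ml_coeff_pos[of n l k] by simp

lemma fact_ratio_pochhammer: "n \<ge> 1 \<Longrightarrow> fact (n - 1 + k) / fact k = pochhammer (real k + 1) (n - 1)"
  using pochhammer_product'[of "1::real" k "n - 1"]
  by (simp add: add_ac pochhammer_fact[symmetric])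

text \<open>Since (k + n) / l = \<tau> + n, the Gamma value splits into
  \<open>pochhammer (\<tau> + 1) (n - 1)\<close> and Gamma (\<tau> + 1). The numerator is a
  Pochhammer symbol of the same length with argument k + 1, and k + n = l (\<tau> + n) makes the two
  comparable, so only a constant is left.\<close>

lemma ml_coeff_upper:
  assumes "n \<ge> 1" "l \<ge> 1" "\<tau> = (real k + real n) / l - real n" "\<tau> \<ge> 0"
  shows "ml_coeff n l k \<le> (l * real n) ^ (n - 1) / Gamma (\<tau> + 1)"
proof -
  have t: "(real k + real n) / l = \<tau> + 1 + real (n - 1)" using assms by (simp add: of_nat_diff)
  have nn: "\<tau> + 1 \<notin> \<int>\<^sub>\<le>\<^sub>0" using assms by (auto elim!: nonpos_Ints_cases)
  have G: "Gamma ((real k + real n) / l) = pochhammer (\<tau> + 1) (n - 1) * Gamma (\<tau> + 1)"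
    using pochhammer_Gamma[OF nn, of "n - 1"] assms(4) Gamma_real_pos[of "\<tau> + 1"]
    by (simp add: t add_ac less_imp_neq[THEN not_sym] del: Gamma_real_pos)
  have "real k + real n = l * (\<tau> + real n)" using assms by (simp add: field_simps)
  also have "\<dots> \<le> l * (real n * (\<tau> + 1))"
    using assms(1,2,4) mult_right_mono[of 1 "real n" \<tau>]
    by (intro mult_left_mono) (auto simp: algebra_simps)
  finally have kn: "real k + real n \<le> l * real n * (\<tau> + 1)" by simp
  have "pochhammer (real k + 1) (n - 1) \<le> (real k + 1 + real (n - 1) - 1) ^ (n - 1)"
    by (intro pochhammer_le_power) simp
  also have "\<dots> \<le> (l * real n * (\<tau> + 1)) ^ (n - 1)"
    using kn assms by (intro power_mono) (auto simp: of_nat_diff)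
  also have "\<dots> = (l * real n) ^ (n - 1) * (\<tau> + 1) ^ (n - 1)" by (simp add: power_mult_distrib)
  also have "\<dots> \<le> (l * real n) ^ (n - 1) * pochhammer (\<tau> + 1) (n - 1)"
    using assms by (intro mult_left_mono pochhammer_ge_power) auto
  finally have P: "pochhammer (real k + 1) (n - 1) \<le> (l * real n) ^ (n - 1) * pochhammer (\<tau> + 1) (n - 1)" .
  have pp: "pochhammer (\<tau> + 1) (n - 1) > 0" using assms by (intro pochhammer_pos) simp
  have "ml_coeff n l k = pochhammer (real k + 1) (n - 1) / (pochhammer (\<tau> + 1) (n - 1) * Gamma (\<tau> + 1))"
    unfolding ml_coeff_def G fact_ratio_pochhammer[OF assms(1)] ..
  also have "\<dots> \<le> (l * real n) ^ (n - 1) * pochhammer (\<tau> + 1) (n - 1) / (pochhammer (\<tau> + 1) (n - 1) * Gamma (\<tau> + 1))"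
    using P pp assms by (intro divide_right_mono) auto
  also have "\<dots> = (l * real n) ^ (n - 1) / Gamma (\<tau> + 1)" using pp by simp
  finally show ?thesis .
qed

lemma ml_coeff_lower:
  assumes "n \<ge> 1" "l \<ge> 1" "\<tau> = (real k + real n) / l - real n" "\<tau> \<ge> 0"
  shows "(1 / real n) ^ (n - 1) / Gamma (\<tau> + 1) \<le> ml_coeff n l k"
proof -
  have t: "(real k + real n) / l = \<tau> + 1 + real (n - 1)" using assms by (simp add: of_nat_diff)
  have nn: "\<tau> + 1 \<notin> \<int>\<^sub>\<le>\<^sub>0" using assms by (auto elim!: nonpos_Ints_cases)
  have G: "Gamma ((real k + real n) / l) = pochhammer (\<tau> + 1) (n - 1) * Gamma (\<tau> + 1)"
    using pochhammer_Gamma[OF nn, of "n - 1"] assms(4) Gamma_real_pos[of "\<tau> + 1"]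
    by (simp add: t add_ac less_imp_neq[THEN not_sym] del: Gamma_real_pos)
  have "\<tau> + real n \<le> real k + real n"
    using assms(2) mult_left_mono[of 1 l "real k + real n"] unfolding assms(3) by (simp add: divide_le_eq)
  also have "\<dots> \<le> real n * (real k + 1)"
    using assms(1) mult_right_mono[of 1 "real n" "real k"] by (simp add: algebra_simps)
  finally have kn: "\<tau> + real n \<le> real n * (real k + 1)" .
  have pp: "pochhammer (\<tau> + 1) (n - 1) > 0" using assms by (intro pochhammer_pos) simp
  have "pochhammer (\<tau> + 1) (n - 1) \<le> (\<tau> + 1 + real (n - 1) - 1) ^ (n - 1)"
    using assms(4) by (intro pochhammer_le_power) simp
  also have "\<dots> \<le> (real n * (real k + 1)) ^ (n - 1)"
    using kn assms(1,4) by (intro power_mono) (auto simp: of_nat_diff)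
  also have "\<dots> = real n ^ (n - 1) * (real k + 1) ^ (n - 1)" by (simp add: power_mult_distrib)
  also have "\<dots> \<le> real n ^ (n - 1) * pochhammer (real k + 1) (n - 1)"
    by (intro mult_left_mono pochhammer_ge_power) auto
  finally have P: "(1 / real n) ^ (n - 1) * pochhammer (\<tau> + 1) (n - 1) \<le> pochhammer (real k + 1) (n - 1)"
    using assms(1) by (simp add: field_simps power_divide)
  have "(1 / real n) ^ (n - 1) / Gamma (\<tau> + 1) =
     (1 / real n) ^ (n - 1) * pochhammer (\<tau> + 1) (n - 1) / (pochhammer (\<tau> + 1) (n - 1) * Gamma (\<tau> + 1))"
    using pp by simp
  also have "\<dots> \<le> pochhammer (real k + 1) (n - 1) / (pochhammer (\<tau> + 1) (n - 1) * Gamma (\<tau> + 1))"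
    using P pp assms by (intro divide_right_mono) auto
  also have "\<dots> = ml_coeff n l k"
    unfolding ml_coeff_def G fact_ratio_pochhammer[OF assms(1)] ..
  finally show ?thesis .
qed

text \<open>Everything rests on l \<tau> = k - s with s = n (l - 1): it gives x^k = x^s y^\<tau> for
  y = x^l, a polynomial factor times a term of the exponential series at a real index. Partial sums
  are estimated because convergence is only deduced from this bound.\<close>

lemma ml_partial_sum_bound:
  assumes "n \<ge> 1" "l \<ge> 1"
  obtains C where "C > 0"
    "\<And>x K. x \<ge> 0 \<Longrightarrow> (\<Sum>k<K. ml_coeff n l k * x ^ k) \<le> C * (1 + x) powr (real n * (l - 1)) * exp (x powr l)"
proof -
  define s where "s = real n * (l - 1)"
  have s0: "s \<ge> 0" using assms by (simp add: s_def)
  define A where "A = (\<Sum>k<nat \<lceil>s\<rceil>. ml_coeff n l k)"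
  define D where "D = (l * real n) ^ (n - 1)"
  have D0: "D \<ge> 0" using assms by (simp add: D_def)
  define C where "C = A + D * (l + 1) * 4 + ml_coeff n l 0"
  have A0: "A \<ge> 0" unfolding A_def using assms ml_coeff_pos[of n l] by (intro sum_nonneg) (simp add: less_imp_le)
  have C0: "C > 0" unfolding C_def using A0 D0 assms ml_coeff_pos[of n l 0] by (intro add_nonneg_pos add_nonneg_nonneg mult_nonneg_nonneg) auto
  have main: "(\<Sum>k<K. ml_coeff n l k * x ^ k) \<le> C * (1 + x) powr s * exp (x powr l)" if "x \<ge> 0" for x K
  proof (cases "x = 0")
    case True
    have "(\<Sum>k<K. ml_coeff n l k * x ^ k) \<le> ml_coeff n l 0"
      using True assms ml_coeff_pos[of n l 0] by (cases K) (auto simp: sum.lessThan_Suc_shift)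
    also have "\<dots> \<le> C" unfolding C_def using A0 D0 assms by simp
    finally show ?thesis using True by simp
  next
    case False
    then have x: "x > 0" using that by simp
    define y where "y = x powr l"
    have y: "y > 0" using x by (simp add: y_def)
    define \<tau> where "\<tau> k = (real k + real n) / l - real n" for k
    have tau: "l * \<tau> k = real k - s" for k
      using assms by (simp add: \<tau>_def s_def field_simps)
    define S where "S = {k. k < K \<and> \<tau> k \<ge> 0}"
    define g where "g m = 2 * (y ^ m / fact m + y ^ (m + 1) / fact (m + 1))" for m :: nat
    have g0: "g m \<ge> 0" for m using y by (simp add: g_def)
    have e: "(\<lambda>m. y ^ m / fact m) sums exp y" using exp_converges[of y] by (simp add: field_simps)
    have e': "(\<lambda>m. y ^ (m + 1) / fact (m + 1)) sums (exp y - 1)"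
      using sums_Suc_iff[of "\<lambda>m. y ^ m / fact m" "exp y - 1"] e by simp
    have gs: "g sums (2 * (exp y + (exp y - 1)))"
      unfolding g_def by (intro sums_mult sums_add e e')
    \<comment> \<open>A negative \<tau> means k < s. These are finitely many indices, and their
      powers of x are absorbed by (1 + x)^s.\<close>
    have small: "ml_coeff n l k * x ^ k \<le> ml_coeff n l k * (1 + x) powr s" if "\<tau> k < 0" for k
    proof -
      have "l * \<tau> k < 0" using that assms by (simp add: mult_less_0_iff)
      then have "real k \<le> s" using tau[of k] by simp
      then have "(1 + x) ^ k \<le> (1 + x) powr s" using x by (simp flip: powr_realpow add: powr_mono)
      moreover have "x ^ k \<le> (1 + x) ^ k" using x by (intro power_mono) auto
      ultimately show ?thesis using ml_coeff_pos[of n l k] assms by (intro mult_left_mono) auto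
    qed
    have big: "ml_coeff n l k * x ^ k \<le> D * x powr s * g (nat \<lfloor>\<tau> k\<rfloor>)" if "\<tau> k \<ge> 0" for k
    proof -
      have xk: "x ^ k = x powr s * y powr \<tau> k"
        using x tau[of k] by (simp add: y_def powr_powr flip: powr_realpow powr_add)
      have "ml_coeff n l k * x ^ k \<le> D / Gamma (\<tau> k + 1) * x ^ k"
        unfolding D_def using that x assms
        by (intro mult_right_mono ml_coeff_upper) (auto simp: \<tau>_def)
      also have "\<dots> = D * x powr s * (y powr \<tau> k / Gamma (\<tau> k + 1))" by (simp add: xk)
      also have "\<dots> \<le> D * x powr s * g (nat \<lfloor>\<tau> k\<rfloor>)"
        unfolding g_def using that y D0 by (intro mult_left_mono powr_div_Gamma_upper) auto
      finally show ?thesis .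
    qed
    \<comment> \<open>Successive \<tau> differ by 1 / l, so at most l + 1 of them share an integer
      part and each term of the exponential series is charged boundedly often.\<close>
    have cardm: "real (card {k \<in> S. nat \<lfloor>\<tau> k\<rfloor> = m}) \<le> l + 1" for m
    proof -
      define c where "c = s + l * real m"
      have c0: "c \<ge> 0" using s0 assms by (simp add: c_def)
      have "{k \<in> S. nat \<lfloor>\<tau> k\<rfloor> = m} \<subseteq> {nat \<lceil>c\<rceil>..<nat \<lceil>c\<rceil> + nat \<lceil>l\<rceil>}"
      proof
        fix k assume "k \<in> {k \<in> S. nat \<lfloor>\<tau> k\<rfloor> = m}"
        then have k: "\<tau> k \<ge> 0" "nat \<lfloor>\<tau> k\<rfloor> = m" by (auto simp: S_def)
        then have "real m \<le> \<tau> k" "\<tau> k < real m + 1" by linarith+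
        then have "l * real m \<le> l * \<tau> k" "l * \<tau> k < l * (real m + 1)" using assms by auto
        then have "c \<le> real k" "real k < c + l" using tau[of k] by (auto simp: c_def algebra_simps)
        then show "k \<in> {nat \<lceil>c\<rceil>..<nat \<lceil>c\<rceil> + nat \<lceil>l\<rceil>}"
          using c0 assms by (auto simp: nat_le_iff ceiling_le_iff) linarith+
      qed
      then have "card {k \<in> S. nat \<lfloor>\<tau> k\<rfloor> = m} \<le> nat \<lceil>l\<rceil>"
        using card_mono[of "{nat \<lceil>c\<rceil>..<nat \<lceil>c\<rceil> + nat \<lceil>l\<rceil>}"] by fastforce
      then show ?thesis using assms by linarith
    qed
    have fS: "finite S" by (simp add: S_def)
    have "(\<Sum>k\<in>S. g (nat \<lfloor>\<tau> k\<rfloor>)) = (\<Sum>m\<in>(\<lambda>k. nat \<lfloor>\<tau> k\<rfloor>) ` S. \<Sum>k | k \<in> S \<and> nat \<lfloor>\<tau> k\<rfloor> = m. g (nat \<lfloor>\<tau> k\<rfloor>))"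
      by (rule sum.image_gen[OF fS])
    also have "\<dots> = (\<Sum>m\<in>(\<lambda>k. nat \<lfloor>\<tau> k\<rfloor>) ` S. real (card {k \<in> S. nat \<lfloor>\<tau> k\<rfloor> = m}) * g m)"
      by (intro sum.cong) auto
    also have "\<dots> \<le> (\<Sum>m\<in>(\<lambda>k. nat \<lfloor>\<tau> k\<rfloor>) ` S. (l + 1) * g m)"
      by (intro sum_mono mult_right_mono cardm g0)
    also have "\<dots> = (l + 1) * (\<Sum>m\<in>(\<lambda>k. nat \<lfloor>\<tau> k\<rfloor>) ` S. g m)" by (simp add: sum_distrib_left)
    also have "\<dots> \<le> (l + 1) * (2 * (exp y + (exp y - 1)))"
      using sum_le_suminf[of g "(\<lambda>k. nat \<lfloor>\<tau> k\<rfloor>) ` S"] gs g0 fS assms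
      by (intro mult_left_mono) (auto simp: sums_iff)
    also have "\<dots> \<le> (l + 1) * (4 * exp y)" using assms by (intro mult_left_mono) auto
    finally have SS: "(\<Sum>k\<in>S. g (nat \<lfloor>\<tau> k\<rfloor>)) \<le> (l + 1) * 4 * exp y" by (simp only: mult.assoc)
    have "(\<Sum>k<K. ml_coeff n l k * x ^ k) = (\<Sum>k\<in>S. ml_coeff n l k * x ^ k) + (\<Sum>k\<in>{..<K} - S. ml_coeff n l k * x ^ k)"
      by (subst sum.subset_diff[of S]) (auto simp: S_def)
    also have "(\<Sum>k\<in>S. ml_coeff n l k * x ^ k) \<le> (\<Sum>k\<in>S. D * x powr s * g (nat \<lfloor>\<tau> k\<rfloor>))"
      by (intro sum_mono big) (auto simp: S_def)
    also have "\<dots> = D * x powr s * (\<Sum>k\<in>S. g (nat \<lfloor>\<tau> k\<rfloor>))" by (simp add: sum_distrib_left)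
    also have "\<dots> \<le> D * x powr s * ((l + 1) * 4 * exp y)"
      using D0 by (intro mult_left_mono SS) auto
    also have "\<dots> \<le> D * (1 + x) powr s * ((l + 1) * 4 * exp y)"
      using D0 x s0 assms by (intro mult_right_mono mult_left_mono powr_mono2) auto
    also have "(\<Sum>k\<in>{..<K} - S. ml_coeff n l k * x ^ k) \<le> (\<Sum>k\<in>{..<K} - S. ml_coeff n l k * (1 + x) powr s)"
      by (intro sum_mono small) (auto simp: S_def)
    also have "\<dots> \<le> (\<Sum>k<nat \<lceil>s\<rceil>. ml_coeff n l k * (1 + x) powr s)"
    proof (intro sum_mono2)
      show "{..<K} - S \<subseteq> {..<nat \<lceil>s\<rceil>}"
      proof
        fix k assume "k \<in> {..<K} - S"
        then have "\<tau> k < 0" by (auto simp: S_def)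
        then have "l * \<tau> k < 0" using assms by (simp add: mult_less_0_iff)
        then have "real k < s" using tau[of k] by simp
        then show "k \<in> {..<nat \<lceil>s\<rceil>}" by simp linarith
      qed
    qed (auto intro!: mult_nonneg_nonneg ml_coeff_nonneg assms)
    also have "\<dots> = A * (1 + x) powr s" by (simp add: A_def sum_distrib_right)
    also have "\<dots> \<le> A * (1 + x) powr s * exp y"
      using A0 y mult_left_mono[of 1 "exp y" "A * (1 + x) powr s"] by simp
    also have "D * (1 + x) powr s * ((l + 1) * 4 * exp y) + A * (1 + x) powr s * exp y \<le> C * (1 + x) powr s * exp y"
      unfolding C_def using ml_coeff_pos[of n l 0] assms by (simp add: algebra_simps)
    finally show ?thesis by (simp add: y_def)
  qed
  show ?thesis using that[OF C0] main unfolding s_def by blast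
qed

lemma summable_ml:
  assumes "n \<ge> 1" "l \<ge> 1" "x \<ge> 0"
  shows "summable (\<lambda>k. ml_coeff n l k * x ^ k)"
proof -
  obtain C where "C > 0" "\<And>x K. x \<ge> 0 \<Longrightarrow> (\<Sum>k<K. ml_coeff n l k * x ^ k) \<le> C * (1 + x) powr (real n * (l - 1)) * exp (x powr l)"
    using ml_partial_sum_bound[OF assms(1,2)] by blast
  then show ?thesis
    using assms by (intro summableI_nonneg_bounded[where x="C * (1 + x) powr (real n * (l - 1)) * exp (x powr l)"]
      mult_nonneg_nonneg ml_coeff_nonneg) auto
qed

lemma ml_upper_bound:
  assumes "n \<ge> 1" "l \<ge> 1"
  obtains C where "C > 0"
    "\<And>x. x \<ge> 0 \<Longrightarrow> (\<Sum>k. ml_coeff n l k * x ^ k) \<le> C * (1 + x) powr (real n * (l - 1)) * exp (x powr l)"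
proof -
  obtain C where "C > 0" "\<And>x K. x \<ge> 0 \<Longrightarrow> (\<Sum>k<K. ml_coeff n l k * x ^ k) \<le> C * (1 + x) powr (real n * (l - 1)) * exp (x powr l)"
    using ml_partial_sum_bound[OF assms] by blast
  then show ?thesis using that suminf_le_const[OF summable_ml[OF assms]] by blast
qed

text \<open>All terms are nonnegative, so keeping one index for each integer part of \<tau> is
  enough; the kept terms dominate the truncated exponential series of
  \<open>exp_le_truncated_sum\<close>.\<close>

lemma ml_lower_bound:
  assumes "n \<ge> 1" "l \<ge> 1"
  obtains c where "c > 0"
    "\<And>x. x \<ge> 0 \<Longrightarrow> c * (1 + x) powr (real n * (l - 1)) * exp (x powr l) \<le> (\<Sum>k. ml_coeff n l k * x ^ k)"
proof -
  define s where "s = real n * (l - 1)"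
  have s0: "s \<ge> 0" using assms by (simp add: s_def)
  define d where "d = (1 / real n) ^ (n - 1)"
  have d0: "d > 0" using assms by (simp add: d_def)
  \<comment> \<open>The first entry serves x \<le> 1, where the constant term alone suffices. The
    second serves x > 1: the 3 comes from the truncated exponential series, the power of 1/2 from (1
    + x) / 2 \<le> x.\<close>
  define c where "c = min (ml_coeff n l 0 * (1/2) powr s * exp (-1)) (d * (1/2) powr s / 3)"
  have c0: "c > 0" using d0 ml_coeff_pos[of n l 0] assms by (simp add: c_def)
  have "c * (1 + x) powr s * exp (x powr l) \<le> (\<Sum>k. ml_coeff n l k * x ^ k)" if x0: "x \<ge> 0" for x
  proof (cases "x \<le> 1")
    case True
    have "c * (1 + x) powr s * exp (x powr l) \<le> (ml_coeff n l 0 * (1/2) powr s * exp (-1)) * 2 powr s * exp 1"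
      using True x0 s0 assms c0 powr_mono2[of l x 1] ml_coeff_pos[of n l 0]
      by (intro mult_mono powr_mono2) (auto simp: c_def)
    also have "\<dots> = ml_coeff n l 0 * ((1/2) powr s * 2 powr s) * (exp (-1) * exp 1)" by simp
    also have "\<dots> = ml_coeff n l 0" by (simp flip: powr_mult exp_add)
    also have "\<dots> = (\<Sum>k<1. ml_coeff n l k * x ^ k)" by simp
    also have "\<dots> \<le> (\<Sum>k. ml_coeff n l k * x ^ k)"
      using x0 assms by (intro sum_le_suminf summable_ml) (auto intro!: mult_nonneg_nonneg ml_coeff_nonneg)
    finally show ?thesis .
  next
    case False
    then have x: "x > 1" by simp
    define y where "y = x powr l"
    have y: "y \<ge> 1" using x assms by (simp add: y_def ge_one_powr_ge_zero)
    define b where "b m = y ^ m / fact m * min 1 (y / (real m + 1))" for m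
    have sb: "summable b" and eb: "exp y \<le> 3 * suminf b"
      using exp_le_truncated_sum[OF y] unfolding b_def by auto
    \<comment> \<open>The first index with \<tau> \<ge> m. As l \<ge> 1, rounding up moves \<tau> by
      at most 1, and distinct m give distinct indices.\<close>
    define K where "K m = nat \<lceil>l * real m + s\<rceil>" for m :: nat
    have sm: "strict_mono K"
    proof (rule strict_monoI_Suc)
      fix m
      have "l * real m + s + 1 \<le> l * real (Suc m) + s" using assms by (simp add: algebra_simps)
      moreover have "l * real m + s \<ge> 0" using assms s0 by simp
      ultimately show "K m < K (Suc m)" unfolding K_def by linarith
    qed
    let ?f = "\<lambda>k. ml_coeff n l k * x ^ k"
    have sf: "summable ?f" using x assms by (intro summable_ml) auto
    have f0: "?f k \<ge> 0" for k using x assms ml_coeff_pos[of n l k] by (intro mult_nonneg_nonneg) auto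
    have inj: "inj K" using sm by (rule strict_mono_imp_inj_on)
    have bd: "d * x powr s * b m \<le> (?f \<circ> K) m" for m
    proof -
      define \<tau> where "\<tau> = (real (K m) + real n) / l - real n"
      have lt: "l * \<tau> = real (K m) - s" using assms by (simp add: \<tau>_def s_def field_simps)
      have "l * real m + s \<ge> 0" using assms s0 by simp
      then have K: "l * real m + s \<le> real (K m)" "real (K m) \<le> l * real m + s + 1"
        unfolding K_def by linarith+
      then have "l * real m \<le> l * \<tau>" using lt by linarith
      moreover have "l * \<tau> \<le> l * real m + l" using K lt assms(2) by linarith
      then have "l * \<tau> \<le> l * (real m + 1)" by (simp only: distrib_left mult_1_right)
      ultimately have t: "real m \<le> \<tau>" "\<tau> \<le> real m + 1" using assms(2) by (metis mult_left_le_imp_le less_le_trans zero_less_one)+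
      then have t0: "\<tau> \<ge> 0" by simp
      have xk: "x ^ K m = x powr s * y powr \<tau>"
        using x lt by (simp add: y_def powr_powr flip: powr_realpow powr_add)
      have "d * x powr s * b m \<le> d * x powr s * (y powr \<tau> / Gamma (\<tau> + 1))"
        unfolding b_def using d0 y t t0 by (intro mult_left_mono powr_div_Gamma_lower) auto
      also have "\<dots> = d / Gamma (\<tau> + 1) * x ^ K m" by (simp add: xk)
      also have "\<dots> \<le> ml_coeff n l (K m) * x ^ K m"
        unfolding d_def using t0 x assms by (intro mult_right_mono ml_coeff_lower) (auto simp: \<tau>_def)
      finally show ?thesis by simp
    qed
    have "c * (1 + x) powr s * exp y \<le> (d * (1/2) powr s / 3) * (1 + x) powr s * (3 * suminf b)"
      using eb c0 d0 by (intro mult_mono) (auto simp: c_def)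
    also have "\<dots> = d * ((1/2) powr s * (1 + x) powr s) * suminf b" by simp
    also have "(1/2) powr s * (1 + x) powr s = ((1 + x) / 2) powr s" by (simp flip: powr_mult)
    also have "d * ((1 + x) / 2) powr s * suminf b \<le> d * x powr s * suminf b"
      using x d0 s0 sb y by (intro mult_right_mono mult_left_mono powr_mono2 suminf_nonneg) (auto simp: b_def)
    also have "\<dots> = (\<Sum>m. d * x powr s * b m)" using sb by (simp add: suminf_mult)
    also have "\<dots> \<le> suminf (?f \<circ> K)"
      by (intro suminf_le bd summable_mult sb summable_reindex[OF sf inj f0])
    also have "\<dots> \<le> suminf ?f" by (rule suminf_reindex_mono[OF sf inj f0])
    finally show ?thesis by (simp add: y_def)
  qed
  then show ?thesis using that[OF c0] unfolding s_def by blast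
qed

section \<open>The kernel is dominated by its values on the positive axis\<close>

text \<open>The coefficients in (1 - u)^(-a) (1 - u)^(-b) = (1 - u)^(-a-b). With a = -s it describes
  the multiplication of a generating function by (1 - u)^s.\<close>

lemma poch_vandermonde:
  fixes a b :: real
  shows "(\<Sum>i\<le>N. (pochhammer a i / fact i) * (pochhammer b (N - i) / fact (N - i))) = pochhammer (a + b) N / fact N"
proof -
  have "pochhammer (a + b) N / fact N = (\<Sum>i\<le>N. real (N choose i) * pochhammer a i * pochhammer b (N - i) / fact N)"
    by (simp add: pochhammer_binomial_sum sum_divide_distrib)
  also have "\<dots> = (\<Sum>i\<le>N. (pochhammer a i / fact i) * (pochhammer b (N - i) / fact (N - i)))"
    by (intro sum.cong) (auto simp: binomial_fact field_simps)
  finally show ?thesis ..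
qed

lemma summable_poly_geometric:
  fixes x :: real
  assumes "0 \<le> x" "x < 1"
  shows "summable (\<lambda>j. (real j + real K) ^ M * x ^ j)"
proof -
  \<comment> \<open>y replaces x to keep the logarithm finite at x = 0. Half of the geometric decay
    of y^j pays for the polynomial, which is at most a constant times exp (e (j + K)).\<close>
  define y where "y = (x + 1) / 2"
  have y: "0 < y" "y < 1" "x \<le> y" using assms by (auto simp: y_def)
  define e where "e = - ln y / 2"
  have e: "e > 0" using y by (simp add: e_def)
  have bd: "norm ((real j + real K) ^ M * x ^ j) \<le> fact M / e ^ M * exp (e * K) * (exp (ln y / 2)) ^ j" for j
  proof -
    let ?u = "e * (real j + real K)"
    have u0: "?u \<ge> 0" using e by simp
    have "?u ^ M / fact M \<le> exp ?u"
      using sum_le_suminf[OF summable_exp_generic[of ?u], of "{M}"] u0 by (simp add: exp_def divide_inverse mult.commute)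
    then have "(real j + real K) ^ M \<le> fact M / e ^ M * exp ?u"
      using e by (simp only: power_mult_distrib) (simp add: pos_divide_le_eq pos_le_divide_eq mult_ac)
    moreover have "x ^ j \<le> y ^ j" using y assms by (intro power_mono) auto
    ultimately have "(real j + real K) ^ M * x ^ j \<le> fact M / e ^ M * exp ?u * y ^ j"
      using assms y e by (intro mult_mono) auto
    also have "\<dots> = fact M / e ^ M * exp (e * K) * (exp (e * real j) * y ^ j)"
      by (simp add: distrib_left exp_add)
    also have "exp (e * real j) * y ^ j = exp (ln y / 2) ^ j"
    proof -
      have "exp (e * real j) * y ^ j = (exp e * exp (ln y)) ^ j" using y by (simp add: power_mult_distrib exp_of_nat2_mult mult.commute)
      also have "exp e * exp (ln y) = exp (ln y / 2)" by (simp add: e_def flip: exp_add)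
      finally show ?thesis .
    qed
    finally show ?thesis using assms by simp
  qed
  show ?thesis
    using y by (intro summable_comparison_test'[OF _ bd] summable_mult summable_geometric) auto
qed

text \<open>
  The numbers \<open>ml_disc s n N j\<close> are the coefficients of \<open>c\<^sup>j u\<^sup>N\<close> in \<open>((1 - u)\<^sup>s - c)\<^sup>-\<^sup>n\<close>.
\<close>

definition ml_disc :: "real \<Rightarrow> nat \<Rightarrow> nat \<Rightarrow> nat \<Rightarrow> real" where
  "ml_disc s n N j = real ((j + n - 1) choose j) * (pochhammer (s * real (j + n)) N / fact N)"

lemma ml_disc_nonneg: "s > 0 \<Longrightarrow> ml_disc s n N j \<ge> 0"
  unfolding ml_disc_def pochhammer_prod by (intro mult_nonneg_nonneg divide_nonneg_nonneg prod_nonneg) auto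

text \<open>For fixed n and N both factors of the coefficient are polynomially bounded in j, so the
  series converges in the unit disc.\<close>

lemma summable_ml_disc:
  assumes "0 < s" "s \<le> 1" "0 \<le> x" "x < 1"
  shows "summable (\<lambda>j. ml_disc s n N j * x ^ j)"
proof (rule summable_comparison_test'[OF summable_poly_geometric[OF assms(3,4), of "n + N" "n + N"]])
  fix j
  have "(j + n - 1) choose j \<le> (j + n) ^ n"
  proof (cases n)
    case (Suc m)
    have "(j + m) choose j = (j + m) choose m" using binomial_symmetric[of j "j + m"] by simp
    also have "\<dots> \<le> (j + m) ^ m" by (rule binomial_le_pow) simp
    also have "\<dots> \<le> (j + Suc m) ^ m" by (intro power_mono) auto
    also have "\<dots> \<le> (j + Suc m) ^ Suc m" by (intro power_increasing) auto
    finally show ?thesis using Suc by simp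
  qed (cases j, auto simp: binomial_eq_0)
  then have "real ((j + n - 1) choose j) \<le> real ((j + n) ^ n)" by (subst of_nat_le_iff)
  also have "\<dots> \<le> (real j + real (n + N)) ^ n" by (simp add: power_mono)
  finally have b1: "real ((j + n - 1) choose j) \<le> (real j + real (n + N)) ^ n" .
  have b2: "pochhammer (s * real (j + n)) N / fact N \<le> (real j + real (n + N)) ^ N"
  proof -
    have "pochhammer (s * real (j + n)) N = (\<Prod>i=0..<N. s * real (j + n) + real i)" by (simp add: pochhammer_prod)
    also have "\<dots> \<le> (\<Prod>i=0..<N. real j + real (n + N))"
    proof (rule prod_mono, safe)
      fix i assume "i \<in> {0..<N}"
      moreover have "s * real (j + n) \<le> 1 * real (j + n)" using assms by (intro mult_right_mono) auto
      ultimately show "s * real (j + n) + real i \<le> real j + real (n + N)" by simp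
    qed (use assms in auto)
    finally have "pochhammer (s * real (j + n)) N \<le> (real j + real (n + N)) ^ N" by simp
    moreover have "pochhammer (s * real (j + n)) N \<ge> 0" using assms by (auto simp: pochhammer_prod intro!: prod_nonneg)
    ultimately show ?thesis by (smt (verit) fact_ge_1 divide_le_eq_1 frac_le div_by_1)
  qed
  have "ml_disc s n N j \<le> (real j + real (n + N)) ^ n * (real j + real (n + N)) ^ N"
    unfolding ml_disc_def using assms by (intro mult_mono b1 b2) (auto simp: pochhammer_prod intro!: divide_nonneg_nonneg prod_nonneg)
  then show "norm (ml_disc s n N j * x ^ j) \<le> (real j + real (n + N)) ^ (n + N) * x ^ j"
    using assms ml_disc_nonneg[of s n N j] by (simp add: abs_mult power_add mult_right_mono)
qed

lemma summable_ml_disc_norm: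
  fixes c :: "'a :: {real_normed_field, banach}"
  assumes "0 < s" "s \<le> 1" "norm c < 1"
  shows "summable (\<lambda>j. of_real (ml_disc s n N j) * c ^ j)"
  using summable_ml_disc[OF assms(1,2) norm_ge_zero assms(3), of n N] ml_disc_nonneg[OF assms(1), of n N]
  by - (rule summable_norm_cancel, simp add: norm_mult norm_power)

definition ml_disc_sum :: "real \<Rightarrow> nat \<Rightarrow> nat \<Rightarrow> 'a \<Rightarrow> 'a::{real_normed_field, banach}" where
  "ml_disc_sum s n N c = (\<Sum>j. of_real (ml_disc s n N j) * c ^ j)"

text \<open>The zeroth power of the generating function is the constant 1. Truncated subtraction
  provides this: \<open>(j - 1) choose j\<close> is 1 for j = 0 and 0 otherwise.\<close>

lemma ml_disc_sum_0:
  "ml_disc_sum s 0 N c = (if N = 0 then 1 else 0)"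
proof -
  have "ml_disc s 0 N j = (if j = 0 then (if N = 0 then 1 else 0) else 0)" for j
    by (cases j; cases N) (auto simp: ml_disc_def pochhammer_0_left)
  then have "ml_disc_sum s 0 N c = (\<Sum>j. if j = 0 then (if N = 0 then 1 else 0) else 0)"
    unfolding ml_disc_sum_def by (intro suminf_cong) auto
  also have "\<dots> = (if N = 0 then 1 else 0)"
    using suminf_finite[of "{0}" "\<lambda>j. if j = 0 then (if N = 0 then 1 else 0) else (0::'a)"] by auto
  finally show ?thesis .
qed

text \<open>Multiply ((1 - u)^s - c)^(-n-1) by (1 - u)^s - c and compare the coefficients of u^N.
  Those of (1 - u)^s are \<open>pochhammer (- s) i / fact i\<close>; the one at i = 0 is 1 and forms
  the factor 1 - c, while the others move to the right with a minus sign.\<close>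

lemma ml_disc_rec:
  fixes c :: "'a :: {real_normed_field, banach}"
  assumes "0 < s" "s \<le> 1" "norm c < 1"
  shows "(1 - c) * ml_disc_sum s (Suc n) N c =
    ml_disc_sum s n N c + (\<Sum>i=1..N. of_real (- (pochhammer (- s) i / fact i)) * ml_disc_sum s (Suc n) (N - i) c)"
proof -
  let ?A = "\<lambda>i. pochhammer (- s) i / fact i"
  let ?P = "\<lambda>j. pochhammer (s * real (j + n)) N / fact N"
  note sm = summable_ml_disc_norm[OF assms]
  \<comment> \<open>Multiplication by (1 - u)^s: by Vandermonde's identity it lowers s (j + n + 1)
    to s (j + n) in every coefficient.\<close>
  have 1: "(\<Sum>i\<le>N. of_real (?A i) * ml_disc_sum s (Suc n) (N - i) c)
      = (\<Sum>j. of_real (real ((j + n) choose j) * ?P j) * c ^ j)"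
  proof -
    have "(\<Sum>i\<le>N. of_real (?A i) * ml_disc_sum s (Suc n) (N - i) c)
      = (\<Sum>i\<le>N. \<Sum>j. of_real (?A i) * (of_real (ml_disc s (Suc n) (N - i) j) * c ^ j))"
      unfolding ml_disc_sum_def by (simp only: suminf_mult[OF sm])
    also have "\<dots> = (\<Sum>j. \<Sum>i\<le>N. of_real (?A i) * (of_real (ml_disc s (Suc n) (N - i) j) * c ^ j))"
      by (intro suminf_sum[symmetric] summable_mult sm)
    also have "\<dots> = (\<Sum>j. of_real (\<Sum>i\<le>N. ?A i * ml_disc s (Suc n) (N - i) j) * c ^ j)"
      by (simp add: sum_distrib_right mult.assoc)
    also have "\<dots> = (\<Sum>j. of_real (real ((j + n) choose j) * ?P j) * c ^ j)"
    proof (intro suminf_cong arg_cong2[where f="(*)"] refl arg_cong[where f=of_real])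
      fix j
      have "(\<Sum>i\<le>N. ?A i * ml_disc s (Suc n) (N - i) j) =
        real ((j + n) choose j) * (\<Sum>i\<le>N. ?A i * (pochhammer (s * real (j + Suc n)) (N - i) / fact (N - i)))"
        by (simp add: ml_disc_def sum_distrib_left mult_ac)
      also have "(\<Sum>i\<le>N. ?A i * (pochhammer (s * real (j + Suc n)) (N - i) / fact (N - i))) = ?P j"
        unfolding poch_vandermonde by (simp add: algebra_simps)
      finally show "(\<Sum>i\<le>N. ?A i * ml_disc s (Suc n) (N - i) j) = real ((j + n) choose j) * ?P j" .
    qed
    finally show ?thesis .
  qed
  have sm1: "summable (\<lambda>j. of_real (real ((j + n) choose j) * ?P j) * c ^ j)"
  proof -
    have "summable (\<lambda>j. \<Sum>i\<le>N. of_real (?A i) * (of_real (ml_disc s (Suc n) (N - i) j) * c ^ j))"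
      by (intro summable_sum summable_mult sm)
    also have "(\<lambda>j. \<Sum>i\<le>N. of_real (?A i) * (of_real (ml_disc s (Suc n) (N - i) j) * c ^ j))
      = (\<lambda>j. of_real (real ((j + n) choose j) * ?P j) * c ^ j)"
    proof
      fix j
      have "(\<Sum>i\<le>N. of_real (?A i) * (of_real (ml_disc s (Suc n) (N - i) j) * c ^ j)) =
        of_real (real ((j + n) choose j) * (\<Sum>i\<le>N. ?A i * (pochhammer (s * real (j + Suc n)) (N - i) / fact (N - i)))) * c ^ j"
        by (simp add: ml_disc_def sum_distrib_left sum_distrib_right mult_ac)
      also have "(\<Sum>i\<le>N. ?A i * (pochhammer (s * real (j + Suc n)) (N - i) / fact (N - i))) = ?P j"
        unfolding poch_vandermonde by (simp add: algebra_simps)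
      finally show "(\<Sum>i\<le>N. of_real (?A i) * (of_real (ml_disc s (Suc n) (N - i) j) * c ^ j)) = of_real (real ((j + n) choose j) * ?P j) * c ^ j" .
    qed
    finally show ?thesis .
  qed
  \<comment> \<open>D is the series multiplied by c, shifted so that it can be subtracted termwise.
    Pascal's rule then turns the difference of the binomial coefficients into the one that belongs
    to n.\<close>
  define D where "D j = (case j of 0 \<Rightarrow> 0 | Suc i \<Rightarrow> of_real (ml_disc s (Suc n) N i) * c ^ Suc i)" for j
  have 2: "D sums (c * ml_disc_sum s (Suc n) N c)"
  proof -
    have "(\<lambda>j. c * (of_real (ml_disc s (Suc n) N j) * c ^ j)) sums (c * ml_disc_sum s (Suc n) N c)"
      unfolding ml_disc_sum_def by (intro sums_mult summable_sums sm)
    then have "(\<lambda>j. D (Suc j)) sums (c * ml_disc_sum s (Suc n) N c)"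
      by (simp add: D_def mult_ac)
    then show ?thesis by (subst (asm) sums_Suc_iff) (simp add: D_def)
  qed
  have "(\<lambda>j. of_real (real ((j + n) choose j) * ?P j) * c ^ j - D j) sums
     ((\<Sum>i\<le>N. of_real (?A i) * ml_disc_sum s (Suc n) (N - i) c) - c * ml_disc_sum s (Suc n) N c)"
    unfolding 1 by (intro sums_diff 2 summable_sums sm1)
  moreover have "of_real (real ((j + n) choose j) * ?P j) * c ^ j - D j = of_real (ml_disc s n N j) * c ^ j" for j
  proof (cases j)
    case 0
    then show ?thesis by (simp add: D_def ml_disc_def)
  next
    case (Suc i)
    have "real ((j + n) choose j) = real ((j + n - 1) choose j) + real ((i + n) choose i)"
      unfolding Suc by simp
    then show ?thesis by (simp add: D_def ml_disc_def Suc algebra_simps add_divide_distrib)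
  qed
  ultimately have "(\<lambda>j. of_real (ml_disc s n N j) * c ^ j) sums
     ((\<Sum>i\<le>N. of_real (?A i) * ml_disc_sum s (Suc n) (N - i) c) - c * ml_disc_sum s (Suc n) N c)" by simp
  then have "ml_disc_sum s n N c = (\<Sum>i\<le>N. of_real (?A i) * ml_disc_sum s (Suc n) (N - i) c) - c * ml_disc_sum s (Suc n) N c"
    unfolding ml_disc_sum_def by (simp add: sums_iff)
  moreover have "(\<Sum>i\<le>N. of_real (?A i) * ml_disc_sum s (Suc n) (N - i) c) =
     ml_disc_sum s (Suc n) N c + (\<Sum>i=1..N. of_real (?A i) * ml_disc_sum s (Suc n) (N - i) c)"
    by (subst atMost_atLeast0, subst sum.atLeast_Suc_atMost) auto
  ultimately show ?thesis by (simp add: algebra_simps sum_negf)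
qed

text \<open>A double induction on n and N along \<open>ml_disc_rec\<close>. All terms on its right
  enter with nonnegative coefficients, so the induction hypotheses add up, and dividing by 1 - c is
  harmless because |1 - c| \<ge> 1 - max 0 (Re c). This division is where the real part gets into
  the bound.\<close>

lemma ml_disc_ridge:
  fixes c :: complex
  assumes "0 < s" "s \<le> 1" "norm c < 1"
  shows "norm (ml_disc_sum s n N c) \<le> ml_disc_sum s n N (max 0 (Re c))"
proof (induction n arbitrary: N)
  case 0
  then show ?case by (simp add: ml_disc_sum_0)
next
  case (Suc n)
  define x where "x = max 0 (Re c)"
  have x: "norm x < 1" "0 \<le> x" "x < 1" using assms(3) abs_Re_le_cmod[of c] by (auto simp: x_def)
  have nc: "1 - x \<le> norm (1 - c)"
    using abs_Re_le_cmod[of "1 - c"] by (auto simp: x_def)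
  show ?case
  proof (induction N rule: less_induct)
    case (less N)
    \<comment> \<open>For i \<ge> 1 the Pochhammer symbol has the factor -s, and the remaining ones
      start with 1 - s, which is nonnegative since s \<le> 1.\<close>
    have A: "0 \<le> - (pochhammer (- s) i / fact i)" if "i \<ge> 1" for i
    proof -
      define m where "m = i - 1"
      have i: "i = Suc m" using that by (simp add: m_def)
      have "0 \<le> pochhammer (- s + 1) m" unfolding pochhammer_prod using assms by (intro prod_nonneg) auto
      then show ?thesis using assms by (simp add: i pochhammer_rec divide_nonpos_pos mult_nonneg_nonneg)
    qed
    have "norm (1 - c) * norm (ml_disc_sum s (Suc n) N c) = norm (ml_disc_sum s n N c + (\<Sum>i=1..N. of_real (- (pochhammer (- s) i / fact i)) * ml_disc_sum s (Suc n) (N - i) c))"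
      by (simp only: norm_mult[symmetric] ml_disc_rec[OF assms])
    also have "\<dots> \<le> norm (ml_disc_sum s n N c) + (\<Sum>i=1..N. norm (of_real (- (pochhammer (- s) i / fact i)) * ml_disc_sum s (Suc n) (N - i) c))"
      by (intro norm_triangle_le add_mono norm_sum order_refl)
    also have "\<dots> \<le> ml_disc_sum s n N x + (\<Sum>i=1..N. (- (pochhammer (- s) i / fact i)) * ml_disc_sum s (Suc n) (N - i) x)"
    proof (intro add_mono sum_mono)
      show "norm (ml_disc_sum s n N c) \<le> ml_disc_sum s n N x" using Suc.IH by (simp add: x_def)
      fix i assume i: "i \<in> {1..N}"
      have "norm (of_real (- (pochhammer (- s) i / fact i)) * ml_disc_sum s (Suc n) (N - i) c)
         = (- (pochhammer (- s) i / fact i)) * norm (ml_disc_sum s (Suc n) (N - i) c)"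
      proof -
        have "norm (of_real B * X) = B * norm X" if "B \<ge> 0" for B :: real and X :: complex
          using that by (simp add: norm_mult)
        then show ?thesis using A[of i] i by (metis atLeastAtMost_iff)
      qed
      also have "\<dots> \<le> (- (pochhammer (- s) i / fact i)) * ml_disc_sum s (Suc n) (N - i) x"
        using i A[of i] less.IH[of "N - i"] by (intro mult_left_mono) (auto simp: x_def)
      finally show "norm (of_real (- (pochhammer (- s) i / fact i)) * ml_disc_sum s (Suc n) (N - i) c) \<le> (- (pochhammer (- s) i / fact i)) * ml_disc_sum s (Suc n) (N - i) x" .
    qed
    also have "\<dots> = (1 - x) * ml_disc_sum s (Suc n) N x"
      using ml_disc_rec[OF assms(1,2) x(1), of n N] by simp
    finally have "norm (1 - c) * norm (ml_disc_sum s (Suc n) N c) \<le> (1 - x) * ml_disc_sum s (Suc n) N x" .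
    moreover have "(1 - x) * norm (ml_disc_sum s (Suc n) N c) \<le> norm (1 - c) * norm (ml_disc_sum s (Suc n) N c)"
      by (intro mult_right_mono nc) auto
    ultimately have "(1 - x) * norm (ml_disc_sum s (Suc n) N c) \<le> (1 - x) * ml_disc_sum s (Suc n) N x" by linarith
    then show ?case using x unfolding x_def[symmetric] by simp
  qed
qed

section \<open>From the generating function to the kernel series\<close>

lemma powr_tangent:
  fixes x p :: real
  assumes "x \<ge> 0" "p \<ge> 1"
  shows "1 + p * (x - 1) \<le> x powr p"
proof (cases "x = 0")
  case False
  have "(x powr p) powr (1 / p) * 1 powr (1 - 1 / p) \<le> (1 / p) * x powr p + (1 - 1 / p) * 1"
    using assms False by (intro Youngs_inequality_0) auto
  then have "x \<le> (1 / p) * x powr p + (1 - 1 / p)" using assms by (simp add: powr_powr)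
  then have "p * x \<le> p * ((1 / p) * x powr p + (1 - 1 / p))" using assms by (intro mult_left_mono) auto
  also have "\<dots> = x powr p + p - 1" using assms by (simp add: algebra_simps)
  finally show ?thesis by (simp add: algebra_simps)
qed (use assms in auto)

text \<open>The coefficient of u^N in (1 - u)^(-a), rescaled so that it converges to 1 / Gamma a by
  Gauss's limit formula.\<close>

definition poch_ratio :: "real \<Rightarrow> nat \<Rightarrow> real" where
  "poch_ratio a N = real N powr (1 - a) * (pochhammer a N / fact N)"

lemma poch_ratio_LIMSEQ:
  assumes "a > 0"
  shows "poch_ratio a \<longlonglongrightarrow> 1 / Gamma a"
proof -
  have "(\<lambda>N. rGamma_series a N * (real N / (real N + a))) \<longlonglongrightarrow> rGamma a * 1"
    by (intro tendsto_mult rGamma_series_LIMSEQ) real_asymp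
  moreover have "eventually (\<lambda>N. rGamma_series a N * (real N / (real N + a)) = poch_ratio a N) sequentially"
    using eventually_gt_at_top[of 0]
  proof eventually_elim
    case (elim N)
    have "real N + a > 0" using assms by simp
    moreover have "rGamma_series a N = pochhammer a N * (real N + a) / (fact N * real N powr a)"
      using elim by (simp add: rGamma_series_def powr_def pochhammer_Suc add.commute mult.commute)
    ultimately have "rGamma_series a N * (real N / (real N + a)) = pochhammer a N / fact N * (real N / real N powr a)"
      by simp
    also have "real N / real N powr a = real N powr (1 - a)" using elim by (simp add: powr_diff)
    finally show ?case by (simp add: poch_ratio_def)
  qed
  ultimately have "poch_ratio a \<longlonglongrightarrow> rGamma a * 1"
    by (rule Lim_transform_eventually)
  then show ?thesis by (simp add: rGamma_inverse_Gamma inverse_eq_divide)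
qed

text \<open>Provides the domination for N tending to infinity: beyond any M the value at M is an
  upper bound. Successive quotients are at most 1 by Bernoulli's inequality with exponent a - 1
  \<ge> 1.\<close>

lemma poch_ratio_antimono:
  assumes "a \<ge> 2" "1 \<le> M" "M \<le> N"
  shows "poch_ratio a N \<le> poch_ratio a M"
  using assms(3)
proof (induction rule: dec_induct)
  case (step N)
  have N: "real N > 0" using step assms by simp
  define x where "x = 1 + 1 / real N"
  have x: "x \<ge> 1" by (simp add: x_def)
  have Sx: "real (Suc N) = real N * x" using N by (simp add: x_def field_simps)
  have "(a + real N) / real (Suc N) = 1 + (a - 1) / real (Suc N)" by (simp add: field_simps)
  also have "\<dots> \<le> 1 + (a - 1) * (x - 1)"
    using assms N unfolding x_def by (simp add: divide_simps) (simp add: algebra_simps)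
  also have "\<dots> \<le> x powr (a - 1)" using x assms by (intro powr_tangent) auto
  finally have r: "(a + real N) / real (Suc N) \<le> x powr (a - 1)" .
  have p0: "poch_ratio a N \<ge> 0" using assms by (auto simp: poch_ratio_def pochhammer_prod intro!: mult_nonneg_nonneg divide_nonneg_nonneg prod_nonneg)
  have "poch_ratio a (Suc N) = (real N * x) powr (1 - a) * (pochhammer a N * (a + real N) / (real (Suc N) * fact N))"
    by (simp only: poch_ratio_def Sx pochhammer_Suc fact_Suc of_nat_mult)
  also have "\<dots> = poch_ratio a N * (x powr (1 - a) * ((a + real N) / real (Suc N)))"
    using N x by (simp add: poch_ratio_def powr_mult mult_ac)
  also have "\<dots> \<le> poch_ratio a N * (x powr (1 - a) * x powr (a - 1))"
    by (intro mult_left_mono r p0) auto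
  also have "x powr (1 - a) * x powr (a - 1) = 1" using x by (simp flip: powr_add)
  finally show ?case using step by simp
qed simp

text \<open>N^(1 - s n) times the k-th power of N^(-s) is N^(1 - s (k + n)), the normalization in
  \<open>poch_ratio\<close> for a = s (k + n).\<close>

lemma ml_disc_scale:
  assumes "N \<ge> 1" "s > 0"
  shows "of_real (real N powr (1 - s * real n) * ml_disc s n N k) * (c * of_real (real N powr (- s))) ^ k
    = of_real (real ((k + n - 1) choose k) * poch_ratio (s * real (k + n)) N) * (c::'a::{real_normed_field,banach}) ^ k"
proof -
  have "real N powr (1 - s * real n) * (real N powr (- s)) ^ k = real N powr (1 - s * real (k + n))"
    using assms by (simp flip: powr_realpow powr_add add: powr_powr algebra_simps)
  then show ?thesis
    by (simp add: ml_disc_def poch_ratio_def power_mult_distrib mult_ac flip: of_real_power of_real_mult)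
qed

text \<open>Under this scaling each coefficient tends to that of the kernel series. Limit and sum
  are exchanged by Tannery's theorem, the majorant being the series at one fixed M.\<close>

lemma ml_disc_LIMSEQ:
  fixes c :: "'a :: {real_normed_field, banach}"
  assumes "0 < s" "s \<le> 1" "n \<ge> 1"
  shows "(\<lambda>N. of_real (real N powr (1 - s * real n)) * ml_disc_sum s n N (c * of_real (real N powr (- s))))
    \<longlonglongrightarrow> (\<Sum>k. of_real (real ((k + n - 1) choose k) / Gamma (s * real (k + n))) * c ^ k)"
proof -
  define a where "a k N = of_real (real ((k + n - 1) choose k) * poch_ratio (s * real (k + n)) N) * c ^ k" for k N
  define b where "b k = of_real (real ((k + n - 1) choose k) / Gamma (s * real (k + n))) * c ^ k" for k
  have lim: "(\<lambda>N. a k N) \<longlonglongrightarrow> b k" for k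
  proof -
    have "poch_ratio (s * real (k + n)) \<longlonglongrightarrow> 1 / Gamma (s * real (k + n))"
      using assms by (intro poch_ratio_LIMSEQ) auto
    then have "(\<lambda>N. a k N) \<longlonglongrightarrow> of_real (real ((k + n - 1) choose k) * (1 / Gamma (s * real (k + n)))) * c ^ k"
      unfolding a_def by (intro tendsto_mult tendsto_of_real tendsto_const)
    then show ?thesis by (simp add: b_def)
  qed
  have "((\<lambda>N. norm c * real N powr (- s)) \<longlongrightarrow> norm c * 0) sequentially"
    using assms by (intro tendsto_mult tendsto_const tendsto_neg_powr filterlim_real_sequentially) auto
  then have ev: "eventually (\<lambda>N. norm c * real N powr (- s) < 1) sequentially"
    by (intro order_tendstoD(2)) auto
  \<comment> \<open>M is so large that the scaled argument lies in the unit disc, where the series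
    converges absolutely.\<close>
  then obtain M where M: "M \<ge> 1" "norm c * real M powr (- s) < 1"
    using eventually_happens'[OF _ eventually_conj[OF ev eventually_ge_at_top[of 1]]] by auto
  define r where "r = norm c * real M powr (- s)"
  have r: "0 \<le> r" "r < 1" using M by (auto simp: r_def)
  define B where "B k = real M powr (1 - s * real n) * (ml_disc s n M k * r ^ k)" for k
  have sB: "summable B" unfolding B_def using assms r by (intro summable_mult summable_ml_disc) auto
  have bound: "norm (a k N) \<le> B k" if "N \<ge> M" "real k \<ge> 2 / s" for k N
  proof -
    have "2 \<le> s * real k" using that assms by (simp add: field_simps)
    also have "\<dots> \<le> s * real (k + n)" using assms by simp
    finally have 2: "2 \<le> s * real (k + n)" .
    have p0: "poch_ratio (s * real (k + n)) N \<ge> 0" using assms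
      by (auto simp: poch_ratio_def pochhammer_prod intro!: mult_nonneg_nonneg divide_nonneg_nonneg prod_nonneg)
    have "norm (a k N) = real ((k + n - 1) choose k) * poch_ratio (s * real (k + n)) N * norm c ^ k"
      using p0 by (simp add: a_def norm_mult norm_power)
    also have "\<dots> \<le> real ((k + n - 1) choose k) * poch_ratio (s * real (k + n)) M * norm c ^ k"
      using 2 M that by (intro mult_right_mono mult_left_mono poch_ratio_antimono) auto
    also have "\<dots> = B k"
      using ml_disc_scale[OF M(1) assms(1), of n k "norm c"] by (simp add: B_def r_def)
    finally show ?thesis .
  qed
  have "eventually (\<lambda>(k,N). norm (a k N) \<le> B k) (at_top \<times>\<^sub>F sequentially)"
    unfolding eventually_prod_filter
  proof (intro exI conjI allI impI)
    \<comment> \<open>Monotonicity in N is available for s (k + n) \<ge> 2 only, hence for large k,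
      and a majorant of the tail is all that is needed.\<close>
    show "eventually (\<lambda>k. real k \<ge> 2 / s) sequentially" by real_asymp
    show "eventually (\<lambda>N. N \<ge> M) sequentially" by (rule eventually_ge_at_top)
  qed (use bound in auto)
  from tannerys_theorem[OF lim this sB] have "(\<lambda>N. \<Sum>k. a k N) \<longlonglongrightarrow> suminf b" by simp
  moreover have "eventually (\<lambda>N. (\<Sum>k. a k N) = of_real (real N powr (1 - s * real n)) * ml_disc_sum s n N (c * of_real (real N powr (- s)))) sequentially"
    using eventually_conj[OF ev eventually_ge_at_top[of 1]]
  proof eventually_elim
    case (elim N)
    have sm: "summable (\<lambda>k. of_real (ml_disc s n N k) * (c * of_real (real N powr (- s))) ^ k)"
      using assms elim by (intro summable_ml_disc_norm) (auto simp: norm_mult)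
    have "(\<Sum>k. a k N) = (\<Sum>k. of_real (real N powr (1 - s * real n)) * (of_real (ml_disc s n N k) * (c * of_real (real N powr (- s))) ^ k))"
      unfolding a_def using ml_disc_scale[OF _ assms(1), of N n _ c] elim by (simp add: mult.assoc)
    also have "\<dots> = of_real (real N powr (1 - s * real n)) * ml_disc_sum s n N (c * of_real (real N powr (- s)))"
      unfolding ml_disc_sum_def by (rule suminf_mult[OF sm])
    finally show ?case .
  qed
  ultimately show ?thesis unfolding b_def by (rule Lim_transform_eventually)
qed

lemma ml_coeff_binomial:
  assumes "n \<ge> 1"
  shows "ml_coeff n l k = fact (n - 1) * (real ((k + n - 1) choose k) / Gamma ((1 / l) * real (k + n)))"
proof -
  have "real ((k + n - 1) choose k) = fact (k + n - 1) / (fact k * fact (n - 1))"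
    using assms by (subst binomial_fact) auto
  then show ?thesis using assms by (simp add: ml_coeff_def add_ac divide_simps mult_ac)
qed

text \<open>
  In the limit \<open>N \<rightarrow> \<infinity>\<close>, the recurrence with nonnegative coefficients for \<open>((1 - u)\<^sup>s - c)\<^sup>-\<^sup>n\<close>
  yields what the representation of \<open>H\<close> as a Laplace transform of a positive measure would give.
\<close>

lemma ml_ridge:
  fixes t :: complex
  assumes "n \<ge> 1" "l \<ge> 1"
  shows "norm (\<Sum>k. of_real (ml_coeff n l k) * t ^ k) \<le> (\<Sum>k. ml_coeff n l k * (max 0 (Re t)) ^ k)"
proof -
  define s where "s = 1 / l"
  have s: "0 < s" "s \<le> 1" using assms by (auto simp: s_def)
  let ?b = "\<lambda>k. real ((k + n - 1) choose k) / Gamma (s * real (k + n))"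
  let ?x = "max 0 (Re t)"
  have L1: "(\<lambda>N. norm (of_real (real N powr (1 - s * real n)) * ml_disc_sum s n N (t * of_real (real N powr (- s)))))
    \<longlonglongrightarrow> norm (\<Sum>k. of_real (?b k) * t ^ k)"
    by (intro tendsto_norm ml_disc_LIMSEQ s assms)
  have L2: "(\<lambda>N. real N powr (1 - s * real n) * ml_disc_sum s n N (?x * real N powr (- s)))
    \<longlonglongrightarrow> (\<Sum>k. ?b k * ?x ^ k)"
    using ml_disc_LIMSEQ[OF s assms(1), of ?x] by simp
  have "((\<lambda>N. norm t * real N powr (- s)) \<longlongrightarrow> norm t * 0) sequentially"
    using s by (intro tendsto_mult tendsto_const tendsto_neg_powr filterlim_real_sequentially) auto
  then have ev: "eventually (\<lambda>N. norm t * real N powr (- s) < 1) sequentially"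
    by (intro order_tendstoD(2)) auto
  have "eventually (\<lambda>N. norm (of_real (real N powr (1 - s * real n)) * ml_disc_sum s n N (t * of_real (real N powr (- s))))
     \<le> real N powr (1 - s * real n) * ml_disc_sum s n N (?x * real N powr (- s))) sequentially"
    using ev
  proof eventually_elim
    case (elim N)
    have "norm (ml_disc_sum s n N (t * of_real (real N powr (- s)))) \<le> ml_disc_sum s n N (max 0 (Re (t * of_real (real N powr (- s)))))"
      using elim by (intro ml_disc_ridge s) (simp add: norm_mult)
    also have "max 0 (Re (t * of_real (real N powr (- s)))) = ?x * real N powr (- s)"
      by (simp add: max_mult_distrib_right)
    finally show ?case by (simp add: norm_mult mult_left_mono)
  qed
  then have le: "norm (\<Sum>k. of_real (?b k) * t ^ k) \<le> (\<Sum>k. ?b k * ?x ^ k)"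
    by (rule tendsto_le[OF _ L2 L1, rotated]) simp
  have mb: "ml_coeff n l k = fact (n - 1) * ?b k" for k
    using ml_coeff_binomial[OF assms(1)] by (simp add: s_def)
  have sm: "summable (\<lambda>k. ?b k * x ^ k)" if "x \<ge> 0" for x
    using summable_mult[OF summable_ml[OF assms that], of "1 / fact (n - 1)"] by (simp add: mb mult.assoc)
  have smc: "summable (\<lambda>k. of_real (?b k) * t ^ k)"
  proof (rule summable_norm_cancel)
    have b0: "?b k \<ge> 0" for k using s assms by (intro divide_nonneg_nonneg less_imp_le[OF Gamma_real_pos]) auto
    have "norm (of_real (?b k) * t ^ k) = ?b k * norm t ^ k" for k
      by (simp only: norm_mult norm_power norm_of_real abs_of_nonneg[OF b0])
    then show "summable (\<lambda>k. norm (of_real (?b k) * t ^ k))"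
      using sm[of "norm t"] by simp
  qed
  have "(\<Sum>k. of_real (ml_coeff n l k) * t ^ k) = of_real (fact (n - 1)) * (\<Sum>k. of_real (?b k) * t ^ k)"
    using suminf_mult[OF smc, of "of_real (fact (n - 1))"] by (simp add: mb mult_ac)
  moreover have "(\<Sum>k. ml_coeff n l k * ?x ^ k) = fact (n - 1) * (\<Sum>k. ?b k * ?x ^ k)"
    using suminf_mult[OF sm[of ?x], of "fact (n - 1)"] by (simp add: mb mult_ac)
  ultimately show ?thesis using le by (simp add: norm_mult mult_left_mono)
qed

section \<open>Lebesgue measure on \<open>\<complex>\<^sup>n\<close>\<close>

lemma nn_integral_lborel_affine:
  fixes f :: "'a::euclidean_space \<Rightarrow> ennreal"
  assumes [measurable]: "f \<in> borel_measurable borel" and c: "c \<noteq> 0"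
  shows "(\<integral>\<^sup>+x. f x \<partial>lborel) = ennreal (\<bar>c\<bar> ^ DIM('a)) * (\<integral>\<^sup>+x. f (t + c *\<^sub>R x) \<partial>lborel)"
  by (subst lborel_affine[OF c, of t])
     (simp add: nn_integral_density nn_integral_distr nn_integral_cmult)

lemma integral_lborel_affine:
  fixes f :: "'a::euclidean_space \<Rightarrow> 'b::{banach, second_countable_topology}"
  assumes [measurable]: "f \<in> borel_measurable borel" and c: "c \<noteq> 0"
  shows "(\<integral>x. f x \<partial>lborel) = \<bar>c\<bar> ^ DIM('a) *\<^sub>R (\<integral>x. f (t + c *\<^sub>R x) \<partial>lborel)"
  by (subst lborel_affine[OF c, of t])
     (simp add: integral_density integral_distr)

text \<open>The double integral of 1_A(Tx) 1_B(y + Tx), with B the unit ball, is computed in both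
  orders. One gives the measure of the preimage of A, the other that of A, each times the measure of
  B, because T preserves B and Lebesgue measure is invariant under translations and reflections. No
  determinant enters.\<close>

lemma lborel_distr_isometry:
  fixes T :: "'a::euclidean_space \<Rightarrow> 'a"
  assumes T: "linear T" "\<And>x. norm (T x) = norm x"
  shows "distr lborel borel T = (lborel :: 'a measure)"
proof (rule measure_eqI)
  have inj: "inj T" using T by (simp add: linear_injective_0) (metis norm_eq_zero)
  then have surj: "surj T" using T(1) linear_injective_imp_surjective by blast
  have Tm[measurable]: "T \<in> borel_measurable borel"
    using T(1) by (intro borel_measurable_continuous_onI linear_continuous_on linear_conv_bounded_linear[THEN iffD1])
  define S where "S = inv T"
  have TS: "T (S y) = y" for y by (simp add: S_def surj surj_f_inv_f)
  have TxS: "T (x - S y) = T x - y" for x y using T(1) by (simp add: linear_diff TS)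
  fix A assume "A \<in> sets (distr lborel borel T)"
  then have A[measurable]: "A \<in> sets borel" by simp
  define B where "B = ball (0::'a) 1"
  have B[measurable]: "B \<in> sets borel" by (simp add: B_def)
  have TB: "T x \<in> B \<longleftrightarrow> x \<in> B" for x by (simp add: B_def T)
  let ?L = "lborel :: 'a measure"
  have Tl: "T -` C \<in> sets borel" if "C \<in> sets borel" for C
    using measurable_sets[OF Tm that] by simp
  have trans: "(\<integral>\<^sup>+y. f (y + t) \<partial>?L) = (\<integral>\<^sup>+y. f y \<partial>?L)" if [measurable]: "f \<in> borel_measurable borel" for f :: "'a \<Rightarrow> ennreal" and t
    using nn_integral_lborel_affine[OF that, of 1 t] by (simp add: add.commute)
  have refl: "(\<integral>\<^sup>+y. f (t - y) \<partial>?L) = (\<integral>\<^sup>+y. f y \<partial>?L)" if [measurable]: "f \<in> borel_measurable borel" for f :: "'a \<Rightarrow> ennreal" and t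
    using nn_integral_lborel_affine[OF that, of "-1" t] by simp
  have "emeasure ?L (T -` A) * emeasure ?L B = (\<integral>\<^sup>+x. indicator A (T x) * emeasure ?L B \<partial>?L)"
    using Tl[OF A] by (simp add: nn_integral_multc flip: indicator_vimage)
  also have "\<dots> = (\<integral>\<^sup>+x. (\<integral>\<^sup>+y. indicator A (T x) * indicator B (y + T x) \<partial>?L) \<partial>?L)"
    by (intro nn_integral_cong) (simp add: nn_integral_cmult trans)
  also have "\<dots> = (\<integral>\<^sup>+y. (\<integral>\<^sup>+x. indicator A (T x) * indicator B (y + T x) \<partial>?L) \<partial>?L)"
    by (rule lborel_pair.Fubini') measurable
  also have "\<dots> = (\<integral>\<^sup>+y. (\<integral>\<^sup>+x. indicator A (T x - y) * indicator B (T x) \<partial>?L) \<partial>?L)"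
  proof (rule nn_integral_cong)
    fix y
    have "(\<integral>\<^sup>+x. indicator A (T x) * indicator B (y + T x) \<partial>?L) =
      (\<integral>\<^sup>+x. indicator A (T (x + - S y)) * indicator B (y + T (x + - S y)) \<partial>?L)"
      by (subst trans[of "\<lambda>x. indicator A (T x) * indicator B (y + T x)" "- S y", symmetric]) simp_all
    also have "\<dots> = (\<integral>\<^sup>+x. indicator A (T x - y) * indicator B (T x) \<partial>?L)"
      using TxS by simp
    finally show "(\<integral>\<^sup>+x. indicator A (T x) * indicator B (y + T x) \<partial>?L) =
      (\<integral>\<^sup>+x. indicator A (T x - y) * indicator B (T x) \<partial>?L)" .
  qed
  also have "\<dots> = (\<integral>\<^sup>+x. (\<integral>\<^sup>+y. indicator A (T x - y) * indicator B (T x) \<partial>?L) \<partial>?L)"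
    by (rule lborel_pair.Fubini'[symmetric]) measurable
  also have "\<dots> = (\<integral>\<^sup>+x. emeasure ?L A * indicator B x \<partial>?L)"
  proof (intro nn_integral_cong)
    fix x
    have "(\<integral>\<^sup>+y. indicator A (T x - y) * indicator B (T x) \<partial>?L) = (\<integral>\<^sup>+y. indicator A (T x - y) \<partial>?L) * indicator B (T x)"
      by (intro nn_integral_multc) measurable
    also have "\<dots> = emeasure ?L A * indicator B x"
    proof -
      have "(\<integral>\<^sup>+y. indicator A (T x - y) \<partial>?L) = (\<integral>\<^sup>+y. indicator A y \<partial>?L)" by (rule refl) simp
      then have "(\<integral>\<^sup>+y. indicator A (T x - y) \<partial>?L) = emeasure ?L A" by simp
      moreover have "indicator B (T x) = (indicator B x :: ennreal)"
        using TB[of x] unfolding indicator_def by (rule arg_cong)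
      ultimately show ?thesis by (rule arg_cong2)
    qed
    finally show "(\<integral>\<^sup>+y. indicator A (T x - y) * indicator B (T x) \<partial>?L) = emeasure ?L A * indicator B x" .
  qed
  also have "\<dots> = emeasure ?L A * emeasure ?L B" by (simp add: nn_integral_cmult)
  finally have eq: "emeasure ?L (T -` A) * emeasure ?L B = emeasure ?L A * emeasure ?L B" .
  have "emeasure ?L B \<noteq> \<infinity>" using emeasure_lborel_ball_finite[of "0::'a" 1] by (simp add: B_def)
  moreover have "emeasure ?L B \<noteq> 0"
  proof -
    have "measure lborel B > 0" unfolding B_def by (rule content_ball_pos) simp
    then show ?thesis by (auto simp: measure_def)
  qed
  ultimately have "emeasure ?L (T -` A) = emeasure ?L A"
    using eq by (simp add: mult.commute[of _ "emeasure ?L B"] ennreal_mult_cancel_left)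
  then show "emeasure (distr lborel borel T) A = emeasure lborel A"
    by (simp add: emeasure_distr)
qed simp

section \<open>The normalized measure\<close>

definition cV :: "'n::finite itself \<Rightarrow> real" where
  "cV _ = 1 / measure lebesgue (ball (0 :: complex ^ 'n) 1)"

lemma cV_pos: "cV TYPE('n::finite) > 0"
  using content_ball_pos[of 1 "0 :: complex ^ 'n"] by (simp add: cV_def)

lemma dV_const: "1 / emeasure lebesgue (ball (0 :: complex ^ 'n::finite) 1) = ennreal (cV TYPE('n))"
proof -
  have "emeasure lebesgue (ball (0 :: complex ^ 'n) 1) = ennreal (measure lebesgue (ball (0 :: complex ^ 'n) 1))"
    by (rule emeasure_eq_ennreal_measure) (metis emeasure_lborel_ball_finite emeasure_completion infinity_ennreal_def less_irrefl lmeasurable_ball fmeasurableD2)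
  then show ?thesis
    using content_ball_pos[of 1 "0 :: complex ^ 'n"] divide_ennreal[of 1 "measure lebesgue (ball (0 :: complex ^ 'n) 1)"]
    by (simp add: cV_def)
qed

lemma dV_density: "(dV :: (complex ^ 'n::finite) measure) = density lebesgue (\<lambda>_. ennreal (cV TYPE('n)))"
  unfolding dV_def dV_const
  by (rule measure_eqI) (auto simp: emeasure_density_const)

lemma sets_dV [measurable_cong, simp]: "sets (dV :: (complex ^ 'n::finite) measure) = sets lebesgue"
  by (simp add: dV_def)

lemma space_dV [simp]: "space (dV :: (complex ^ 'n::finite) measure) = UNIV"
  by (simp add: dV_def space_scale_measure)

lemma measurable_dV [simp]: "measurable (dV :: (complex ^ 'n::finite) measure) M = measurable lebesgue M"
  by (intro measurable_cong_sets) auto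

lemma borel_measurable_dV: "f \<in> borel_measurable borel \<Longrightarrow> f \<in> borel_measurable (dV :: (complex ^ 'n::finite) measure)"
  by (auto intro!: measurable_completion)

lemma nn_integral_dV:
  "f \<in> borel_measurable lebesgue \<Longrightarrow> (\<integral>\<^sup>+z. f z \<partial>dV) = ennreal (cV TYPE('n)) * (\<integral>\<^sup>+z. f z \<partial>lborel)"
  for f :: "complex ^ 'n::finite \<Rightarrow> ennreal"
  by (simp add: dV_density nn_integral_density nn_integral_cmult del: nn_integral_completion)
     (simp add: nn_integral_completion)

lemma integral_dV:
  fixes f :: "complex ^ 'n::finite \<Rightarrow> 'b::{banach, second_countable_topology}"
  shows "f \<in> borel_measurable borel \<Longrightarrow> (\<integral>z. f z \<partial>dV) = cV TYPE('n) *\<^sub>R (\<integral>z. f z \<partial>lborel)"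
  using cV_pos[where 'n='n]
  by (simp add: dV_density integral_density integral_completion measurable_completion)

lemma emeasure_dV_ball:
  fixes z :: "complex ^ 'n::finite"
  assumes "r \<ge> 0"
  shows "emeasure dV (ball z r) = ennreal (r ^ (2 * CARD('n)))"
proof -
  have "emeasure lebesgue (ball (0 :: complex ^ 'n) 1) \<noteq> 0"
    using content_ball_pos[of 1 "0 :: complex ^ 'n"] by (auto simp: measure_def)
  moreover have "emeasure lebesgue (ball (0 :: complex ^ 'n) 1) \<noteq> top"
    by (metis fmeasurableD2 lmeasurable_ball infinity_ennreal_def)
  ultimately have "1 / emeasure lebesgue (ball (0 :: complex ^ 'n) 1) * emeasure lebesgue (ball (0 :: complex ^ 'n) 1) = 1"
    by (simp add: ennreal_divide_times ennreal_divide_self less_top)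
  then show ?thesis
    unfolding dV_def emeasure_scale_measure emeasure_lebesgue_ball_conv_unit_ball[OF assms, of z]
    by (subst mult.left_commute) (simp add: mult.commute[of 2] del: emeasure_completion)
qed

lemma sigma_finite_dV: "sigma_finite_measure (dV :: (complex ^ 'n::finite) measure)"
proof
  show "\<exists>A. countable A \<and> A \<subseteq> sets dV \<and> \<Union> A = space (dV :: (complex ^ 'n) measure) \<and> (\<forall>a\<in>A. emeasure dV a \<noteq> \<infinity>)"
  proof (intro exI conjI ballI)
    show "countable (range (\<lambda>k. ball (0 :: complex ^ 'n) (real k)))" by simp
    show "\<Union> (range (\<lambda>k. ball (0 :: complex ^ 'n) (real k))) = space dV"
      using reals_Archimedean2 by auto
  qed (auto simp: emeasure_dV_ball)
qed

interpretation dV: sigma_finite_measure "dV :: (complex ^ 'n::finite) measure"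
  by (rule sigma_finite_dV)

interpretation dV_pair: pair_sigma_finite "dV :: (complex ^ 'n::finite) measure" "dV :: (complex ^ 'n::finite) measure" ..

lemma nn_integral_dV_affine:
  fixes f :: "complex ^ 'n::finite \<Rightarrow> ennreal"
  assumes "f \<in> borel_measurable borel" "c > 0"
  shows "(\<integral>\<^sup>+z. f (t + c *\<^sub>R z) \<partial>dV) = ennreal (c powr (- (2 * real CARD('n)))) * (\<integral>\<^sup>+z. f z \<partial>dV)"
proof -
  have fm: "f \<in> borel_measurable lebesgue" using assms(1) by (simp add: measurable_completion)
  have fm': "(\<lambda>z. f (t + c *\<^sub>R z)) \<in> borel_measurable lebesgue"
    using assms(1) by (intro measurable_completion) simp
  let ?d = "c ^ (2 * CARD('n))"
  have c: "ennreal (c powr (- (2 * real CARD('n)))) * ennreal ?d = 1"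
    using assms by (simp add: powr_minus flip: powr_realpow ennreal_mult)
  have "(\<integral>\<^sup>+z. f z \<partial>lborel) = ennreal ?d * (\<integral>\<^sup>+z. f (t + c *\<^sub>R z) \<partial>lborel)"
    using nn_integral_lborel_affine[OF assms(1), of c t] assms by (simp add: mult.commute)
  then have "ennreal (c powr (- (2 * real CARD('n)))) * (\<integral>\<^sup>+z. f z \<partial>lborel) = (\<integral>\<^sup>+z. f (t + c *\<^sub>R z) \<partial>lborel)"
    using c by (simp flip: mult.assoc)
  then show ?thesis
    unfolding nn_integral_dV[OF fm] nn_integral_dV[OF fm'] by (simp add: mult.left_commute)
qed

lemma integral_dV_affine:
  fixes f :: "complex ^ 'n::finite \<Rightarrow> 'b::{banach, second_countable_topology}"
  assumes "f \<in> borel_measurable borel" "c > 0"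
  shows "(\<integral>z. f (t + c *\<^sub>R z) \<partial>dV) = c powr (- (2 * real CARD('n))) *\<^sub>R (\<integral>z. f z \<partial>dV)"
proof -
  have fm': "(\<lambda>z. f (t + c *\<^sub>R z)) \<in> borel_measurable borel" using assms(1) by simp
  let ?d = "c ^ (2 * CARD('n))"
  have c: "c powr (- (2 * real CARD('n))) * ?d = 1"
    using assms by (simp add: powr_minus flip: powr_realpow)
  have "(\<integral>z. f z \<partial>lborel) = ?d *\<^sub>R (\<integral>z. f (t + c *\<^sub>R z) \<partial>lborel)"
    using integral_lborel_affine[OF assms(1), of c t] assms by (simp add: mult.commute)
  then have "c powr (- (2 * real CARD('n))) *\<^sub>R (\<integral>z. f z \<partial>lborel) = (\<integral>z. f (t + c *\<^sub>R z) \<partial>lborel)"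
    using c by simp
  then show ?thesis
    unfolding integral_dV[OF assms(1)] integral_dV[OF fm'] by (metis scaleR_left_commute)
qed

lemma integral_dV_isometry:
  fixes f :: "complex ^ 'n::finite \<Rightarrow> 'b::{banach, second_countable_topology}"
    and T :: "complex ^ 'n \<Rightarrow> complex ^ 'n"
  assumes [measurable]: "f \<in> borel_measurable borel" and T: "linear T" "\<And>x. norm (T x) = norm x"
  shows "(\<integral>z. f (T z) \<partial>dV) = (\<integral>z. f z \<partial>dV)"
proof -
  have [measurable]: "T \<in> borel_measurable borel"
    using T(1) by (intro borel_measurable_continuous_onI linear_continuous_on linear_conv_bounded_linear[THEN iffD1])
  have "(\<integral>z. f z \<partial>lborel) = (\<integral>z. f (T z) \<partial>lborel)"
    by (subst lborel_distr_isometry[OF T, symmetric]) (simp add: integral_distr)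
  then show ?thesis by (simp add: integral_dV)
qed

text \<open>Dyadic shells: where 1 + |z| is about 2^k the integrand is at most 2^(-Mk) and the
  volume is at most of order 2^(2nk), which sums geometrically for M > 2n.\<close>

lemma nn_integral_polynomial_decay:
  assumes "M > 2 * real CARD('n::finite)"
  shows "(\<integral>\<^sup>+z. ennreal ((1 + norm (z :: complex ^ 'n)) powr (- M)) \<partial>dV) < \<infinity>"
proof -
  let ?D = "2 * CARD('n)"
  let ?g = "\<lambda>k z. ennreal (2 powr (- M * real k)) * indicator (ball (0 :: complex ^ 'n) (2 ^ Suc k)) z"
  have le: "ennreal ((1 + norm z) powr (- M)) \<le> (\<Sum>k. ?g k z)" for z :: "complex ^ 'n"
  proof -
    define k where "k = nat \<lfloor>log 2 (1 + norm z)\<rfloor>"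
    have l0: "log 2 (1 + norm z) \<ge> 0" by (subst zero_le_log_cancel_iff) (auto intro: add_pos_nonneg)
    then have k: "real k \<le> log 2 (1 + norm z)" "log 2 (1 + norm z) < real (Suc k)"
      unfolding k_def by linarith+
    have "1 + norm z \<ge> 2 powr real k" using k(1) by (simp add: le_log_iff add_pos_nonneg)
    then have "(1 + norm z) powr (- M) \<le> (2 powr real k) powr (- M)"
      using assms by (intro powr_mono2') auto
    also have "\<dots> = 2 powr (- M * real k)" by (simp add: powr_powr mult.commute)
    finally have 1: "(1 + norm z) powr (- M) \<le> 2 powr (- M * real k)" .
    have "1 + norm z < 2 powr real (Suc k)" using k(2) by (simp only: log_less_iff add_pos_nonneg zero_less_one norm_ge_zero)
    then have "norm z < 2 ^ Suc k" by (simp add: powr_realpow del: of_nat_Suc power_Suc)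
    then have "ennreal ((1 + norm z) powr (- M)) \<le> ?g k z" using 1 by (simp add: ennreal_leI)
    also have "\<dots> \<le> (\<Sum>k. ?g k z)"
    proof -
      have "f k \<le> (\<Sum>k. f k)" for f :: "nat \<Rightarrow> ennreal"
        using sum_le_suminf[of f "{k}"] by simp
      then show ?thesis .
    qed
    finally show ?thesis .
  qed
  have "(\<integral>\<^sup>+z. ennreal ((1 + norm (z :: complex ^ 'n)) powr (- M)) \<partial>dV) \<le> (\<integral>\<^sup>+z. (\<Sum>k. ?g k z) \<partial>dV)"
    by (intro nn_integral_mono le)
  also have "\<dots> = (\<Sum>k. \<integral>\<^sup>+z. ?g k z \<partial>dV)"
    by (intro nn_integral_suminf borel_measurable_dV borel_measurable_times_ennreal borel_measurable_const borel_measurable_indicator) simp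
  also have "\<dots> = (\<Sum>k. ennreal (2 powr (- M * real k)) * ennreal ((2 ^ Suc k) ^ ?D))"
  proof (rule suminf_cong)
    fix k
    have "(\<integral>\<^sup>+z. ?g k z \<partial>dV) = ennreal (2 powr (- M * real k)) * emeasure dV (ball (0 :: complex ^ 'n) (2 ^ Suc k))"
      by (rule nn_integral_cmult_indicator) simp
    also have "emeasure dV (ball (0 :: complex ^ 'n) (2 ^ Suc k)) = ennreal ((2 ^ Suc k) ^ ?D)"
      by (rule emeasure_dV_ball) simp
    finally show "(\<integral>\<^sup>+z. ?g k z \<partial>dV) = ennreal (2 powr (- M * real k)) * ennreal ((2 ^ Suc k) ^ ?D)" .
  qed
  also have "\<dots> = (\<Sum>k. ennreal (2 ^ ?D * (2 powr (real ?D - M)) ^ k))"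
  proof (intro suminf_cong)
    fix k
    have "(2::real) powr (- M * real k) * (2 ^ Suc k) ^ ?D = 2 ^ ?D * (2 powr (real ?D - M)) ^ k"
    proof -
      have "(2 ^ k) ^ D = (2::real) powr (real D * real k)" for D :: nat
        by (simp add: powr_realpow[symmetric] powr_powr mult.commute)
      moreover have "(2 powr (real D - M)) ^ k = 2 powr (- M * real k) * 2 powr (real D * real k)" for D :: nat
        by (simp add: powr_realpow[symmetric] powr_powr powr_add[symmetric] algebra_simps)
      ultimately show ?thesis by (simp only: power_Suc power_mult_distrib mult_ac)
    qed
    then show "ennreal (2 powr (- M * real k)) * ennreal ((2 ^ Suc k) ^ ?D) = ennreal (2 ^ ?D * (2 powr (real ?D - M)) ^ k)"
      by (simp flip: ennreal_mult del: power_Suc)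
  qed
  also have "\<dots> < \<infinity>"
  proof -
    have "2 powr (real ?D - M) < (1::real)" using assms by (simp add: powr_less_one)
    then have "summable (\<lambda>k. 2 ^ ?D * (2 powr (real ?D - M)) ^ k)" by (intro summable_mult summable_geometric) simp
    then show ?thesis by (subst suminf_ennreal2) auto
  qed
  finally show ?thesis .
qed

section \<open>The Hermitian inner product\<close>

definition cinner :: "complex ^ 'n::finite \<Rightarrow> complex ^ 'n \<Rightarrow> complex" where
  "cinner z w = (\<Sum>j\<in>UNIV. z $ j * cnj (w $ j))"

lemma cinner_add_left: "cinner (x + y) w = cinner x w + cinner y w"
  and cinner_add_right: "cinner w (x + y) = cinner w x + cinner w y"
  and cinner_scale_left: "cinner (c *s x) w = c * cinner x w"
  and cinner_scale_right: "cinner w (c *s x) = cnj c * cinner w x"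
  and cinner_scaleR_left: "cinner (r *\<^sub>R x) w = of_real r * cinner x w"
  and cinner_scaleR_right: "cinner w (r *\<^sub>R x) = of_real r * cinner w x"
  by (auto simp: cinner_def algebra_simps sum.distrib sum_distrib_left scaleR_conv_of_real[of r "_::complex"])

lemma cinner_commute: "cinner w z = cnj (cinner z w)"
  by (simp add: cinner_def mult.commute)

lemma Re_cinner: "Re (cinner z w) = z \<bullet> w"
  by (simp add: cinner_def inner_vec_def inner_complex_def)

lemma cinner_self: "cinner z z = of_real ((norm z)\<^sup>2)"
proof (rule complex_eqI)
  show "Re (cinner z z) = Re (of_real ((norm z)\<^sup>2))" by (simp add: Re_cinner power2_norm_eq_inner)
  have "Im (cinner z z) = - Im (cinner z z)" using cinner_commute[of z z] by (metis cnj.simps(2))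
  then show "Im (cinner z z) = Im (of_real ((norm z)\<^sup>2))" by simp
qed

lemma norm_vec_scale: "norm (c *s z) = norm c * norm (z :: complex ^ 'n::finite)"
  by (simp add: norm_vec_def norm_mult L2_set_right_distrib)

lemma norm_cinner_le: "norm (cinner z w) \<le> norm z * norm w"
proof -
  \<comment> \<open>Rotating z by this phase makes the product real and nonnegative, so that the
    real Cauchy-Schwarz inequality applies.\<close>
  define c where "c = cis (- Arg (cinner z w))"
  have nc: "norm c = 1" by (simp add: c_def)
  have "cinner (c *s z) w = c * rcis (norm (cinner z w)) (Arg (cinner z w))"
    by (simp only: cinner_scale_left rcis_cmod_Arg)
  also have "\<dots> = of_real (norm (cinner z w))"
    unfolding c_def rcis_def by (simp only: mult.left_commute[of _ "of_real _"] cis_mult) simp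
  finally have "norm (cinner z w) = (c *s z) \<bullet> w" by (metis Re_cinner Re_complex_of_real)
  also have "\<dots> \<le> norm (c *s z) * norm w" by (rule norm_cauchy_schwarz)
  finally show ?thesis using nc by (simp add: norm_vec_scale)
qed

lemma continuous_on_cinner [continuous_intros]:
  "continuous_on S f \<Longrightarrow> continuous_on S g \<Longrightarrow> continuous_on S (\<lambda>x. cinner (f x) (g x))"
  unfolding cinner_def by (intro continuous_intros)

lemma borel_measurable_cinner [measurable]:
  assumes [measurable]: "f \<in> borel_measurable M" "g \<in> borel_measurable M"
  shows "(\<lambda>x. cinner (f x) (g x)) \<in> borel_measurable M"
  using borel_measurable_continuous_Pair[OF assms, of cinner] by (simp add: continuous_intros case_prod_unfold)

section \<open>The reproducing kernel\<close>

text \<open>The Taylor coefficients of \<open>bergman_H n l 1\<close>;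
  \<open>bergman_H_scale\<close> reduces every other \<alpha> to this case.\<close>

definition bh :: "nat \<Rightarrow> real \<Rightarrow> nat \<Rightarrow> real" where
  "bh n l k = l / fact n * ml_coeff n l k"

definition bH :: "nat \<Rightarrow> real \<Rightarrow> complex \<Rightarrow> complex" where
  "bH n l t = (\<Sum>k. of_real (bh n l k) * t ^ k)"

definition bHr :: "nat \<Rightarrow> real \<Rightarrow> real \<Rightarrow> real" where
  "bHr n l x = (\<Sum>k. bh n l k * x ^ k)"

context
  fixes n :: nat and l :: real
  assumes n: "n \<ge> 1" and l: "l \<ge> 1"
begin

lemma bh_pos: "bh n l k > 0"
  using l ml_coeff_pos[OF n, of l k] by (simp add: bh_def)

lemma bh_nonneg: "bh n l k \<ge> 0"
  using bh_pos[of k] by simp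

lemma summable_bHr: "x \<ge> 0 \<Longrightarrow> summable (\<lambda>k. bh n l k * x ^ k)"
  using summable_mult[OF summable_ml[OF n l], of x "l / fact n"] by (simp add: bh_def mult.assoc)

lemma summable_bH_norm:
  fixes t :: "'a :: {real_normed_field, banach}"
  shows "summable (\<lambda>k. norm (of_real (bh n l k) * t ^ k))"
  using summable_bHr[of "norm t"] bh_nonneg by (simp add: norm_mult norm_power)

lemma summable_bH:
  fixes t :: "'a :: {real_normed_field, banach}"
  shows "summable (\<lambda>k. of_real (bh n l k) * t ^ k)"
  by (rule summable_norm_cancel[OF summable_bH_norm])

lemma bHr_ml: "x \<ge> 0 \<Longrightarrow> bHr n l x = l / fact n * (\<Sum>k. ml_coeff n l k * x ^ k)"
  unfolding bHr_def bh_def using suminf_mult[OF summable_ml[OF n l], of x "l / fact n"] by (simp add: mult.assoc)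

text \<open>Since \<alpha>^(k/l) is the k-th power of \<alpha>^(1/l), the parameter only rescales
  the argument.\<close>

lemma bergman_H_scale:
  assumes "\<alpha> > 0"
  shows "bergman_H n l \<alpha> t = of_real (\<alpha> powr (real n / l)) * bH n l (of_real (\<alpha> powr (1 / l)) * t)"
proof -
  let ?c = "complex_of_real (l * \<alpha> powr (real n / l) / fact n)"
  let ?s = "of_real (\<alpha> powr (1 / l)) * t"
  have p: "\<alpha> powr (real k / l) = (\<alpha> powr (1 / l)) ^ k" for k
    using assms by (simp add: powr_powr flip: powr_realpow)
  have eq: "of_real (fact (n - 1 + k) / fact k * \<alpha> powr (real k / l) / Gamma ((real k + real n) / l)) * t ^ k
     = of_real (fact n / l) * (of_real (bh n l k) * ?s ^ k)" for k
    using l by (simp add: bh_def ml_coeff_def p power_mult_distrib)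
  have "bergman_H n l \<alpha> t = ?c * (\<Sum>k. of_real (fact n / l) * (of_real (bh n l k) * ?s ^ k))"
    unfolding bergman_H_def eq[symmetric] by simp
  also have "\<dots> = ?c * (of_real (fact n / l) * bH n l ?s)"
    unfolding bH_def by (simp only: suminf_mult[OF summable_bH])
  also have "\<dots> = of_real (\<alpha> powr (real n / l)) * bH n l ?s" using l by simp
  finally show ?thesis .
qed

lemma norm_bH_le: "norm (bH n l t) \<le> bHr n l (max 0 (Re t))"
proof -
  have "bH n l t = of_real (l / fact n) * (\<Sum>k. of_real (ml_coeff n l k) * t ^ k)"
  proof -
    have "summable (\<lambda>k. of_real (ml_coeff n l k) * t ^ k)"
      using summable_mult[OF summable_bH[of t], of "of_real (fact n / l)"] l by (simp add: bh_def)
    from suminf_mult[OF this, of "of_real (l / fact n)"] show ?thesis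
      unfolding bH_def bh_def by (simp add: mult.assoc)
  qed
  then have "norm (bH n l t) = l / fact n * norm (\<Sum>k. of_real (ml_coeff n l k) * t ^ k)"
    using l by (simp add: norm_mult norm_divide)
  also have "\<dots> \<le> l / fact n * (\<Sum>k. ml_coeff n l k * (max 0 (Re t)) ^ k)"
    using l by (intro mult_left_mono ml_ridge n) auto
  finally show ?thesis by (simp add: bHr_ml)
qed

lemma bHr_nonneg: "x \<ge> 0 \<Longrightarrow> bHr n l x \<ge> 0"
  unfolding bHr_def by (intro suminf_nonneg summable_bHr) (auto intro!: bh_nonneg mult_nonneg_nonneg)

lemma bHr_mono: "0 \<le> x \<Longrightarrow> x \<le> y \<Longrightarrow> bHr n l x \<le> bHr n l y"
  unfolding bHr_def by (intro suminf_le summable_bHr) (auto intro!: mult_left_mono power_mono bh_nonneg)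

lemma bHr_ge_term: "0 \<le> x \<Longrightarrow> bh n l k * x ^ k \<le> bHr n l x"
  unfolding bHr_def using sum_le_suminf[OF summable_bHr, of x "{k}"] bh_nonneg by simp

lemma norm_partial_bH_le: "norm (\<Sum>k<K. of_real (bh n l k) * t ^ k :: complex) \<le> bHr n l (norm t)"
proof -
  have "norm (\<Sum>k<K. of_real (bh n l k) * t ^ k) \<le> (\<Sum>k<K. bh n l k * norm t ^ k)"
    using bh_nonneg by (intro sum_norm_le) (auto simp: norm_mult norm_power)
  also have "\<dots> \<le> bHr n l (norm t)"
    unfolding bHr_def using bh_nonneg by (intro sum_le_suminf summable_bHr) auto
  finally show ?thesis .
qed

lemma norm_bH_le': "norm (bH n l t) \<le> bHr n l (norm t)"
  by (rule order_trans[OF norm_bH_le]) (auto intro!: bHr_mono intro: complex_Re_le_cmod)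

lemma bH_of_real: "bH n l (of_real x) = of_real (bHr n l x)"
  unfolding bH_def bHr_def using summable_bH[of x] by (simp flip: of_real_power of_real_mult add: suminf_of_real)

lemma bH_cnj: "bH n l (cnj t) = cnj (bH n l t)"
proof -
  have "(\<lambda>k. cnj (of_real (bh n l k) * t ^ k)) sums cnj (bH n l t)"
    unfolding bH_def by (intro sums_cnj[THEN iffD2] summable_sums summable_bH)
  then show ?thesis by (simp add: bH_def sums_iff)
qed

lemma continuous_on_bH [continuous_intros]: "continuous_on S f \<Longrightarrow> continuous_on S (\<lambda>x. bH n l (f x))"
proof -
  have "isCont (bH n l) t" for t
    unfolding bH_def[abs_def] by (intro isCont_powser_converges_everywhere summable_bH)
  then have "continuous_on UNIV (bH n l)" by (simp add: continuous_at_imp_continuous_on)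
  then show "continuous_on S f \<Longrightarrow> continuous_on S (\<lambda>x. bH n l (f x))"
    using continuous_on_compose2 by blast
qed

lemma bH_measurable [measurable]: "bH n l \<in> borel_measurable borel"
  by (intro borel_measurable_continuous_onI continuous_on_bH continuous_on_id)

lemma bHr_measurable [measurable]: "bHr n l \<in> borel_measurable borel"
proof -
  have "isCont (bHr n l) x" for x
    unfolding bHr_def[abs_def] using summable_bH[where 'a=real] by (intro isCont_powser_converges_everywhere) simp
  then show ?thesis by (intro borel_measurable_continuous_onI continuous_at_imp_continuous_on) simp
qed

lemma bHr_upper:
  obtains C where "C > 0" "\<And>x. x \<ge> 0 \<Longrightarrow> bHr n l x \<le> C * (1 + x) powr (real n * (l - 1)) * exp (x powr l)"
proof -
  obtain C where C: "C > 0" "\<And>x. x \<ge> 0 \<Longrightarrow> (\<Sum>k. ml_coeff n l k * x ^ k) \<le> C * (1 + x) powr (real n * (l - 1)) * exp (x powr l)"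
    using ml_upper_bound[OF n l] by blast
  have "bHr n l x \<le> (l / fact n * C) * (1 + x) powr (real n * (l - 1)) * exp (x powr l)" if "x \<ge> 0" for x
    unfolding bHr_ml[OF that] mult.assoc using C(2)[OF that] l by (intro mult_left_mono) (auto simp: mult_ac)
  then show ?thesis using that[of "l / fact n * C"] C(1) l by auto
qed

lemma bHr_lower:
  obtains c where "c > 0" "\<And>x. x \<ge> 0 \<Longrightarrow> c * (1 + x) powr (real n * (l - 1)) * exp (x powr l) \<le> bHr n l x"
proof -
  obtain c where c: "c > 0" "\<And>x. x \<ge> 0 \<Longrightarrow> c * (1 + x) powr (real n * (l - 1)) * exp (x powr l) \<le> (\<Sum>k. ml_coeff n l k * x ^ k)"
    using ml_lower_bound[OF n l] by blast
  have "(l / fact n * c) * (1 + x) powr (real n * (l - 1)) * exp (x powr l) \<le> bHr n l x" if "x \<ge> 0" for x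
    unfolding bHr_ml[OF that] mult.assoc using c(2)[OF that] l by (intro mult_left_mono) (auto simp: mult_ac)
  then show ?thesis using that[of "l / fact n * c"] c(1) l by auto
qed

end

section \<open>Orthogonality of powers under unitary maps\<close>

lemma linear_vec_scale: "linear (\<lambda>w. c *s (w :: complex ^ 'n::finite))"
  by (rule linearI) (auto simp: vec_eq_iff algebra_simps scaleR_conv_of_real)

text \<open>Multiplying w by a unimodular number preserves the integral and multiplies the integrand
  by a phase; the angle pi / (k - j) makes that phase -1.\<close>

lemma integral_mixed_moment_zero:
  fixes z \<zeta> :: "complex ^ 'n::finite" and g :: "real \<Rightarrow> complex"
  assumes [measurable]: "g \<in> borel_measurable borel" and jk: "j \<noteq> k"
  shows "(\<integral>w. cinner w \<zeta> ^ k * cinner z w ^ j * g (norm w) \<partial>dV) = 0"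
proof -
  define \<theta> where "\<theta> = pi / (real k - real j)"
  define I where "I = (\<integral>w. cinner w \<zeta> ^ k * cinner z w ^ j * g (norm w) \<partial>dV)"
  have "cis \<theta> ^ k * cnj (cis \<theta>) ^ j = cis ((real k - real j) * \<theta>)"
    by (simp only: cis_cnj Complex.DeMoivre cis_mult) (rule arg_cong[where f=cis], simp add: algebra_simps)
  also have "\<dots> = -1" using jk by (simp add: \<theta>_def)
  finally have rot: "cis \<theta> ^ k * cnj (cis \<theta>) ^ j = -1" .
  have "I = (\<integral>w. cinner (cis \<theta> *s w) \<zeta> ^ k * cinner z (cis \<theta> *s w) ^ j * g (norm (cis \<theta> *s w)) \<partial>dV)"
    unfolding I_def by (rule integral_dV_isometry[symmetric])
      (auto intro: linear_vec_scale simp: norm_vec_scale)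
  also have "\<dots> = (\<integral>w. (cis \<theta> ^ k * cnj (cis \<theta>) ^ j) * (cinner w \<zeta> ^ k * cinner z w ^ j * g (norm w)) \<partial>dV)"
    by (simp add: cinner_scale_left cinner_scale_right norm_vec_scale power_mult_distrib mult_ac)
  also have "\<dots> = - I" unfolding rot I_def by simp
  finally show ?thesis unfolding I_def[symmetric] by simp
qed

text \<open>\<open>cinner z w\<close> is split into the part A that belongs to the component of z
  along \<zeta> and the rest B. Rotating only the direction of \<zeta> changes the phase of A and
  leaves B fixed, which kills every binomial term except A^k; in that term the two factors combine
  to a modulus.\<close>

lemma integral_diagonal_moment:
  fixes z \<zeta> :: "complex ^ 'n::finite" and g :: "real \<Rightarrow> real"
  assumes [measurable]: "g \<in> borel_measurable borel" and \<zeta>: "\<zeta> \<noteq> 0"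
    and int: "integrable dV (\<lambda>w :: complex ^ 'n. norm w ^ (2 * k) * g (norm w))"
  shows "(\<integral>w. cinner w \<zeta> ^ k * cinner z w ^ k * of_real (g (norm w)) \<partial>dV)
    = (cinner z \<zeta> / of_real ((norm \<zeta>)\<^sup>2)) ^ k * of_real (\<integral>w. norm (cinner w \<zeta>) ^ (2 * k) * g (norm w) \<partial>dV)"
proof -
  define N where "N = (norm \<zeta>)\<^sup>2"
  have N: "N > 0" using \<zeta> by (simp add: N_def)
  define v where "v = cinner z \<zeta>"
  define A where "A w = v * cnj (cinner w \<zeta>) / of_real N" for w
  define B where "B w = cinner z w - A w" for w
  have cA: "continuous_on UNIV A" unfolding A_def[abs_def] using N by (intro continuous_intros) auto
  have cB: "continuous_on UNIV B" unfolding B_def[abs_def] by (intro continuous_intros cA)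
  have [measurable]: "A \<in> borel_measurable borel" "B \<in> borel_measurable borel"
    by (intro borel_measurable_continuous_onI cA cB)+
  \<comment> \<open>Multiplies the component along \<zeta> by e and fixes the orthogonal complement;
    it is unitary for |e| = 1.\<close>
  define T where "T e w = w + ((e - 1) / of_real N * cinner w \<zeta>) *s \<zeta>" for e w
  have linT: "linear (T e)" for e
    by (rule linearI)
      (auto simp: T_def vec_eq_iff cinner_add_left cinner_scaleR_left algebra_simps scaleR_conv_of_real[where 'a=complex] add_divide_distrib diff_divide_distrib)
  have uT: "cinner (T e w) \<zeta> = e * cinner w \<zeta>" for e w
  proof -
    have "cinner (T e w) \<zeta> = cinner w \<zeta> + (e - 1) / of_real N * cinner w \<zeta> * of_real N"
      by (simp only: T_def cinner_add_left cinner_scale_left cinner_self N_def)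
    also have "(e - 1) / of_real N * cinner w \<zeta> * of_real N = (e - 1) * cinner w \<zeta>" using N by simp
    also have "cinner w \<zeta> + (e - 1) * cinner w \<zeta> = e * cinner w \<zeta>" by (simp add: algebra_simps)
    finally show ?thesis .
  qed
  have AT: "A (T e w) = cnj e * A w" for e w
    by (simp add: A_def uT mult_ac)
  have zT: "cinner z (T e w) = cnj e * A w + B w" for e w
    unfolding T_def cinner_add_right cinner_scale_right A_def B_def v_def
    by (simp add: algebra_simps diff_divide_distrib)
  have BT: "B (T e w) = B w" for e w
    using zT[of e w] AT[of e w] by (simp add: B_def)
  have nT: "norm (T e w) = norm w" if "norm e = 1" for e w
  proof -
    define u where "u = cinner w \<zeta>"
    have ee: "e * cnj e = 1" using that by (simp add: complex_norm_square[symmetric])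
    have "cinner (T e w) (T e w) = cinner w w + cnj ((e - 1) * u / of_real N) * u + ((e - 1) * u / of_real N) * cnj u
       + ((e - 1) * u / of_real N) * cnj ((e - 1) * u / of_real N) * of_real N"
      unfolding T_def cinner_add_right cinner_add_left cinner_scale_right cinner_scale_left u_def[symmetric]
         cinner_commute[of \<zeta> w] cinner_self[of \<zeta>] N_def[symmetric] by (simp add: algebra_simps)
    also have "\<dots> = cinner w w + (e * cnj e - 1) * (u * cnj u) / of_real N"
      using N by (simp add: field_simps)
    also have "\<dots> = cinner w w" by (simp add: ee)
    finally have "of_real ((norm (T e w))\<^sup>2) = (of_real ((norm w)\<^sup>2) :: complex)" by (simp only: cinner_self)
    then have "(norm (T e w))\<^sup>2 = (norm w)\<^sup>2" by (simp only: of_real_eq_iff)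
    then show ?thesis by simp
  qed
  define a where "a = norm v * norm \<zeta> / N"
  have An: "norm (A w) \<le> a * norm w" for w
    using norm_cinner_le[of w \<zeta>] N mult_left_mono[of "norm (cinner w \<zeta>)" "norm w * norm \<zeta>" "norm v"]
    by (simp add: A_def a_def norm_mult norm_divide field_simps)
  have Bn: "norm (B w) \<le> (norm z + a) * norm w" for w
    using norm_triangle_ineq4[of "cinner z w" "A w"] An[of w] norm_cinner_le[of z w]
    by (simp add: B_def algebra_simps)
  have a0: "a \<ge> 0" using N by (simp add: a_def)
  let ?f = "\<lambda>i w. cinner w \<zeta> ^ k * A w ^ i * B w ^ (k - i) * of_real (g (norm w))"
  have inti: "integrable dV (?f i)" if "i \<le> k" for i
  proof (rule Bochner_Integration.integrable_bound)
    show "integrable dV (\<lambda>w :: complex ^ 'n. (norm \<zeta> ^ k * a ^ i * (norm z + a) ^ (k - i)) * (norm w ^ (2 * k) * g (norm w)))"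
      by (intro integrable_mult_right int)
    show "?f i \<in> borel_measurable dV" by (intro borel_measurable_dV) measurable
    show "AE w in dV. norm (?f i w) \<le> norm ((norm \<zeta> ^ k * a ^ i * (norm z + a) ^ (k - i)) * (norm w ^ (2 * k) * g (norm w)))"
    proof (intro AE_I2)
      fix w :: "complex ^ 'n"
      have "norm (?f i w) = norm (cinner w \<zeta>) ^ k * norm (A w) ^ i * norm (B w) ^ (k - i) * \<bar>g (norm w)\<bar>"
        by (simp add: norm_mult norm_power)
      also have "\<dots> \<le> (norm w * norm \<zeta>) ^ k * (a * norm w) ^ i * ((norm z + a) * norm w) ^ (k - i) * \<bar>g (norm w)\<bar>"
        using a0 by (intro mult_mono power_mono An Bn norm_cinner_le mult_nonneg_nonneg zero_le_power) auto
      also have "\<dots> = norm \<zeta> ^ k * a ^ i * (norm z + a) ^ (k - i) * (norm w ^ k * (norm w ^ i * norm w ^ (k - i))) * \<bar>g (norm w)\<bar>"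
        by (simp add: power_mult_distrib mult_ac)
      also have "norm w ^ i * norm w ^ (k - i) = norm w ^ k" using that by (simp flip: power_add)
      also have "norm w ^ k * norm w ^ k = norm w ^ (2 * k)" by (simp add: mult_2 power_add)
      finally show "norm (?f i w) \<le> norm ((norm \<zeta> ^ k * a ^ i * (norm z + a) ^ (k - i)) * (norm w ^ (2 * k) * g (norm w)))"
        using a0 by (simp add: abs_mult mult.assoc)
    qed
  qed
  have Ji: "(\<integral>w. ?f i w \<partial>dV) = 0" if i: "i < k" for i
  proof -
    define \<theta> where "\<theta> = pi / real (k - i)"
    have "cis \<theta> ^ k * cnj (cis \<theta>) ^ i = cis (real (k - i) * \<theta>)"
      using i by (simp only: cis_cnj Complex.DeMoivre cis_mult)
        (rule arg_cong[where f=cis], simp add: algebra_simps of_nat_diff)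
    also have "\<dots> = -1" using i by (simp add: \<theta>_def)
    finally have rot: "cis \<theta> ^ k * cnj (cis \<theta>) ^ i = -1" .
    have "(\<integral>w. ?f i w \<partial>dV) = (\<integral>w. ?f i (T (cis \<theta>) w) \<partial>dV)"
      by (rule integral_dV_isometry[symmetric]) (auto intro: linT simp: nT)
    also have "\<dots> = (\<integral>w. (cis \<theta> ^ k * cnj (cis \<theta>) ^ i) * ?f i w \<partial>dV)"
      by (simp add: uT AT BT nT power_mult_distrib mult_ac)
    also have "\<dots> = - (\<integral>w. ?f i w \<partial>dV)" unfolding rot by simp
    finally show ?thesis by simp
  qed
  have "(\<integral>w. cinner w \<zeta> ^ k * cinner z w ^ k * of_real (g (norm w)) \<partial>dV)
    = (\<integral>w. (\<Sum>i\<le>k. of_nat (k choose i) * ?f i w) \<partial>dV)"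
  proof (intro arg_cong[where f="integral\<^sup>L dV"] ext)
    fix w
    have "cinner z w ^ k = (A w + B w) ^ k" by (simp add: B_def)
    also have "\<dots> = (\<Sum>i\<le>k. of_nat (k choose i) * A w ^ i * B w ^ (k - i))" by (rule binomial_ring)
    finally show "cinner w \<zeta> ^ k * cinner z w ^ k * of_real (g (norm w)) = (\<Sum>i\<le>k. of_nat (k choose i) * ?f i w)"
      by (simp add: sum_distrib_left sum_distrib_right mult_ac)
  qed
  also have "\<dots> = (\<Sum>i\<le>k. of_nat (k choose i) * (\<integral>w. ?f i w \<partial>dV))"
    using inti by (subst Bochner_Integration.integral_sum) auto
  also have "\<dots> = (\<Sum>i\<in>{k}. of_nat (k choose i) * (\<integral>w. ?f i w \<partial>dV))"
    by (intro sum.mono_neutral_right) (auto simp: Ji)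
  also have "\<dots> = (\<integral>w. ?f k w \<partial>dV)" by simp
  also have "\<dots> = (\<integral>w. (v / of_real N) ^ k * of_real (norm (cinner w \<zeta>) ^ (2 * k) * g (norm w)) \<partial>dV)"
  proof (intro arg_cong[where f="integral\<^sup>L dV"] ext)
    fix w
    have "cinner w \<zeta> ^ k * cnj (cinner w \<zeta>) ^ k = of_real (norm (cinner w \<zeta>) ^ (2 * k))"
    proof -
      have "of_real (norm (cinner w \<zeta>) ^ (2 * k)) = (of_real ((norm (cinner w \<zeta>))\<^sup>2) :: complex) ^ k"
        by (simp add: power_mult)
      then show ?thesis by (simp only: complex_norm_square power_mult_distrib)
    qed
    then show "?f k w = (v / of_real N) ^ k * of_real (norm (cinner w \<zeta>) ^ (2 * k) * g (norm w))"
      by (simp add: A_def power_mult_distrib power_divide mult_ac)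
  qed
  also have "\<dots> = (v / of_real N) ^ k * of_real (\<integral>w. norm (cinner w \<zeta>) ^ (2 * k) * g (norm w) \<partial>dV)"
    by (simp only: integral_mult_right_zero integral_complex_of_real)
  finally show ?thesis unfolding v_def N_def .
qed

text \<open>Termwise integration of the kernel series: mixed moments vanish and only the k-th term
  is left. The radial weight g stays general because the lemma is applied both to the exponential
  weight, for the reproducing formula, and to the cut-off to a ball, for the divergence.\<close>

lemma integral_bH_moment:
  fixes z \<zeta> :: "complex ^ 'n::finite" and g :: "real \<Rightarrow> real"
  assumes l: "l \<ge> 1" and g[measurable]: "g \<in> borel_measurable borel" and g0: "\<And>x. g x \<ge> 0" and \<zeta>: "\<zeta> \<noteq> 0"
    and int: "integrable dV (\<lambda>w :: complex ^ 'n. norm w ^ (2 * k) * g (norm w))"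
    and int': "integrable dV (\<lambda>w :: complex ^ 'n. norm w ^ k * bHr CARD('n) l (norm z * norm w) * g (norm w))"
  shows "(\<integral>w. cinner w \<zeta> ^ k * bH CARD('n) l (cinner z w) * of_real (g (norm w)) \<partial>dV)
    = of_real (bh CARD('n) l k) * (cinner z \<zeta> / of_real ((norm \<zeta>)\<^sup>2)) ^ k * of_real (\<integral>w. norm (cinner w \<zeta>) ^ (2 * k) * g (norm w) \<partial>dV)"
    (is "?I = ?R")
proof -
  let ?n = "CARD('n)"
  have n: "?n \<ge> 1" by (simp add: Suc_le_eq)
  note [measurable] = bH_measurable[OF n l]
  let ?s = "\<lambda>K w. cinner w \<zeta> ^ k * (\<Sum>j<K. of_real (bh ?n l j) * cinner z w ^ j) * of_real (g (norm w))"
  let ?f = "\<lambda>w. cinner w \<zeta> ^ k * bH ?n l (cinner z w) * of_real (g (norm w))"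
  let ?W = "\<lambda>w :: complex ^ 'n. norm \<zeta> ^ k * (norm w ^ k * bHr ?n l (norm z * norm w) * g (norm w))"
  have bd: "norm (cinner w \<zeta> ^ k * t * of_real (g (norm w))) \<le> ?W w" if "norm t \<le> bHr ?n l (norm (cinner z w))" for t and w :: "complex ^ 'n"
  proof -
    have "norm t \<le> bHr ?n l (norm z * norm w)"
      using that bHr_mono[OF n l _ norm_cinner_le[of z w]] by (meson norm_ge_zero order_trans)
    then have "norm (cinner w \<zeta>) ^ k * norm t * g (norm w) \<le> (norm w * norm \<zeta>) ^ k * bHr ?n l (norm z * norm w) * g (norm w)"
      using g0 by (intro mult_mono power_mono norm_cinner_le mult_nonneg_nonneg bHr_nonneg n l) auto
    then show ?thesis using g0 by (simp add: norm_mult norm_power power_mult_distrib mult_ac)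
  qed
  have 1: "?f \<in> borel_measurable dV" by (intro borel_measurable_dV) measurable
  have 2: "?s K \<in> borel_measurable dV" for K by (intro borel_measurable_dV) measurable
  have 3: "integrable dV ?W" by (intro integrable_mult_right int')
  have 4: "AE w in dV. (\<lambda>K. ?s K w) \<longlonglongrightarrow> ?f w"
    unfolding bH_def by (intro AE_I2 tendsto_mult tendsto_const summable_LIMSEQ summable_bH n l)
  have 5: "AE w in dV. norm (?s K w) \<le> ?W w" for K
    by (intro AE_I2 bd norm_partial_bH_le n l)
  have lim: "(\<lambda>K. integral\<^sup>L dV (?s K)) \<longlonglongrightarrow> ?I"
    by (rule integral_dominated_convergence[OF 1 2 3 4 5])
  let ?t = "\<lambda>j w. of_real (bh ?n l j) * (cinner w \<zeta> ^ k * cinner z w ^ j * of_real (g (norm w)))"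
  have intt: "integrable dV (?t j)" for j
  proof (rule Bochner_Integration.integrable_bound[OF 3])
    show "?t j \<in> borel_measurable dV" by (intro borel_measurable_dV) measurable
    have "norm (of_real (bh ?n l j) * cinner z w ^ j) \<le> bHr ?n l (norm (cinner z w))" for w :: "complex ^ 'n"
      using bHr_ge_term[OF n l norm_ge_zero, of j "cinner z w"] bh_nonneg[OF n l, of j] by (simp add: norm_mult norm_power)
    from bd[OF this] show "AE w in dV. norm (?t j w) \<le> norm (?W w)"
      by (intro AE_I2) (auto simp: mult_ac intro: order_trans[OF _ abs_ge_self])
  qed
  have val: "integral\<^sup>L dV (?t j) = (if j = k then ?R else 0)" for j
  proof (cases "j = k")
    case True
    then show ?thesis using integral_diagonal_moment[OF g \<zeta> int, of z] by simp
  next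
    case False
    then show ?thesis using integral_mixed_moment_zero[of "\<lambda>x. of_real (g x)" j k \<zeta> z] by simp
  qed
  have "integral\<^sup>L dV (?s K) = (\<Sum>j<K. integral\<^sup>L dV (?t j))" for K
    using intt by (subst Bochner_Integration.integral_sum[symmetric]) (auto simp: sum_distrib_left sum_distrib_right mult_ac)
  then have "integral\<^sup>L dV (?s K) = (if k < K then ?R else 0)" for K
    unfolding val by simp
  then have "(\<lambda>K. if k < K then ?R else 0) \<longlonglongrightarrow> ?I" using lim by simp
  moreover have "eventually (\<lambda>K. (if k < K then ?R else 0) = ?R) sequentially"
    using eventually_gt_at_top[of k] by eventually_elim simp
  ultimately have "(\<lambda>K. ?R) \<longlonglongrightarrow> ?I" by (rule Lim_transform_eventually)
  then show ?thesis by (simp add: LIMSEQ_const_iff)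
qed

section \<open>Moments over the unit ball and for exponential weights\<close>

definition ball_moment :: "complex ^ 'n::finite \<Rightarrow> nat \<Rightarrow> real" where
  "ball_moment \<zeta> k = (\<integral>w. norm (cinner w \<zeta>) ^ (2 * k) * indicator (ball 0 1) w \<partial>dV)"

lemma ball_moment_nn:
  fixes \<zeta> :: "complex ^ 'n::finite"
  shows "(\<integral>\<^sup>+w. ennreal (norm (cinner w \<zeta>) ^ (2 * k) * indicator (ball 0 1) w) \<partial>dV) = ennreal (ball_moment \<zeta> k)"
  unfolding ball_moment_def
proof (rule nn_integral_eq_integral)
  have [measurable]: "ball (0 :: complex ^ 'n) 1 \<in> sets borel" by simp
  have "integrable dV (\<lambda>w. norm \<zeta> ^ (2 * k) * indicator (ball (0 :: complex ^ 'n) 1) w)"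
    using emeasure_dV_ball[of 1 "0 :: complex ^ 'n"] by (intro integrable_mult_right integrable_real_indicator) auto
  then show "integrable dV (\<lambda>w. norm (cinner w \<zeta>) ^ (2 * k) * indicator (ball 0 1) w)"
  proof (rule Bochner_Integration.integrable_bound)
    show "(\<lambda>w. norm (cinner w \<zeta>) ^ (2 * k) * indicator (ball 0 1) w) \<in> borel_measurable dV"
      by (intro borel_measurable_dV) measurable
    show "AE w in dV. norm (norm (cinner w \<zeta>) ^ (2 * k) * indicator (ball 0 1) w) \<le> norm (norm \<zeta> ^ (2 * k) * indicator (ball (0 :: complex ^ 'n) 1) w)"
    proof (intro AE_I2)
      fix w :: "complex ^ 'n"
      have "norm (cinner w \<zeta>) \<le> norm \<zeta>" if "norm w < 1"
        using that norm_cinner_le[of w \<zeta>] mult_right_mono[of "norm w" 1 "norm \<zeta>"] by simp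
      then show "norm (norm (cinner w \<zeta>) ^ (2 * k) * indicator (ball 0 1) w) \<le> norm (norm \<zeta> ^ (2 * k) * indicator (ball (0 :: complex ^ 'n) 1) w)"
        by (auto simp: indicator_def intro!: power_mono)
    qed
  qed
qed auto

lemma ball_moment_nonneg: "ball_moment \<zeta> k \<ge> 0"
  unfolding ball_moment_def by (intro integral_nonneg_AE AE_I2) simp

lemma ball_moment_scale:
  fixes \<zeta> :: "complex ^ 'n::finite"
  assumes t: "t > 0"
  shows "(\<integral>\<^sup>+w. ennreal (norm (cinner w \<zeta>) ^ (2 * k) * indicator (ball 0 t) w) \<partial>dV)
    = ennreal (t powr (2 * (real k + real CARD('n))) * ball_moment \<zeta> k)"
proof -
  let ?f = "\<lambda>w. ennreal (norm (cinner w \<zeta>) ^ (2 * k) * indicator (ball 0 t) w)"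
  have [measurable]: "ball (0 :: complex ^ 'n) r \<in> sets borel" for r by simp
  have fm: "?f \<in> borel_measurable borel" by measurable
  have "(\<integral>\<^sup>+w. ?f (0 + t *\<^sub>R w) \<partial>dV) = (\<integral>\<^sup>+w. ennreal (t powr (2 * real k)) * ennreal (norm (cinner w \<zeta>) ^ (2 * k) * indicator (ball 0 1) w) \<partial>dV)"
  proof (intro nn_integral_cong)
    fix w :: "complex ^ 'n"
    have "t powr (2 * real k) = t ^ (2 * k)" using t powr_realpow[of t "2 * k"] by simp
    moreover have "indicator (ball 0 t) (t *\<^sub>R w) = (indicator (ball 0 1) w :: real)"
      using t by (auto simp: indicator_def dist_norm)
    ultimately show "?f (0 + t *\<^sub>R w) = ennreal (t powr (2 * real k)) * ennreal (norm (cinner w \<zeta>) ^ (2 * k) * indicator (ball 0 1) w)"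
      using t by (simp add: cinner_scaleR_left norm_mult power_mult_distrib mult.assoc flip: ennreal_mult')
  qed
  also have "\<dots> = ennreal (t powr (2 * real k)) * ennreal (ball_moment \<zeta> k)"
    unfolding ball_moment_nn[symmetric] by (rule nn_integral_cmult, intro borel_measurable_dV) measurable
  finally have "ennreal (t powr (- (2 * real CARD('n)))) * (\<integral>\<^sup>+w. ?f w \<partial>dV) = ennreal (t powr (2 * real k)) * ennreal (ball_moment \<zeta> k)"
    using nn_integral_dV_affine[OF fm t, of 0] by simp
  then have "ennreal (t powr (2 * real CARD('n))) * (ennreal (t powr (- (2 * real CARD('n)))) * (\<integral>\<^sup>+w. ?f w \<partial>dV))
     = ennreal (t powr (2 * real CARD('n))) * (ennreal (t powr (2 * real k)) * ennreal (ball_moment \<zeta> k))" by simp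
  also have "ennreal (t powr (2 * real CARD('n))) * (ennreal (t powr (- (2 * real CARD('n)))) * (\<integral>\<^sup>+w. ?f w \<partial>dV))
    = ennreal (t powr (2 * real CARD('n)) * t powr (- (2 * real CARD('n)))) * (\<integral>\<^sup>+w. ?f w \<partial>dV)"
    by (simp add: ennreal_mult mult.assoc)
  also have "t powr (2 * real CARD('n)) * t powr (- (2 * real CARD('n))) = 1" using t by (simp flip: powr_add)
  also have "ennreal (t powr (2 * real CARD('n))) * (ennreal (t powr (2 * real k)) * ennreal (ball_moment \<zeta> k))
     = ennreal (t powr (2 * real CARD('n)) * t powr (2 * real k) * ball_moment \<zeta> k)"
    using ball_moment_nonneg[of \<zeta> k] by (simp add: ennreal_mult mult.assoc)
  also have "t powr (2 * real CARD('n)) * t powr (2 * real k) = t powr (2 * (real k + real CARD('n)))"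
    by (simp add: powr_add[symmetric] algebra_simps)
  finally show ?thesis by simp
qed

text \<open>Layer cake: \<open>exp (- a)\<close> is the integral of \<open>exp (- v)\<close> over \<open>v > a\<close>.\<close>

lemma exp_weight_moment:
  fixes \<zeta> :: "complex ^ 'n::finite"
  assumes m: "m > 0"
  shows "(\<integral>\<^sup>+w. ennreal (norm (cinner w \<zeta>) ^ (2 * k) * exp (- (norm w powr (2 * m)))) \<partial>dV)
    = ennreal (ball_moment \<zeta> k * Gamma ((real k + real CARD('n)) / m + 1))"
proof -
  interpret p: pair_sigma_finite "dV :: (complex ^ 'n) measure" "lborel :: real measure" ..
  let ?e = "\<lambda>v. exp (- v) :: real"
  let ?i = "\<lambda>w v. indicator {norm (w :: complex ^ 'n) powr (2 * m)..} (v :: real)"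
  have lay: "ennreal (?e a) = (\<integral>\<^sup>+v. ennreal (?e v) * indicator {a..} v \<partial>lborel)" for a
  proof -
    have "((\<lambda>v. - ?e v) \<longlongrightarrow> 0) at_top" by real_asymp
    then have "(\<integral>\<^sup>+v. ennreal (?e v) * indicator {a..} v \<partial>lborel) = ennreal (0 - (- ?e a))"
      by (intro nn_integral_FTC_atLeast[where F="\<lambda>v. - ?e v"]) (auto intro!: derivative_eq_intros)
    then show ?thesis by simp
  qed
  have "(\<integral>\<^sup>+w. ennreal (norm (cinner w \<zeta>) ^ (2 * k) * exp (- (norm w powr (2 * m)))) \<partial>dV)
    = (\<integral>\<^sup>+w. (\<integral>\<^sup>+v. ennreal (norm (cinner w \<zeta>) ^ (2 * k) * ?e v * ?i w v) \<partial>lborel) \<partial>dV)"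
  proof (rule nn_integral_cong)
    fix w
    have "ennreal (norm (cinner w \<zeta>) ^ (2 * k) * exp (- (norm w powr (2 * m))))
      = ennreal (norm (cinner w \<zeta>) ^ (2 * k)) * ennreal (exp (- (norm w powr (2 * m))))"
      by (rule ennreal_mult) auto
    also have "\<dots> = ennreal (norm (cinner w \<zeta>) ^ (2 * k)) * (\<integral>\<^sup>+v. ennreal (?e v) * ?i w v \<partial>lborel)"
      by (rule arg_cong[OF lay])
    also have "\<dots> = (\<integral>\<^sup>+v. ennreal (norm (cinner w \<zeta>) ^ (2 * k)) * (ennreal (?e v) * ?i w v) \<partial>lborel)"
      by (rule nn_integral_cmult[symmetric]) measurable
    also have "\<dots> = (\<integral>\<^sup>+v. ennreal (norm (cinner w \<zeta>) ^ (2 * k) * ?e v * ?i w v) \<partial>lborel)"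
      by (rule nn_integral_cong) (simp add: indicator_def ennreal_mult)
    finally show "ennreal (norm (cinner w \<zeta>) ^ (2 * k) * exp (- (norm w powr (2 * m)))) =
      (\<integral>\<^sup>+v. ennreal (norm (cinner w \<zeta>) ^ (2 * k) * ?e v * ?i w v) \<partial>lborel)" .
  qed
  also have "\<dots> = (\<integral>\<^sup>+v. (\<integral>\<^sup>+w. ennreal (norm (cinner w \<zeta>) ^ (2 * k) * ?e v * ?i w v) \<partial>dV) \<partial>lborel)"
  proof (rule p.Fubini'[symmetric])
    have [measurable]: "fst \<in> borel_measurable ((dV :: (complex ^ 'n) measure) \<Otimes>\<^sub>M (lborel :: real measure))"
      by (rule measurable_compose[OF measurable_fst]) (intro borel_measurable_dV measurable_ident_sets refl)
    have "(\<lambda>x. ennreal (norm (cinner (fst x) \<zeta>) ^ (2 * k) * ?e (snd x) * of_bool (norm (fst x) powr (2 * m) \<le> snd x))) \<in> borel_measurable ((dV :: (complex ^ 'n) measure) \<Otimes>\<^sub>M lborel)"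
      by measurable
    then show "(\<lambda>(w, v). ennreal (norm (cinner w \<zeta>) ^ (2 * k) * ?e v * ?i w v)) \<in> borel_measurable ((dV :: (complex ^ 'n) measure) \<Otimes>\<^sub>M lborel)"
      by (simp add: indicator_def case_prod_unfold)
  qed
  also have "\<dots> = (\<integral>\<^sup>+v. ennreal (ball_moment \<zeta> k) * ennreal (indicator {0..} v * v powr ((real k + real CARD('n)) / m) / exp v) \<partial>lborel)"
  proof (rule nn_integral_cong_AE)
    have "AE v in lborel. v \<noteq> (0::real)" by (rule AE_lborel_singleton)
    then show "AE v in lborel. (\<integral>\<^sup>+w. ennreal (norm (cinner w \<zeta>) ^ (2 * k) * ?e v * ?i w v) \<partial>dV) =
       ennreal (ball_moment \<zeta> k) * ennreal (indicator {0..} v * v powr ((real k + real CARD('n)) / m) / exp v)"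
    proof eventually_elim
      case (elim v)
      show ?case
      proof (cases "v > 0")
        case False
        then have v: "v < 0" using elim by simp
        have "?i w v = (0::real)" for w
          using v powr_ge_zero[of "norm w" "2 * m"] by (auto simp: indicator_def simp del: powr_ge_zero)
        then show ?thesis using v by simp
      next
        case True
        define t where "t = v powr (1 / (2 * m))"
        have t: "t > 0" using True by (simp add: t_def)
        have tv: "t powr (2 * m) = v" using True m by (simp add: t_def powr_powr)
        have iff: "norm w powr (2 * m) \<le> v \<longleftrightarrow> norm w \<le> t" for w :: "complex ^ 'n"
          using m t powr_mono2[of "2 * m" "norm w" t] powr_less_mono2[of "2 * m" t "norm w"] unfolding tv
          by (auto simp: not_le[symmetric])
        have [measurable]: "ball (0 :: complex ^ 'n) r \<in> sets borel" for r by simp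
        have "(\<integral>\<^sup>+w. ennreal (norm (cinner w \<zeta>) ^ (2 * k) * ?e v * ?i w v) \<partial>dV)
           = (\<integral>\<^sup>+w. ennreal (?e v) * ennreal (norm (cinner w \<zeta>) ^ (2 * k) * indicator (ball 0 t) w) \<partial>dV)"
        proof (rule nn_integral_cong_AE)
          \<comment> \<open>The layer is a closed ball while the moments are those of open balls;
            the sphere between them is a null set.\<close>
          have "sphere (0 :: complex ^ 'n) t \<in> null_sets lebesgue"
            using negligible_sphere negligible_iff_null_sets by blast
          then have "AE w in lebesgue. w \<notin> sphere (0 :: complex ^ 'n) t" by (rule AE_not_in)
          then have "AE w in dV. w \<notin> sphere (0 :: complex ^ 'n) t"
            unfolding dV_density by (subst AE_density) auto
          then show "AE w in dV. ennreal (norm (cinner w \<zeta>) ^ (2 * k) * ?e v * ?i w v)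
             = ennreal (?e v) * ennreal (norm (cinner w \<zeta>) ^ (2 * k) * indicator (ball 0 t) w)"
            by eventually_elim (auto simp: indicator_def iff iff[unfolded mult.commute[of 2 m]] ennreal_mult'[symmetric] mult_ac)
        qed
        also have "\<dots> = ennreal (?e v) * ennreal (t powr (2 * (real k + real CARD('n))) * ball_moment \<zeta> k)"
          unfolding ball_moment_scale[OF t, symmetric] by (rule nn_integral_cmult, intro borel_measurable_dV) measurable
        also have "t powr (2 * (real k + real CARD('n))) = v powr ((real k + real CARD('n)) / m)"
        proof -
          have "1 / (2 * m) * (2 * (real k + real CARD('n))) = (real k + real CARD('n)) / m"
            using m by (simp add: divide_simps)
          then show ?thesis unfolding t_def powr_powr by simp
        qed
        finally show ?thesis using True ball_moment_nonneg[of \<zeta> k]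
          by (simp add: exp_minus divide_inverse mult_ac flip: ennreal_mult)
      qed
    qed
  qed
  also have "\<dots> = ennreal (ball_moment \<zeta> k) * (\<integral>\<^sup>+v. ennreal (indicator {0..} v * v powr ((real k + real CARD('n)) / m) / exp v) \<partial>lborel)"
    by (rule nn_integral_cmult) measurable
  also have "(\<integral>\<^sup>+v. ennreal (indicator {0..} v * v powr ((real k + real CARD('n)) / m) / exp v) \<partial>lborel)
     = ennreal (Gamma ((real k + real CARD('n)) / m + 1))"
    using Gamma_conv_nn_integral_real[of "(real k + real CARD('n)) / m + 1"] m by (simp add: add_pos_nonneg add_nonneg_pos)
  finally show ?thesis using ball_moment_nonneg[of \<zeta> k] by (simp add: ennreal_mult')
qed

text \<open>Once the lower coefficients vanish, division by s^m leaves a continuous power series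
  that is 0 off the origin and therefore also at it.\<close>

lemma powser_zero_coeff:
  fixes a :: "nat \<Rightarrow> real"
  assumes "\<And>s. (\<lambda>j. a j * s ^ j) sums 0"
  shows "a m = 0"
proof (induction m rule: less_induct)
  case (less m)
  let ?f = "\<lambda>s. \<Sum>j. a (j + m) * s ^ j"
  have sm: "(\<lambda>j. a (j + m) * s ^ j) sums 0" if "s \<noteq> 0" for s
  proof -
    have "(\<lambda>j. a (j + m) * s ^ (j + m)) sums (0 - (\<Sum>i<m. a i * s ^ i))"
      using sums_iff_shift[of "\<lambda>j. a j * s ^ j" m] assms[of s] by simp
    then have "(\<lambda>j. a (j + m) * s ^ (j + m)) sums 0" using less.IH by simp
    then have "(\<lambda>j. a (j + m) * s ^ (j + m) / s ^ m) sums (0 / s ^ m)" by (rule sums_divide)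
    then show ?thesis using that by (simp add: power_add)
  qed
  have sum0: "summable (\<lambda>j. a (j + m) * s ^ j)" for s
    by (cases "s = 0") (auto simp: sums_summable[OF sm] summable_0_powser)
  have "isCont ?f 0" by (rule isCont_powser_converges_everywhere) (rule sum0)
  then have "?f \<midarrow>0\<rightarrow> ?f 0" by (simp add: isCont_def)
  moreover have "eventually (\<lambda>s. ?f s = 0) (at 0)"
    using sm by (auto simp: eventually_at_filter sums_iff)
  then have "?f \<midarrow>0\<rightarrow> 0" by (simp add: tendsto_eventually)
  ultimately have "?f 0 = 0" by (rule tendsto_unique[rotated]) simp
  then show ?case by simp
qed

lemma ball_moment_0: "ball_moment (\<zeta> :: complex ^ 'n::finite) 0 = 1"
proof -
  have "ennreal (ball_moment \<zeta> 0) = (\<integral>\<^sup>+w. indicator (ball (0 :: complex ^ 'n) 1) w \<partial>dV)"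
    unfolding ball_moment_nn[symmetric] by (simp add: ennreal_indicator)
  also have "\<dots> = emeasure dV (ball (0 :: complex ^ 'n) 1)" by (rule nn_integral_indicator) simp
  also have "\<dots> = 1" by (simp add: emeasure_dV_ball)
  finally show ?thesis by (metis ennreal_1 ennreal_inj ball_moment_nonneg zero_le_one)
qed

lemma exp_weight_moment_2:
  fixes \<zeta> :: "complex ^ 'n::finite"
  shows "(\<integral>\<^sup>+w. ennreal (norm (cinner w \<zeta>) ^ (2 * k) * exp (- (norm w)\<^sup>2)) \<partial>dV)
    = ennreal (ball_moment \<zeta> k * fact (k + CARD('n)))"
proof -
  have "Gamma (real k + real CARD('n) + 1) = fact (k + CARD('n))"
    using Gamma_fact[of "k + CARD('n)", where 'a=real] by (simp add: add_ac)
  then show ?thesis using exp_weight_moment[of 1 \<zeta> k] by (simp add: powr_numeral)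
qed

text \<open>Completing the square: the exponent is s^2 |\<zeta>|^2 minus the squared norm of w - s
  \<zeta>. The value is the generating function behind \<open>gaussian_real_moment\<close>.\<close>

lemma gaussian_translate:
  fixes \<zeta> :: "complex ^ 'n::finite"
  shows "integrable dV (\<lambda>w. exp (2 * s * (w \<bullet> \<zeta>) - (norm w)\<^sup>2))"
    and "(\<integral>w. exp (2 * s * (w \<bullet> \<zeta>) - (norm w)\<^sup>2) \<partial>dV) = fact CARD('n) * exp (s\<^sup>2 * (norm \<zeta>)\<^sup>2)"
proof -
  let ?f = "\<lambda>w :: complex ^ 'n. ennreal (exp (- (norm w)\<^sup>2))"
  have fm: "?f \<in> borel_measurable borel" by measurable
  have m: "(\<lambda>w. exp (2 * s * (w \<bullet> \<zeta>) - (norm w)\<^sup>2)) \<in> borel_measurable dV"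
    by (intro borel_measurable_dV) measurable
  have G: "(\<integral>\<^sup>+w. ?f w \<partial>dV) = ennreal (fact CARD('n))"
    using exp_weight_moment_2[of "0 :: complex ^ 'n" 0] by (simp add: ball_moment_0)
  have sq: "2 * s * (w \<bullet> \<zeta>) - (norm w)\<^sup>2 = s\<^sup>2 * (norm \<zeta>)\<^sup>2 + - (norm (- (s *\<^sub>R \<zeta>) + 1 *\<^sub>R w))\<^sup>2" for w
    by (simp only: power2_norm_eq_inner power2_eq_square[of s] scaleR_one)
      (simp add: inner_diff_left inner_diff_right inner_commute[of w \<zeta>] algebra_simps)
  have "(\<integral>\<^sup>+w. ennreal (exp (2 * s * (w \<bullet> \<zeta>) - (norm w)\<^sup>2)) \<partial>dV)
    = (\<integral>\<^sup>+w. ennreal (exp (s\<^sup>2 * (norm \<zeta>)\<^sup>2)) * ?f (- (s *\<^sub>R \<zeta>) + 1 *\<^sub>R w) \<partial>dV)"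
    by (intro nn_integral_cong) (simp only: sq exp_add ennreal_mult[OF exp_ge_zero exp_ge_zero])
  also have "\<dots> = ennreal (exp (s\<^sup>2 * (norm \<zeta>)\<^sup>2)) * (\<integral>\<^sup>+w. ?f (- (s *\<^sub>R \<zeta>) + 1 *\<^sub>R w) \<partial>dV)"
    by (rule nn_integral_cmult, intro borel_measurable_dV) measurable
  also have "(\<integral>\<^sup>+w. ?f (- (s *\<^sub>R \<zeta>) + 1 *\<^sub>R w) \<partial>dV) = ennreal (fact CARD('n))"
    by (subst nn_integral_dV_affine[OF fm]) (simp_all add: G)
  finally have *: "(\<integral>\<^sup>+w. ennreal (exp (2 * s * (w \<bullet> \<zeta>) - (norm w)\<^sup>2)) \<partial>dV) = ennreal (fact CARD('n) * exp (s\<^sup>2 * (norm \<zeta>)\<^sup>2))"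
    by (simp add: ennreal_mult'' mult.commute)
  show "integrable dV (\<lambda>w. exp (2 * s * (w \<bullet> \<zeta>) - (norm w)\<^sup>2))"
    using m by (intro integrableI_nonneg) (auto simp: *)
  show "(\<integral>w. exp (2 * s * (w \<bullet> \<zeta>) - (norm w)\<^sup>2) \<partial>dV) = fact CARD('n) * exp (s\<^sup>2 * (norm \<zeta>)\<^sup>2)"
    using m by (intro integral_eq_nn_integral[THEN trans]) (auto simp: *)
qed

text \<open>Both sides of \<open>gaussian_translate\<close> are power series in s, and equal
  coefficients give the moments. This takes the place of polar coordinates.\<close>

lemma gaussian_real_moment:
  fixes \<zeta> :: "complex ^ 'n::finite"
  defines "M \<equiv> \<lambda>j. \<integral>w. (2 * (w \<bullet> \<zeta>)) ^ j * exp (- (norm w)\<^sup>2) \<partial>dV"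
  shows "M (2 * k) = fact CARD('n) * norm \<zeta> ^ (2 * k) * fact (2 * k) / fact k"
proof -
  let ?x = "\<lambda>w. 2 * (w \<bullet> \<zeta>)"
  have S: "(\<lambda>j. M j / fact j * s ^ j) sums (fact CARD('n) * exp (s\<^sup>2 * (norm \<zeta>)\<^sup>2))" for s
  proof -
    \<comment> \<open>A majorant of all partial sums, because exp |y| \<le> exp y + exp (-
      y).\<close>
    let ?W = "\<lambda>w. exp (2 * s * (w \<bullet> \<zeta>) - (norm w)\<^sup>2) + exp (2 * (- s) * (w \<bullet> \<zeta>) - (norm w)\<^sup>2)"
    let ?t = "\<lambda>j w. (s * ?x w) ^ j / fact j * exp (- (norm w)\<^sup>2)"
    let ?f = "\<lambda>w. exp (2 * s * (w \<bullet> \<zeta>) - (norm w)\<^sup>2)"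
    have W: "integrable dV ?W" by (intro Bochner_Integration.integrable_add gaussian_translate)
    have es: "(\<lambda>j. y ^ j / fact j) sums exp y" for y :: real
      using exp_converges[of y] by (simp add: field_simps)
    have expabs: "exp \<bar>y\<bar> * e \<le> exp y * e + exp (- y) * e" if "e \<ge> 0" for y e :: real
      using that by (cases "y \<ge> 0") auto
    have psum: "(\<Sum>j<K. \<bar>y\<bar> ^ j / fact j) \<le> exp \<bar>y\<bar>" for y :: real and K
      using sum_le_suminf[OF sums_summable[OF es], of "{..<K}" "\<bar>y\<bar>"] sums_unique[OF es, of "\<bar>y\<bar>"] by simp
    have dom: "(\<Sum>j<K. \<bar>s * ?x w\<bar> ^ j / fact j) * exp (- (norm w)\<^sup>2) \<le> ?W w" for K w
    proof -
      have "(\<Sum>j<K. \<bar>s * ?x w\<bar> ^ j / fact j) * exp (- (norm w)\<^sup>2) \<le> exp \<bar>s * ?x w\<bar> * exp (- (norm w)\<^sup>2)"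
        by (intro mult_right_mono psum) simp
      also have "\<dots> \<le> exp (s * ?x w) * exp (- (norm w)\<^sup>2) + exp (- (s * ?x w)) * exp (- (norm w)\<^sup>2)"
        by (rule expabs) simp
      also have "\<dots> = ?W w" by (simp add: mult_ac flip: exp_add)
      finally show ?thesis .
    qed
    have 1: "?f \<in> borel_measurable dV" by (intro borel_measurable_dV) measurable
    have 2: "(\<lambda>w. \<Sum>j<K. ?t j w) \<in> borel_measurable dV" for K by (intro borel_measurable_dV) measurable
    have 4: "AE w in dV. (\<lambda>K. \<Sum>j<K. ?t j w) \<longlonglongrightarrow> ?f w"
    proof (intro AE_I2)
      fix w
      have "(\<lambda>j. ?t j w) sums (exp (s * ?x w) * exp (- (norm w)\<^sup>2))"
        by (intro sums_mult2 es)
      also have "exp (s * ?x w) * exp (- (norm w)\<^sup>2) = ?f w" by (simp add: mult_ac flip: exp_add)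
      finally show "(\<lambda>K. \<Sum>j<K. ?t j w) \<longlonglongrightarrow> ?f w" by (simp add: sums_def)
    qed
    have 5: "AE w in dV. norm (\<Sum>j<K. ?t j w) \<le> ?W w" for K
    proof (intro AE_I2)
      fix w
      have "norm (\<Sum>j<K. ?t j w) \<le> (\<Sum>j<K. \<bar>s * ?x w\<bar> ^ j / fact j * exp (- (norm w)\<^sup>2))"
        by (intro sum_norm_le) (auto simp: abs_mult power_abs)
      also have "\<dots> = (\<Sum>j<K. \<bar>s * ?x w\<bar> ^ j / fact j) * exp (- (norm w)\<^sup>2)" by (simp add: sum_distrib_right)
      also note dom
      finally show "norm (\<Sum>j<K. ?t j w) \<le> ?W w" .
    qed
    have lim: "(\<lambda>K. \<integral>w. (\<Sum>j<K. ?t j w) \<partial>dV) \<longlonglongrightarrow> integral\<^sup>L dV ?f"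
      by (rule integral_dominated_convergence[OF 1 2 W 4 5])
    have it: "integrable dV (?t j)" for j
    proof (rule Bochner_Integration.integrable_bound[OF W])
      show "?t j \<in> borel_measurable dV" by (intro borel_measurable_dV) measurable
      show "AE w in dV. norm (?t j w) \<le> norm (?W w)"
      proof (intro AE_I2)
        fix w
        have "norm (?t j w) = (\<Sum>j\<in>{j}. \<bar>s * ?x w\<bar> ^ j / fact j) * exp (- (norm w)\<^sup>2)" by (simp add: abs_mult power_abs)
        also have "\<dots> \<le> (\<Sum>j<Suc j. \<bar>s * ?x w\<bar> ^ j / fact j) * exp (- (norm w)\<^sup>2)"
          by (intro mult_right_mono sum_mono2) auto
        also have "\<dots> \<le> ?W w" by (rule dom)
        also have "\<dots> \<le> norm (?W w)" by simp
        finally show "norm (?t j w) \<le> norm (?W w)" .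
      qed
    qed
    have "(\<integral>w. (\<Sum>j<K. ?t j w) \<partial>dV) = (\<Sum>j<K. M j / fact j * s ^ j)" for K
    proof -
      have "integral\<^sup>L dV (?t j) = M j / fact j * s ^ j" for j
      proof -
        have "integral\<^sup>L dV (?t j) = (\<integral>w. s ^ j / fact j * ((2 * (w \<bullet> \<zeta>)) ^ j * exp (- (norm w)\<^sup>2)) \<partial>dV)"
          by (simp add: power_mult_distrib mult_ac)
        then show ?thesis by (simp add: M_def)
      qed
      then show ?thesis using it by (subst Bochner_Integration.integral_sum) auto
    qed
    then show ?thesis using lim unfolding gaussian_translate by (simp add: sums_def)
  qed
  define b where "b j = (if even j then fact CARD('n) * norm \<zeta> ^ j / fact (j div 2) else 0)" for j
  have T: "(\<lambda>j. b j * s ^ j) sums (fact CARD('n) * exp (s\<^sup>2 * (norm \<zeta>)\<^sup>2))" for s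
  proof -
    have "(\<lambda>i. fact CARD('n) * ((s\<^sup>2 * (norm \<zeta>)\<^sup>2) ^ i /\<^sub>R fact i)) sums (fact CARD('n) * exp (s\<^sup>2 * (norm \<zeta>)\<^sup>2))"
      by (intro sums_mult exp_converges)
    moreover have "fact CARD('n) * ((s\<^sup>2 * (norm \<zeta>)\<^sup>2) ^ i /\<^sub>R fact i) = b (2 * i) * s ^ (2 * i)" for i
    proof -
      have "(s\<^sup>2 * (norm \<zeta>)\<^sup>2) ^ i = s ^ (2 * i) * norm \<zeta> ^ (2 * i)"
        by (simp only: power_mult_distrib power_mult[symmetric])
      then show ?thesis by (simp add: b_def divide_inverse mult_ac)
    qed
    ultimately have "(\<lambda>i. b (2 * i) * s ^ (2 * i)) sums (fact CARD('n) * exp (s\<^sup>2 * (norm \<zeta>)\<^sup>2))" by simp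
    then show ?thesis
      by (subst (asm) sums_mono_reindex[of "\<lambda>i. 2 * i" "\<lambda>j. b j * s ^ j"]) (auto simp: strict_mono_def b_def)
  qed
  have "(\<lambda>j. (M j / fact j - b j) * s ^ j) sums 0" for s
    using sums_diff[OF S T, of s s] by (simp add: algebra_simps)
  then have "M (2 * k) / fact (2 * k) - b (2 * k) = 0" by (rule powser_zero_coeff)
  then show ?thesis by (simp add: b_def field_simps)
qed

text \<open>The real moments are known, and 2 (w \<bullet> \<zeta>) is
  \<open>cinner w \<zeta>\<close> plus its conjugate. In the expansion of the 2k-th power rotation
  kills all terms but the middle one, so the real moment is the central binomial coefficient times
  the wanted moment.\<close>

lemma ball_moment_eq:
  fixes \<zeta> :: "complex ^ 'n::finite"
  shows "ball_moment \<zeta> k * fact (k + CARD('n)) = fact CARD('n) * fact k * norm \<zeta> ^ (2 * k)"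
proof -
  let ?g = "\<lambda>w :: complex ^ 'n. exp (- (norm w)\<^sup>2)"
  let ?u = "\<lambda>w. cinner w \<zeta>"
  have m: "(\<lambda>w. norm (?u w) ^ (2 * k) * ?g w) \<in> borel_measurable dV" by (intro borel_measurable_dV) measurable
  have X: "integrable dV (\<lambda>w. norm (?u w) ^ (2 * k) * ?g w)"
    using m by (intro integrableI_nonneg) (auto simp: exp_weight_moment_2)
  have Xv: "(\<integral>w. norm (?u w) ^ (2 * k) * ?g w \<partial>dV) = ball_moment \<zeta> k * fact (k + CARD('n))"
    using m ball_moment_nonneg[of \<zeta> k] by (intro integral_eq_nn_integral[THEN trans]) (auto simp: exp_weight_moment_2)
  let ?t = "\<lambda>i w. cinner w \<zeta> ^ i * cinner \<zeta> w ^ (2 * k - i) * of_real (?g w)"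
  have it: "integrable dV (?t i)" if "i \<le> 2 * k" for i
  proof (rule Bochner_Integration.integrable_bound[OF X])
    show "?t i \<in> borel_measurable dV" by (intro borel_measurable_dV) measurable
    show "AE w in dV. norm (?t i w) \<le> norm (norm (?u w) ^ (2 * k) * ?g w)"
    proof (intro AE_I2)
      fix w
      have "norm (cinner \<zeta> w) = norm (cinner w \<zeta>)" by (subst cinner_commute) simp
      then show "norm (?t i w) \<le> norm (norm (?u w) ^ (2 * k) * ?g w)"
        using that by (simp add: norm_mult norm_power flip: power_add)
    qed
  qed
  have "complex_of_real (\<integral>w. (2 * (w \<bullet> \<zeta>)) ^ (2 * k) * ?g w \<partial>dV) = (\<integral>w. of_real ((2 * (w \<bullet> \<zeta>)) ^ (2 * k) * ?g w) \<partial>dV)"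
    by (rule integral_complex_of_real[symmetric])
  also have "\<dots> = (\<integral>w. (\<Sum>i\<le>2 * k. of_nat (2 * k choose i) * ?t i w) \<partial>dV)"
  proof (rule Bochner_Integration.integral_cong[OF refl])
    fix w
    have "of_real (2 * (w \<bullet> \<zeta>)) = cinner w \<zeta> + cinner \<zeta> w"
      by (subst (2) cinner_commute) (simp add: Re_cinner complex_add_cnj)
    then have "complex_of_real ((2 * (w \<bullet> \<zeta>)) ^ (2 * k) * ?g w) = (cinner w \<zeta> + cinner \<zeta> w) ^ (2 * k) * of_real (?g w)"
      by (simp only: of_real_mult[of "_ ^ _"] of_real_power)
    also have "(cinner w \<zeta> + cinner \<zeta> w) ^ (2 * k) = (\<Sum>i\<le>2 * k. of_nat (2 * k choose i) * cinner w \<zeta> ^ i * cinner \<zeta> w ^ (2 * k - i))"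
      by (rule binomial_ring)
    finally show "complex_of_real ((2 * (w \<bullet> \<zeta>)) ^ (2 * k) * ?g w) = (\<Sum>i\<le>2 * k. of_nat (2 * k choose i) * ?t i w)"
      by (simp only: sum_distrib_right mult.assoc)
  qed
  also have "\<dots> = (\<Sum>i\<le>2 * k. of_nat (2 * k choose i) * (\<integral>w. ?t i w \<partial>dV))"
    using it by (subst Bochner_Integration.integral_sum) auto
  also have "\<dots> = (\<Sum>i\<in>{k}. of_nat (2 * k choose i) * (\<integral>w. ?t i w \<partial>dV))"
  proof (intro sum.mono_neutral_right ballI)
    fix i assume i: "i \<in> {..2 * k} - {k}"
    have "(\<integral>w. ?t i w \<partial>dV) = 0"
      using integral_mixed_moment_zero[of "\<lambda>r. of_real (exp (- r\<^sup>2))" "2 * k - i" i \<zeta> \<zeta>] i by auto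
    then show "of_nat (2 * k choose i) * (\<integral>w. ?t i w \<partial>dV) = 0" by simp
  qed auto
  also have "\<dots> = of_nat (2 * k choose k) * (\<integral>w. ?t k w \<partial>dV)" by simp
  also have "(\<integral>w. ?t k w \<partial>dV) = (\<integral>w. of_real (norm (?u w) ^ (2 * k) * ?g w) \<partial>dV)"
  proof (rule Bochner_Integration.integral_cong[OF refl])
    fix w
    have "of_real (norm (cinner w \<zeta>) ^ (2 * k)) = (of_real ((norm (cinner w \<zeta>))\<^sup>2) :: complex) ^ k"
      by (simp add: power_mult)
    also have "\<dots> = cinner w \<zeta> ^ k * cinner \<zeta> w ^ k"
      by (subst (3) cinner_commute) (simp only: complex_norm_square power_mult_distrib)
    finally have "of_real (norm (cinner w \<zeta>) ^ (2 * k)) = cinner w \<zeta> ^ k * cinner \<zeta> w ^ k" .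
    then show "?t k w = of_real (norm (?u w) ^ (2 * k) * ?g w)"
      by (simp only: of_real_mult) (simp add: mult_2)
  qed
  also have "\<dots> = of_real (\<integral>w. norm (?u w) ^ (2 * k) * ?g w \<partial>dV)" by (rule integral_complex_of_real)
  finally have "complex_of_real (\<integral>w. (2 * (w \<bullet> \<zeta>)) ^ (2 * k) * ?g w \<partial>dV) = of_real (real (2 * k choose k) * (\<integral>w. norm (?u w) ^ (2 * k) * ?g w \<partial>dV))"
    by simp
  then have "(\<integral>w. (2 * (w \<bullet> \<zeta>)) ^ (2 * k) * ?g w \<partial>dV) = real (2 * k choose k) * (\<integral>w. norm (?u w) ^ (2 * k) * ?g w \<partial>dV)"
    by (simp only: of_real_eq_iff)
  then have "fact CARD('n) * norm \<zeta> ^ (2 * k) * fact (2 * k) / fact k = real (2 * k choose k) * (ball_moment \<zeta> k * fact (k + CARD('n)))"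
    unfolding gaussian_real_moment Xv .
  moreover have "real (2 * k choose k) = fact (2 * k) / (fact k * fact k)"
    by (subst binomial_fact) auto
  ultimately have "fact (2 * k) / (fact k * fact k) * (ball_moment \<zeta> k * fact (k + CARD('n)))
      = fact (2 * k) / (fact k * fact k) * (fact CARD('n) * fact k * norm \<zeta> ^ (2 * k))"
    by (simp add: mult_ac)
  then show ?thesis by (subst (asm) mult_left_cancel) auto
qed

text \<open>The Gamma factor of the weighted moment cancels that of the coefficient, by Gamma (t +
  1) = t Gamma t and l t = k + n. This normalization of the powers is what makes the kernel
  reproducing.\<close>

lemma bh_moment:
  fixes \<zeta> :: "complex ^ 'n::finite"
  assumes l: "l \<ge> 1"
  shows "integrable dV (\<lambda>w. norm (cinner w \<zeta>) ^ (2 * k) * exp (- (norm w powr (2 * l))))"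
    and "bh CARD('n) l k * (\<integral>w. norm (cinner w \<zeta>) ^ (2 * k) * exp (- (norm w powr (2 * l))) \<partial>dV) = norm \<zeta> ^ (2 * k)"
proof -
  let ?n = "CARD('n)"
  define t where "t = (real k + real ?n) / l"
  have t: "t > 0" using l by (simp add: t_def add_nonneg_pos)
  have m: "(\<lambda>w. norm (cinner w \<zeta>) ^ (2 * k) * exp (- (norm w powr (2 * l)))) \<in> borel_measurable dV"
    by (intro borel_measurable_dV) measurable
  have e: "(\<integral>\<^sup>+w. ennreal (norm (cinner w \<zeta>) ^ (2 * k) * exp (- (norm w powr (2 * l)))) \<partial>dV) = ennreal (ball_moment \<zeta> k * Gamma (t + 1))"
    using exp_weight_moment[of l \<zeta> k] l by (simp add: t_def)
  show "integrable dV (\<lambda>w. norm (cinner w \<zeta>) ^ (2 * k) * exp (- (norm w powr (2 * l))))"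
    using m by (intro integrableI_nonneg) (auto simp: e)
  have "(\<integral>w. norm (cinner w \<zeta>) ^ (2 * k) * exp (- (norm w powr (2 * l))) \<partial>dV) = ball_moment \<zeta> k * Gamma (t + 1)"
    using m ball_moment_nonneg[of \<zeta> k] t by (intro integral_eq_nn_integral[THEN trans]) (auto simp: e)
  moreover have "Gamma (t + 1) = t * Gamma t" using t by (intro Gamma_plus1) (auto elim!: nonpos_Ints_cases)
  moreover have "bh ?n l k = l / fact ?n * (fact (?n - 1 + k) / fact k / Gamma t)"
    by (simp add: bh_def ml_coeff_def t_def)
  moreover have "fact (k + ?n) = (l * t) * (fact (?n - 1 + k) :: real)"
  proof -
    have "k + ?n = Suc (?n - 1 + k)" by simp
    then have "fact (k + ?n) = real (k + ?n) * (fact (?n - 1 + k) :: real)" by (metis fact_Suc of_nat_fact)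
    moreover have "l * t = real (k + ?n)" using l by (simp add: t_def)
    ultimately show ?thesis by simp
  qed
  moreover have "Gamma t > 0" using t by simp
  ultimately have "bh ?n l k * (\<integral>w. norm (cinner w \<zeta>) ^ (2 * k) * exp (- (norm w powr (2 * l))) \<partial>dV)
     = ball_moment \<zeta> k * fact (k + ?n) / (fact ?n * fact k)"
    by (simp add: field_simps)
  also have "\<dots> = norm \<zeta> ^ (2 * k)" by (simp add: ball_moment_eq)
  finally show "bh ?n l k * (\<integral>w. norm (cinner w \<zeta>) ^ (2 * k) * exp (- (norm w powr (2 * l))) \<partial>dV) = norm \<zeta> ^ (2 * k)" .
qed

section \<open>Decay of the kernel off the diagonal\<close>

lemma poly_gaussian_bounded:
  fixes c k :: real
  assumes "c > 0" "k \<ge> 0"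
  shows "\<exists>C>0. \<forall>D\<ge>0. (1 + D) powr k * exp (- c * D\<^sup>2) \<le> C"
proof (intro exI[of _ "exp (k\<^sup>2 / (4 * c))"] conjI allI impI)
  fix D :: real assume D: "D \<ge> 0"
  have "(1 + D) powr k = exp (k * ln (1 + D))" using D by (simp add: powr_def)
  also have "\<dots> \<le> exp (k * D)" using D assms ln_add_one_self_le_self[of D] by (simp add: mult_left_mono)
  finally have "(1 + D) powr k * exp (- c * D\<^sup>2) \<le> exp (k * D) * exp (- c * D\<^sup>2)" by (intro mult_right_mono) auto
  also have "\<dots> = exp (k * D - c * D\<^sup>2)" by (simp flip: exp_add)
  also have "k * D - c * D\<^sup>2 \<le> k\<^sup>2 / (4 * c)"
  proof -
    have "0 \<le> (2 * c * D - k)\<^sup>2" by simp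
    then have "4 * c * (k * D - c * D\<^sup>2) \<le> k\<^sup>2" by (simp add: power2_eq_square algebra_simps)
    then show ?thesis using assms by (simp add: field_simps)
  qed
  finally show "(1 + D) powr k * exp (- c * D\<^sup>2) \<le> exp (k\<^sup>2 / (4 * c))" by simp
qed auto

lemma sq_powr: "Z \<ge> 0 \<Longrightarrow> (Z\<^sup>2) powr l = Z powr (2 * l)" for Z l :: real
  by (cases "Z = 0") (auto simp: powr_powr simp flip: powr_numeral)

text \<open>
  The Gaussian decay comes from convexity: with \<open>S = (Z\<^sup>2 + W\<^sup>2) / 2\<close> and \<open>S - x = d\<^sup>2 / 2\<close> one has
  \<open>x\<^sup>l - (Z\<^sup>2\<^sup>l + W\<^sup>2\<^sup>l) / 2 \<le> x\<^sup>l - S\<^sup>l \<le> - (d\<^sup>2 / 4) S\<^sup>l\<^sup>-\<^sup>1\<close>.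
\<close>

lemma exponent_bound:
  fixes Z W x d l :: real
  assumes l: "l \<ge> 1" and pos: "Z \<ge> 0" "W \<ge> 0" "d \<ge> 0"
    and x: "\<bar>x\<bar> \<le> Z * W" and d: "d\<^sup>2 = Z\<^sup>2 + W\<^sup>2 - 2 * x"
  defines "S \<equiv> (Z\<^sup>2 + W\<^sup>2) / 2"
  shows "(max 0 x) powr l - (Z powr (2 * l) + W powr (2 * l)) / 2 \<le> - (d\<^sup>2 / 4) * S powr (l - 1)"
    and "max 0 x \<le> S" and "d\<^sup>2 / 4 \<le> S"
proof -
  have "Z * W \<le> S"
  proof -
    have "0 \<le> (Z - W)\<^sup>2" by simp
    then show ?thesis by (simp add: S_def power2_eq_square algebra_simps)
  qed
  then have xS: "x \<le> S" "- x \<le> S" using x by auto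
  have dS: "d\<^sup>2 / 2 = S - x" using d by (simp add: S_def)
  have S0: "S \<ge> 0" by (simp add: S_def)
  show mS: "max 0 x \<le> S" using xS S0 by simp
  show d4: "d\<^sup>2 / 4 \<le> S" using dS xS by simp
  \<comment> \<open>For x \<ge> 0 the gap is d^2 / 2. For x < 0 it is S itself, and - x \<le> S
    gives d^2 / 4 \<le> S.\<close>
  have gap: "d\<^sup>2 / 4 \<le> S - max 0 x" using dS xS d4 S0 by (cases "x \<ge> 0") auto
  \<comment> \<open>Midpoint convexity of the l-th power, from its tangent at S: the linear parts
    cancel since Z^2 and W^2 have mean S.\<close>
  have cv: "2 * S powr l \<le> Z powr (2 * l) + W powr (2 * l)"
  proof (cases "S = 0")
    case False
    then have S: "S > 0" using S0 by simp
    have "1 + l * (Z\<^sup>2 / S - 1) \<le> (Z\<^sup>2 / S) powr l" "1 + l * (W\<^sup>2 / S - 1) \<le> (W\<^sup>2 / S) powr l"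
      using S l by (auto intro!: powr_tangent)
    then have "2 + l * ((Z\<^sup>2 + W\<^sup>2) / S - 2) \<le> (Z powr (2 * l) + W powr (2 * l)) / S powr l"
      using pos S by (simp add: powr_divide sq_powr add_divide_distrib algebra_simps)
    moreover have "Z\<^sup>2 + W\<^sup>2 = 2 * S" by (simp add: S_def)
    then have "(Z\<^sup>2 + W\<^sup>2) / S = 2" using False by simp
    ultimately have "2 \<le> (Z powr (2 * l) + W powr (2 * l)) / S powr l" by simp
    then show ?thesis using S by (simp add: pos_le_divide_eq)
  qed simp
  have Sl: "S powr l = S * S powr (l - 1)"
    using S0 by (cases "S = 0") (auto simp: powr_diff)
  have "(max 0 x) powr l = max 0 x * (max 0 x) powr (l - 1)"
    by (cases "max 0 x = 0") (auto simp: powr_diff)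
  also have "\<dots> \<le> max 0 x * S powr (l - 1)"
    using mS l by (intro mult_left_mono powr_mono2) auto
  finally have "(max 0 x) powr l - S powr l \<le> - (S - max 0 x) * S powr (l - 1)"
    unfolding Sl by (simp add: algebra_simps)
  also have "\<dots> \<le> - (d\<^sup>2 / 4) * S powr (l - 1)"
    using gap by (intro mult_right_mono) auto
  finally have fin: "(max 0 x) powr l - S powr l \<le> - (d\<^sup>2 / 4) * S powr (l - 1)" .
  show "(max 0 x) powr l - (Z powr (2 * l) + W powr (2 * l)) / 2 \<le> - (d\<^sup>2 / 4) * S powr (l - 1)"
  proof -
    have "a - P / 2 \<le> X" if "a - s \<le> X" "2 * s \<le> P" for a P X s :: real using that by linarith
    then show ?thesis using fin cv by blast
  qed
qed

text \<open>Expresses the decay in the natural variable R^(l-1) d with R = 1 + Z. For Z \<ge> 1 one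
  has R^2 \<le> 4 Z^2 \<le> 8 S, whence the 8. For Z < 1 also R^2 \<le> 8, and either d^2 / 4 \<le>
  1, which the factor exp 1 pays for, or S \<ge> d^2 / 4 > 1.\<close>

lemma gaussian_factor_bound:
  fixes Z S d l :: real
  assumes l: "l \<ge> 1" and Z: "Z \<ge> 0" "d \<ge> 0" and S: "Z\<^sup>2 / 2 \<le> S" "d\<^sup>2 / 4 \<le> S"
  shows "exp (- (d\<^sup>2 / 4) * S powr (l - 1)) \<le> exp 1 * exp (- (8 powr (1 - l) / 4) * ((1 + Z) powr (l - 1) * d)\<^sup>2)"
proof -
  define c where "c = 8 powr (1 - l) / 4"
  define R where "R = 1 + Z"
  have R: "R \<ge> 1" using Z by (simp add: R_def)
  have D2: "(R powr (l - 1) * d)\<^sup>2 = (R\<^sup>2) powr (l - 1) * d\<^sup>2"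
    using R by (simp add: power2_eq_square powr_mult mult_ac)
  have key: "c * ((R\<^sup>2) powr (l - 1) * d\<^sup>2) \<le> 1 + (d\<^sup>2 / 4) * S powr (l - 1)"
  proof (cases "Z \<ge> 1")
    case True
    have "R\<^sup>2 \<le> (2 * Z)\<^sup>2" using True Z by (intro power_mono) (auto simp: R_def)
    then have "R\<^sup>2 / 8 \<le> S" using S by (simp add: power_mult_distrib)
    then have "(R\<^sup>2 / 8) powr (l - 1) \<le> S powr (l - 1)" using l by (intro powr_mono2) auto
    moreover have "(R\<^sup>2 / 8) powr (l - 1) = 8 powr (1 - l) * (R\<^sup>2) powr (l - 1)"
      by (simp add: powr_divide powr_diff field_simps)
    ultimately have "(d\<^sup>2 / 4) * (8 powr (1 - l) * (R\<^sup>2) powr (l - 1)) \<le> (d\<^sup>2 / 4) * S powr (l - 1)"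
      by (intro mult_left_mono) auto
    then show ?thesis by (simp add: c_def mult_ac)
  next
    case False
    then have "R\<^sup>2 \<le> 2\<^sup>2" using Z by (intro power_mono) (auto simp: R_def)
    then have "(R\<^sup>2) powr (l - 1) \<le> 8 powr (l - 1)" using l by (intro powr_mono2) auto
    then have "c * ((R\<^sup>2) powr (l - 1) * d\<^sup>2) \<le> c * (8 powr (l - 1) * d\<^sup>2)"
      by (intro mult_left_mono mult_right_mono) (auto simp: c_def)
    also have "\<dots> = (8 powr (1 - l) * 8 powr (l - 1)) * (d\<^sup>2 / 4)" by (simp add: c_def)
    also have "8 powr (1 - l) * 8 powr (l - 1) = (1::real)" by (simp flip: powr_add)
    also have "1 * (d\<^sup>2 / 4) \<le> 1 + (d\<^sup>2 / 4) * S powr (l - 1)"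
    proof (cases "d\<^sup>2 / 4 \<le> 1")
      case True
      moreover have "0 \<le> (d\<^sup>2 / 4) * S powr (l - 1)" by simp
      ultimately show ?thesis by linarith
    next
      case False
      then have "1 \<le> S powr (l - 1)" using S l by (intro ge_one_powr_ge_zero) auto
      then have "(d\<^sup>2 / 4) * 1 \<le> (d\<^sup>2 / 4) * S powr (l - 1)" by (intro mult_left_mono) auto
      then show ?thesis by simp
    qed
    finally show ?thesis .
  qed
  have "- (d\<^sup>2 / 4) * S powr (l - 1) \<le> 1 + - c * ((R powr (l - 1) * d)\<^sup>2)"
    using key unfolding D2 by simp
  then have "exp (- (d\<^sup>2 / 4) * S powr (l - 1)) \<le> exp (1 + - c * ((R powr (l - 1) * d)\<^sup>2))" by simp
  then show ?thesis by (simp only: exp_add c_def R_def)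
qed

text \<open>Z, W, x and d stand for |z|, |w|, the real part of \<open>cinner z w\<close> and |z -
  w|. The polynomial growth of H is at most (R (1 + D))^(2s) with s = n (l - 1). Its part in D and
  the wanted M powers are swallowed by the Gaussian factor, and R^(2s) remains.\<close>

lemma kernel_bound_real:
  assumes n: "n \<ge> 1" and l: "l \<ge> 1" and M: "M \<ge> 0"
  obtains C where "C > 0"
    "\<And>Z W x d. Z \<ge> 0 \<Longrightarrow> W \<ge> 0 \<Longrightarrow> d \<ge> 0 \<Longrightarrow> \<bar>x\<bar> \<le> Z * W \<Longrightarrow> d\<^sup>2 = Z\<^sup>2 + W\<^sup>2 - 2 * x \<Longrightarrow>
      bHr n l (max 0 x) * exp (- (Z powr (2 * l) + W powr (2 * l)) / 2)
      \<le> C * (1 + Z) powr (2 * real n * (l - 1)) * (1 + (1 + Z) powr (l - 1) * d) powr (- M)"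
proof -
  obtain C0 where C0: "C0 > 0" "\<And>x. x \<ge> 0 \<Longrightarrow> bHr n l x \<le> C0 * (1 + x) powr (real n * (l - 1)) * exp (x powr l)"
    using bHr_upper[OF n l] by blast
  define s where "s = real n * (l - 1)"
  have s: "s \<ge> 0" using l by (simp add: s_def)
  define c where "c = 8 powr (1 - l) / 4"
  have c: "c > 0" by (simp add: c_def)
  obtain C1 where C1: "C1 > 0" "\<And>D. D \<ge> 0 \<Longrightarrow> (1 + D) powr (2 * s + M) * exp (- c * D\<^sup>2) \<le> C1"
    using poly_gaussian_bounded[OF c, of "2 * s + M"] s M by auto
  show ?thesis
  proof (rule that[of "C0 * exp 1 * C1"])
    show "C0 * exp 1 * C1 > 0" using C0 C1 by simp
    fix Z W x d :: real
    assume a: "Z \<ge> 0" "W \<ge> 0" "d \<ge> 0" "\<bar>x\<bar> \<le> Z * W" "d\<^sup>2 = Z\<^sup>2 + W\<^sup>2 - 2 * x"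
    define S where "S = (Z\<^sup>2 + W\<^sup>2) / 2"
    define R where "R = 1 + Z"
    define D where "D = R powr (l - 1) * d"
    have R: "R \<ge> 1" using a by (simp add: R_def)
    have "R powr (l - 1) \<ge> 1" using R l by (intro ge_one_powr_ge_zero) auto
    then have dD: "d \<le> D" using a mult_right_mono[of 1 "R powr (l - 1)" d] by (simp add: D_def)
    then have D0: "D \<ge> 0" using a by simp
    note eb = exponent_bound[OF l a(1-3) a(4,5), folded S_def]
    have "(W - Z)\<^sup>2 \<le> d\<^sup>2" using a(4,5) by (simp add: power2_eq_square algebra_simps)
    then have "\<bar>W - Z\<bar> \<le> \<bar>d\<bar>" by (simp add: abs_le_square_iff)
    then have W: "W \<le> Z + d" using a by simp
    have "S \<le> (Z + d)\<^sup>2"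
    proof -
      have "Z\<^sup>2 \<le> (Z + d)\<^sup>2" "W\<^sup>2 \<le> (Z + d)\<^sup>2" using a(1-3) W by (auto intro!: power_mono)
      then show ?thesis by (simp add: S_def)
    qed
    then have "1 + max 0 x \<le> 1 + (Z + d)\<^sup>2" using eb(2) by simp
    also have "\<dots> \<le> (1 + (Z + d))\<^sup>2" using a by (simp add: power2_eq_square algebra_simps)
    also have "\<dots> \<le> (R * (1 + d))\<^sup>2" using a by (intro power_mono) (auto simp: R_def algebra_simps)
    also have "\<dots> \<le> (R * (1 + D))\<^sup>2" using a dD R by (intro power_mono mult_left_mono) auto
    finally have "(1 + max 0 x) powr s \<le> ((R * (1 + D))\<^sup>2) powr s" using s by (intro powr_mono2) auto
    also have "\<dots> = R powr (2 * s) * (1 + D) powr (2 * s)" using R D0 by (simp add: sq_powr powr_mult)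
    finally have p: "(1 + max 0 x) powr s \<le> R powr (2 * s) * (1 + D) powr (2 * s)" .
    have "exp (- (d\<^sup>2 / 4) * S powr (l - 1)) \<le> exp 1 * exp (- c * D\<^sup>2)"
      unfolding c_def D_def R_def using a eb(3) by (intro gaussian_factor_bound l) (auto simp: S_def)
    moreover have "(max 0 x) powr l + - (Z powr (2 * l) + W powr (2 * l)) / 2 \<le> - (d\<^sup>2 / 4) * S powr (l - 1)"
      using eb(1) by linarith
    ultimately have e: "exp ((max 0 x) powr l + - (Z powr (2 * l) + W powr (2 * l)) / 2) \<le> exp 1 * exp (- c * D\<^sup>2)"
      by (meson exp_le_cancel_iff order_trans)
    have "bHr n l (max 0 x) * exp (- (Z powr (2 * l) + W powr (2 * l)) / 2)
       \<le> (C0 * (1 + max 0 x) powr s * exp ((max 0 x) powr l)) * exp (- (Z powr (2 * l) + W powr (2 * l)) / 2)"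
      unfolding s_def using C0(2)[of "max 0 x"] by (intro mult_right_mono) auto
    also have "\<dots> = C0 * (1 + max 0 x) powr s * exp ((max 0 x) powr l + - (Z powr (2 * l) + W powr (2 * l)) / 2)"
      by (simp only: exp_add mult.assoc)
    also have "\<dots> \<le> C0 * (R powr (2 * s) * (1 + D) powr (2 * s)) * (exp 1 * exp (- c * D\<^sup>2))"
      using C0(1) by (intro mult_mono mult_left_mono p e mult_nonneg_nonneg) auto
    also have "\<dots> = C0 * exp 1 * R powr (2 * s) * ((1 + D) powr (2 * s + M) * exp (- c * D\<^sup>2)) * (1 + D) powr (- M)"
      using D0 by (simp add: powr_add powr_minus)
    also have "\<dots> \<le> C0 * exp 1 * R powr (2 * s) * C1 * (1 + D) powr (- M)"
      using C0(1) D0 by (intro mult_right_mono mult_left_mono C1(2)) auto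
    finally show "bHr n l (max 0 x) * exp (- (Z powr (2 * l) + W powr (2 * l)) / 2)
      \<le> C0 * exp 1 * C1 * (1 + Z) powr (2 * real n * (l - 1)) * (1 + (1 + Z) powr (l - 1) * d) powr (- M)"
      by (simp add: R_def D_def s_def mult_ac)
  qed
qed

text \<open>The preceding bound for parallel points, x = Z W and d = |Z - W|, at fixed Z. It
  supplies the majorants in \<open>bkernel_reproducing\<close>.\<close>

lemma bHr_decay:
  assumes n: "n \<ge> 1" and l: "l \<ge> 1" and M: "M \<ge> 0" and Z: "Z \<ge> 0"
  obtains C where "C > 0" "\<And>W. W \<ge> 0 \<Longrightarrow> bHr n l (Z * W) * exp (- (W powr (2 * l)) / 2) \<le> C * (1 + W) powr (- M)"
proof -
  obtain C0 where C0: "C0 > 0" "\<And>Z W x d. Z \<ge> 0 \<Longrightarrow> W \<ge> 0 \<Longrightarrow> d \<ge> 0 \<Longrightarrow> \<bar>x\<bar> \<le> Z * W \<Longrightarrow> d\<^sup>2 = Z\<^sup>2 + W\<^sup>2 - 2 * x \<Longrightarrow>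
      bHr n l (max 0 x) * exp (- (Z powr (2 * l) + W powr (2 * l)) / 2)
      \<le> C0 * (1 + Z) powr (2 * real n * (l - 1)) * (1 + (1 + Z) powr (l - 1) * d) powr (- M)"
    using kernel_bound_real[OF n l M] by blast
  define e where "e = exp (Z powr (2 * l) / 2)"
  define r where "r = (1 + Z) powr (2 * real n * (l - 1))"
  show ?thesis
  proof (rule that[of "e * (C0 * r * (1 + Z) powr M)"])
    show "e * (C0 * r * (1 + Z) powr M) > 0" using C0 Z by (simp add: e_def r_def)
    fix W :: real assume W: "W \<ge> 0"
    let ?d = "\<bar>Z - W\<bar>"
    have "(1 + Z) powr (l - 1) \<ge> 1" using Z l by (intro ge_one_powr_ge_zero) auto
    then have dD: "?d \<le> (1 + Z) powr (l - 1) * ?d" using mult_right_mono[of 1 "(1 + Z) powr (l - 1)" ?d] by simp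
    have "1 + W \<le> (1 + Z) + ?d" by simp
    also have "\<dots> \<le> (1 + Z) * (1 + ?d)" using Z by (simp add: algebra_simps)
    finally have W1: "(1 + W) / (1 + Z) \<le> 1 + ?d" using Z by (simp add: field_simps)
    have "(1 + (1 + Z) powr (l - 1) * ?d) powr (- M) \<le> (1 + ?d) powr (- M)"
      using dD M by (intro powr_mono2') auto
    also have "\<dots> \<le> ((1 + W) / (1 + Z)) powr (- M)"
      using W1 M W Z by (intro powr_mono2') auto
    also have "\<dots> = (1 + Z) powr M * (1 + W) powr (- M)"
      using W Z by (simp add: powr_divide powr_minus field_simps)
    finally have d1: "(1 + (1 + Z) powr (l - 1) * ?d) powr (- M) \<le> (1 + Z) powr M * (1 + W) powr (- M)" .
    have "bHr n l (Z * W) * exp (- (W powr (2 * l)) / 2)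
      = e * (bHr n l (max 0 (Z * W)) * exp (- (Z powr (2 * l) + W powr (2 * l)) / 2))"
      using Z W by (simp add: e_def max_def diff_divide_distrib flip: exp_add)
    also have "\<dots> \<le> e * (C0 * r * (1 + (1 + Z) powr (l - 1) * ?d) powr (- M))"
      unfolding r_def using Z W
      by (intro mult_left_mono C0(2)) (auto simp: e_def power2_eq_square algebra_simps)
    also have "\<dots> \<le> e * (C0 * r * ((1 + Z) powr M * (1 + W) powr (- M)))"
      using C0 by (intro mult_left_mono d1) (auto simp: e_def r_def)
    finally show "bHr n l (Z * W) * exp (- (W powr (2 * l)) / 2) \<le> e * (C0 * r * (1 + Z) powr M) * (1 + W) powr (- M)"
      by (simp add: mult_ac)
  qed
qed

section \<open>Comparison of polynomial weights\<close>

lemma powr_le_of_ratio: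
  fixes t q \<rho> :: real
  assumes "q \<ge> 1" "1 / q \<le> t" "t \<le> q"
  shows "t powr \<rho> \<le> q powr \<bar>\<rho>\<bar>"
proof (cases "\<rho> \<ge> 0")
  case True
  have "0 \<le> t" using assms by (smt (verit) divide_nonneg_nonneg)
  then show ?thesis using True assms by (simp add: powr_mono2)
next
  case False
  have "t powr \<rho> \<le> (1 / q) powr \<rho>" using assms False by (intro powr_mono2') auto
  also have "\<dots> = q powr \<bar>\<rho>\<bar>" using assms False by (simp add: powr_divide powr_minus field_simps)
  finally show ?thesis .
qed

text \<open>Peetre's inequality: 1 + u \<le> (1 + |u - v|) (1 + v), and the same with u and v
  exchanged.\<close>

lemma weight_ratio_le:
  fixes u v \<rho> :: real
  assumes "u \<ge> 0" "v \<ge> 0"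
  shows "(1 + u) powr \<rho> * (1 + v) powr (- \<rho>) \<le> (1 + \<bar>u - v\<bar>) powr \<bar>\<rho>\<bar>"
proof -
  have 1: "x \<le> (1 + \<bar>x - y\<bar>) * y" if "y \<ge> 1" for x y :: real
  proof -
    have "x \<le> y + \<bar>x - y\<bar> * 1" by simp
    also have "\<dots> \<le> y + \<bar>x - y\<bar> * y" using that by (intro add_left_mono mult_left_mono) auto
    finally show ?thesis by (simp add: algebra_simps)
  qed
  have "(1 + u) powr \<rho> * (1 + v) powr (- \<rho>) = ((1 + u) / (1 + v)) powr \<rho>"
    using assms by (simp add: powr_divide powr_minus field_simps)
  also have "\<dots> \<le> (1 + \<bar>u - v\<bar>) powr \<bar>\<rho>\<bar>"
    using 1[of "1 + v" "1 + u"] 1[of "1 + u" "1 + v"] assms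
    by (intro powr_le_of_ratio) (auto simp: field_simps abs_minus_commute)
  finally show ?thesis .
qed

lemma weight_equiv:
  fixes a \<rho> :: real
  assumes "a > 0"
  obtains C where "C > 0" "\<And>x. x \<ge> 0 \<Longrightarrow> (1 + x) powr \<rho> \<le> C * (1 + a * x) powr \<rho>"
    "\<And>x. x \<ge> 0 \<Longrightarrow> (1 + a * x) powr \<rho> \<le> C * (1 + x) powr \<rho>"
proof -
  define q where "q = max a (1 / a)"
  have q: "q \<ge> 1" using assms by (cases "a \<ge> 1") (auto simp: q_def le_max_iff_disj)
  have b: "1 + x \<le> q * (1 + a * x)" "1 + a * x \<le> q * (1 + x)" if "x \<ge> 0" for x
  proof -
    have "x \<le> q * (a * x)"
    proof -
      have "1 / a * (a * x) \<le> q * (a * x)" using assms that by (intro mult_right_mono) (auto simp: q_def)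
      then show ?thesis using assms by simp
    qed
    moreover have "a * x \<le> q * x" using that by (intro mult_right_mono) (auto simp: q_def)
    ultimately show "1 + x \<le> q * (1 + a * x)" "1 + a * x \<le> q * (1 + x)" using q by (auto simp: algebra_simps)
  qed
  have p: "1 + x > 0" "1 + a * x > 0" if "x \<ge> 0" for x using that assms by (auto intro: add_pos_nonneg)
  show ?thesis
  proof (rule that[of "q powr \<bar>\<rho>\<bar>"])
    show "q powr \<bar>\<rho>\<bar> > 0" using q by simp
    fix x :: real assume x: "x \<ge> 0"
    have "((1 + x) / (1 + a * x)) powr \<rho> \<le> q powr \<bar>\<rho>\<bar>"
      using b[OF x] p[OF x] q by (intro powr_le_of_ratio) (auto simp: field_simps)
    then show "(1 + x) powr \<rho> \<le> q powr \<bar>\<rho>\<bar> * (1 + a * x) powr \<rho>"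
      using p[OF x] by (simp add: powr_divide field_simps)
    have "((1 + a * x) / (1 + x)) powr \<rho> \<le> q powr \<bar>\<rho>\<bar>"
      using b[OF x] p[OF x] q by (intro powr_le_of_ratio) (auto simp: field_simps)
    then show "(1 + a * x) powr \<rho> \<le> q powr \<bar>\<rho>\<bar> * (1 + x) powr \<rho>"
      using p[OF x] by (simp add: powr_divide field_simps)
  qed
qed

text \<open>The kernel for \<alpha> = 1 with half of the exponential weight attached to each
  variable, so that it acts on spaces without exponential weight and stays Hermitian.\<close>

definition bkernel :: "real \<Rightarrow> complex ^ 'n::finite \<Rightarrow> complex ^ 'n \<Rightarrow> complex" where
  "bkernel l z w = bH CARD('n) l (cinner z w) * of_real (exp (- (norm z powr (2 * l) + norm w powr (2 * l)) / 2))"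

lemma card_ge_1: "CARD('n::finite) \<ge> 1"
  by (simp add: Suc_le_eq)

lemma bkernel_cnj: "l \<ge> 1 \<Longrightarrow> bkernel l w z = cnj (bkernel l z w)"
  unfolding bkernel_def by (subst cinner_commute, subst bH_cnj) (auto simp: add.commute Suc_le_eq)

lemma norm_bkernel_commute: "l \<ge> 1 \<Longrightarrow> norm (bkernel l w z) = norm (bkernel l z w)"
  by (subst bkernel_cnj) auto

lemma borel_measurable_bkernel:
  assumes "l \<ge> 1" and [measurable]: "f \<in> borel_measurable M" "g \<in> borel_measurable M"
  shows "(\<lambda>x. bkernel l (f x) (g x :: complex ^ 'n::finite)) \<in> borel_measurable M"
proof -
  note [measurable] = bH_measurable[OF card_ge_1[where 'n='n] assms(1)]
  show ?thesis unfolding bkernel_def by measurable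
qed

text \<open>\<open>norm_bH_le\<close> brings in the real part of \<open>cinner z w\<close>, which is
  z \<bullet> w, and |z - w|^2 = |z|^2 + |w|^2 - 2 (z \<bullet> w) turns it into a distance.\<close>

lemma bkernel_bound:
  assumes l: "l \<ge> 1" and M: "M \<ge> 0"
  obtains C where "C > 0"
    "\<And>z w :: complex ^ 'n::finite. norm (bkernel l z w)
      \<le> C * (1 + norm z) powr (2 * real CARD('n) * (l - 1)) * (1 + (1 + norm z) powr (l - 1) * norm (z - w)) powr (- M)"
proof -
  obtain C where C: "C > 0" "\<And>Z W x d. Z \<ge> 0 \<Longrightarrow> W \<ge> 0 \<Longrightarrow> d \<ge> 0 \<Longrightarrow> \<bar>x\<bar> \<le> Z * W \<Longrightarrow> d\<^sup>2 = Z\<^sup>2 + W\<^sup>2 - 2 * x \<Longrightarrow>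
      bHr CARD('n) l (max 0 x) * exp (- (Z powr (2 * l) + W powr (2 * l)) / 2)
      \<le> C * (1 + Z) powr (2 * real CARD('n) * (l - 1)) * (1 + (1 + Z) powr (l - 1) * d) powr (- M)"
    using kernel_bound_real[OF card_ge_1[where 'n='n] l M] by blast
  show ?thesis
  proof (rule that[OF C(1)])
    fix z w :: "complex ^ 'n"
    have "norm (bkernel l z w) = norm (bH CARD('n) l (cinner z w)) * exp (- (norm z powr (2 * l) + norm w powr (2 * l)) / 2)"
      by (simp add: bkernel_def norm_mult)
    also have "\<dots> \<le> bHr CARD('n) l (max 0 (z \<bullet> w)) * exp (- (norm z powr (2 * l) + norm w powr (2 * l)) / 2)"
      using norm_bH_le[OF card_ge_1[where 'n='n] l, of "cinner z w"] by (intro mult_right_mono) (auto simp: Re_cinner)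
    also have "\<dots> \<le> C * (1 + norm z) powr (2 * real CARD('n) * (l - 1)) * (1 + (1 + norm z) powr (l - 1) * norm (z - w)) powr (- M)"
      using Cauchy_Schwarz_ineq2[of z w]
      by (intro C(2)) (auto simp: power2_norm_eq_inner inner_diff_left inner_diff_right inner_commute[of w z])
    finally show "norm (bkernel l z w)
      \<le> C * (1 + norm z) powr (2 * real CARD('n) * (l - 1)) * (1 + (1 + norm z) powr (l - 1) * norm (z - w)) powr (- M)" .
  qed
qed

text \<open>On the diagonal the exponentials cancel and the lower growth bound of H is left. The
  height in \<open>bkernel_bound\<close> is thus attained, and the test functions rely on
  this.\<close>

lemma bkernel_diag:
  assumes l: "l \<ge> 1"
  obtains c where "c > 0"
    "\<And>z :: complex ^ 'n::finite. c * (1 + norm z) powr (2 * real CARD('n) * (l - 1)) \<le> Re (bkernel l z z)"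
proof -
  let ?s = "real CARD('n) * (l - 1)"
  have s: "?s \<ge> 0" using l by simp
  obtain c where c: "c > 0" "\<And>x. x \<ge> 0 \<Longrightarrow> c * (1 + x) powr ?s * exp (x powr l) \<le> bHr CARD('n) l x"
    using bHr_lower[OF card_ge_1[where 'n='n] l] by blast
  show ?thesis
  proof (rule that[of "c * (1/2) powr ?s"])
    show "c * (1/2) powr ?s > 0" using c by simp
    fix z :: "complex ^ 'n"
    let ?r = "norm z"
    have "(1 + ?r)\<^sup>2 / 2 \<le> 1 + ?r\<^sup>2"
    proof -
      have "0 \<le> (1 - ?r)\<^sup>2" by simp
      then show ?thesis by (simp add: power2_eq_square algebra_simps)
    qed
    then have "((1 + ?r)\<^sup>2 / 2) powr ?s \<le> (1 + ?r\<^sup>2) powr ?s" using s by (intro powr_mono2) auto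
    then have "(1/2) powr ?s * (1 + ?r) powr (2 * ?s) \<le> (1 + ?r\<^sup>2) powr ?s"
      by (simp add: powr_divide sq_powr)
    then have "c * ((1/2) powr ?s * (1 + ?r) powr (2 * ?s)) \<le> c * (1 + ?r\<^sup>2) powr ?s"
      using c by (intro mult_left_mono) auto
    also have "\<dots> = c * (1 + ?r\<^sup>2) powr ?s * exp (?r\<^sup>2 powr l) * exp (- (?r powr (2 * l)))"
      by (simp add: sq_powr flip: exp_add)
    also have "\<dots> \<le> bHr CARD('n) l (?r\<^sup>2) * exp (- (?r powr (2 * l)))"
      using c(2)[of "?r\<^sup>2"] by (intro mult_right_mono) auto
    also have "\<dots> = Re (bkernel l z z)"
      unfolding bkernel_def cinner_self bH_of_real[OF card_ge_1 l] by simp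
    finally show "c * (1/2) powr ?s * (1 + ?r) powr (2 * real CARD('n) * (l - 1)) \<le> Re (bkernel l z z)"
      by (simp add: mult_ac)
  qed
qed

lemma integrable_polynomial_decay:
  fixes f :: "complex ^ 'n::finite \<Rightarrow> 'b::{banach, second_countable_topology}"
  assumes f: "f \<in> borel_measurable borel" and b: "\<And>w. norm (f w) \<le> C * (1 + norm w) powr (- (2 * real CARD('n) + 1))"
  shows "integrable dV f"
proof (rule Bochner_Integration.integrable_bound)
  have "integrable dV (\<lambda>w :: complex ^ 'n. (1 + norm w) powr (- (2 * real CARD('n) + 1)))"
    using nn_integral_polynomial_decay[of "2 * real CARD('n) + 1", where 'n='n]
    by (intro integrableI_nonneg borel_measurable_dV) auto
  then show "integrable dV (\<lambda>w :: complex ^ 'n. C * (1 + norm w) powr (- (2 * real CARD('n) + 1)))"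
    by (rule integrable_mult_right)
  show "f \<in> borel_measurable dV" by (intro borel_measurable_dV f)
  show "AE w in dV. norm (f w) \<le> norm (C * (1 + norm w) powr (- (2 * real CARD('n) + 1)))"
    using b by (intro AE_I2) (auto intro: order_trans[OF _ abs_ge_self])
qed

text \<open>Only the factor that contains \<zeta> is expanded; \<open>integral_bH_moment\<close>
  integrates each power against the other factor, and \<open>bh_moment\<close> normalizes the result
  to a term of the kernel series. The point 0 is excluded because the moments are divided by the
  norm of \<zeta>.\<close>

lemma bkernel_reproducing:
  fixes z \<zeta> :: "complex ^ 'n::finite"
  assumes l: "l \<ge> 1" and \<zeta>: "\<zeta> \<noteq> 0"
  shows "integrable dV (\<lambda>w. bkernel l z w * bkernel l w \<zeta>)"
    and "(\<integral>w. bkernel l z w * bkernel l w \<zeta> \<partial>dV) = bkernel l z \<zeta>"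
proof -
  let ?n = "CARD('n)"
  note n = card_ge_1[where 'n='n]
  note [measurable] = bH_measurable[OF n l] bHr_measurable[OF n l]
  let ?M = "2 * real ?n + 1"
  let ?e = "\<lambda>r. exp (- (r powr (2 * l)))"
  let ?h = "\<lambda>w. exp (- (norm w powr (2 * l)) / 2)"
  have ee: "?e r = exp (- (r powr (2 * l)) / 2) * exp (- (r powr (2 * l)) / 2)" for r
    by (simp flip: exp_add)
  obtain Cz where Cz: "Cz > 0" "\<And>W. W \<ge> 0 \<Longrightarrow> bHr ?n l (norm z * W) * exp (- (W powr (2 * l)) / 2) \<le> Cz * (1 + W) powr (- ?M)"
    using bHr_decay[OF n l, of ?M "norm z"] by auto
  obtain Cw where Cw: "Cw > 0" "\<And>W. W \<ge> 0 \<Longrightarrow> bHr ?n l (norm \<zeta> * W) * exp (- (W powr (2 * l)) / 2) \<le> Cw * (1 + W) powr (- 0)"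
    using bHr_decay[OF n l, of 0 "norm \<zeta>"] by auto
  \<comment> \<open>A common majorant of all partial sums. Its decay results from giving half of the
    exponential weight to each of the two series.\<close>
  define D where "D w = bHr ?n l (norm z * norm w) * (bHr ?n l (norm \<zeta> * norm w) * ?e (norm w))" for w :: "complex ^ 'n"
  have Db: "D w \<le> Cz * Cw * (1 + norm w) powr (- ?M)" for w
  proof -
    have "D w = (bHr ?n l (norm z * norm w) * ?h w) * (bHr ?n l (norm \<zeta> * norm w) * ?h w)"
      unfolding D_def ee by (simp add: mult_ac)
    also have "\<dots> \<le> (Cz * (1 + norm w) powr (- ?M)) * (Cw * (1 + norm w) powr (- 0))"
      using Cz Cw by (intro mult_mono Cz(2) Cw(2) mult_nonneg_nonneg bHr_nonneg n l) auto
    finally show ?thesis using add_pos_nonneg[OF zero_less_one norm_ge_zero[of w]] by (simp add: mult_ac)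
  qed
  have D0: "D w \<ge> 0" for w unfolding D_def by (intro mult_nonneg_nonneg bHr_nonneg n l) auto
  have [measurable]: "D \<in> borel_measurable borel" unfolding D_def[abs_def] by measurable
  have iD: "integrable dV D"
    using Db D0 by (intro integrable_polynomial_decay[of D "Cz * Cw"]) auto
  let ?u = "\<lambda>w. cinner w \<zeta>"
  let ?f = "\<lambda>w. bH ?n l (?u w) * bH ?n l (cinner z w) * of_real (?e (norm w))"
  let ?s = "\<lambda>K w. (\<Sum>k<K. of_real (bh ?n l k) * ?u w ^ k) * bH ?n l (cinner z w) * of_real (?e (norm w))"
  have bz: "norm (bH ?n l (cinner z w)) \<le> bHr ?n l (norm z * norm w)" for w
    by (rule order_trans[OF norm_bH_le'[OF n l] bHr_mono[OF n l norm_ge_zero norm_cinner_le]])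
  have bd: "norm (t * bH ?n l (cinner z w) * of_real (?e (norm w))) \<le> D w" if "norm t \<le> bHr ?n l (norm (?u w))" for t w
  proof -
    have "norm t \<le> bHr ?n l (norm \<zeta> * norm w)"
      using that bHr_mono[OF n l norm_ge_zero norm_cinner_le[of w \<zeta>]] by (simp add: mult.commute)
    then have "norm t * norm (bH ?n l (cinner z w)) * ?e (norm w) \<le> bHr ?n l (norm \<zeta> * norm w) * bHr ?n l (norm z * norm w) * ?e (norm w)"
      using bz by (intro mult_right_mono mult_mono bHr_nonneg n l) auto
    then show ?thesis by (simp add: D_def norm_mult mult_ac)
  qed
  have 1: "?f \<in> borel_measurable dV" by (intro borel_measurable_dV) measurable
  have 2: "?s K \<in> borel_measurable dV" for K by (intro borel_measurable_dV) measurable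
  have 4: "AE w in dV. (\<lambda>K. ?s K w) \<longlonglongrightarrow> ?f w"
    unfolding bH_def[of _ _ "?u _"] by (intro AE_I2 tendsto_mult tendsto_const summable_LIMSEQ summable_bH n l)
  have 5: "AE w in dV. norm (?s K w) \<le> D w" for K
    by (intro AE_I2 bd norm_partial_bH_le n l)
  have lim: "(\<lambda>K. integral\<^sup>L dV (?s K)) \<longlonglongrightarrow> integral\<^sup>L dV ?f"
    by (rule integral_dominated_convergence[OF 1 2 iD 4 5])
  have intf: "integrable dV ?f" by (rule integrable_dominated_convergence[OF 1 2 iD 4 5])
  let ?t = "\<lambda>k w. of_real (bh ?n l k) * (?u w ^ k * bH ?n l (cinner z w) * of_real (?e (norm w)))"
  have it: "integrable dV (?t k)" for k
  proof (rule Bochner_Integration.integrable_bound[OF iD])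
    show "?t k \<in> borel_measurable dV" by (intro borel_measurable_dV) measurable
    have "norm (of_real (bh ?n l k) * ?u w ^ k) \<le> bHr ?n l (norm (?u w))" for w
      using bHr_ge_term[OF n l norm_ge_zero, of k "?u w"] bh_nonneg[OF n l, of k] by (simp add: norm_mult norm_power)
    from bd[OF this] show "AE w in dV. norm (?t k w) \<le> norm (D w)"
      by (intro AE_I2) (auto simp: mult_ac intro: order_trans[OF _ abs_ge_self])
  qed
  have val: "integral\<^sup>L dV (?t k) = of_real (bh ?n l k) * cinner z \<zeta> ^ k" for k
  proof -
    have N: "norm \<zeta> > 0" using \<zeta> by simp
    let ?I = "\<integral>w. norm (?u w) ^ (2 * k) * ?e (norm w) \<partial>dV"
    obtain C2 where C2: "C2 > 0" "\<And>W. W \<ge> 0 \<Longrightarrow> bHr ?n l (0 * W) * exp (- (W powr (2 * l)) / 2) \<le> C2 * (1 + W) powr (- (2 * real k + ?M))"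
      using bHr_decay[OF n l, of "2 * real k + ?M" 0] by auto
    obtain C3 where C3: "C3 > 0" "\<And>W. W \<ge> 0 \<Longrightarrow> bHr ?n l (norm z * W) * exp (- (W powr (2 * l)) / 2) \<le> C3 * (1 + W) powr (- (real k + ?M))"
      using bHr_decay[OF n l, of "real k + ?M" "norm z"] by auto
    have pw: "W ^ j * (1 + W) powr (- (real j + ?M)) \<le> (1 + W) powr (- ?M)" if "W \<ge> 0" for W :: real and j
    proof -
      have "W ^ j * (1 + W) powr (- (real j + ?M)) \<le> (1 + W) ^ j * (1 + W) powr (- (real j + ?M))"
        using that by (intro mult_right_mono power_mono) auto
      also have "\<dots> = (1 + W) powr (- ?M)" using that by (simp flip: powr_realpow powr_add)
      finally show ?thesis .
    qed
    have b00: "bHr ?n l 0 = bh ?n l 0" unfolding bHr_def by (simp)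
    have b0: "bh ?n l 0 > 0" by (rule bh_pos[OF n l])
    have i1: "integrable dV (\<lambda>w :: complex ^ 'n. norm w ^ (2 * k) * ?e (norm w))"
    proof (rule integrable_polynomial_decay[where C="C2 / bh ?n l 0"])
      fix w :: "complex ^ 'n"
      have "?e (norm w) \<le> ?h w" by simp
      also have "\<dots> \<le> C2 / bh ?n l 0 * (1 + norm w) powr (- (real (2 * k) + ?M))"
        using C2(2)[of "norm w"] b0 by (simp add: b00 field_simps)
      finally have "norm w ^ (2 * k) * ?e (norm w) \<le> norm w ^ (2 * k) * (C2 / bh ?n l 0 * (1 + norm w) powr (- (real (2 * k) + ?M)))"
        by (intro mult_left_mono) auto
      also have "\<dots> = C2 / bh ?n l 0 * (norm w ^ (2 * k) * (1 + norm w) powr (- (real (2 * k) + ?M)))" by simp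
      also have "\<dots> \<le> C2 / bh ?n l 0 * (1 + norm w) powr (- ?M)"
        using C2 b0 by (intro mult_left_mono pw) auto
      finally show "norm (norm w ^ (2 * k) * ?e (norm w)) \<le> C2 / bh ?n l 0 * (1 + norm w) powr (- ?M)" by simp
    qed measurable
    have i2: "integrable dV (\<lambda>w :: complex ^ 'n. norm w ^ k * bHr ?n l (norm z * norm w) * ?e (norm w))"
    proof (rule integrable_polynomial_decay[where C=C3])
      fix w :: "complex ^ 'n"
      have "bHr ?n l (norm z * norm w) * ?e (norm w) \<le> bHr ?n l (norm z * norm w) * ?h w"
        by (intro mult_left_mono bHr_nonneg n l) auto
      also have "\<dots> \<le> C3 * (1 + norm w) powr (- (real k + ?M))" by (rule C3(2)) simp
      finally have "norm w ^ k * (bHr ?n l (norm z * norm w) * ?e (norm w)) \<le> norm w ^ k * (C3 * (1 + norm w) powr (- (real k + ?M)))"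
        by (intro mult_left_mono) auto
      also have "\<dots> = C3 * (norm w ^ k * (1 + norm w) powr (- (real k + ?M)))" by simp
      also have "\<dots> \<le> C3 * (1 + norm w) powr (- ?M)" using C3 by (intro mult_left_mono pw) auto
      finally show "norm (norm w ^ k * bHr ?n l (norm z * norm w) * ?e (norm w)) \<le> C3 * (1 + norm w) powr (- ?M)"
        using bHr_nonneg[OF n l, of "norm z * norm w"] by (simp add: abs_mult mult_ac)
    qed measurable
    have "integral\<^sup>L dV (?t k) = of_real (bh ?n l k) * (of_real (bh ?n l k) * (cinner z \<zeta> / of_real ((norm \<zeta>)\<^sup>2)) ^ k * of_real ?I)"
      using integral_bH_moment[OF l _ _ \<zeta> i1 i2] by simp
    also have "\<dots> = of_real (bh ?n l k) * (cinner z \<zeta> / of_real ((norm \<zeta>)\<^sup>2)) ^ k * of_real (bh ?n l k * ?I)" by simp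
    also have "bh ?n l k * ?I = norm \<zeta> ^ (2 * k)" by (rule bh_moment(2)[OF l])
    also have "of_real (bh ?n l k) * (cinner z \<zeta> / of_real ((norm \<zeta>)\<^sup>2)) ^ k * of_real (norm \<zeta> ^ (2 * k)) = of_real (bh ?n l k) * cinner z \<zeta> ^ k"
      using N by (simp add: power_divide power_mult)
    finally show ?thesis .
  qed
  have "integral\<^sup>L dV (?s K) = (\<Sum>k<K. of_real (bh ?n l k) * cinner z \<zeta> ^ k)" for K
  proof -
    have "?s K = (\<lambda>w. \<Sum>k<K. ?t k w)" by (rule ext) (simp only: sum_distrib_right mult.assoc)
    then have "integral\<^sup>L dV (?s K) = (\<Sum>k<K. integral\<^sup>L dV (?t k))"
      by (simp only:) (rule Bochner_Integration.integral_sum, rule it)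
    then show ?thesis by (simp only: val)
  qed
  then have "(\<lambda>K. \<Sum>k<K. of_real (bh ?n l k) * cinner z \<zeta> ^ k) \<longlonglongrightarrow> integral\<^sup>L dV ?f" using lim by simp
  moreover have "(\<lambda>K. \<Sum>k<K. of_real (bh ?n l k) * cinner z \<zeta> ^ k) \<longlonglongrightarrow> bH ?n l (cinner z \<zeta>)"
    unfolding bH_def by (intro summable_LIMSEQ summable_bH n l)
  ultimately have val: "integral\<^sup>L dV ?f = bH ?n l (cinner z \<zeta>)" by (rule LIMSEQ_unique)
  let ?c = "of_real (exp (- (norm z powr (2 * l) + norm \<zeta> powr (2 * l)) / 2)) :: complex"
  have eq: "bkernel l z w * bkernel l w \<zeta> = ?c * ?f w" for w
  proof -
    have "exp (- (norm z powr (2 * l) + norm w powr (2 * l)) / 2) * exp (- (norm w powr (2 * l) + norm \<zeta> powr (2 * l)) / 2)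
      = exp (- (norm z powr (2 * l) + norm \<zeta> powr (2 * l)) / 2) * ?e (norm w)"
      unfolding exp_add[symmetric] by (rule arg_cong[where f=exp]) (simp add: field_simps)
    then have "of_real (exp (- (norm z powr (2 * l) + norm w powr (2 * l)) / 2)) * of_real (exp (- (norm w powr (2 * l) + norm \<zeta> powr (2 * l)) / 2))
      = ?c * of_real (?e (norm w))" by (simp only: of_real_mult[symmetric])
    then show ?thesis unfolding bkernel_def by (simp only: mult_ac)
  qed
  show "integrable dV (\<lambda>w. bkernel l z w * bkernel l w \<zeta>)"
    unfolding eq by (intro integrable_mult_right intf)
  show "(\<integral>w. bkernel l z w * bkernel l w \<zeta> \<partial>dV) = bkernel l z \<zeta>"
  proof -
    have "(\<integral>w. bkernel l z w * bkernel l w \<zeta> \<partial>dV) = (\<integral>w. ?c * ?f w \<partial>dV)" by (simp only: eq)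
    also have "\<dots> = ?c * integral\<^sup>L dV ?f" by (rule integral_mult_right_zero)
    also have "\<dots> = bkernel l z \<zeta>" by (simp only: val) (simp only: bkernel_def mult.commute)
    finally show ?thesis .
  qed
qed

section \<open>Sufficiency\<close>

text \<open>Hoelder's inequality for the measure with density k, obtained by integrating a tangent
  inequality f \<le> c f^p + (1 - 1/p) t. It is applied with a kernel, a polynomial weight and an
  indicator in the role of k.\<close>

lemma jensen_nn_integral:
  fixes k f :: "'a \<Rightarrow> real"
  assumes [measurable]: "k \<in> borel_measurable M" "f \<in> borel_measurable M"
    and k0: "\<And>x. k x \<ge> 0" and f0: "\<And>x. f x \<ge> 0" and p: "p \<ge> 1" and A: "A > 0" and B: "B \<ge> 0"
    and kA: "(\<integral>\<^sup>+x. ennreal (k x) \<partial>M) \<le> ennreal A"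
    and kB: "(\<integral>\<^sup>+x. ennreal (k x * f x powr p) \<partial>M) \<le> ennreal B"
  shows "(\<integral>\<^sup>+x. ennreal (k x * f x) \<partial>M) \<le> ennreal (A powr (1 - 1 / p) * B powr (1 / p))"
proof (cases "B = 0")
  case True
  then have "(\<integral>\<^sup>+x. ennreal (k x * f x powr p) \<partial>M) = 0" using kB by simp
  then have "AE x in M. ennreal (k x * f x powr p) = 0" by (subst (asm) nn_integral_0_iff_AE) auto
  then have "AE x in M. ennreal (k x * f x) = 0"
  proof eventually_elim
    case (elim x)
    then have "k x * f x powr p \<le> 0" by (simp only: ennreal_eq_0_iff)
    moreover have "k x * f x powr p \<ge> 0" using k0 by simp
    ultimately have "k x * f x powr p = 0" by (rule antisym)
    then have "k x = 0 \<or> f x = 0" by (simp only: mult_eq_0_iff powr_eq_0_iff)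
    then have "k x * f x = 0" by (simp only: mult_eq_0_iff)
    then show ?case by (simp only: ennreal_0)
  qed
  then have "(\<integral>\<^sup>+x. ennreal (k x * f x) \<partial>M) = 0" by (subst nn_integral_0_iff_AE) auto
  then show ?thesis by simp
next
  case False
  then have B: "B > 0" using B by simp
  \<comment> \<open>The optimal point of tangency: the constant value of f at which both bounds are
    attained. It degenerates for B = 0, hence the separate case.\<close>
  define t where "t = (B / A) powr (1 / p)"
  have t: "t > 0" using A B by (simp add: t_def)
  have tp: "t powr p = B / A" using A B p by (simp add: t_def powr_powr)
  define c where "c = t / p * (A / B)"
  have c: "c > 0" using t p A B by (simp add: c_def)
  have pt: "f x \<le> c * f x powr p + (1 - 1 / p) * t" for x
  proof -
    have "1 + p * (f x / t - 1) \<le> (f x / t) powr p" using f0 t p by (intro powr_tangent) auto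
    also have "\<dots> = f x powr p * (A / B)" using f0[of x] t by (simp add: powr_divide tp)
    finally have "t / p * (1 + p * (f x / t - 1)) \<le> t / p * (f x powr p * (A / B))"
      using t p by (intro mult_left_mono) auto
    moreover have "t / p * (1 + p * (f x / t - 1)) = f x - (1 - 1 / p) * t" using t p by (simp add: field_simps)
    ultimately show ?thesis by (simp add: c_def mult_ac)
  qed
  have p1: "1 - 1 / p \<ge> 0" using p by simp
  have "(\<integral>\<^sup>+x. ennreal (k x * f x) \<partial>M) \<le> (\<integral>\<^sup>+x. ennreal c * ennreal (k x * f x powr p) + ennreal ((1 - 1 / p) * t) * ennreal (k x) \<partial>M)"
  proof (intro nn_integral_mono)
    fix x
    have "k x * f x \<le> k x * (c * f x powr p + (1 - 1 / p) * t)" using k0 pt by (intro mult_left_mono) auto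
    also have "\<dots> = c * (k x * f x powr p) + ((1 - 1 / p) * t) * k x" by (simp add: algebra_simps)
    finally have "ennreal (k x * f x) \<le> ennreal (c * (k x * f x powr p) + ((1 - 1 / p) * t) * k x)" by (rule ennreal_leI)
    also have "\<dots> = ennreal (c * (k x * f x powr p)) + ennreal (((1 - 1 / p) * t) * k x)"
      using k0[of x] c t p1 by (intro ennreal_plus mult_nonneg_nonneg) auto
    also have "\<dots> = ennreal c * ennreal (k x * f x powr p) + ennreal ((1 - 1 / p) * t) * ennreal (k x)"
      using k0[of x] c t p1 by (intro arg_cong2[where f="(+)"] ennreal_mult mult_nonneg_nonneg) auto
    finally show "ennreal (k x * f x) \<le> ennreal c * ennreal (k x * f x powr p) + ennreal ((1 - 1 / p) * t) * ennreal (k x)" .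
  qed
  also have "\<dots> = ennreal c * (\<integral>\<^sup>+x. ennreal (k x * f x powr p) \<partial>M) + ennreal ((1 - 1 / p) * t) * (\<integral>\<^sup>+x. ennreal (k x) \<partial>M)"
    by (subst nn_integral_add) (auto simp: nn_integral_cmult)
  also have "\<dots> \<le> ennreal c * ennreal B + ennreal ((1 - 1 / p) * t) * ennreal A"
    by (intro add_mono mult_left_mono kA kB) auto
  also have "\<dots> = ennreal (c * B + (1 - 1 / p) * t * A)"
    using c B t A p1 by (simp add: ennreal_mult ennreal_plus)
  also have "c * B + (1 - 1 / p) * t * A = t * A" using B A p by (simp add: c_def field_simps)
  also have "t * A = A powr (1 - 1 / p) * B powr (1 / p)" using A B by (simp add: t_def powr_divide powr_diff)
  finally show ?thesis .
qed

section \<open>Norms of weighted moduli\<close>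

definition Lp_finite :: "ennreal \<Rightarrow> (complex ^ 'n::finite \<Rightarrow> real) \<Rightarrow> bool" where
  "Lp_finite p F \<longleftrightarrow> (if p = \<infinity> then esssup dV (\<lambda>z. ennreal (F z)) < \<infinity>
     else (\<integral>\<^sup>+z. ennreal (F z powr enn2real p) \<partial>dV) < \<infinity>)"

definition Lp_norm :: "ennreal \<Rightarrow> (complex ^ 'n::finite \<Rightarrow> real) \<Rightarrow> real" where
  "Lp_norm p F = (if p = \<infinity> then enn2real (esssup dV (\<lambda>z. ennreal (F z)))
      else enn2real (\<integral>\<^sup>+z. ennreal (F z powr enn2real p) \<partial>dV) powr (1 / enn2real p))"

lemma L_space_iff: "f \<in> L_space p l \<alpha> \<rho> \<longleftrightarrow> f \<in> borel_measurable lebesgue \<and> Lp_finite p (\<lambda>z. norm (f z) * wt l \<alpha> \<rho> z)"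
  by (simp add: L_space_def Lp_finite_def)

lemma L_norm_eq: "L_norm p l \<alpha> \<rho> f = Lp_norm p (\<lambda>z. norm (f z) * wt l \<alpha> \<rho> z)"
  by (simp add: L_norm_def Lp_norm_def)

lemma enn2real_ge_1: "p \<ge> 1 \<Longrightarrow> p \<noteq> \<infinity> \<Longrightarrow> enn2real p \<ge> 1"
  by (cases p) (auto simp: top_unique)

lemma recip_eq: "p \<ge> 1 \<Longrightarrow> p \<noteq> \<infinity> \<Longrightarrow> recip p = 1 / enn2real p"
proof -
  assume p: "p \<ge> 1" "p \<noteq> \<infinity>"
  then obtain r where r: "p = ennreal r" "r \<ge> 1" by (cases p) auto
  then have "1 / p = ennreal (1 / r)" using divide_ennreal[of 1 r] by simp
  then show ?thesis using r by (simp add: recip_def)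
qed

lemma recip_top: "recip \<infinity> = 0"
  by (simp add: recip_def)

lemma Lp_norm_nonneg: "Lp_norm p F \<ge> 0"
  by (simp add: Lp_norm_def)

lemma Lp_integral:
  assumes "p \<ge> 1" "p \<noteq> \<infinity>" "Lp_finite p F"
  shows "(\<integral>\<^sup>+z. ennreal (F z powr enn2real p) \<partial>dV) = ennreal (Lp_norm p F powr enn2real p)"
  using assms enn2real_ge_1[OF assms(1,2)]
  by (simp add: Lp_norm_def Lp_finite_def powr_powr)

lemma Lp_of_bound:
  assumes "p \<ge> 1" "p \<noteq> \<infinity>" "(\<integral>\<^sup>+z. ennreal (F z powr enn2real p) \<partial>dV) \<le> ennreal (B powr enn2real p)" "B \<ge> 0"
  shows "Lp_finite p F" "Lp_norm p F \<le> B"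
proof -
  have P: "enn2real p \<ge> 1" by (rule enn2real_ge_1[OF assms(1,2)])
  show "Lp_finite p F" using assms by (auto simp: Lp_finite_def intro: order_le_less_trans)
  have "enn2real (\<integral>\<^sup>+z. ennreal (F z powr enn2real p) \<partial>dV) \<le> B powr enn2real p"
    using assms(3) by (simp add: enn2real_leI)
  then have "enn2real (\<integral>\<^sup>+z. ennreal (F z powr enn2real p) \<partial>dV) powr (1 / enn2real p) \<le> (B powr enn2real p) powr (1 / enn2real p)"
    using P by (intro powr_mono2) auto
  then show "Lp_norm p F \<le> B" using assms P by (simp add: Lp_norm_def powr_powr)
qed

lemma Lp_infty_AE:
  assumes "Lp_finite \<infinity> F"
  shows "AE z in dV. F z \<le> Lp_norm \<infinity> F"
proof -
  have e: "esssup dV (\<lambda>z. ennreal (F z)) = ennreal (Lp_norm \<infinity> F)"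
    using assms by (simp add: Lp_finite_def Lp_norm_def)
  have "AE z in dV. ennreal (F z) \<le> esssup dV (\<lambda>z. ennreal (F z))" by (rule esssup_AE)
  then show ?thesis unfolding e
    by eventually_elim (simp add: Lp_norm_nonneg)
qed

lemma Lp_infty_of_bound:
  fixes F :: "complex ^ 'n::finite \<Rightarrow> real"
  assumes F: "F \<in> borel_measurable lebesgue" and "AE z in dV. F z \<le> B" and "B \<ge> 0"
  shows "Lp_finite \<infinity> F" "Lp_norm \<infinity> F \<le> B"
proof -
  have "esssup dV (\<lambda>z. ennreal (F z)) \<le> ennreal B"
    using assms by (intro esssup_I) (auto intro: ennreal_leI)
  then show "Lp_finite \<infinity> F" "Lp_norm \<infinity> F \<le> B"
    using assms(3) by (auto simp: Lp_finite_def Lp_norm_def enn2real_leI intro: order_le_less_trans)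
qed

lemma Lp_mono:
  fixes F G :: "complex ^ 'n::finite \<Rightarrow> real"
  assumes p: "p \<ge> 1" and F: "F \<in> borel_measurable lebesgue" and G: "G \<in> borel_measurable lebesgue" and c: "c \<ge> 0"
    and b: "\<And>z. 0 \<le> F z" "\<And>z. 0 \<le> G z" "\<And>z. F z \<le> c * G z" and fin: "Lp_finite p G"
  shows "Lp_finite p F" "Lp_norm p F \<le> c * Lp_norm p G"
proof -
  have "Lp_finite p F \<and> Lp_norm p F \<le> c * Lp_norm p G"
  proof (cases "p = \<infinity>")
    case True
    have "AE z in dV. F z \<le> c * Lp_norm \<infinity> G"
      using Lp_infty_AE[OF fin[unfolded True]]
      by eventually_elim (meson b(3) c mult_left_mono order_trans)
    then show ?thesis
      using Lp_infty_of_bound[OF F, of "c * Lp_norm \<infinity> G"] c Lp_norm_nonneg[of \<infinity> G] True by simp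
  next
    case False
    let ?P = "enn2real p"
    have P: "?P \<ge> 1" by (rule enn2real_ge_1[OF p False])
    have "(\<integral>\<^sup>+z. ennreal (F z powr ?P) \<partial>dV) \<le> (\<integral>\<^sup>+z. ennreal (c powr ?P) * ennreal (G z powr ?P) \<partial>dV)"
    proof (intro nn_integral_mono)
      fix z
      have "F z powr ?P \<le> (c * G z) powr ?P" using b P by (intro powr_mono2) auto
      also have "\<dots> = c powr ?P * G z powr ?P" by (rule powr_mult)
      finally show "ennreal (F z powr ?P) \<le> ennreal (c powr ?P) * ennreal (G z powr ?P)"
        by (simp flip: ennreal_mult)
    qed
    also have "\<dots> = ennreal (c powr ?P) * (\<integral>\<^sup>+z. ennreal (G z powr ?P) \<partial>dV)"
      using G by (intro nn_integral_cmult) simp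
    also have "\<dots> = ennreal ((c * Lp_norm p G) powr ?P)"
      unfolding Lp_integral[OF p False fin] by (simp add: powr_mult flip: ennreal_mult)
    finally show ?thesis
      using Lp_of_bound[OF p False, where F=F and B="c * Lp_norm p G"] c Lp_norm_nonneg[of p G] by simp
  qed
  then show "Lp_finite p F" "Lp_norm p F \<le> c * Lp_norm p G" by auto
qed

section \<open>Kernel bounds for Schur's test\<close>

lemma dV_fst_measurable [measurable]: "fst \<in> borel_measurable ((dV :: (complex ^ 'n::finite) measure) \<Otimes>\<^sub>M M)"
  by (rule measurable_compose[OF measurable_fst]) (intro borel_measurable_dV measurable_ident_sets refl)

lemma dV_snd_measurable [measurable]: "snd \<in> borel_measurable (M \<Otimes>\<^sub>M (dV :: (complex ^ 'n::finite) measure))"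
  by (rule measurable_compose[OF measurable_snd]) (intro borel_measurable_dV measurable_ident_sets refl)

lemma nn_integral_kernel_decay:
  fixes u :: "complex ^ 'n::finite"
  assumes s: "s > 0" and b: "b > 0"
  shows "(\<integral>\<^sup>+w. ennreal ((1 + s * norm (u - b *\<^sub>R w)) powr (- M)) \<partial>dV)
    = ennreal ((s * b) powr (- (2 * real CARD('n)))) * (\<integral>\<^sup>+w. ennreal ((1 + norm (w :: complex ^ 'n)) powr (- M)) \<partial>dV)"
proof -
  let ?f = "\<lambda>w :: complex ^ 'n. ennreal ((1 + norm w) powr (- M))"
  have "s * norm (u - b *\<^sub>R w) = norm (- (s *\<^sub>R u) + (s * b) *\<^sub>R w)" for w :: "complex ^ 'n"
  proof -
    have "- (s *\<^sub>R u) + (s * b) *\<^sub>R w = s *\<^sub>R (b *\<^sub>R w - u)" by (simp add: algebra_simps)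
    then show ?thesis using s by (simp add: norm_minus_commute)
  qed
  then have "(\<integral>\<^sup>+w. ennreal ((1 + s * norm (u - b *\<^sub>R w)) powr (- M)) \<partial>dV) = (\<integral>\<^sup>+w. ?f (- (s *\<^sub>R u) + (s * b) *\<^sub>R w) \<partial>dV)"
    by simp
  also have "\<dots> = ennreal ((s * b) powr (- (2 * real CARD('n)))) * (\<integral>\<^sup>+w. ?f w \<partial>dV)"
  proof (rule nn_integral_dV_affine)
    show "?f \<in> borel_measurable borel" by measurable
    show "s * b > 0" using s b by simp
  qed
  finally show ?thesis .
qed

text \<open>By Peetre's inequality the quotient of the weights grows at most like the power |\<rho>|
  of the distance, and |\<rho>| extra powers of decay pay for it. The substitution in
  \<open>nn_integral_kernel_decay\<close> yields R^(-2n(l-1)), which cancels the height of the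
  kernel exactly and makes rows and columns uniformly integrable.\<close>

lemma weighted_kernel_bounds:
  fixes l a b \<rho> :: real
  assumes l: "l \<ge> 1" and a: "a > 0" and b: "b > 0"
  defines "T \<equiv> \<lambda>z w :: complex ^ 'n::finite. (1 + norm z) powr \<rho> * (1 + norm w) powr (- \<rho>) * norm (bkernel l (a *\<^sub>R z) (b *\<^sub>R w))"
  obtains A where "A > 0"
    "\<And>z w. T z w \<le> A * (1 + norm z) powr (2 * real CARD('n) * (l - 1))"
    "\<And>z. (\<integral>\<^sup>+w. ennreal (T z w) \<partial>dV) \<le> ennreal A"
    "\<And>w. (\<integral>\<^sup>+z. ennreal (T z w) \<partial>dV) \<le> ennreal A"
proof -
  let ?n = "real CARD('n)"
  define M where "M = 2 * ?n + 1"
  define s where "s = 2 * ?n * (l - 1)"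
  have s0: "s \<ge> 0" using l by (simp add: s_def)
  obtain C where C: "C > 0" "\<And>z w :: complex ^ 'n. norm (bkernel l z w)
      \<le> C * (1 + norm z) powr s * (1 + (1 + norm z) powr (l - 1) * norm (z - w)) powr (- (M + \<bar>\<rho>\<bar>))"
    using bkernel_bound[OF l, of "M + \<bar>\<rho>\<bar>", where 'n='n] unfolding s_def M_def by auto
  obtain C1 where C1: "C1 > 0" "\<And>x. x \<ge> 0 \<Longrightarrow> (1 + x) powr \<rho> \<le> C1 * (1 + a * x) powr \<rho>"
    using weight_equiv[OF a, of \<rho>] by metis
  obtain C2 where C2: "C2 > 0" "\<And>x. x \<ge> 0 \<Longrightarrow> (1 + x) powr (- \<rho>) \<le> C2 * (1 + b * x) powr (- \<rho>)"
    using weight_equiv[OF b, of "- \<rho>"] by metis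
  obtain C3 where C3: "C3 > 0" "\<And>x. x \<ge> 0 \<Longrightarrow> (1 + a * x) powr s \<le> C3 * (1 + x) powr s"
    using weight_equiv[OF a, of s] by metis
  define D where "D = C1 * C2 * C"
  have D: "D > 0" using C1 C2 C by (simp add: D_def)
  have w8: "(1 + norm z) powr \<rho> * (1 + norm w) powr (- \<rho>) \<le> C1 * C2 * (1 + norm (a *\<^sub>R z - b *\<^sub>R w)) powr \<bar>\<rho>\<bar>" for z w :: "complex ^ 'n"
  proof -
    have "(1 + norm z) powr \<rho> * (1 + norm w) powr (- \<rho>) \<le> (C1 * (1 + a * norm z) powr \<rho>) * (C2 * (1 + b * norm w) powr (- \<rho>))"
      using C1 C2 by (intro mult_mono) auto
    also have "\<dots> = C1 * C2 * ((1 + a * norm z) powr \<rho> * (1 + b * norm w) powr (- \<rho>))" by simp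
    also have "\<dots> \<le> C1 * C2 * (1 + \<bar>a * norm z - b * norm w\<bar>) powr \<bar>\<rho>\<bar>"
      using C1 C2 a b by (intro mult_left_mono weight_ratio_le) auto
    also have "\<dots> \<le> C1 * C2 * (1 + norm (a *\<^sub>R z - b *\<^sub>R w)) powr \<bar>\<rho>\<bar>"
      using C1 C2 a b norm_triangle_ineq3[of "a *\<^sub>R z" "b *\<^sub>R w"] by (intro mult_left_mono powr_mono2) auto
    finally show ?thesis .
  qed
  have core: "c * (1 + d) powr \<bar>\<rho>\<bar> * (C * R powr s * (1 + R powr (l - 1) * d) powr (- (M + \<bar>\<rho>\<bar>))) \<le> c * C * R powr s * (1 + R powr (l - 1) * d) powr (- M)"
    if "R \<ge> 1" "d \<ge> 0" "c \<ge> 0" for c R d :: real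
  proof -
    have "R powr (l - 1) \<ge> 1" using that l by (intro ge_one_powr_ge_zero) auto
    then have dD: "d \<le> R powr (l - 1) * d" using that mult_right_mono[of 1 "R powr (l - 1)" d] by simp
    let ?E = "1 + R powr (l - 1) * d"
    have E: "?E > 0" using that by (intro add_pos_nonneg) auto
    have "(1 + d) powr \<bar>\<rho>\<bar> \<le> ?E powr \<bar>\<rho>\<bar>" using dD that by (intro powr_mono2) auto
    then have "c * (1 + d) powr \<bar>\<rho>\<bar> * (C * R powr s * ?E powr (- (M + \<bar>\<rho>\<bar>))) \<le> c * ?E powr \<bar>\<rho>\<bar> * (C * R powr s * ?E powr (- (M + \<bar>\<rho>\<bar>)))"
      using that C by (intro mult_right_mono mult_left_mono) auto
    also have "\<dots> = c * C * R powr s * (?E powr \<bar>\<rho>\<bar> * ?E powr (- (M + \<bar>\<rho>\<bar>)))" by simp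
    also have "?E powr \<bar>\<rho>\<bar> * ?E powr (- (M + \<bar>\<rho>\<bar>)) = ?E powr (- M)" by (simp flip: powr_add)
    finally show ?thesis .
  qed
  have T1: "T z w \<le> D * (1 + norm (a *\<^sub>R z)) powr s * (1 + (1 + norm (a *\<^sub>R z)) powr (l - 1) * norm (a *\<^sub>R z - b *\<^sub>R w)) powr (- M)" for z w
  proof -
    let ?R = "1 + norm (a *\<^sub>R z)" and ?d = "norm (a *\<^sub>R z - b *\<^sub>R w)"
    have "T z w \<le> (C1 * C2 * (1 + ?d) powr \<bar>\<rho>\<bar>) * (C * ?R powr s * (1 + ?R powr (l - 1) * ?d) powr (- (M + \<bar>\<rho>\<bar>)))"
      unfolding T_def using C1 C2 by (intro mult_mono w8 C(2)) auto
    also have "\<dots> \<le> C1 * C2 * C * ?R powr s * (1 + ?R powr (l - 1) * ?d) powr (- M)"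
      using C1 C2 by (intro core) auto
    finally show ?thesis unfolding D_def .
  qed
  \<comment> \<open>The same bound centred at w, by the symmetry of the kernel; the integral over z
    needs it.\<close>
  have T2: "T z w \<le> D * (1 + norm (b *\<^sub>R w)) powr s * (1 + (1 + norm (b *\<^sub>R w)) powr (l - 1) * norm (b *\<^sub>R w - a *\<^sub>R z)) powr (- M)" for z w
  proof -
    let ?R = "1 + norm (b *\<^sub>R w)" and ?d = "norm (b *\<^sub>R w - a *\<^sub>R z)"
    have "T z w \<le> (C1 * C2 * (1 + ?d) powr \<bar>\<rho>\<bar>) * (C * ?R powr s * (1 + ?R powr (l - 1) * ?d) powr (- (M + \<bar>\<rho>\<bar>)))"
      unfolding T_def norm_bkernel_commute[OF l, of "a *\<^sub>R z"] using C1 C2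
      by (intro mult_mono w8[of z w, unfolded norm_minus_commute[of "a *\<^sub>R z" "b *\<^sub>R w"]] C(2)) auto
    also have "\<dots> \<le> C1 * C2 * C * ?R powr s * (1 + ?R powr (l - 1) * ?d) powr (- M)"
      using C1 C2 by (intro core) auto
    finally show ?thesis unfolding D_def .
  qed
  define K where "K = enn2real (\<integral>\<^sup>+w. ennreal ((1 + norm (w :: complex ^ 'n)) powr (- M)) \<partial>dV)"
  have K: "(\<integral>\<^sup>+w. ennreal ((1 + norm (w :: complex ^ 'n)) powr (- M)) \<partial>dV) = ennreal K"
    using nn_integral_polynomial_decay[of M, where 'n='n] by (simp add: K_def M_def)
  have K0: "K \<ge> 0" by (simp add: K_def)
  have int: "(\<integral>\<^sup>+w. ennreal (D * R powr s * (1 + R powr (l - 1) * norm (u - c *\<^sub>R w)) powr (- M)) \<partial>dV) \<le> ennreal (D * c powr (- (2 * ?n)) * K)"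
    if "R \<ge> 1" "c > 0" for R c :: real and u :: "complex ^ 'n"
  proof -
    have "(\<integral>\<^sup>+w. ennreal (D * R powr s * (1 + R powr (l - 1) * norm (u - c *\<^sub>R w)) powr (- M)) \<partial>dV)
      = (\<integral>\<^sup>+w. ennreal (D * R powr s) * ennreal ((1 + R powr (l - 1) * norm (u - c *\<^sub>R w)) powr (- M)) \<partial>dV)"
      using D by (intro nn_integral_cong ennreal_mult) auto
    also have "\<dots> = ennreal (D * R powr s) * (\<integral>\<^sup>+w. ennreal ((1 + R powr (l - 1) * norm (u - c *\<^sub>R w)) powr (- M)) \<partial>dV)"
      by (intro nn_integral_cmult borel_measurable_dV) measurable
    also have "\<dots> = ennreal (D * R powr s) * (ennreal ((R powr (l - 1) * c) powr (- (2 * ?n))) * ennreal K)"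
      using that by (subst nn_integral_kernel_decay) (auto simp: K)
    also have "\<dots> = ennreal (D * R powr s * ((R powr (l - 1) * c) powr (- (2 * ?n)) * K))"
      using D K0 by (simp add: ennreal_mult)
    also have "(R powr (l - 1) * c) powr (- (2 * ?n)) = R powr (- s) * c powr (- (2 * ?n))"
      by (simp add: powr_mult powr_powr s_def algebra_simps)
    also have "D * R powr s * (R powr (- s) * c powr (- (2 * ?n)) * K) = D * c powr (- (2 * ?n)) * K * (R powr s * R powr (- s))"
      by simp
    also have "R powr s * R powr (- s) = 1" using that by (simp flip: powr_add)
    finally show ?thesis by simp
  qed
  define A where "A = D * C3 + D * b powr (- (2 * ?n)) * K + D * a powr (- (2 * ?n)) * K"
  have A: "A > 0" "D * C3 \<le> A" "D * b powr (- (2 * ?n)) * K \<le> A" "D * a powr (- (2 * ?n)) * K \<le> A"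
    using D C3 K0 by (auto simp: A_def intro!: add_pos_nonneg)
  show ?thesis
  proof (rule that[OF A(1)])
    fix z w :: "complex ^ 'n"
    have "1 + 0 \<le> 1 + (1 + norm (a *\<^sub>R z)) powr (l - 1) * norm (a *\<^sub>R z - b *\<^sub>R w)" by (intro add_left_mono) simp
    then have "(1 + (1 + norm (a *\<^sub>R z)) powr (l - 1) * norm (a *\<^sub>R z - b *\<^sub>R w)) powr (- M) \<le> 1 powr (- M)"
      by (intro powr_mono2') (auto simp: M_def)
    then have "T z w \<le> D * (1 + norm (a *\<^sub>R z)) powr s * 1"
      using D by (intro order_trans[OF T1] mult_left_mono) auto
    also have "\<dots> \<le> D * (C3 * (1 + norm z) powr s)"
      using D C3(2)[of "norm z"] a by simp
    also have "\<dots> \<le> A * (1 + norm z) powr s"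
      using A(2) by (simp add: mult_right_mono flip: mult.assoc)
    finally show "T z w \<le> A * (1 + norm z) powr (2 * ?n * (l - 1))" by (simp add: s_def)
  next
    fix z :: "complex ^ 'n"
    have "(\<integral>\<^sup>+w. ennreal (T z w) \<partial>dV) \<le> (\<integral>\<^sup>+w. ennreal (D * (1 + norm (a *\<^sub>R z)) powr s * (1 + (1 + norm (a *\<^sub>R z)) powr (l - 1) * norm (a *\<^sub>R z - b *\<^sub>R w)) powr (- M)) \<partial>dV)"
      by (intro nn_integral_mono ennreal_leI T1)
    also have "\<dots> \<le> ennreal (D * b powr (- (2 * ?n)) * K)" using b by (intro int) auto
    also have "\<dots> \<le> ennreal A" by (intro ennreal_leI A)
    finally show "(\<integral>\<^sup>+w. ennreal (T z w) \<partial>dV) \<le> ennreal A" .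
  next
    fix w :: "complex ^ 'n"
    have "(\<integral>\<^sup>+z. ennreal (T z w) \<partial>dV) \<le> (\<integral>\<^sup>+z. ennreal (D * (1 + norm (b *\<^sub>R w)) powr s * (1 + (1 + norm (b *\<^sub>R w)) powr (l - 1) * norm (b *\<^sub>R w - a *\<^sub>R z)) powr (- M)) \<partial>dV)"
      by (intro nn_integral_mono ennreal_leI T2)
    also have "\<dots> \<le> ennreal (D * a powr (- (2 * ?n)) * K)" using a by (intro int) auto
    also have "\<dots> \<le> ennreal A" by (intro ennreal_leI A)
    finally show "(\<integral>\<^sup>+z. ennreal (T z w) \<partial>dV) \<le> ennreal A" .
  qed
qed

section \<open>The projection as an integral operator with the normalized kernel\<close>

lemma wt_pos: "wt l \<alpha> \<rho> z > 0"
proof -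
  have "1 + norm z > 0" by (simp add: add_pos_nonneg)
  then show ?thesis by (simp add: wt_def)
qed

lemma wt_measurable [measurable]: "wt l \<alpha> \<rho> \<in> borel_measurable borel"
  unfolding wt_def[abs_def] by measurable

lemma wt_change: "wt l \<alpha> \<eta> z = wt l \<alpha> \<rho> z * (1 + norm z) powr (\<eta> - \<rho>)"
proof -
  have "1 + norm z > 0" by (simp add: add_pos_nonneg)
  then show ?thesis by (simp add: wt_def powr_diff)
qed

lemma bergman_kernel_eq:
  assumes "l \<ge> 1" "\<alpha> > 0"
  shows "bergman_kernel l \<alpha> z w = of_real (\<alpha> powr (real CARD('n) / l)) * bH CARD('n) l (of_real (\<alpha> powr (1 / l)) * cinner z (w :: complex ^ 'n::finite))"
  unfolding bergman_kernel_def cinner_def using bergman_H_scale[OF card_ge_1[where 'n='n] assms(1,2)] by simp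

text \<open>
  Rescaling both variables turns \<open>P\<^sub>\<alpha>\<close> on \<open>L\<^sup>p\<^sub>\<beta>\<^sub>,\<^sub>\<rho>\<close> into the integral operator whose kernel is that of
  \<open>\<alpha> = \<beta> = 1\<close>; this is where \<open>\<alpha>\<^sup>2 / (2\<alpha> - \<beta>)\<close> comes from.
\<close>

lemma bergman_integrand_eq:
  fixes f :: "complex ^ 'n::finite \<Rightarrow> complex"
  assumes l: "l \<ge> 1" and \<alpha>: "\<alpha> > 0" and \<beta>: "\<beta> < 2 * \<alpha>"
  defines "a \<equiv> (\<alpha>\<^sup>2 / (2 * \<alpha> - \<beta>)) powr (1 / (2 * l))" and "b \<equiv> (2 * \<alpha> - \<beta>) powr (1 / (2 * l))"
  shows "bergman_integrand l \<alpha> f z w * of_real (wt l (\<alpha>\<^sup>2 / (2 * \<alpha> - \<beta>)) \<eta> z) =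
    of_real (\<alpha> powr (real CARD('n) / l) * (1 + norm z) powr \<eta> * (1 + norm w) powr (- \<rho>))
      * (f w * of_real (wt l \<beta> \<rho> w)) * bkernel l (a *\<^sub>R z) (b *\<^sub>R w)"
proof -
  let ?g = "\<alpha>\<^sup>2 / (2 * \<alpha> - \<beta>)"
  have g: "?g > 0" using \<alpha> \<beta> by simp
  \<comment> \<open>The two scales must multiply to the factor \<alpha>^(1/l) inside H. As b^(2l) =
    2\<alpha> - \<beta> is fixed by the weight at w, this determines a, and a^(2l) is the exponent
    on the target side.\<close>
  have ab: "a * b = \<alpha> powr (1 / l)"
  proof -
    have "a * b = (?g * (2 * \<alpha> - \<beta>)) powr (1 / (2 * l))" unfolding a_def b_def by (rule powr_mult[symmetric])
    also have "?g * (2 * \<alpha> - \<beta>) = \<alpha>\<^sup>2" using \<beta> by simp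
    also have "\<alpha>\<^sup>2 powr (1 / (2 * l)) = \<alpha> powr (1 / l)" using \<alpha> by (simp add: sq_powr)
    finally show ?thesis .
  qed
  have na: "norm (a *\<^sub>R z) powr (2 * l) = ?g * norm z powr (2 * l)"
    using l g \<beta> by (simp add: a_def powr_mult powr_powr)
  have nb: "norm (b *\<^sub>R w) powr (2 * l) = (2 * \<alpha> - \<beta>) * norm w powr (2 * l)"
    using l \<beta> by (simp add: b_def powr_mult powr_powr)
  have ci: "cinner (a *\<^sub>R z) (b *\<^sub>R w) = of_real (\<alpha> powr (1 / l)) * cinner z w"
    by (simp add: cinner_scaleR_left cinner_scaleR_right ab[symmetric])
  have w1: "1 + norm w > 0" by (simp add: add_pos_nonneg)
  \<comment> \<open>At w the exponent \<alpha> splits as \<beta>/2 + (2\<alpha> - \<beta>)/2: the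
    first part is the weight of f, the second the share of the normalized kernel.\<close>
  have e: "exp (- \<alpha> * norm w powr (2 * l)) * exp (- (?g / 2) * norm z powr (2 * l))
     = exp (- (\<beta> / 2) * norm w powr (2 * l)) * exp (- (norm (a *\<^sub>R z) powr (2 * l) + norm (b *\<^sub>R w) powr (2 * l)) / 2)"
  proof -
    have "- \<alpha> * W + - (g / 2) * Z = - (\<beta> / 2) * W + - (g * Z + (2 * \<alpha> - \<beta>) * W) / 2" for g W Z :: real
      by (simp add: field_simps)
    then show ?thesis unfolding na nb exp_add[symmetric] by (rule arg_cong[where f=exp])
  qed
  have e': "exp (- \<alpha> * norm w powr (2 * l)) * wt l ?g \<eta> z = (1 + norm z) powr \<eta> * (1 + norm w) powr (- \<rho>) * wt l \<beta> \<rho> w * exp (- (norm (a *\<^sub>R z) powr (2 * l) + norm (b *\<^sub>R w) powr (2 * l)) / 2)"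
  proof -
    have "exp (- \<alpha> * norm w powr (2 * l)) * wt l ?g \<eta> z = (1 + norm z) powr \<eta> * (exp (- \<alpha> * norm w powr (2 * l)) * exp (- (?g / 2) * norm z powr (2 * l)))"
      by (simp only: wt_def mult_ac)
    also have "\<dots> = (1 + norm z) powr \<eta> * ((1 + norm w) powr (- \<rho>) * (1 + norm w) powr \<rho>) * (exp (- (\<beta> / 2) * norm w powr (2 * l)) * exp (- (norm (a *\<^sub>R z) powr (2 * l) + norm (b *\<^sub>R w) powr (2 * l)) / 2))"
      unfolding e using w1 by (simp flip: powr_add)
    finally show ?thesis by (simp only: wt_def mult_ac)
  qed
  have "bergman_integrand l \<alpha> f z w * of_real (wt l ?g \<eta> z) = f w * bergman_kernel l \<alpha> z w * of_real (exp (- \<alpha> * norm w powr (2 * l)) * wt l ?g \<eta> z)"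
    by (simp add: bergman_integrand_def)
  then show ?thesis
    unfolding e' bergman_kernel_eq[OF l \<alpha>] bkernel_def ci by (simp add: mult_ac)
qed

lemma bergman_integrand_measurable:
  fixes f :: "complex ^ 'n::finite \<Rightarrow> complex"
  assumes l: "l \<ge> 1" and \<alpha>: "\<alpha> > 0" and f: "f \<in> borel_measurable lebesgue"
  shows "(\<lambda>(z, w). bergman_integrand l \<alpha> f z w) \<in> borel_measurable ((dV :: (complex ^ 'n) measure) \<Otimes>\<^sub>M dV)"
    and "bergman_integrand l \<alpha> f z \<in> borel_measurable lebesgue"
proof -
  note [measurable] = bH_measurable[OF card_ge_1[where 'n='n] l]
  have "(\<lambda>x. f (snd x)) \<in> borel_measurable ((dV :: (complex ^ 'n) measure) \<Otimes>\<^sub>M (dV :: (complex ^ 'n) measure))"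
    using f by (intro measurable_compose[OF measurable_snd]) simp
  then show "(\<lambda>(z, w). bergman_integrand l \<alpha> f z w) \<in> borel_measurable ((dV :: (complex ^ 'n) measure) \<Otimes>\<^sub>M dV)"
    unfolding bergman_integrand_def bergman_kernel_eq[OF l \<alpha>] case_prod_unfold by measurable
  have "(\<lambda>w :: complex ^ 'n. bergman_kernel l \<alpha> z w * complex_of_real (exp (- \<alpha> * norm w powr (2 * l)))) \<in> borel_measurable borel"
    unfolding bergman_kernel_eq[OF l \<alpha>] by measurable
  then have "(\<lambda>w :: complex ^ 'n. bergman_kernel l \<alpha> z w * complex_of_real (exp (- \<alpha> * norm w powr (2 * l)))) \<in> borel_measurable lebesgue"
    by (simp add: measurable_completion)
  then show "bergman_integrand l \<alpha> f z \<in> borel_measurable lebesgue"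
    unfolding bergman_integrand_def[abs_def] using f by (simp add: mult.assoc)
qed

lemma bergman_projection_measurable:
  fixes f :: "complex ^ 'n::finite \<Rightarrow> complex"
  assumes "l \<ge> 1" "\<alpha> > 0" "f \<in> borel_measurable lebesgue"
  shows "bergman_projection l \<alpha> f \<in> borel_measurable lebesgue"
proof -
  have "(\<lambda>z. \<integral>w. bergman_integrand l \<alpha> f z w \<partial>dV) \<in> borel_measurable (dV :: (complex ^ 'n) measure)"
    using bergman_integrand_measurable(1)[OF assms] by (intro dV.borel_measurable_lebesgue_integral) simp
  then show ?thesis unfolding bergman_projection_def[abs_def] by simp
qed

lemma weight_measurable_dV: "(\<lambda>z :: complex ^ 'n::finite. norm (f z) * wt l \<alpha> \<rho> z) \<in> borel_measurable lebesgue"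
  if "f \<in> borel_measurable lebesgue" for f :: "complex ^ 'n::finite \<Rightarrow> complex"
proof -
  have "wt l \<alpha> \<rho> \<in> borel_measurable (lebesgue :: (complex ^ 'n) measure)"
    by (intro measurable_completion) simp
  then show ?thesis using that by measurable
qed

text \<open>The pointwise estimate interpolates between the row integrals, which settle p =
  \<infinity>, and the supremum of the kernel, which settles p = 1. The norm estimate is Schur's
  test. For p = \<infinity> the pointwise estimate already is the norm estimate, as
  \<open>recip p\<close> is then 0.\<close>

lemma bergman_projection_basic:
  assumes l: "l \<ge> 1" and \<alpha>: "\<alpha> > 0" and \<beta>: "\<beta> < 2 * \<alpha>" and p: "p \<ge> 1"
  defines "g \<equiv> \<alpha>\<^sup>2 / (2 * \<alpha> - \<beta>)"
  obtains C where "C > 0"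
    "\<And>f :: complex ^ 'n::finite \<Rightarrow> complex. f \<in> L_space p l \<beta> \<rho> \<Longrightarrow>
       (\<forall>z. integrable dV (bergman_integrand l \<alpha> f z)) \<and>
       (\<forall>z. norm (bergman_projection l \<alpha> f z) * wt l g \<rho> z
          \<le> C * (1 + norm z) powr (2 * real CARD('n) * (l - 1) * recip p) * L_norm p l \<beta> \<rho> f) \<and>
       (p \<noteq> \<infinity> \<longrightarrow> Lp_finite p (\<lambda>z. norm (bergman_projection l \<alpha> f z) * wt l g \<rho> z) \<and>
          Lp_norm p (\<lambda>z. norm (bergman_projection l \<alpha> f z) * wt l g \<rho> z) \<le> C * L_norm p l \<beta> \<rho> f)"
proof -
  let ?n = "real CARD('n)"
  define a where "a = g powr (1 / (2 * l))"
  define b where "b = (2 * \<alpha> - \<beta>) powr (1 / (2 * l))"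
  have g: "g > 0" using \<alpha> \<beta> by (simp add: g_def)
  have ab: "a > 0" "b > 0" using g \<beta> by (simp_all add: a_def b_def)
  define k where "k z w = (1 + norm z) powr \<rho> * (1 + norm w) powr (- \<rho>) * norm (bkernel l (a *\<^sub>R z) (b *\<^sub>R w))" for z w :: "complex ^ 'n"
  define s where "s = 2 * ?n * (l - 1)"
  have s0: "s \<ge> 0" using l by (simp add: s_def)
  obtain A where A: "A > 0" "\<And>z w. k z w \<le> A * (1 + norm z) powr s"
    "\<And>z. (\<integral>\<^sup>+w. ennreal (k z w) \<partial>dV) \<le> ennreal A" "\<And>w. (\<integral>\<^sup>+z. ennreal (k z w) \<partial>dV) \<le> ennreal A"
    using weighted_kernel_bounds[OF l ab, of \<rho>, where 'n='n] unfolding k_def s_def by blast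
  have k0: "k z w \<ge> 0" for z w by (simp add: k_def)
  have km: "k z \<in> borel_measurable borel" for z
    unfolding k_def[abs_def] using borel_measurable_bkernel[OF l, of "\<lambda>w. a *\<^sub>R z" borel "\<lambda>w. b *\<^sub>R w"] by measurable
  have km': "k z \<in> borel_measurable lebesgue" for z using km by (simp add: measurable_completion)
  have kpm: "(\<lambda>x. k (fst x) (snd x)) \<in> borel_measurable ((dV :: (complex ^ 'n) measure) \<Otimes>\<^sub>M dV)"
  proof -
    have "(\<lambda>x. bkernel l (a *\<^sub>R fst x) (b *\<^sub>R snd x)) \<in> borel_measurable ((dV :: (complex ^ 'n) measure) \<Otimes>\<^sub>M (dV :: (complex ^ 'n) measure))"
      by (intro borel_measurable_bkernel l) measurable
    then show ?thesis unfolding k_def by measurable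
  qed
  define c where "c = \<alpha> powr (?n / l)"
  have c: "c > 0" using \<alpha> by (simp add: c_def)
  define C where "C = c * (A + 1)"
  have C: "C > 0" using A c by (simp add: C_def)
  show ?thesis
  proof (rule that[OF C])
    fix f :: "complex ^ 'n \<Rightarrow> complex"
    assume "f \<in> L_space p l \<beta> \<rho>"
    define F where "F w = norm (f w) * wt l \<beta> \<rho> w" for w
    have fm: "f \<in> borel_measurable lebesgue" and Ff: "Lp_finite p F"
      using \<open>f \<in> L_space p l \<beta> \<rho>\<close> by (simp_all add: L_space_iff F_def[abs_def])
    have Fm: "F \<in> borel_measurable lebesgue" unfolding F_def[abs_def] by (rule weight_measurable_dV[OF fm])
    have F0: "F w \<ge> 0" for w using wt_pos[of l \<beta> \<rho> w] by (simp add: F_def)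
    define N where "N = Lp_norm p F"
    have N: "N = L_norm p l \<beta> \<rho> f" by (simp add: N_def L_norm_eq F_def[abs_def])
    have N0: "N \<ge> 0" by (simp add: N_def Lp_norm_nonneg)
    have ie: "norm (bergman_integrand l \<alpha> f z w) * wt l g \<rho> z = c * (k z w * F w)" for z w
    proof -
      have "norm (bergman_integrand l \<alpha> f z w * of_real (wt l g \<rho> z)) = c * (k z w * F w)"
        unfolding g_def bergman_integrand_eq[OF l \<alpha> \<beta>, of f z w \<rho> \<rho>] using wt_pos[of l \<beta> \<rho> w]
        by (simp add: norm_mult c_def k_def F_def a_def b_def g_def mult_ac)
      then show ?thesis using wt_pos[of l g \<rho> z] by (simp add: norm_mult)
    qed
    have reduce: "integrable dV (bergman_integrand l \<alpha> f z) \<and> norm (bergman_projection l \<alpha> f z) * wt l g \<rho> z \<le> c * X"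
      if X: "(\<integral>\<^sup>+w. ennreal (k z w * F w) \<partial>dV) \<le> ennreal X" and X0: "X \<ge> 0" for z X
    proof -
      let ?v = "wt l g \<rho> z"
      have v: "?v > 0" by (rule wt_pos)
      have im: "bergman_integrand l \<alpha> f z \<in> borel_measurable dV"
        using bergman_integrand_measurable(2)[OF l \<alpha> fm] by simp
      have "(\<integral>\<^sup>+w. ennreal (norm (bergman_integrand l \<alpha> f z w)) \<partial>dV) = (\<integral>\<^sup>+w. ennreal (c / ?v) * ennreal (k z w * F w) \<partial>dV)"
      proof (intro nn_integral_cong)
        fix w
        have e: "norm (bergman_integrand l \<alpha> f z w) = c / ?v * (k z w * F w)" using ie[of z w] v by (simp add: field_simps)
        show "ennreal (norm (bergman_integrand l \<alpha> f z w)) = ennreal (c / ?v) * ennreal (k z w * F w)"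
          unfolding e by (rule ennreal_mult) (use c v k0[of z w] F0[of w] in auto)
      qed
      also have "\<dots> = ennreal (c / ?v) * (\<integral>\<^sup>+w. ennreal (k z w * F w) \<partial>dV)"
        using km' Fm by (intro nn_integral_cmult) simp
      also have "\<dots> \<le> ennreal (c / ?v) * ennreal X" by (intro mult_left_mono X) simp
      also have "\<dots> = ennreal (c / ?v * X)"
        by (rule ennreal_mult[symmetric]) (use c v X0 in auto)
      finally have b: "(\<integral>\<^sup>+w. ennreal (norm (bergman_integrand l \<alpha> f z w)) \<partial>dV) \<le> ennreal (c / ?v * X)" .
      then have int: "integrable dV (bergman_integrand l \<alpha> f z)"
        using im by (intro integrableI_bounded) (auto intro: order_le_less_trans)
      have "ennreal (norm (bergman_projection l \<alpha> f z)) \<le> (\<integral>\<^sup>+w. ennreal (norm (bergman_integrand l \<alpha> f z w)) \<partial>dV)"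
        unfolding bergman_projection_def by (rule integral_norm_bound_ennreal[OF int])
      also note b
      finally have "norm (bergman_projection l \<alpha> f z) \<le> c / ?v * X"
        using c v X0 by (simp add: ennreal_le_iff)
      then show ?thesis using int v by (simp add: field_simps)
    qed
    show "(\<forall>z. integrable dV (bergman_integrand l \<alpha> f z)) \<and>
       (\<forall>z. norm (bergman_projection l \<alpha> f z) * wt l g \<rho> z
          \<le> C * (1 + norm z) powr (2 * ?n * (l - 1) * recip p) * L_norm p l \<beta> \<rho> f) \<and>
       (p \<noteq> \<infinity> \<longrightarrow> Lp_finite p (\<lambda>z. norm (bergman_projection l \<alpha> f z) * wt l g \<rho> z) \<and>
          Lp_norm p (\<lambda>z. norm (bergman_projection l \<alpha> f z) * wt l g \<rho> z) \<le> C * L_norm p l \<beta> \<rho> f)"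
    proof (cases "p = \<infinity>")
      case True
      have "(\<integral>\<^sup>+w. ennreal (k z w * F w) \<partial>dV) \<le> ennreal (A * N)" for z
      proof -
        have "(\<integral>\<^sup>+w. ennreal (k z w * F w) \<partial>dV) \<le> (\<integral>\<^sup>+w. ennreal (k z w) * ennreal N \<partial>dV)"
        proof (rule nn_integral_mono_AE)
          show "AE w in dV. ennreal (k z w * F w) \<le> ennreal (k z w) * ennreal N"
            using Lp_infty_AE[OF Ff[unfolded True]]
          proof eventually_elim
            case (elim w)
            then have "k z w * F w \<le> k z w * N" using k0 by (simp add: N_def True mult_left_mono)
            then show ?case using k0 N0 by (simp add: ennreal_leI flip: ennreal_mult)
          qed
        qed
        also have "\<dots> = (\<integral>\<^sup>+w. ennreal (k z w) \<partial>dV) * ennreal N" using km' by (intro nn_integral_multc) simp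
        also have "\<dots> \<le> ennreal A * ennreal N" by (intro mult_right_mono A) simp
        finally show ?thesis using A N0 by (simp add: ennreal_mult)
      qed
      from reduce[OF this] have r: "integrable dV (bergman_integrand l \<alpha> f z)" "norm (bergman_projection l \<alpha> f z) * wt l g \<rho> z \<le> c * (A * N)" for z
        using A N0 by auto
      have "norm (bergman_projection l \<alpha> f z) * wt l g \<rho> z \<le> C * (1 + norm z) powr (2 * ?n * (l - 1) * recip p) * N" for z
      proof -
        have "1 + norm z \<noteq> 0" using norm_ge_zero[of z] by linarith
        moreover have "c * (A * N) \<le> C * N" using c N0 by (simp add: C_def algebra_simps)
        ultimately show ?thesis using r(2)[of z] unfolding True recip_top by simp
      qed
      then show ?thesis unfolding N[symmetric] using r(1) True by blast
    next
      case False
      define P where "P = enn2real p"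
      have P: "P \<ge> 1" unfolding P_def by (rule enn2real_ge_1[OF p False])
      have FP: "(\<integral>\<^sup>+w. ennreal (F w powr P) \<partial>dV) = ennreal (N powr P)"
        unfolding P_def N_def by (rule Lp_integral[OF p False Ff])
      have A1: "A powr (1 - 1 / P) \<le> A + 1"
      proof -
        have "A powr (1 - 1 / P) \<le> (A + 1) powr (1 - 1 / P)" using A P by (intro powr_mono2) auto
        also have "\<dots> \<le> (A + 1) powr 1" using A P by (intro powr_mono) auto
        finally show ?thesis using A by simp
      qed
      define I where "I z = (\<integral>\<^sup>+w. ennreal (k z w * F w powr P) \<partial>dV)" for z
      \<comment> \<open>The supremum of the kernel enters here. Besides the pointwise estimate this
        shows that I is finite, so that its real value can be used below.\<close>
      have Ib: "I z \<le> ennreal (A * (1 + norm z) powr s * N powr P)" for z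
      proof -
        have "I z \<le> (\<integral>\<^sup>+w. ennreal (A * (1 + norm z) powr s) * ennreal (F w powr P) \<partial>dV)"
          unfolding I_def using A by (intro nn_integral_mono) (simp add: ennreal_leI mult_right_mono flip: ennreal_mult)
        also have "\<dots> = ennreal (A * (1 + norm z) powr s) * (\<integral>\<^sup>+w. ennreal (F w powr P) \<partial>dV)"
          using Fm by (intro nn_integral_cmult) simp
        finally show ?thesis unfolding FP using A by (simp add: ennreal_mult)
      qed
      then have Ifin: "I z = ennreal (enn2real (I z))" for z
        by (metis ennreal_enn2real_if ennreal_less_top order_le_less_trans not_le less_irrefl infinity_ennreal_def)
      have kF: "(\<integral>\<^sup>+w. ennreal (k z w * F w) \<partial>dV) \<le> ennreal (A powr (1 - 1 / P) * B powr (1 / P))" if "I z \<le> ennreal B" "B \<ge> 0" for z B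
        using that km' Fm k0 F0 P A unfolding I_def by (intro jensen_nn_integral) auto
      have pw: "integrable dV (bergman_integrand l \<alpha> f z) \<and> norm (bergman_projection l \<alpha> f z) * wt l g \<rho> z \<le> C * (1 + norm z) powr (2 * ?n * (l - 1) * recip p) * N" for z
      proof -
        have "(A * (1 + norm z) powr s * N powr P) powr (1 / P) = A powr (1 / P) * (1 + norm z) powr (s * recip p) * N"
          using A P N0 by (simp add: powr_mult powr_powr recip_eq[OF p False] P_def)
        then have e: "A powr (1 - 1 / P) * (A * (1 + norm z) powr s * N powr P) powr (1 / P) = A * ((1 + norm z) powr (s * recip p) * N)"
          using A by (simp add: powr_diff)
        have "A * ((1 + norm z) powr (s * recip p) * N) \<le> (A + 1) * ((1 + norm z) powr (s * recip p) * N)"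
          using N0 by (intro mult_right_mono) auto
        then have "c * (A * ((1 + norm z) powr (s * recip p) * N)) \<le> C * (1 + norm z) powr (s * recip p) * N"
          using c by (simp add: C_def mult.assoc)
        moreover have "(\<integral>\<^sup>+w. ennreal (k z w * F w) \<partial>dV) \<le> ennreal (A * ((1 + norm z) powr (s * recip p) * N))"
          unfolding e[symmetric] by (rule kF[OF Ib]) (use A in simp)
        from reduce[OF this] A N0 have "integrable dV (bergman_integrand l \<alpha> f z)"
          "norm (bergman_projection l \<alpha> f z) * wt l g \<rho> z \<le> c * (A * ((1 + norm z) powr (s * recip p) * N))"
          by auto
        ultimately show ?thesis unfolding s_def by auto
      qed
      have "(\<integral>\<^sup>+z. ennreal ((norm (bergman_projection l \<alpha> f z) * wt l g \<rho> z) powr P) \<partial>dV) \<le> ennreal ((C * N) powr P)"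
      proof -
        let ?D = "(c * A powr (1 - 1 / P)) powr P"
        have "(\<integral>\<^sup>+z. ennreal ((norm (bergman_projection l \<alpha> f z) * wt l g \<rho> z) powr P) \<partial>dV) \<le> (\<integral>\<^sup>+z. ennreal ?D * I z \<partial>dV)"
        proof (intro nn_integral_mono)
          fix z
          have "norm (bergman_projection l \<alpha> f z) * wt l g \<rho> z \<le> c * (A powr (1 - 1 / P) * enn2real (I z) powr (1 / P))"
            using reduce[OF kF[of z "enn2real (I z)"]] Ifin[of z] by auto
          then have "(norm (bergman_projection l \<alpha> f z) * wt l g \<rho> z) powr P \<le> (c * (A powr (1 - 1 / P) * enn2real (I z) powr (1 / P))) powr P"
            using P wt_pos[of l g \<rho> z] by (intro powr_mono2) auto
          also have "\<dots> = ?D * enn2real (I z)" using P by (simp add: powr_mult powr_powr)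
          finally have "ennreal ((norm (bergman_projection l \<alpha> f z) * wt l g \<rho> z) powr P) \<le> ennreal ?D * ennreal (enn2real (I z))"
            by (simp add: ennreal_leI flip: ennreal_mult)
          then show "ennreal ((norm (bergman_projection l \<alpha> f z) * wt l g \<rho> z) powr P) \<le> ennreal ?D * I z"
            using Ifin[of z] by simp
        qed
        also have "\<dots> = ennreal ?D * (\<integral>\<^sup>+z. I z \<partial>dV)"
        proof (rule nn_integral_cmult)
          show "I \<in> borel_measurable dV"
            unfolding I_def[abs_def]
          proof (rule dV.borel_measurable_nn_integral)
            have "(\<lambda>x. F (snd x)) \<in> borel_measurable ((dV :: (complex ^ 'n) measure) \<Otimes>\<^sub>M (dV :: (complex ^ 'n) measure))"
              using Fm by (intro measurable_compose[OF measurable_snd]) simp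
            then show "(\<lambda>(z, w). ennreal (k z w * F w powr P)) \<in> borel_measurable ((dV :: (complex ^ 'n) measure) \<Otimes>\<^sub>M dV)"
              unfolding case_prod_unfold using kpm by measurable
          qed
        qed
        \<comment> \<open>After the exchange of the integrals the column bounds of the kernel
          apply.\<close>
        also have "(\<integral>\<^sup>+z. I z \<partial>dV) = (\<integral>\<^sup>+w. (\<integral>\<^sup>+z. ennreal (k z w * F w powr P) \<partial>dV) \<partial>dV)"
          unfolding I_def
        proof (rule dV_pair.Fubini'[symmetric])
          have "(\<lambda>x. F (snd x)) \<in> borel_measurable ((dV :: (complex ^ 'n) measure) \<Otimes>\<^sub>M (dV :: (complex ^ 'n) measure))"
            using Fm by (intro measurable_compose[OF measurable_snd]) simp
          then show "(\<lambda>(z, w). ennreal (k z w * F w powr P)) \<in> borel_measurable ((dV :: (complex ^ 'n) measure) \<Otimes>\<^sub>M dV)"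
            unfolding case_prod_unfold using kpm by measurable
        qed
        also have "\<dots> \<le> (\<integral>\<^sup>+w. ennreal A * ennreal (F w powr P) \<partial>dV)"
        proof (intro nn_integral_mono)
          fix w
          have "(\<lambda>z. k z w) \<in> borel_measurable borel"
            unfolding k_def using borel_measurable_bkernel[OF l, of "\<lambda>z. a *\<^sub>R z" borel "\<lambda>z. b *\<^sub>R w"] by measurable
          then have "(\<lambda>z. k z w) \<in> borel_measurable lebesgue" by (simp add: measurable_completion)
          then have "(\<integral>\<^sup>+z. ennreal (k z w * F w powr P) \<partial>dV) = (\<integral>\<^sup>+z. ennreal (k z w) \<partial>dV) * ennreal (F w powr P)"
            using k0 by (subst nn_integral_multc[symmetric]) (auto simp: ennreal_mult)
          also have "\<dots> \<le> ennreal A * ennreal (F w powr P)" by (intro mult_right_mono A) simp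
          finally show "(\<integral>\<^sup>+z. ennreal (k z w * F w powr P) \<partial>dV) \<le> ennreal A * ennreal (F w powr P)" .
        qed
        also have "\<dots> = ennreal A * ennreal (N powr P)"
          unfolding FP[symmetric] using Fm by (intro nn_integral_cmult) simp
        finally have "(\<integral>\<^sup>+z. ennreal ((norm (bergman_projection l \<alpha> f z) * wt l g \<rho> z) powr P) \<partial>dV) \<le> ennreal ?D * (ennreal A * ennreal (N powr P))"
          by (simp add: mult_left_mono)
        also have "\<dots> = ennreal (?D * (A * N powr P))" using A by (simp add: ennreal_mult)
        also have "?D * (A * N powr P) = (c * A * N) powr P"
        proof -
          have "(1 - 1 / P) * P = P - 1" using P by (simp add: field_simps)
          then have "(A powr (1 - 1 / P)) powr P = A powr (P - 1)" by (simp only: powr_powr)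
          moreover have "A powr (P - 1) * A = A powr P" using A by (simp add: powr_diff)
          ultimately have "(A powr (1 - 1 / P)) powr P * A = A powr P" by (simp only:)
          then show ?thesis by (simp add: powr_mult mult_ac)
        qed
        also have "\<dots> \<le> (C * N) powr P"
          using A c P N0 by (intro powr_mono2 mult_right_mono) (auto simp: C_def algebra_simps)
        finally show ?thesis by (simp add: ennreal_leI)
      qed
      from Lp_of_bound[OF p False this[unfolded P_def]] have
        "Lp_finite p (\<lambda>z. norm (bergman_projection l \<alpha> f z) * wt l g \<rho> z)"
        "Lp_norm p (\<lambda>z. norm (bergman_projection l \<alpha> f z) * wt l g \<rho> z) \<le> C * N"
        using C N0 by auto
      then show ?thesis unfolding N[symmetric] using pw by blast
    qed
  qed
qed

section \<open>Passing to other weights and target exponents\<close>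

lemma maps_boundedly_mono:
  assumes b: "maps_boundedly TYPE('n::finite) l \<alpha> p \<beta> \<rho> q \<gamma> \<eta>" and q: "q \<ge> 1" and C: "C \<ge> 0"
    and w: "\<And>z :: complex ^ 'n. wt l \<gamma>' \<eta>' z \<le> C * wt l \<gamma> \<eta> z"
  shows "maps_boundedly TYPE('n) l \<alpha> p \<beta> \<rho> q \<gamma>' \<eta>'"
proof -
  obtain C0 where C0: "\<And>f :: complex ^ 'n \<Rightarrow> complex. f \<in> L_space p l \<beta> \<rho> \<Longrightarrow>
        (\<forall>z. integrable dV (bergman_integrand l \<alpha> f z)) \<and>
        bergman_projection l \<alpha> f \<in> L_space q l \<gamma> \<eta> \<and>
        L_norm q l \<gamma> \<eta> (bergman_projection l \<alpha> f) \<le> C0 * L_norm p l \<beta> \<rho> f"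
    using b unfolding maps_boundedly_def by blast
  show ?thesis
    unfolding maps_boundedly_def
  proof (intro exI[of _ "C * C0"] allI impI)
    fix f :: "complex ^ 'n \<Rightarrow> complex" assume f: "f \<in> L_space p l \<beta> \<rho>"
    define h where "h = bergman_projection l \<alpha> f"
    have h: "h \<in> L_space q l \<gamma> \<eta>" "L_norm q l \<gamma> \<eta> h \<le> C0 * L_norm p l \<beta> \<rho> f"
      using C0[OF f] by (auto simp: h_def)
    then have hm: "h \<in> borel_measurable lebesgue" and hf: "Lp_finite q (\<lambda>z. norm (h z) * wt l \<gamma> \<eta> z)"
      by (auto simp: L_space_iff)
    have "Lp_finite q (\<lambda>z. norm (h z) * wt l \<gamma>' \<eta>' z) \<and> Lp_norm q (\<lambda>z. norm (h z) * wt l \<gamma>' \<eta>' z) \<le> C * Lp_norm q (\<lambda>z. norm (h z) * wt l \<gamma> \<eta> z)"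
    proof -
      have b: "norm (h z) * wt l \<gamma>' \<eta>' z \<le> C * (norm (h z) * wt l \<gamma> \<eta> z)" for z
        using mult_left_mono[OF w[of z], of "norm (h z)"] by (simp add: mult_ac)
      have nn: "0 \<le> norm (h z) * wt l a b z" for a b z using wt_pos[of l a b z] by simp
      show ?thesis
        using Lp_mono[OF q weight_measurable_dV[OF hm] weight_measurable_dV[OF hm] C nn nn b hf] by blast
    qed
    moreover have "C * L_norm q l \<gamma> \<eta> h \<le> C * (C0 * L_norm p l \<beta> \<rho> f)" using h C by (intro mult_left_mono)
    ultimately show "(\<forall>z. integrable dV (bergman_integrand l \<alpha> f z)) \<and>
        bergman_projection l \<alpha> f \<in> L_space q l \<gamma>' \<eta>' \<and>
        L_norm q l \<gamma>' \<eta>' (bergman_projection l \<alpha> f) \<le> C * C0 * L_norm p l \<beta> \<rho> f"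
      using C0[OF f] hm by (simp add: L_space_iff L_norm_eq flip: h_def)
  qed
qed

text \<open>Half of the difference of the exponents is a Gaussian reserve that beats every power.
  The factor exp d comes from r^2 \<le> 1 + r^(2l).\<close>

lemma wt_exponential_gap:
  assumes l: "l \<ge> 1" and g: "\<gamma> < \<gamma>'"
  obtains C where "C > 0" "\<And>z :: complex ^ 'n::finite. wt l \<gamma>' \<eta>' z \<le> C * wt l \<gamma> \<eta> z"
proof -
  define d where "d = (\<gamma>' - \<gamma>) / 2"
  have d: "d > 0" using g by (simp add: d_def)
  define k where "k = max 0 (\<eta>' - \<eta>)"
  obtain C where C: "C > 0" "\<And>D. D \<ge> 0 \<Longrightarrow> (1 + D) powr k * exp (- d * D\<^sup>2) \<le> C"
    using poly_gaussian_bounded[OF d, of k] by (auto simp: k_def)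
  show ?thesis
  proof (rule that[of "C * exp d"])
    show "C * exp d > 0" using C by simp
    fix z :: "complex ^ 'n"
    let ?r = "norm z"
    have r1: "?r\<^sup>2 \<le> 1 + ?r powr (2 * l)"
    proof (cases "?r \<le> 1")
      case True
      then have "?r\<^sup>2 \<le> 1" by (simp add: power_le_one)
      then show ?thesis by (smt (verit) powr_ge_zero)
    next
      case False
      then have "?r powr 2 \<le> ?r powr (2 * l)" using l by (intro powr_mono) auto
      then show ?thesis by (simp add: powr_numeral)
    qed
    have e: "- (\<gamma>' / 2) * ?r powr (2 * l) \<le> d + - d * ?r\<^sup>2 + - (\<gamma> / 2) * ?r powr (2 * l)"
      using mult_left_mono[OF r1, of d] d by (simp add: d_def field_simps)
    have pos: "1 + ?r > 0" by (simp add: add_pos_nonneg)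
    have "(1 + ?r) powr \<eta>' = (1 + ?r) powr (\<eta>' - \<eta>) * (1 + ?r) powr \<eta>" using pos by (simp flip: powr_add)
    also have "\<dots> \<le> (1 + ?r) powr k * (1 + ?r) powr \<eta>"
      by (intro mult_right_mono powr_mono) (auto simp: k_def)
    finally have p: "(1 + ?r) powr \<eta>' \<le> (1 + ?r) powr k * (1 + ?r) powr \<eta>" .
    have "wt l \<gamma>' \<eta>' z \<le> ((1 + ?r) powr k * (1 + ?r) powr \<eta>) * exp (d + - d * ?r\<^sup>2 + - (\<gamma> / 2) * ?r powr (2 * l))"
      unfolding wt_def using p e by (intro mult_mono) auto
    also have "\<dots> = ((1 + ?r) powr k * exp (- d * ?r\<^sup>2)) * (exp d * wt l \<gamma> \<eta> z)"
      by (simp only: exp_add wt_def mult_ac)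
    also have "\<dots> \<le> C * (exp d * wt l \<gamma> \<eta> z)"
      using wt_pos[of l \<gamma> \<eta> z] by (intro mult_right_mono C(2)) auto
    finally show "wt l \<gamma>' \<eta>' z \<le> C * exp d * wt l \<gamma> \<eta> z" by simp
  qed
qed

lemma polynomial_weight_measurable:
  "(\<lambda>z :: complex ^ 'n::finite. (1 + norm z) powr e) \<in> borel_measurable lebesgue"
  by (intro measurable_completion) simp

text \<open>Combines a norm bound and a pointwise bound on G. For finite p \<le> q the surplus
  G^(q-p) is estimated pointwise; for q < p < \<infinity> Hoelder's inequality is applied against an
  integrable power of 1 + |z|; the cases with an infinite exponent use the pointwise bound alone.
  The constant is fixed before G, as boundedness of the operator requires.\<close>

lemma polynomial_weight_transfer:
  fixes G :: "complex ^ 'n::finite \<Rightarrow> real"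
  assumes p: "p \<ge> 1" and q: "q \<ge> 1" and l: "l \<ge> 1"
    and cond: "p \<le> q \<and> \<rho> - \<eta> \<ge> 2 * real CARD('n) * (l - 1) * (recip p - recip q) \<or>
       q < p \<and> \<rho> - \<eta> > 2 * real CARD('n) * (recip q - recip p)"
  obtains C where "C \<ge> 0"
    "\<And>(G :: complex ^ 'n \<Rightarrow> real) N. G \<in> borel_measurable lebesgue \<Longrightarrow> N \<ge> 0 \<Longrightarrow> (\<And>z. G z \<ge> 0) \<Longrightarrow>
      (\<And>z. G z \<le> N * (1 + norm z) powr (2 * real CARD('n) * (l - 1) * recip p)) \<Longrightarrow>
      (p \<noteq> \<infinity> \<Longrightarrow> Lp_finite p G \<and> Lp_norm p G \<le> N) \<Longrightarrow>
      Lp_finite q (\<lambda>z. G z * (1 + norm z) powr (\<eta> - \<rho>)) \<and> Lp_norm q (\<lambda>z. G z * (1 + norm z) powr (\<eta> - \<rho>)) \<le> C * N"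
proof (cases "q = \<infinity>")
  case True
  have pq: "p \<le> q" using True by simp
  then have c: "\<rho> - \<eta> \<ge> 2 * real CARD('n) * (l - 1) * recip p"
    using cond True recip_top by auto
  show ?thesis
  proof (rule that[of 1])
    fix G :: "complex ^ 'n \<Rightarrow> real" and N
    assume G: "G \<in> borel_measurable lebesgue" "N \<ge> 0" "\<And>z. G z \<ge> 0"
      "\<And>z. G z \<le> N * (1 + norm z) powr (2 * real CARD('n) * (l - 1) * recip p)"
    have "G z * (1 + norm z) powr (\<eta> - \<rho>) \<le> N" for z
    proof -
      have "1 + norm z > 0" by (simp add: add_pos_nonneg)
      have "G z * (1 + norm z) powr (\<eta> - \<rho>) \<le> N * (1 + norm z) powr (2 * real CARD('n) * (l - 1) * recip p) * (1 + norm z) powr (\<eta> - \<rho>)"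
        by (intro mult_right_mono G) simp
      also have "\<dots> = N * (1 + norm z) powr (2 * real CARD('n) * (l - 1) * recip p + (\<eta> - \<rho>))"
        by (simp add: powr_add)
      also have "\<dots> \<le> N * (1 + norm z) powr 0" using c G(2) by (intro mult_left_mono powr_mono) auto
      finally show ?thesis using \<open>1 + norm z > 0\<close> by simp
    qed
    then show "Lp_finite q (\<lambda>z. G z * (1 + norm z) powr (\<eta> - \<rho>)) \<and> Lp_norm q (\<lambda>z. G z * (1 + norm z) powr (\<eta> - \<rho>)) \<le> 1 * N"
      unfolding True using Lp_infty_of_bound[OF borel_measurable_times[OF G(1) polynomial_weight_measurable], of "\<eta> - \<rho>" N] G(2)
      by simp
  qed simp
next
  case qf: False
  define Q where "Q = enn2real q"
  have Q: "Q \<ge> 1" unfolding Q_def by (rule enn2real_ge_1[OF q qf])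
  have rq: "recip q = 1 / Q" unfolding Q_def by (rule recip_eq[OF q qf])
  show ?thesis
  proof (cases "p = \<infinity>")
    case True
    have "\<not> p \<le> q" using True qf by (simp add: top_unique)
    then have c: "\<rho> - \<eta> > 2 * real CARD('n) * (1 / Q)"
      using cond rq recip_top unfolding True by auto
    define K where "K = enn2real (\<integral>\<^sup>+z. ennreal ((1 + norm (z :: complex ^ 'n)) powr (- ((\<rho> - \<eta>) * Q))) \<partial>dV)"
    have "2 * real CARD('n) < (\<rho> - \<eta>) * Q" using c Q by (simp add: field_simps)
    then have K: "(\<integral>\<^sup>+z. ennreal ((1 + norm (z :: complex ^ 'n)) powr (- ((\<rho> - \<eta>) * Q))) \<partial>dV) = ennreal K"
      using nn_integral_polynomial_decay[of "(\<rho> - \<eta>) * Q", where 'n='n] by (simp add: K_def)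
    have K0: "K \<ge> 0" by (simp add: K_def)
    show ?thesis
    proof (rule that[of "K powr (1 / Q)"])
      fix G :: "complex ^ 'n \<Rightarrow> real" and N
      assume G: "G \<in> borel_measurable lebesgue" "N \<ge> 0" "\<And>z. G z \<ge> 0"
        "\<And>z. G z \<le> N * (1 + norm z) powr (2 * real CARD('n) * (l - 1) * recip p)"
      have "(\<integral>\<^sup>+z. ennreal ((G z * (1 + norm z) powr (\<eta> - \<rho>)) powr Q) \<partial>dV) \<le> (\<integral>\<^sup>+z. ennreal (N powr Q) * ennreal ((1 + norm (z :: complex ^ 'n)) powr (- ((\<rho> - \<eta>) * Q))) \<partial>dV)"
      proof (intro nn_integral_mono)
        fix z :: "complex ^ 'n"
        have "1 + norm z > 0" by (simp add: add_pos_nonneg)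
        then have "G z \<le> N" using G(4)[of z] unfolding True recip_top by simp
        then have "(G z * (1 + norm z) powr (\<eta> - \<rho>)) powr Q \<le> (N * (1 + norm z) powr (\<eta> - \<rho>)) powr Q"
          using G Q by (intro powr_mono2 mult_right_mono) auto
        also have "\<dots> = N powr Q * (1 + norm z) powr (- ((\<rho> - \<eta>) * Q))"
          by (simp add: powr_mult powr_powr algebra_simps)
        finally show "ennreal ((G z * (1 + norm z) powr (\<eta> - \<rho>)) powr Q) \<le> ennreal (N powr Q) * ennreal ((1 + norm z) powr (- ((\<rho> - \<eta>) * Q)))"
          by (simp add: ennreal_leI flip: ennreal_mult)
      qed
      also have "\<dots> = ennreal (N powr Q) * ennreal K"
        unfolding K[symmetric] using polynomial_weight_measurable by (intro nn_integral_cmult) simp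
      also have "\<dots> = ennreal ((K powr (1 / Q) * N) powr Q)"
        using K0 Q by (simp add: powr_mult powr_powr mult.commute flip: ennreal_mult)
      finally have b: "(\<integral>\<^sup>+z. ennreal ((G z * (1 + norm z) powr (\<eta> - \<rho>)) powr enn2real q) \<partial>dV) \<le> ennreal ((K powr (1 / Q) * N) powr enn2real q)"
        by (simp add: Q_def)
      show "Lp_finite q (\<lambda>z. G z * (1 + norm z) powr (\<eta> - \<rho>)) \<and> Lp_norm q (\<lambda>z. G z * (1 + norm z) powr (\<eta> - \<rho>)) \<le> K powr (1 / Q) * N"
        using Lp_of_bound[OF q qf b] G(2) by simp
    qed simp
  next
    case pf: False
    define P where "P = enn2real p"
    have P: "P \<ge> 1" unfolding P_def by (rule enn2real_ge_1[OF p pf])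
    have rp: "recip p = 1 / P" unfolding P_def by (rule recip_eq[OF p pf])
    have pP: "p = ennreal P" and qQ: "q = ennreal Q"
      using pf qf unfolding P_def Q_def by (metis ennreal_enn2real infinity_ennreal_def less_top)+
    have le: "p \<le> q \<longleftrightarrow> P \<le> Q" using P Q by (simp add: pP qQ)
    have GP: "(\<integral>\<^sup>+z. ennreal (G z powr P) \<partial>dV) \<le> ennreal (N powr P)" if "Lp_finite p G" "Lp_norm p G \<le> N" for G :: "complex ^ 'n \<Rightarrow> real" and N
    proof -
      have "Lp_norm p G powr P \<le> N powr P" using that P by (intro powr_mono2) (auto simp: Lp_norm_nonneg)
      then show ?thesis using Lp_integral[OF p pf that(1)] by (simp add: P_def ennreal_leI)
    qed
    show ?thesis
    proof (cases "P \<le> Q")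
      case True
      then have c: "\<rho> - \<eta> \<ge> 2 * real CARD('n) * (l - 1) * (1 / P - 1 / Q)"
        using cond le rp rq by auto
      show ?thesis
      proof (rule that[of 1])
        fix G :: "complex ^ 'n \<Rightarrow> real" and N
        assume G: "G \<in> borel_measurable lebesgue" "N \<ge> 0" "\<And>z. G z \<ge> 0"
          "\<And>z. G z \<le> N * (1 + norm z) powr (2 * real CARD('n) * (l - 1) * recip p)"
          "p \<noteq> \<infinity> \<Longrightarrow> Lp_finite p G \<and> Lp_norm p G \<le> N"
        let ?e = "2 * real CARD('n) * (l - 1) * recip p"
        have "(\<integral>\<^sup>+z. ennreal ((G z * (1 + norm z) powr (\<eta> - \<rho>)) powr Q) \<partial>dV) \<le> (\<integral>\<^sup>+z. ennreal (N powr (Q - P)) * ennreal (G z powr P) \<partial>dV)"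
        proof (intro nn_integral_mono)
          fix z :: "complex ^ 'n"
          have z: "1 + norm z > 0" by (simp add: add_pos_nonneg)
          \<comment> \<open>In the limiting case of the condition this exponent is exactly
            0.\<close>
          have ex: "?e * (Q - P) + (\<eta> - \<rho>) * Q \<le> 0"
          proof -
            have "2 * real CARD('n) * (l - 1) * (1 / P - 1 / Q) * Q \<le> (\<rho> - \<eta>) * Q" using c Q by (intro mult_right_mono) auto
            moreover have "?e * (Q - P) = 2 * real CARD('n) * (l - 1) * (1 / P - 1 / Q) * Q"
              using P Q unfolding rp by (simp add: field_simps)
            moreover have "(\<eta> - \<rho>) * Q = - ((\<rho> - \<eta>) * Q)" by (simp add: algebra_simps)
            ultimately show ?thesis by linarith
          qed
          have "(G z * (1 + norm z) powr (\<eta> - \<rho>)) powr Q = G z powr P * (G z powr (Q - P) * (1 + norm z) powr ((\<eta> - \<rho>) * Q))"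
            by (simp add: powr_mult powr_powr flip: powr_add mult.assoc)
          also have "\<dots> \<le> G z powr P * ((N * (1 + norm z) powr ?e) powr (Q - P) * (1 + norm z) powr ((\<eta> - \<rho>) * Q))"
            using G True by (intro mult_left_mono mult_right_mono powr_mono2) auto
          also have "\<dots> = G z powr P * (N powr (Q - P) * (1 + norm z) powr (?e * (Q - P) + (\<eta> - \<rho>) * Q))"
            by (simp add: powr_mult powr_powr powr_add)
          also have "\<dots> \<le> G z powr P * (N powr (Q - P) * (1 + norm z) powr 0)"
            using ex by (intro mult_left_mono powr_mono) auto
          also have "\<dots> = N powr (Q - P) * G z powr P" using z by simp
          finally show "ennreal ((G z * (1 + norm z) powr (\<eta> - \<rho>)) powr Q) \<le> ennreal (N powr (Q - P)) * ennreal (G z powr P)"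
            by (simp add: ennreal_leI flip: ennreal_mult)
        qed
        also have "\<dots> = ennreal (N powr (Q - P)) * (\<integral>\<^sup>+z. ennreal (G z powr P) \<partial>dV)"
          using G(1) by (intro nn_integral_cmult) simp
        also have "\<dots> \<le> ennreal (N powr (Q - P)) * ennreal (N powr P)"
          using G(5) pf by (intro mult_left_mono GP) auto
        also have "\<dots> = ennreal ((1 * N) powr Q)" by (simp flip: ennreal_mult powr_add)
        finally have b: "(\<integral>\<^sup>+z. ennreal ((G z * (1 + norm z) powr (\<eta> - \<rho>)) powr enn2real q) \<partial>dV) \<le> ennreal ((1 * N) powr enn2real q)"
          by (simp add: Q_def)
        show "Lp_finite q (\<lambda>z. G z * (1 + norm z) powr (\<eta> - \<rho>)) \<and> Lp_norm q (\<lambda>z. G z * (1 + norm z) powr (\<eta> - \<rho>)) \<le> 1 * N"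
          using Lp_of_bound[OF q qf b] G(2) by simp
      qed simp
    next
      case False
      then have PQ: "Q < P" by simp
      then have c: "\<rho> - \<eta> > 2 * real CARD('n) * (1 / Q - 1 / P)"
        using cond le rp rq by auto
      \<comment> \<open>Chosen so that the powers of 1 + |z| cancel in k X^r. The strict condition
        on \<rho> - \<eta> then says precisely that \<sigma> > 2n, that is, that k is
        integrable.\<close>
      define \<sigma> where "\<sigma> = (\<rho> - \<eta>) * (P * Q / (P - Q))"
      define r where "r = P / Q"
      have r: "r \<ge> 1" using PQ Q by (simp add: r_def)
      have "2 * real CARD('n) = 2 * real CARD('n) * (1 / Q - 1 / P) * (P * Q / (P - Q))"
        using PQ P Q by (simp add: field_simps)
      also have "\<dots> < \<sigma>" unfolding \<sigma>_def using PQ P Q by (intro mult_strict_right_mono c) auto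
      finally have s: "2 * real CARD('n) < \<sigma>" .
      define k where "k z = (1 + norm z) powr (- \<sigma>)" for z :: "complex ^ 'n"
      define A where "A = enn2real (\<integral>\<^sup>+z. ennreal (k z) \<partial>dV) + 1"
      have A: "(\<integral>\<^sup>+z. ennreal (k z) \<partial>dV) \<le> ennreal A" "A > 0"
      proof -
        have "(\<integral>\<^sup>+z. ennreal (k z) \<partial>dV) < \<infinity>" unfolding k_def by (rule nn_integral_polynomial_decay[OF s])
        then have "(\<integral>\<^sup>+z. ennreal (k z) \<partial>dV) = ennreal (enn2real (\<integral>\<^sup>+z. ennreal (k z) \<partial>dV))" by simp
        also have "\<dots> \<le> ennreal A" by (intro ennreal_leI) (simp add: A_def)
        finally show "(\<integral>\<^sup>+z. ennreal (k z) \<partial>dV) \<le> ennreal A" .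
        show "A > 0" by (simp add: A_def add_nonneg_pos)
      qed
      show ?thesis
      proof (rule that[of "A powr ((1 - 1 / r) / Q)"])
        fix G :: "complex ^ 'n \<Rightarrow> real" and N
        assume G: "G \<in> borel_measurable lebesgue" "N \<ge> 0" "\<And>z. G z \<ge> 0"
          "p \<noteq> \<infinity> \<Longrightarrow> Lp_finite p G \<and> Lp_norm p G \<le> N"
        define X where "X z = G z powr Q * (1 + norm z) powr ((\<eta> - \<rho>) * Q + \<sigma>)" for z
        have kX: "k z * X z = (G z * (1 + norm z) powr (\<eta> - \<rho>)) powr Q" for z
          by (simp add: k_def X_def powr_mult powr_powr mult.left_commute flip: powr_add)
        have kXr: "k z * X z powr r = G z powr P" for z
        proof -
          have z: "1 + norm z > 0" by (simp add: add_pos_nonneg)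
          have "Q * r = P" using Q by (simp add: r_def)
          moreover have "- \<sigma> + ((\<eta> - \<rho>) * Q + \<sigma>) * r = 0"
          proof -
            have "\<sigma> * (r - 1) = (\<rho> - \<eta>) * P" using PQ P Q by (simp add: \<sigma>_def r_def field_simps)
            moreover have "(\<eta> - \<rho>) * Q * r = - ((\<rho> - \<eta>) * P)" using Q by (simp add: r_def algebra_simps)
            ultimately show ?thesis by (simp add: algebra_simps)
          qed
          ultimately have "(1 + norm z) powr (- \<sigma>) * (1 + norm z) powr (((\<eta> - \<rho>) * Q + \<sigma>) * r) = 1"
            unfolding powr_add[symmetric] using z by simp
          then show ?thesis using \<open>Q * r = P\<close> by (simp add: k_def X_def powr_mult powr_powr mult.left_commute)
        qed
        have "(\<integral>\<^sup>+z. ennreal (k z * X z) \<partial>dV) \<le> ennreal (A powr (1 - 1 / r) * (N powr P) powr (1 / r))"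
        proof (rule jensen_nn_integral)
          show "k \<in> borel_measurable dV" unfolding k_def[abs_def] using polynomial_weight_measurable by simp
          have "(\<lambda>z. G z powr Q) \<in> borel_measurable lebesgue" using G(1) by measurable
          from borel_measurable_times[OF this polynomial_weight_measurable]
          show "X \<in> borel_measurable dV" by (simp add: X_def[abs_def])
          show "(\<integral>\<^sup>+z. ennreal (k z * X z powr r) \<partial>dV) \<le> ennreal (N powr P)"
            unfolding kXr using G(4) pf by (intro GP) auto
        qed (use A r in \<open>auto simp: k_def X_def\<close>)
        also have "A powr (1 - 1 / r) * (N powr P) powr (1 / r) = (A powr ((1 - 1 / r) / Q) * N) powr Q"
          using Q P by (simp add: powr_mult powr_powr r_def)
        finally have b: "(\<integral>\<^sup>+z. ennreal ((G z * (1 + norm z) powr (\<eta> - \<rho>)) powr enn2real q) \<partial>dV) \<le> ennreal ((A powr ((1 - 1 / r) / Q) * N) powr enn2real q)"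
          unfolding kX by (simp add: Q_def)
        show "Lp_finite q (\<lambda>z. G z * (1 + norm z) powr (\<eta> - \<rho>)) \<and> Lp_norm q (\<lambda>z. G z * (1 + norm z) powr (\<eta> - \<rho>)) \<le> A powr ((1 - 1 / r) / Q) * N"
          using Lp_of_bound[OF q qf b] G(2) by simp
      qed simp
    qed
  qed
qed

lemma maps_boundedly_sharp:
  assumes l: "l \<ge> 1" and \<alpha>: "\<alpha> > 0" and \<beta>: "\<beta> < 2 * \<alpha>" and p: "p \<ge> 1" and q: "q \<ge> 1"
    and cond: "p \<le> q \<and> \<rho> - \<eta> \<ge> 2 * real CARD('n::finite) * (l - 1) * (recip p - recip q) \<or>
       q < p \<and> \<rho> - \<eta> > 2 * real CARD('n) * (recip q - recip p)"
  shows "maps_boundedly TYPE('n) l \<alpha> p \<beta> \<rho> q (\<alpha>\<^sup>2 / (2 * \<alpha> - \<beta>)) \<eta>"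
proof -
  let ?g = "\<alpha>\<^sup>2 / (2 * \<alpha> - \<beta>)"
  obtain C where C: "C > 0"
    "\<And>f :: complex ^ 'n \<Rightarrow> complex. f \<in> L_space p l \<beta> \<rho> \<Longrightarrow>
       (\<forall>z. integrable dV (bergman_integrand l \<alpha> f z)) \<and>
       (\<forall>z. norm (bergman_projection l \<alpha> f z) * wt l ?g \<rho> z
          \<le> C * (1 + norm z) powr (2 * real CARD('n) * (l - 1) * recip p) * L_norm p l \<beta> \<rho> f) \<and>
       (p \<noteq> \<infinity> \<longrightarrow> Lp_finite p (\<lambda>z. norm (bergman_projection l \<alpha> f z) * wt l ?g \<rho> z) \<and>
          Lp_norm p (\<lambda>z. norm (bergman_projection l \<alpha> f z) * wt l ?g \<rho> z) \<le> C * L_norm p l \<beta> \<rho> f)"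
    using bergman_projection_basic[OF l \<alpha> \<beta> p, of \<rho>, where 'n='n] by blast
  obtain D where D: "D \<ge> 0"
    "\<And>(G :: complex ^ 'n \<Rightarrow> real) N. G \<in> borel_measurable lebesgue \<Longrightarrow> N \<ge> 0 \<Longrightarrow> (\<And>z. G z \<ge> 0) \<Longrightarrow>
      (\<And>z. G z \<le> N * (1 + norm z) powr (2 * real CARD('n) * (l - 1) * recip p)) \<Longrightarrow>
      (p \<noteq> \<infinity> \<Longrightarrow> Lp_finite p G \<and> Lp_norm p G \<le> N) \<Longrightarrow>
      Lp_finite q (\<lambda>z. G z * (1 + norm z) powr (\<eta> - \<rho>)) \<and> Lp_norm q (\<lambda>z. G z * (1 + norm z) powr (\<eta> - \<rho>)) \<le> D * N"
    using polynomial_weight_transfer[OF p q l cond] by blast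
  show ?thesis
    unfolding maps_boundedly_def
  proof (intro exI[of _ "D * C"] allI impI)
    fix f :: "complex ^ 'n \<Rightarrow> complex" assume f: "f \<in> L_space p l \<beta> \<rho>"
    then have fm: "f \<in> borel_measurable lebesgue" by (simp add: L_space_iff)
    define h where "h = bergman_projection l \<alpha> f"
    define N where "N = L_norm p l \<beta> \<rho> f"
    have N: "N \<ge> 0" by (simp add: N_def L_norm_eq Lp_norm_nonneg)
    have hm: "h \<in> borel_measurable lebesgue" unfolding h_def by (rule bergman_projection_measurable[OF l \<alpha> fm])
    note Cf = C(2)[OF f, folded h_def N_def]
    have "Lp_finite q (\<lambda>z. (norm (h z) * wt l ?g \<rho> z) * (1 + norm z) powr (\<eta> - \<rho>)) \<and>
      Lp_norm q (\<lambda>z. (norm (h z) * wt l ?g \<rho> z) * (1 + norm z) powr (\<eta> - \<rho>)) \<le> D * (C * N)"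
    proof (rule D(2))
      show "(\<lambda>z. norm (h z) * wt l ?g \<rho> z) \<in> borel_measurable lebesgue" by (rule weight_measurable_dV[OF hm])
      show "C * N \<ge> 0" using C(1) N by simp
      show "norm (h z) * wt l ?g \<rho> z \<ge> 0" for z using wt_pos[of l ?g \<rho> z] by simp
      show "norm (h z) * wt l ?g \<rho> z \<le> C * N * (1 + norm z) powr (2 * real CARD('n) * (l - 1) * recip p)" for z
      proof -
        have "norm (h z) * wt l ?g \<rho> z \<le> C * (1 + norm z) powr (2 * real CARD('n) * (l - 1) * recip p) * N"
          using Cf by blast
        then show ?thesis by (simp only: mult_ac)
      qed
    qed (use Cf in blast)
    then show "(\<forall>z. integrable dV (bergman_integrand l \<alpha> f z)) \<and>
        bergman_projection l \<alpha> f \<in> L_space q l ?g \<eta> \<and>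
        L_norm q l ?g \<eta> (bergman_projection l \<alpha> f) \<le> D * C * L_norm p l \<beta> \<rho> f"
      unfolding L_space_iff L_norm_eq[of q] h_def[symmetric] N_def[symmetric] wt_change[of l ?g \<eta> _ \<rho>]
      using Cf hm by (simp add: mult.assoc)
  qed
qed

lemma maps_boundedly_sufficient:
  assumes l: "l \<ge> 1" and \<alpha>: "\<alpha> > 0" and p: "p \<ge> 1" and q: "q \<ge> 1" and \<beta>: "\<beta> < 2 * \<alpha>"
    and g: "\<alpha>\<^sup>2 / (2 * \<alpha> - \<beta>) < \<gamma>"
  shows "maps_boundedly TYPE('n::finite) l \<alpha> p \<beta> \<rho> q \<gamma> \<eta>"
proof -
  \<comment> \<open>Lowering the exponent of the polynomial weight by m satisfies whichever of the
    two conditions applies to p and q; the larger \<gamma> makes up for it.\<close>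
  define m where "m = max (2 * real CARD('n) * (l - 1) * (recip p - recip q)) (2 * real CARD('n) * (recip q - recip p)) + 1"
  have "maps_boundedly TYPE('n) l \<alpha> p \<beta> \<rho> q (\<alpha>\<^sup>2 / (2 * \<alpha> - \<beta>)) (\<rho> - m)"
    by (rule maps_boundedly_sharp[OF l \<alpha> \<beta> p q]) (auto simp: m_def)
  moreover obtain C where "C > 0" "\<And>z :: complex ^ 'n. wt l \<gamma> \<eta> z \<le> C * wt l (\<alpha>\<^sup>2 / (2 * \<alpha> - \<beta>)) (\<rho> - m) z"
    using wt_exponential_gap[OF l g] by metis
  ultimately show ?thesis using maps_boundedly_mono[OF _ q] by (metis less_imp_le)
qed

section \<open>Test functions\<close>

text \<open>Covers the default value: the Bochner integral of a non-integrable function is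
  0.\<close>

lemma norm_integral_le:
  fixes f :: "'a \<Rightarrow> 'b::{banach, second_countable_topology}"
  assumes "(\<integral>\<^sup>+x. ennreal (norm (f x)) \<partial>M) \<le> ennreal X" "X \<ge> 0"
  shows "norm (integral\<^sup>L M f) \<le> X"
proof (cases "integrable M f")
  case True
  have "ennreal (norm (integral\<^sup>L M f)) \<le> ennreal X"
    by (rule order_trans[OF integral_norm_bound_ennreal[OF True] assms(1)])
  then show ?thesis using assms(2) by (simp add: ennreal_le_iff)
qed (use assms in \<open>simp add: not_integrable_integral_eq\<close>)

text \<open>A Euclidean ball about \<zeta> of radius A (1 + |\<zeta>|)^(1-l), the scale on which the
  kernel at \<zeta> is concentrated.\<close>

definition tube :: "real \<Rightarrow> real \<Rightarrow> complex ^ 'n::finite \<Rightarrow> (complex ^ 'n) set" where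
  "tube l A \<zeta> = {w. (1 + norm \<zeta>) powr (l - 1) * norm (w - \<zeta>) < A}"

lemma tube_measurable [measurable]: "tube l A \<zeta> \<in> sets borel"
  unfolding tube_def by measurable

lemma tube_close:
  assumes "l \<ge> 1" "w \<in> tube l A \<zeta>"
  shows "norm (w - \<zeta>) < A"
proof -
  have "1 \<le> (1 + norm \<zeta>) powr (l - 1)" using assms by (intro ge_one_powr_ge_zero) auto
  then have "norm (w - \<zeta>) \<le> (1 + norm \<zeta>) powr (l - 1) * norm (w - \<zeta>)"
    using mult_right_mono[of 1 "(1 + norm \<zeta>) powr (l - 1)" "norm (w - \<zeta>)"] by simp
  then show ?thesis using assms by (simp add: tube_def)
qed

lemma tube_preimage:
  assumes "c > 0"
  shows "{w. c *\<^sub>R w \<in> tube l A \<zeta>} = ball ((1 / c) *\<^sub>R \<zeta>) (A * (1 + norm \<zeta>) powr (1 - l) / c)"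
proof (rule set_eqI)
  fix w
  have R: "(1 + norm \<zeta>) powr (l - 1) > 0" using add_pos_nonneg[OF zero_less_one norm_ge_zero[of \<zeta>]] by simp
  have "c *\<^sub>R w - \<zeta> = c *\<^sub>R (w - (1 / c) *\<^sub>R \<zeta>)" using assms by (simp add: algebra_simps)
  then have "norm (c *\<^sub>R w - \<zeta>) = c * norm (w - (1 / c) *\<^sub>R \<zeta>)" using assms by simp
  then have "c *\<^sub>R w \<in> tube l A \<zeta> \<longleftrightarrow> (1 + norm \<zeta>) powr (l - 1) * (c * norm (w - (1 / c) *\<^sub>R \<zeta>)) < A"
    by (simp add: tube_def)
  also have "\<dots> \<longleftrightarrow> norm (w - (1 / c) *\<^sub>R \<zeta>) < A / ((1 + norm \<zeta>) powr (l - 1) * c)"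
    using R assms by (simp add: pos_less_divide_eq mult_ac)
  also have "A / ((1 + norm \<zeta>) powr (l - 1) * c) = A * (1 + norm \<zeta>) powr (1 - l) / c"
  proof -
    have "1 + norm \<zeta> \<noteq> 0" using norm_ge_zero[of \<zeta>] by linarith
    then show ?thesis by (simp add: powr_diff)
  qed
  finally show "w \<in> {w. c *\<^sub>R w \<in> tube l A \<zeta>} \<longleftrightarrow> w \<in> ball ((1 / c) *\<^sub>R \<zeta>) (A * (1 + norm \<zeta>) powr (1 - l) / c)"
    by (simp add: dist_norm norm_minus_commute)
qed

lemma emeasure_tube:
  fixes \<zeta> :: "complex ^ 'n::finite"
  assumes "c > 0" "A > 0"
  shows "emeasure dV {w. c *\<^sub>R w \<in> tube l A \<zeta>} = ennreal ((A / c) powr (2 * real CARD('n)) * (1 + norm \<zeta>) powr (- (2 * real CARD('n) * (l - 1))))"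
proof -
  have R: "1 + norm \<zeta> > 0" by (simp add: add_pos_nonneg)
  let ?r = "A * (1 + norm \<zeta>) powr (1 - l) / c"
  have r: "?r > 0" using assms R by simp
  have "emeasure dV {w. c *\<^sub>R w \<in> tube l A \<zeta>} = ennreal (?r ^ (2 * CARD('n)))"
    unfolding tube_preimage[OF assms(1)] using r by (intro emeasure_dV_ball) simp
  also have "?r ^ (2 * CARD('n)) = ?r powr (2 * real CARD('n))" using powr_realpow[OF r, of "2 * CARD('n)"] by simp
  also have "?r = (A / c) * (1 + norm \<zeta>) powr (1 - l)" by simp
  also have "((A / c) * (1 + norm \<zeta>) powr (1 - l)) powr (2 * real CARD('n)) = (A / c) powr (2 * real CARD('n)) * (1 + norm \<zeta>) powr (- (2 * real CARD('n) * (l - 1)))"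
    by (simp only: powr_mult powr_powr) (simp add: algebra_simps)
  finally show ?thesis .
qed

section \<open>Localization of the reproducing formula\<close>

lemma bkernel_nn_integral:
  assumes l: "l \<ge> 1"
  obtains A where "A > 0" "\<And>z :: complex ^ 'n::finite. (\<integral>\<^sup>+w. ennreal (norm (bkernel l z w)) \<partial>dV) \<le> ennreal A"
proof (rule weighted_kernel_bounds[OF l zero_less_one zero_less_one, where \<rho>=0 and 'n='n])
  fix A :: real
  assume A: "A > 0" and *: "\<And>z :: complex ^ 'n.
    (\<integral>\<^sup>+w. ennreal ((1 + norm z) powr 0 * (1 + norm w) powr (- 0) * norm (bkernel l (1 *\<^sub>R z) (1 *\<^sub>R w))) \<partial>dV) \<le> ennreal A"
  have nz: "1 + norm z \<noteq> 0" for z :: "complex ^ 'n" using norm_ge_zero[of z] by linarith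
  show thesis
  proof (rule that[OF A])
    fix z :: "complex ^ 'n"
    show "(\<integral>\<^sup>+w. ennreal (norm (bkernel l z w)) \<partial>dV) \<le> ennreal A"
      using *[of z] nz by simp
  qed
qed

text \<open>The reproducing integral for the kernel at \<zeta>, restricted to the tube; up to
  scaling and weights it is the projection of \<open>test_fun\<close>.\<close>

definition tube_integral :: "real \<Rightarrow> real \<Rightarrow> complex ^ 'n::finite \<Rightarrow> complex ^ 'n \<Rightarrow> complex" where
  "tube_integral l A \<zeta> z = (\<integral>w. indicator (tube l A \<zeta>) w * (bkernel l z w * bkernel l w \<zeta>) \<partial>dV)"

lemma tube_integral_measurable: "l \<ge> 1 \<Longrightarrow> tube_integral l A \<zeta> \<in> borel_measurable borel"
  for \<zeta> :: "complex ^ 'n::finite"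
proof -
  assume l: "l \<ge> 1"
  let ?f = "\<lambda>z w :: complex ^ 'n. indicator (tube l A \<zeta>) w * (bkernel l z w * bkernel l w \<zeta>)"
  have m: "(\<lambda>x. ?f (fst x) (snd x)) \<in> borel_measurable ((borel :: (complex ^ 'n) measure) \<Otimes>\<^sub>M (lborel :: (complex ^ 'n) measure))"
    using borel_measurable_bkernel[OF l, of fst "(borel :: (complex ^ 'n) measure) \<Otimes>\<^sub>M (lborel :: (complex ^ 'n) measure)" snd]
      borel_measurable_bkernel[OF l, of snd "(borel :: (complex ^ 'n) measure) \<Otimes>\<^sub>M (lborel :: (complex ^ 'n) measure)" "\<lambda>_. \<zeta>"]
    by measurable
  have "(\<lambda>z. \<integral>w. ?f z w \<partial>lborel) \<in> borel_measurable (borel :: (complex ^ 'n) measure)"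
    by (rule lborel.borel_measurable_lebesgue_integral) (use m in \<open>simp add: case_prod_unfold\<close>)
  moreover have "?f z \<in> borel_measurable borel" for z
    using borel_measurable_bkernel[OF l, of "\<lambda>_. z" borel "\<lambda>w. w"] borel_measurable_bkernel[OF l, of "\<lambda>w. w" borel "\<lambda>_. \<zeta>"]
    by measurable
  then have "tube_integral l A \<zeta> z = cV TYPE('n) *\<^sub>R (\<integral>w. ?f z w \<partial>lborel)" for z
    unfolding tube_integral_def by (rule integral_dV)
  then have "tube_integral l A \<zeta> = (\<lambda>z. cV TYPE('n) *\<^sub>R (\<integral>w. ?f z w \<partial>lborel))" by (rule ext)
  ultimately show ?thesis by simp
qed

text \<open>
  The reproducing formula, applied twice, gives \<open>K(\<zeta>, \<zeta>)\<close> when both integrations run over the whole space;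
  by the decay of the kernel, tubes with large \<open>A\<close> carry most of the double integral.
\<close>

lemma bkernel_localized:
  assumes l: "l \<ge> 1"
  obtains A c where "A > 0" "c > 0" "\<And>\<zeta> :: complex ^ 'n::finite. \<zeta> \<noteq> 0 \<Longrightarrow>
     c * (1 + norm \<zeta>) powr (2 * real CARD('n) * (l - 1)) \<le> norm (\<integral>z. indicator (tube l A \<zeta>) z * (bkernel l \<zeta> z * tube_integral l A \<zeta> z) \<partial>dV)"
proof -
  define s where "s = 2 * real CARD('n) * (l - 1)"
  obtain c0 where c0: "c0 > 0" "\<And>z :: complex ^ 'n. c0 * (1 + norm z) powr s \<le> Re (bkernel l z z)"
    using bkernel_diag[OF l, where 'n='n] unfolding s_def by blast
  obtain C where C: "C > 0" "\<And>z w :: complex ^ 'n. norm (bkernel l z w) \<le> C * (1 + norm z) powr s * (1 + (1 + norm z) powr (l - 1) * norm (z - w)) powr (- 1)"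
    using bkernel_bound[OF l zero_le_one, where 'n='n] unfolding s_def by blast
  obtain A0 where A0: "A0 > 0" "\<And>z :: complex ^ 'n. (\<integral>\<^sup>+w. ennreal (norm (bkernel l z w)) \<partial>dV) \<le> ennreal A0"
    using bkernel_nn_integral[OF l, where 'n='n] by blast
  \<comment> \<open>Large enough for the two truncation errors, together (A0 + A0^2) C R^s / (1 +
    A), to stay below half of the lower bound c0 R^s of the diagonal value.\<close>
  define A where "A = 2 * C * (A0 + A0 * A0) / c0"
  have A: "A > 0" using C A0 c0 by (simp add: A_def add_pos_pos)
  show ?thesis
  proof (rule that[OF A, of "c0 / 2"])
    show "c0 / 2 > 0" using c0 by simp
    fix \<zeta> :: "complex ^ 'n" assume \<zeta>: "\<zeta> \<noteq> 0"
    define R where "R = 1 + norm \<zeta>"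
    have R: "R \<ge> 1" by (simp add: R_def)
    let ?T = "tube l A \<zeta>"
    let ?k = "bkernel l"
    have km: "?k z \<in> borel_measurable borel" "(\<lambda>w. ?k w z) \<in> borel_measurable borel" for z :: "complex ^ 'n"
      by (rule borel_measurable_bkernel[OF l]; simp)+
    have sup: "norm (?k w \<zeta>) \<le> C * R powr s" for w
    proof -
      have "(1 + R powr (l - 1) * norm (\<zeta> - w)) powr (- 1) \<le> 1 powr (- 1)" using R by (intro powr_mono2') auto
      then have "C * R powr s * (1 + R powr (l - 1) * norm (\<zeta> - w)) powr (- 1) \<le> C * R powr s * 1"
        using C by (intro mult_left_mono) auto
      then show ?thesis using C(2)[of \<zeta> w] norm_bkernel_commute[OF l, of w \<zeta>] by (simp add: R_def)
    qed
    \<comment> \<open>The size of the kernel at \<zeta> outside the tube, from a single power of its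
      decay.\<close>
    define \<epsilon> where "\<epsilon> = C * R powr s / (1 + A)"
    have e0: "\<epsilon> \<ge> 0" using C A by (simp add: \<epsilon>_def)
    have far: "norm (?k w \<zeta>) \<le> \<epsilon>" if "w \<notin> ?T" for w
    proof -
      have "A \<le> R powr (l - 1) * norm (\<zeta> - w)" using that by (simp add: tube_def R_def norm_minus_commute)
      then have "(1 + R powr (l - 1) * norm (\<zeta> - w)) powr (- 1) \<le> (1 + A) powr (- 1)" using A by (intro powr_mono2') auto
      then have "C * R powr s * (1 + R powr (l - 1) * norm (\<zeta> - w)) powr (- 1) \<le> C * R powr s * (1 + A) powr (- 1)"
        using C by (intro mult_left_mono) auto
      also have "\<dots> = \<epsilon>" using A by (simp add: \<epsilon>_def powr_minus divide_inverse)
      finally show ?thesis using C(2)[of \<zeta> w] norm_bkernel_commute[OF l, of w \<zeta>] by (simp add: R_def)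
    qed
    define J where "J = tube_integral l A \<zeta>"
    have Jm: "J \<in> borel_measurable borel" unfolding J_def by (rule tube_integral_measurable[OF l])
    have int_le: "(\<integral>\<^sup>+w. ennreal (norm (u w * (?k z w * v w))) \<partial>dV) \<le> ennreal (A0 * X)"
      if "\<And>w. norm (u w) * norm (v w) \<le> X" "X \<ge> 0" for u v :: "complex ^ 'n \<Rightarrow> complex" and X and z :: "complex ^ 'n"
    proof -
      have "(\<integral>\<^sup>+w. ennreal (norm (u w * (?k z w * v w))) \<partial>dV) \<le> (\<integral>\<^sup>+w. ennreal (norm (?k z w)) * ennreal X \<partial>dV)"
      proof (intro nn_integral_mono)
        fix w
        have "norm (u w * (?k z w * v w)) = norm (?k z w) * (norm (u w) * norm (v w))" by (simp add: norm_mult)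
        also have "\<dots> \<le> norm (?k z w) * X" by (intro mult_left_mono that) simp
        finally show "ennreal (norm (u w * (?k z w * v w))) \<le> ennreal (norm (?k z w)) * ennreal X"
          using that(2) by (simp add: ennreal_leI flip: ennreal_mult)
      qed
      also have "\<dots> = (\<integral>\<^sup>+w. ennreal (norm (?k z w)) \<partial>dV) * ennreal X"
        using km by (intro nn_integral_multc borel_measurable_dV) simp
      also have "\<dots> \<le> ennreal A0 * ennreal X" by (intro mult_right_mono A0) simp
      finally show ?thesis using A0 that by (simp add: ennreal_mult)
    qed
    have IJ: "norm (?k z \<zeta> - J z) \<le> A0 * \<epsilon>" for z
    proof -
      let ?f = "\<lambda>w. ?k z w * ?k w \<zeta>"
      have fi: "integrable dV ?f" by (rule bkernel_reproducing(1)[OF l \<zeta>])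
      have ii: "integrable dV (\<lambda>w. indicator ?T w * ?f w)"
      proof (rule Bochner_Integration.integrable_bound[OF fi])
        show "(\<lambda>w. indicator ?T w * ?f w) \<in> borel_measurable dV"
          using km[of z] km[of \<zeta>] by (intro borel_measurable_dV) measurable
      qed (auto simp: norm_mult indicator_def)
      have "?k z \<zeta> - J z = (\<integral>w. ?f w - indicator ?T w * ?f w \<partial>dV)"
        unfolding J_def tube_integral_def bkernel_reproducing(2)[OF l \<zeta>, of z, symmetric]
        by (rule Bochner_Integration.integral_diff[OF fi ii, symmetric])
      also have "(\<lambda>w. ?f w - indicator ?T w * ?f w) = (\<lambda>w. indicator (- ?T) w * (?k z w * ?k w \<zeta>))"
        by (auto simp: indicator_def)
      also have "norm (integral\<^sup>L dV (\<lambda>w. indicator (- ?T) w * (?k z w * ?k w \<zeta>))) \<le> A0 * \<epsilon>"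
        using far e0 A0 by (intro norm_integral_le int_le) (auto simp: indicator_def)
      finally show ?thesis .
    qed
    have Jb: "norm (J z) \<le> A0 * (C * R powr s)" for z
      unfolding J_def tube_integral_def using sup C A0
      by (intro norm_integral_le int_le) (auto simp: indicator_def)
    define Q where "Q = (\<integral>z. indicator ?T z * (?k \<zeta> z * J z) \<partial>dV)"
    have i1: "integrable dV (\<lambda>z. indicator ?T z * (?k \<zeta> z * J z))"
    proof (rule integrableI_bounded)
      show "(\<lambda>z. indicator ?T z * (?k \<zeta> z * J z)) \<in> borel_measurable dV"
        using km[of \<zeta>] Jm by (intro borel_measurable_dV) measurable
      have "(\<integral>\<^sup>+z. ennreal (norm (indicator ?T z * (?k \<zeta> z * J z))) \<partial>dV) \<le> ennreal (A0 * (A0 * (C * R powr s)))"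
        using Jb C A0 by (intro int_le) (auto simp: indicator_def)
      then show "(\<integral>\<^sup>+z. ennreal (norm (indicator ?T z * (?k \<zeta> z * J z))) \<partial>dV) < \<infinity>"
        by (rule order_le_less_trans) simp
    qed
    have i2: "integrable dV (\<lambda>z. ?k \<zeta> z * ?k z \<zeta>)" by (rule bkernel_reproducing(1)[OF l \<zeta>])
    have i3: "integrable dV (\<lambda>z. indicator (- ?T) z * (?k \<zeta> z * ?k z \<zeta>))"
    proof (rule Bochner_Integration.integrable_bound[OF i2])
      show "(\<lambda>z. indicator (- ?T) z * (?k \<zeta> z * ?k z \<zeta>)) \<in> borel_measurable dV"
        using km[of \<zeta>] by (intro borel_measurable_dV) measurable
    qed (auto simp: norm_mult indicator_def)
    have i4: "integrable dV (\<lambda>z. indicator ?T z * (?k \<zeta> z * (?k z \<zeta> - J z)))"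
    proof (rule integrableI_bounded)
      have "(\<lambda>z. ?k z \<zeta> - J z) \<in> borel_measurable borel" by (intro borel_measurable_diff km Jm)
      then show "(\<lambda>z. indicator ?T z * (?k \<zeta> z * (?k z \<zeta> - J z))) \<in> borel_measurable dV"
        using km[of \<zeta>] by (intro borel_measurable_dV) measurable
      have "(\<integral>\<^sup>+z. ennreal (norm (indicator ?T z * (?k \<zeta> z * (?k z \<zeta> - J z)))) \<partial>dV) \<le> ennreal (A0 * (A0 * \<epsilon>))"
        using IJ e0 A0 by (intro int_le) (auto simp: indicator_def)
      then show "(\<integral>\<^sup>+z. ennreal (norm (indicator ?T z * (?k \<zeta> z * (?k z \<zeta> - J z)))) \<partial>dV) < \<infinity>"
        by (rule order_le_less_trans) simp
    qed
    \<comment> \<open>The first piece is the wanted integral; the other two are the truncation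
      errors of the outer and of the inner integration.\<close>
    have "?k \<zeta> \<zeta> = (\<integral>z. indicator ?T z * (?k \<zeta> z * J z) + (indicator (- ?T) z * (?k \<zeta> z * ?k z \<zeta>) + indicator ?T z * (?k \<zeta> z * (?k z \<zeta> - J z))) \<partial>dV)"
      unfolding bkernel_reproducing(2)[OF l \<zeta>, of \<zeta>, symmetric]
      by (intro Bochner_Integration.integral_cong refl) (auto simp: indicator_def algebra_simps)
    also have "\<dots> = Q + ((\<integral>z. indicator (- ?T) z * (?k \<zeta> z * ?k z \<zeta>) \<partial>dV) + (\<integral>z. indicator ?T z * (?k \<zeta> z * (?k z \<zeta> - J z)) \<partial>dV))"
      using i1 i3 i4 by (simp add: Q_def)
    finally have kk: "?k \<zeta> \<zeta> = Q + ((\<integral>z. indicator (- ?T) z * (?k \<zeta> z * ?k z \<zeta>) \<partial>dV) + (\<integral>z. indicator ?T z * (?k \<zeta> z * (?k z \<zeta> - J z)) \<partial>dV))" .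
    have b1: "norm (\<integral>z. indicator (- ?T) z * (?k \<zeta> z * ?k z \<zeta>) \<partial>dV) \<le> A0 * \<epsilon>"
      using far e0 A0 by (intro norm_integral_le int_le) (auto simp: indicator_def)
    have b2: "norm (\<integral>z. indicator ?T z * (?k \<zeta> z * (?k z \<zeta> - J z)) \<partial>dV) \<le> A0 * (A0 * \<epsilon>)"
      using IJ e0 A0 by (intro norm_integral_le int_le) (auto simp: indicator_def)
    have "c0 * R powr s \<le> norm (?k \<zeta> \<zeta>)"
      using c0(2)[of \<zeta>] complex_Re_le_cmod[of "?k \<zeta> \<zeta>"] by (simp add: R_def)
    also have "\<dots> \<le> norm Q + (A0 * \<epsilon> + A0 * (A0 * \<epsilon>))"
      unfolding kk by (intro norm_triangle_le add_mono b1 b2 order_refl)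
    also have "A0 * \<epsilon> + A0 * (A0 * \<epsilon>) \<le> c0 / 2 * R powr s"
    proof -
      have "C * (A0 + A0 * A0) \<le> c0 / 2 * (1 + A)" using c0 A_def by (simp add: field_simps)
      then have "C * (A0 + A0 * A0) / (1 + A) \<le> c0 / 2" using A by (simp add: pos_divide_le_eq)
      then have "C * (A0 + A0 * A0) / (1 + A) * R powr s \<le> c0 / 2 * R powr s" by (intro mult_right_mono) auto
      then show ?thesis by (simp add: \<epsilon>_def field_simps add_divide_distrib)
    qed
    finally show "c0 / 2 * (1 + norm \<zeta>) powr (2 * real CARD('n) * (l - 1)) \<le> norm (\<integral>z. indicator (tube l A \<zeta>) z * (bkernel l \<zeta> z * tube_integral l A \<zeta> z) \<partial>dV)"
      by (simp add: Q_def J_def R_def s_def)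
  qed
qed

text \<open>A rescaled and truncated kernel function, normalized so that its weighted modulus is at most of order 1.\<close>

definition test_fun :: "real \<Rightarrow> real \<Rightarrow> real \<Rightarrow> real \<Rightarrow> real \<Rightarrow> complex ^ 'n::finite \<Rightarrow> complex ^ 'n \<Rightarrow> complex" where
  "test_fun l \<beta> \<rho> b A \<zeta> w = indicator (tube l A \<zeta>) (b *\<^sub>R w) * bkernel l (b *\<^sub>R w) \<zeta>
     * of_real ((1 + norm w) powr \<rho> * (1 + norm \<zeta>) powr (- \<rho> - 2 * real CARD('n) * (l - 1)) / wt l \<beta> \<rho> w)"

lemma test_fun_measurable:
  fixes \<zeta> :: "complex ^ 'n::finite"
  assumes l: "l \<ge> 1"
  shows "test_fun l \<beta> \<rho> b A \<zeta> \<in> borel_measurable borel"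
proof -
  have [measurable]: "(\<lambda>w. bkernel l (b *\<^sub>R w) \<zeta>) \<in> borel_measurable borel"
    by (rule borel_measurable_bkernel[OF l]; simp)
  show ?thesis unfolding test_fun_def[abs_def] by measurable
qed

text \<open>The lower bound comes from pairing the projection with the kernel at \<zeta>: its size
  C0 R^s cancels the R^s of \<open>bkernel_localized\<close>, so the modulus of
  \<open>tube_integral\<close> has an integral bounded below. The normalization of the test function
  then contributes R^(-\<rho>-s) and the target weight R^\<eta>.\<close>

lemma bergman_test_fun:
  fixes l \<alpha> \<beta> \<rho> \<eta> :: real
  assumes l: "l \<ge> 1" and \<alpha>: "\<alpha> > 0" and \<beta>: "\<beta> < 2 * \<alpha>"
  defines "g \<equiv> \<alpha>\<^sup>2 / (2 * \<alpha> - \<beta>)" and "a \<equiv> (\<alpha>\<^sup>2 / (2 * \<alpha> - \<beta>)) powr (1 / (2 * l))" and "b \<equiv> (2 * \<alpha> - \<beta>) powr (1 / (2 * l))"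
  obtains A c C where "A > 0" "c > 0" "C > 0"
    "\<And>(\<zeta> :: complex ^ 'n::finite) w. norm (test_fun l \<beta> \<rho> b A \<zeta> w) * wt l \<beta> \<rho> w \<le> C * indicator {w. b *\<^sub>R w \<in> tube l A \<zeta>} w"
    "\<And>\<zeta> :: complex ^ 'n. \<zeta> \<noteq> 0 \<Longrightarrow> ennreal (c * (1 + norm \<zeta>) powr (\<eta> - \<rho> - 2 * real CARD('n) * (l - 1))) \<le>
       (\<integral>\<^sup>+z. ennreal (indicator {z. a *\<^sub>R z \<in> tube l A \<zeta>} z * (norm (bergman_projection l \<alpha> (test_fun l \<beta> \<rho> b A \<zeta>) z) * wt l g \<eta> z)) \<partial>dV)"
proof -
  let ?n = "real CARD('n)"
  define s where "s = 2 * ?n * (l - 1)"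
  have g: "g > 0" using \<alpha> \<beta> by (simp add: g_def)
  have a: "a > 0" and b: "b > 0" using \<alpha> \<beta> by (simp_all add: a_def b_def)
  obtain A c0 where A: "A > 0" and c0: "c0 > 0" "\<And>\<zeta> :: complex ^ 'n. \<zeta> \<noteq> 0 \<Longrightarrow>
     c0 * (1 + norm \<zeta>) powr s \<le> norm (\<integral>z. indicator (tube l A \<zeta>) z * (bkernel l \<zeta> z * tube_integral l A \<zeta> z) \<partial>dV)"
    using bkernel_localized[OF l, where 'n='n] unfolding s_def by blast
  obtain C0 where C0: "C0 > 0" "\<And>z w :: complex ^ 'n. norm (bkernel l z w) \<le> C0 * (1 + norm z) powr s * (1 + (1 + norm z) powr (l - 1) * norm (z - w)) powr (- 0)"
    using bkernel_bound[OF l order_refl, where 'n='n] unfolding s_def by blast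
  have sup: "norm (bkernel l \<zeta> w) \<le> C0 * (1 + norm \<zeta>) powr s" for \<zeta> w :: "complex ^ 'n"
  proof -
    have "1 + (1 + norm \<zeta>) powr (l - 1) * norm (\<zeta> - w) > 0" by (intro add_pos_nonneg) auto
    then show ?thesis using C0(2)[of \<zeta> w] by simp
  qed
  \<comment> \<open>Tubes have radius at most A, so 1 + |w| and 1 + |\<zeta>| are comparable on them
    and polynomial weights may be evaluated at the centre.\<close>
  have near: "\<exists>D>0. \<forall>(\<zeta> :: complex ^ 'n) w. e *\<^sub>R w \<in> tube l A \<zeta> \<longrightarrow> (1 + norm w) powr r * (1 + norm \<zeta>) powr (- r) \<le> D" if e: "e > 0" for e r :: real
  proof -
    obtain C1 where C1: "C1 > 0" "\<And>x. x \<ge> 0 \<Longrightarrow> (1 + x) powr r \<le> C1 * (1 + e * x) powr r"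
      using weight_equiv[OF e, of r] by metis
    show ?thesis
    proof (intro exI[of _ "C1 * (1 + A) powr \<bar>r\<bar>"] conjI allI impI)
      show "C1 * (1 + A) powr \<bar>r\<bar> > 0" using C1 A by simp
      fix \<zeta> w :: "complex ^ 'n" assume "e *\<^sub>R w \<in> tube l A \<zeta>"
      then have d: "norm (e *\<^sub>R w - \<zeta>) < A" by (rule tube_close[OF l])
      have "\<bar>norm (e *\<^sub>R w) - norm \<zeta>\<bar> \<le> norm (e *\<^sub>R w - \<zeta>)" by (rule norm_triangle_ineq3)
      then have d': "\<bar>e * norm w - norm \<zeta>\<bar> \<le> A" using d e by simp
      have "(1 + norm w) powr r * (1 + norm \<zeta>) powr (- r) \<le> C1 * ((1 + e * norm w) powr r * (1 + norm \<zeta>) powr (- r))"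
        using C1(2)[of "norm w"] by (simp add: mult_right_mono flip: mult.assoc)
      also have "\<dots> \<le> C1 * (1 + \<bar>e * norm w - norm \<zeta>\<bar>) powr \<bar>r\<bar>"
        using C1 e by (intro mult_left_mono weight_ratio_le) auto
      also have "\<dots> \<le> C1 * (1 + A) powr \<bar>r\<bar>" using C1 d' by (intro mult_left_mono powr_mono2) auto
      finally show "(1 + norm w) powr r * (1 + norm \<zeta>) powr (- r) \<le> C1 * (1 + A) powr \<bar>r\<bar>" .
    qed
  qed
  obtain D1 where D1: "D1 > 0" "\<And>(\<zeta> :: complex ^ 'n) w. b *\<^sub>R w \<in> tube l A \<zeta> \<Longrightarrow> (1 + norm w) powr \<rho> * (1 + norm \<zeta>) powr (- \<rho>) \<le> D1"
    using near[OF b, of \<rho>] by blast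
  obtain D2 where D2: "D2 > 0" "\<And>(\<zeta> :: complex ^ 'n) w. a *\<^sub>R w \<in> tube l A \<zeta> \<Longrightarrow> (1 + norm w) powr (- \<eta>) * (1 + norm \<zeta>) powr (- (- \<eta>)) \<le> D2"
    using near[OF a, of "- \<eta>"] by blast
  define k where "k = \<alpha> powr (?n / l) * b powr (- (2 * ?n))"
  have k: "k > 0" using \<alpha> b by (simp add: k_def)
  define c where "c = c0 * k / (a powr (2 * ?n) * C0 * D2)"
  have c: "c > 0" using c0 k a C0 D2 by (simp add: c_def)
  show ?thesis
  proof (rule that[OF A c, of "C0 * D1"])
    show "C0 * D1 > 0" using C0 D1 by simp
    fix \<zeta> w :: "complex ^ 'n"
    let ?R = "1 + norm \<zeta>"
    have R: "?R > 0" by (simp add: add_pos_nonneg)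
    have wp: "wt l \<beta> \<rho> w > 0" by (rule wt_pos)
    have "norm (bkernel l (b *\<^sub>R w) \<zeta>) * ((1 + norm w) powr \<rho> * ?R powr (- \<rho> - s)) \<le> C0 * D1" if t: "b *\<^sub>R w \<in> tube l A \<zeta>"
    proof -
      have "norm (bkernel l (b *\<^sub>R w) \<zeta>) * ((1 + norm w) powr \<rho> * ?R powr (- \<rho> - s)) \<le> (C0 * ?R powr s) * ((1 + norm w) powr \<rho> * ?R powr (- \<rho> - s))"
        using sup[of \<zeta> "b *\<^sub>R w"] norm_bkernel_commute[OF l, of "b *\<^sub>R w" \<zeta>] by (intro mult_right_mono) auto
      also have "\<dots> = C0 * ((1 + norm w) powr \<rho> * ?R powr (- \<rho>)) * (?R powr s * ?R powr (- s))"
        by (simp add: powr_diff powr_minus divide_inverse mult_ac)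
      also have "?R powr s * ?R powr (- s) = 1" using R by (simp flip: powr_add)
      also have "C0 * ((1 + norm w) powr \<rho> * ?R powr (- \<rho>)) * 1 \<le> C0 * D1 * 1"
        using C0 D1(2)[OF t] by (intro mult_right_mono mult_left_mono) auto
      finally show ?thesis by simp
    qed
    moreover have "norm (test_fun l \<beta> \<rho> b A \<zeta> w) * wt l \<beta> \<rho> w
      = indicator (tube l A \<zeta>) (b *\<^sub>R w) * (norm (bkernel l (b *\<^sub>R w) \<zeta>) * ((1 + norm w) powr \<rho> * ?R powr (- \<rho> - s)))"
      using wp by (simp add: test_fun_def s_def norm_mult norm_divide indicator_def)
    ultimately show "norm (test_fun l \<beta> \<rho> b A \<zeta> w) * wt l \<beta> \<rho> w \<le> C0 * D1 * indicator {w. b *\<^sub>R w \<in> tube l A \<zeta>} w"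
      by (auto simp: indicator_def)
  next
    fix \<zeta> :: "complex ^ 'n" assume \<zeta>: "\<zeta> \<noteq> 0"
    let ?R = "1 + norm \<zeta>"
    let ?T = "tube l A \<zeta>"
    have R: "?R > 0" by (simp add: add_pos_nonneg)
    define f where "f = test_fun l \<beta> \<rho> b A \<zeta>"
    define h where "h z = norm (bergman_projection l \<alpha> f z) * wt l g \<eta> z" for z
    have h0: "h z \<ge> 0" for z using wt_pos[of l g \<eta> z] by (simp add: h_def)
    have fm: "f \<in> borel_measurable lebesgue" unfolding f_def by (rule measurable_completion) (simp add: test_fun_measurable[OF l])
    have hm: "h \<in> borel_measurable lebesgue" unfolding h_def[abs_def]
      by (intro weight_measurable_dV bergman_projection_measurable[OF l \<alpha> fm])
    define J where "J = tube_integral l A \<zeta>"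
    have Jm: "J \<in> borel_measurable borel" unfolding J_def by (rule tube_integral_measurable[OF l])
    have Pf: "bergman_projection l \<alpha> f z * of_real (wt l g \<eta> z) = of_real (k * (1 + norm z) powr \<eta> * ?R powr (- \<rho> - s)) * J (a *\<^sub>R z)" for z
    proof -
      let ?F = "\<lambda>v. indicator ?T v * (bkernel l (a *\<^sub>R z) v * bkernel l v \<zeta>)"
      have "bergman_integrand l \<alpha> f z w * of_real (wt l g \<eta> z) = of_real (\<alpha> powr (?n / l) * (1 + norm z) powr \<eta> * ?R powr (- \<rho> - s)) * ?F (b *\<^sub>R w)" for w
      proof -
        have wp: "wt l \<beta> \<rho> w > 0" by (rule wt_pos)
        have w1: "(1 + norm w) powr (- \<rho>) * (1 + norm w) powr \<rho> = 1"
        proof -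
          have "1 + norm w > 0" by (simp add: add_pos_nonneg)
          then show ?thesis by (simp flip: powr_add)
        qed
        have "f w * of_real (wt l \<beta> \<rho> w) = indicator ?T (b *\<^sub>R w) * bkernel l (b *\<^sub>R w) \<zeta> * of_real ((1 + norm w) powr \<rho> * ?R powr (- \<rho> - s))"
          using wp by (simp add: f_def test_fun_def s_def)
        then have "bergman_integrand l \<alpha> f z w * of_real (wt l g \<eta> z) =
          of_real (\<alpha> powr (?n / l) * (1 + norm z) powr \<eta> * (1 + norm w) powr (- \<rho>)) *
           (indicator ?T (b *\<^sub>R w) * bkernel l (b *\<^sub>R w) \<zeta> * of_real ((1 + norm w) powr \<rho> * ?R powr (- \<rho> - s))) * bkernel l (a *\<^sub>R z) (b *\<^sub>R w)"
          unfolding g_def a_def b_def by (simp only: bergman_integrand_eq[OF l \<alpha> \<beta>, of f z w \<eta> \<rho>])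
        also have "\<dots> = of_real (\<alpha> powr (?n / l) * (1 + norm z) powr \<eta> * ?R powr (- \<rho> - s) * ((1 + norm w) powr (- \<rho>) * (1 + norm w) powr \<rho>)) * ?F (b *\<^sub>R w)"
          by (simp only: of_real_mult mult_ac)
        finally show ?thesis unfolding w1 by simp
      qed
      then have "(\<integral>w. bergman_integrand l \<alpha> f z w * of_real (wt l g \<eta> z) \<partial>dV) = (\<integral>w. of_real (\<alpha> powr (?n / l) * (1 + norm z) powr \<eta> * ?R powr (- \<rho> - s)) * ?F (b *\<^sub>R w) \<partial>dV)"
        by (simp only:)
      moreover have "(\<integral>w. bergman_integrand l \<alpha> f z w * of_real (wt l g \<eta> z) \<partial>dV) = bergman_projection l \<alpha> f z * of_real (wt l g \<eta> z)"
        unfolding bergman_projection_def by (rule integral_mult_left_zero)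
      moreover have "(\<integral>w. of_real (\<alpha> powr (?n / l) * (1 + norm z) powr \<eta> * ?R powr (- \<rho> - s)) * ?F (b *\<^sub>R w) \<partial>dV)
         = of_real (\<alpha> powr (?n / l) * (1 + norm z) powr \<eta> * ?R powr (- \<rho> - s)) * (\<integral>w. ?F (b *\<^sub>R w) \<partial>dV)"
        by (rule integral_mult_right_zero)
      moreover have "(\<integral>w. ?F (b *\<^sub>R w) \<partial>dV) = b powr (- (2 * ?n)) *\<^sub>R J (a *\<^sub>R z)"
      proof -
        have [measurable]: "(\<lambda>v. bkernel l (a *\<^sub>R z) v) \<in> borel_measurable borel" "(\<lambda>v. bkernel l v \<zeta>) \<in> borel_measurable borel"
          by (rule borel_measurable_bkernel[OF l]; simp)+
        have "?F \<in> borel_measurable borel" by measurable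
        from integral_dV_affine[OF this b, of 0] show ?thesis by (simp add: J_def tube_integral_def)
      qed
      ultimately show ?thesis by (simp add: k_def scaleR_conv_of_real mult_ac)
    qed
    have hJ: "h z = k * (1 + norm z) powr \<eta> * ?R powr (- \<rho> - s) * norm (J (a *\<^sub>R z))" for z
    proof -
      have "h z = norm (bergman_projection l \<alpha> f z * of_real (wt l g \<eta> z))"
        using wt_pos[of l g \<eta> z] by (simp add: h_def norm_mult)
      then show ?thesis unfolding Pf using k by (simp add: norm_mult)
    qed
    define X where "X = (\<integral>\<^sup>+z. ennreal (indicator {z. a *\<^sub>R z \<in> ?T} z * h z) \<partial>dV)"
    \<comment> \<open>The factor from h to the paired integrand: R^s bounds the kernel at \<zeta>,
      R^(\<rho>+s) undoes the normalization and R^(-\<eta>) the weight.\<close>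
    define E where "E = C0 * D2 * ?R powr (2 * s + \<rho> - \<eta>) / k"
    have E0: "E \<ge> 0" using C0 D2 k by (simp add: E_def)
    have "ennreal (c0 * ?R powr s) \<le> ennreal (a powr (2 * ?n) * E) * X"
    proof (cases "X = \<infinity>")
      case True
      have "a powr (2 * ?n) * E > 0" using a C0 D2 k R by (simp add: E_def)
      then have "ennreal (a powr (2 * ?n) * E) \<noteq> 0" by (simp only: ennreal_eq_0_iff not_le)
      then have "ennreal (a powr (2 * ?n) * E) * X = \<infinity>"
        unfolding True infinity_ennreal_def by (simp only: ennreal_mult_top if_False)
      then show ?thesis by (simp only: infinity_ennreal_def top_greatest)
    next
      case False
      define x where "x = enn2real X"
      have x: "X = ennreal x" "x \<ge> 0" using False by (simp_all add: x_def less_top)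
      let ?Q = "\<lambda>v. indicator ?T v * (bkernel l \<zeta> v * J v)"
      have [measurable]: "(\<lambda>v. bkernel l \<zeta> v) \<in> borel_measurable borel" by (rule borel_measurable_bkernel[OF l]; simp)
      have Qm: "(\<lambda>v. ennreal (norm (?Q v))) \<in> borel_measurable borel" using Jm by measurable
      have "ennreal (a powr (- (2 * ?n))) * (\<integral>\<^sup>+v. ennreal (norm (?Q v)) \<partial>dV) = (\<integral>\<^sup>+z. ennreal (norm (?Q (a *\<^sub>R z))) \<partial>dV)"
        using nn_integral_dV_affine[OF Qm a, of 0] by simp
      also have "\<dots> \<le> (\<integral>\<^sup>+z. ennreal E * ennreal (indicator {z. a *\<^sub>R z \<in> ?T} z * h z) \<partial>dV)"
      proof (intro nn_integral_mono)
        fix z :: "complex ^ 'n"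
        have "norm (?Q (a *\<^sub>R z)) \<le> E * (indicator {z. a *\<^sub>R z \<in> ?T} z * h z)"
        proof (cases "a *\<^sub>R z \<in> ?T")
          case t: True
          have z1: "1 + norm z > 0" by (simp add: add_pos_nonneg)
          have "1 = ((1 + norm z) powr (- \<eta>) * ?R powr \<eta>) * ((1 + norm z) powr \<eta> * ?R powr (- \<eta>))"
          proof -
            have "(1 + norm z) powr (- \<eta>) * (1 + norm z) powr \<eta> = 1" "?R powr \<eta> * ?R powr (- \<eta>) = 1"
              using z1 R by (simp_all flip: powr_add)
            then have "((1 + norm z) powr (- \<eta>) * (1 + norm z) powr \<eta>) * (?R powr \<eta> * ?R powr (- \<eta>)) = 1" by simp
            then show ?thesis by (simp only: mult_ac)
          qed
          also have "\<dots> \<le> D2 * ((1 + norm z) powr \<eta> * ?R powr (- \<eta>))"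
            using D2(2)[OF t] by (intro mult_right_mono) auto
          finally have d: "1 \<le> D2 * ((1 + norm z) powr \<eta> * ?R powr (- \<eta>))" .
          have "norm (?Q (a *\<^sub>R z)) = norm (bkernel l \<zeta> (a *\<^sub>R z)) * norm (J (a *\<^sub>R z))" using t by (simp add: norm_mult)
          also have "\<dots> \<le> (C0 * ?R powr s) * norm (J (a *\<^sub>R z)) * 1" using sup by (simp add: mult_right_mono)
          also have "\<dots> \<le> (C0 * ?R powr s) * norm (J (a *\<^sub>R z)) * (D2 * ((1 + norm z) powr \<eta> * ?R powr (- \<eta>)))"
            using C0 by (intro mult_left_mono d) auto
          also have "\<dots> = E * h z"
          proof -
            have "?R powr (2 * s + \<rho> - \<eta>) * ?R powr (- \<rho> - s) = ?R powr s * ?R powr (- \<eta>)"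
              by (simp add: powr_add[symmetric])
            then have "E * h z = C0 * D2 * (?R powr s * ?R powr (- \<eta>)) * (1 + norm z) powr \<eta> * norm (J (a *\<^sub>R z))"
              unfolding E_def hJ using k by simp
            then show ?thesis by (simp add: mult_ac)
          qed
          finally show ?thesis using t by simp
        qed (use E0 in simp)
        then show "ennreal (norm (?Q (a *\<^sub>R z))) \<le> ennreal E * ennreal (indicator {z. a *\<^sub>R z \<in> ?T} z * h z)"
          using E0 h0 by (simp add: ennreal_leI flip: ennreal_mult)
      qed
      also have "\<dots> = ennreal E * X"
      proof -
        have [measurable]: "{z. a *\<^sub>R z \<in> ?T} \<in> sets lebesgue" "h \<in> borel_measurable lebesgue"
          unfolding tube_preimage[OF a] using hm by simp_all
        have "(\<lambda>z. ennreal (indicator {z. a *\<^sub>R z \<in> ?T} z * h z)) \<in> borel_measurable lebesgue" by measurable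
        then show ?thesis unfolding X_def by (intro nn_integral_cmult) simp
      qed
      finally have "ennreal (a powr (2 * ?n)) * (ennreal (a powr (- (2 * ?n))) * (\<integral>\<^sup>+v. ennreal (norm (?Q v)) \<partial>dV)) \<le> ennreal (a powr (2 * ?n)) * (ennreal E * X)"
        by (intro mult_left_mono) auto
      moreover have "a powr (2 * ?n) * a powr (- (2 * ?n)) = 1" using a by (simp flip: powr_add)
      ultimately have "(\<integral>\<^sup>+v. ennreal (norm (?Q v)) \<partial>dV) \<le> ennreal (a powr (2 * ?n)) * (ennreal E * X)"
        by (simp add: mult.assoc[symmetric] flip: ennreal_mult')
      also have "\<dots> = ennreal (a powr (2 * ?n) * E * x)" using E0 x by (simp add: ennreal_mult mult.assoc)
      finally have "norm (integral\<^sup>L dV ?Q) \<le> a powr (2 * ?n) * E * x" using E0 x by (intro norm_integral_le) auto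
      then have "c0 * ?R powr s \<le> a powr (2 * ?n) * E * x" using c0(2)[OF \<zeta>] by (simp add: J_def)
      then show ?thesis using E0 x by (simp add: ennreal_leI flip: ennreal_mult)
    qed
    moreover define Y where "Y = a powr (2 * ?n) * E"
    ultimately have XY: "ennreal (c0 * ?R powr s) \<le> ennreal Y * X" by simp
    have Y: "Y > 0" using a C0 D2 k R by (simp add: Y_def E_def)
    have "ennreal (1 / Y * (c0 * ?R powr s)) = ennreal (1 / Y) * ennreal (c0 * ?R powr s)"
      using Y c0 by (intro ennreal_mult) auto
    also have "\<dots> \<le> ennreal (1 / Y) * (ennreal Y * X)" by (intro mult_left_mono XY) auto
    also have "\<dots> = X" using Y by (simp add: mult.assoc[symmetric] flip: ennreal_mult)
    finally have "ennreal (1 / Y * (c0 * ?R powr s)) \<le> X" .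
    moreover have "1 / Y * (c0 * ?R powr s) = c * ?R powr (\<eta> - \<rho> - s)"
    proof -
      have "?R powr s / ?R powr (2 * s + \<rho> - \<eta>) = ?R powr (\<eta> - \<rho> - s)"
        by (simp add: powr_diff[symmetric] algebra_simps)
      moreover have "1 / Y * (c0 * ?R powr s) = c * (?R powr s / ?R powr (2 * s + \<rho> - \<eta>))"
        unfolding Y_def E_def c_def using k C0 D2 a by (simp add: field_simps)
      ultimately show ?thesis by simp
    qed
    ultimately show "ennreal (c * (1 + norm \<zeta>) powr (\<eta> - \<rho> - 2 * ?n * (l - 1))) \<le>
       (\<integral>\<^sup>+z. ennreal (indicator {z. a *\<^sub>R z \<in> tube l A \<zeta>} z * (norm (bergman_projection l \<alpha> (test_fun l \<beta> \<rho> b A \<zeta>) z) * wt l g \<eta> z)) \<partial>dV)"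
      by (simp add: X_def h_def f_def s_def)
  qed
qed

section \<open>Necessity of the conditions on the exponents\<close>

lemma exponent_nonpos_of_bounded:
  fixes d K :: real
  assumes "\<And>N :: nat. N \<ge> 2 \<Longrightarrow> real N powr d \<le> K"
  shows "d \<le> 0"
proof (rule ccontr)
  assume "\<not> d \<le> 0"
  then have "filterlim (\<lambda>N. real N powr d) at_top sequentially" by real_asymp
  then have "eventually (\<lambda>N. K < real N powr d) sequentially" by (simp add: filterlim_at_top_dense)
  then obtain N0 where "\<And>N. N \<ge> N0 \<Longrightarrow> K < real N powr d" by (auto simp: eventually_sequentially)
  then show False using assms[of "max N0 2"] by (meson max.cobounded1 max.cobounded2 not_le)
qed

lemma set_integral_le_Lp:
  fixes h :: "complex ^ 'n::finite \<Rightarrow> real"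
  assumes q: "q \<ge> 1" and h: "h \<in> borel_measurable lebesgue" "\<And>z. h z \<ge> 0"
    and S: "S \<in> sets lebesgue" "emeasure dV S = ennreal v" "v > 0" and fin: "Lp_finite q h"
  shows "(\<integral>\<^sup>+z. ennreal (indicator S z * h z) \<partial>dV) \<le> ennreal (v powr (1 - recip q) * Lp_norm q h)"
proof -
  have iS: "(\<integral>\<^sup>+z. ennreal (indicator S z) \<partial>dV) = ennreal v"
    using S nn_integral_indicator[of S dV] by (simp add: ennreal_indicator)
  show ?thesis
  proof (cases "q = \<infinity>")
    case True
    have "AE z in dV. h z \<le> Lp_norm \<infinity> h" by (rule Lp_infty_AE) (use fin True in simp)
    then have "(\<integral>\<^sup>+z. ennreal (indicator S z * h z) \<partial>dV) \<le> (\<integral>\<^sup>+z. ennreal (Lp_norm \<infinity> h) * ennreal (indicator S z) \<partial>dV)"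
      by (intro nn_integral_mono_AE, elim eventually_mono) (auto simp: indicator_def ennreal_leI)
    also have "\<dots> = ennreal (Lp_norm \<infinity> h) * (\<integral>\<^sup>+z. ennreal (indicator S z) \<partial>dV)"
      using S by (intro nn_integral_cmult) simp
    also have "\<dots> = ennreal (v * Lp_norm \<infinity> h)"
      unfolding iS using S by (simp add: Lp_norm_nonneg mult.commute flip: ennreal_mult)
    finally show ?thesis using S unfolding True recip_top by simp
  next
    case False
    define Q where "Q = enn2real q"
    have Q: "Q \<ge> 1" using enn2real_ge_1[OF q False] by (simp add: Q_def)
    have "(\<integral>\<^sup>+z. ennreal (indicator S z * h z powr Q) \<partial>dV) \<le> (\<integral>\<^sup>+z. ennreal (h z powr Q) \<partial>dV)"
      by (intro nn_integral_mono ennreal_leI) (auto simp: indicator_def)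
    also have "\<dots> = ennreal (Lp_norm q h powr Q)" unfolding Q_def by (rule Lp_integral[OF q False fin])
    finally have "(\<integral>\<^sup>+z. ennreal (indicator S z * h z) \<partial>dV) \<le> ennreal (v powr (1 - 1 / Q) * (Lp_norm q h powr Q) powr (1 / Q))"
      using h S Q iS by (intro jensen_nn_integral) auto
    then show ?thesis using Q recip_eq[OF q False] by (simp add: powr_powr Lp_norm_nonneg Q_def)
  qed
qed

text \<open>Jensen's inequality read backwards: a large integral over a set of volume v forces a
  large q-th moment on it.\<close>

lemma jensen_set:
  fixes h :: "complex ^ 'n::finite \<Rightarrow> real"
  assumes q: "q \<ge> 1" and h: "h \<in> borel_measurable lebesgue" "\<And>z. h z \<ge> 0"
    and S: "S \<in> sets lebesgue" "emeasure dV S = ennreal v" "v > 0"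
    and x: "ennreal x \<le> (\<integral>\<^sup>+z. ennreal (indicator S z * h z) \<partial>dV)" "x \<ge> 0"
  shows "ennreal (x powr q * v powr (1 - q)) \<le> (\<integral>\<^sup>+z. ennreal (indicator S z * h z powr q) \<partial>dV)"
proof (cases "(\<integral>\<^sup>+z. ennreal (indicator S z * h z powr q) \<partial>dV)")
  case (real y)
  have iS: "(\<integral>\<^sup>+z. ennreal (indicator S z) \<partial>dV) = ennreal v"
    using S nn_integral_indicator[of S dV] by (simp add: ennreal_indicator)
  have "(\<integral>\<^sup>+z. ennreal (indicator S z * h z) \<partial>dV) \<le> ennreal (v powr (1 - 1 / q) * y powr (1 / q))"
    using h S q iS real by (intro jensen_nn_integral) auto
  then have "ennreal x \<le> ennreal (v powr (1 - 1 / q) * y powr (1 / q))" using x(1) by order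
  then have "x \<le> v powr (1 - 1 / q) * y powr (1 / q)" by (simp add: ennreal_le_iff)
  then have "x powr q \<le> (v powr (1 - 1 / q) * y powr (1 / q)) powr q" using x q by (intro powr_mono2) auto
  also have "\<dots> = v powr (q - 1) * y" using q real by (simp add: powr_mult powr_powr algebra_simps)
  finally have "x powr q * v powr (1 - q) \<le> v powr (q - 1) * y * v powr (1 - q)" by (intro mult_right_mono) auto
  also have "\<dots> = (v powr (q - 1) * v powr (1 - q)) * y" by (simp only: mult_ac)
  also have "v powr (q - 1) * v powr (1 - q) = 1" using S by (simp flip: powr_add)
  finally show ?thesis using real by (simp add: ennreal_leI)
qed simp

text \<open>At each point at most one summand is active, so powers pass through the sum. For p =
  \<infinity> the bound a i \<le> 1 replaces the volume count, and Y enters with exponent 0.\<close>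

lemma Lp_disjoint_sum:
  fixes F :: "complex ^ 'n::finite \<Rightarrow> real"
  assumes p: "p \<ge> 1" and F: "F \<in> borel_measurable lebesgue" "\<And>z. F z \<ge> 0" and Z: "finite Z" and S: "\<And>i. i \<in> Z \<Longrightarrow> S i \<in> sets lebesgue"
    and dj: "disjoint_family_on S Z" and a: "\<And>i. i \<in> Z \<Longrightarrow> a i > 0" and M: "M \<ge> 0" and Y: "Y > 0"
    and b: "\<And>z. F z \<le> (\<Sum>i\<in>Z. M * a i * indicator (S i) z)"
    and fin: "p \<noteq> \<infinity> \<Longrightarrow> (\<Sum>i\<in>Z. ennreal (a i powr enn2real p) * emeasure dV (S i)) \<le> ennreal Y"
    and inf: "p = \<infinity> \<Longrightarrow> (\<And>i. i \<in> Z \<Longrightarrow> a i \<le> 1)"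
  shows "Lp_finite p F" "Lp_norm p F \<le> M * Y powr recip p"
proof -
  have cases: "F z = 0 \<or> (\<exists>i\<in>Z. z \<in> S i \<and> F z \<le> M * a i)" for z
  proof (cases "\<exists>i\<in>Z. z \<in> S i")
    case True
    then obtain i where i: "i \<in> Z" "z \<in> S i" by blast
    have "z \<notin> S k" if "k \<in> Z - {i}" for k
      using that i dj by (auto simp: disjoint_family_on_def)
    then have "(\<Sum>k\<in>Z - {i}. M * a k * indicator (S k) z) = 0" by (intro sum.neutral) (auto simp: indicator_def)
    then have "F z \<le> M * a i" using b[of z] sum.remove[OF Z i(1), of "\<lambda>k. M * a k * indicator (S k) z"] i by simp
    then show ?thesis using i by blast
  next
    case False
    then have "(\<Sum>i\<in>Z. M * a i * indicator (S i) z) = 0" by (intro sum.neutral) (auto simp: indicator_def)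
    then show ?thesis using b[of z] F(2)[of z] by simp
  qed
  have "Lp_finite p F \<and> Lp_norm p F \<le> M * Y powr recip p"
  proof (cases "p = \<infinity>")
    case True
    have "F z \<le> M" for z
      using cases[of z] M inf[OF True] mult_left_mono[OF _ M, of _ 1] by force
    then have "Lp_finite \<infinity> F" "Lp_norm \<infinity> F \<le> M" using Lp_infty_of_bound[OF F(1), of M] M by auto
    then show ?thesis using Y unfolding True recip_top by simp
  next
    case False
    define P where "P = enn2real p"
    have P: "P \<ge> 1" using enn2real_ge_1[OF p False] by (simp add: P_def)
    have "(\<integral>\<^sup>+z. ennreal (F z powr P) \<partial>dV) \<le> (\<integral>\<^sup>+z. (\<Sum>i\<in>Z. ennreal (M powr P) * (ennreal (a i powr P) * indicator (S i) z)) \<partial>dV)"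
    proof (intro nn_integral_mono)
      fix z
      show "ennreal (F z powr P) \<le> (\<Sum>i\<in>Z. ennreal (M powr P) * (ennreal (a i powr P) * indicator (S i) z))"
      proof (cases "F z = 0")
        case nz: False
        then obtain i where i: "i \<in> Z" "z \<in> S i" "F z \<le> M * a i" using cases[of z] by blast
        have "F z powr P \<le> (M * a i) powr P" using F i P by (intro powr_mono2) auto
        also have "\<dots> = M powr P * a i powr P" by (rule powr_mult)
        finally have "ennreal (F z powr P) \<le> ennreal (M powr P) * (ennreal (a i powr P) * indicator (S i) z)"
          using i by (simp add: ennreal_leI flip: ennreal_mult)
        also have "\<dots> \<le> (\<Sum>i\<in>Z. ennreal (M powr P) * (ennreal (a i powr P) * indicator (S i) z))"
          by (rule member_le_sum[OF i(1)]) (use Z in auto)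
        finally show ?thesis .
      qed (use P in simp)
    qed
    also have "\<dots> = (\<Sum>i\<in>Z. ennreal (M powr P) * (ennreal (a i powr P) * emeasure dV (S i)))"
      using S by (simp add: nn_integral_sum nn_integral_cmult)
    also have "\<dots> = ennreal (M powr P) * (\<Sum>i\<in>Z. ennreal (a i powr P) * emeasure dV (S i))" by (simp add: sum_distrib_left)
    also have "\<dots> \<le> ennreal (M powr P) * ennreal Y" using fin[OF False] by (intro mult_left_mono) (auto simp: P_def)
    also have "\<dots> = ennreal ((M * Y powr recip p) powr P)"
      using recip_eq[OF p False] P Y by (simp add: powr_mult powr_powr P_def flip: ennreal_mult)
    finally show ?thesis using Lp_of_bound[OF p False, of F "M * Y powr recip p"] M by (simp add: P_def)
  qed
  then show "Lp_finite p F" "Lp_norm p F \<le> M * Y powr recip p" by auto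
qed

text \<open>Flipping the signs of all terms but one and adding isolates that term.\<close>

lemma sum_signs_ge:
  fixes x :: "'i \<Rightarrow> complex"
  assumes Z: "finite Z" and i: "i \<in> Z" and q: "q \<ge> 0"
  shows "2 ^ card Z * norm (x i) powr q \<le> 2 * (\<Sum>T\<in>Pow Z. norm (\<Sum>k\<in>Z. (if k \<in> T then - 1 else 1) * x k) powr q)"
proof -
  define u where "u T = (\<Sum>k\<in>Z. (if k \<in> T then - 1 else 1) * x k)" for T
  \<comment> \<open>Symmetric difference with Z - {i}, an involution of the sign patterns.\<close>
  define \<phi> where "\<phi> T = (T - (Z - {i})) \<union> ((Z - {i}) - T)" for T
  have bij: "bij_betw \<phi> (Pow Z) (Pow Z)"
    by (rule bij_betw_byWitness[where f'=\<phi>]) (use i in \<open>auto simp: \<phi>_def\<close>)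
  have "norm (x i) powr q \<le> norm (u T) powr q + norm (u (\<phi> T)) powr q" for T
  proof -
    have "u T + u (\<phi> T) = (\<Sum>k\<in>Z. ((if k \<in> T then - 1 else 1) + (if k \<in> \<phi> T then - 1 else 1)) * x k)"
      unfolding u_def by (simp add: sum.distrib[symmetric] distrib_right)
    also have "\<dots> = ((if i \<in> T then - 1 else 1) + (if i \<in> \<phi> T then - 1 else 1)) * x i"
      unfolding sum.remove[OF Z i] by (subst sum.neutral) (auto simp: \<phi>_def)
    also have "\<dots> = (if i \<in> T then - 2 else 2) * x i" by (auto simp: \<phi>_def)
    finally have "norm (u T + u (\<phi> T)) = 2 * norm (x i)" by (simp add: norm_mult)
    then have "2 * norm (x i) \<le> norm (u T) + norm (u (\<phi> T))" by (metis norm_triangle_ineq)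
    then have "norm (x i) \<le> norm (u T) \<or> norm (x i) \<le> norm (u (\<phi> T))" by linarith
    then have "norm (x i) powr q \<le> norm (u T) powr q \<or> norm (x i) powr q \<le> norm (u (\<phi> T)) powr q"
      using q by (auto intro: powr_mono2)
    then show ?thesis by (smt (verit) powr_ge_zero)
  qed
  then have "(\<Sum>T\<in>Pow Z. norm (x i) powr q) \<le> (\<Sum>T\<in>Pow Z. norm (u T) powr q + norm (u (\<phi> T)) powr q)"
    by (intro sum_mono)
  also have "\<dots> = (\<Sum>T\<in>Pow Z. norm (u T) powr q) + (\<Sum>T\<in>Pow Z. norm (u (\<phi> T)) powr q)" by (rule sum.distrib)
  also have "(\<Sum>T\<in>Pow Z. norm (u (\<phi> T)) powr q) = (\<Sum>T\<in>Pow Z. norm (u T) powr q)"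
    by (rule sum.reindex_bij_betw[OF bij])
  finally show ?thesis using Z by (simp add: card_Pow u_def)
qed

text \<open>Greedy choice: as long as the balls of radius d about the chosen points have total
  volume below that of S, they do not cover S and a further point is free.\<close>

lemma separated_set_exists:
  fixes S :: "(complex ^ 'n::finite) set"
  assumes S: "S \<in> sets lebesgue" and d: "d > 0" and V: "ennreal V \<le> emeasure dV S" and N: "real N * d ^ (2 * CARD('n)) \<le> V"
  shows "\<exists>Z\<subseteq>S. finite Z \<and> card Z = N \<and> (\<forall>x\<in>Z. \<forall>y\<in>Z. x \<noteq> y \<longrightarrow> d \<le> norm (x - y))"
  using N
proof (induction N)
  case 0
  show ?case by (intro exI[of _ "{}"]) auto
next
  case (Suc N)
  have dp: "d ^ (2 * CARD('n)) > 0" using d by simp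
  have lt: "real N * d ^ (2 * CARD('n)) < V" using Suc.prems dp by (simp add: algebra_simps)
  then obtain Z where Z: "Z \<subseteq> S" "finite Z" "card Z = N" "\<forall>x\<in>Z. \<forall>y\<in>Z. x \<noteq> y \<longrightarrow> d \<le> norm (x - y)"
    using Suc.IH by auto
  have "\<not> S \<subseteq> (\<Union>x\<in>Z. ball x d)"
  proof
    assume "S \<subseteq> (\<Union>x\<in>Z. ball x d)"
    then have "emeasure dV S \<le> emeasure dV (\<Union>x\<in>Z. ball x d)" by (rule emeasure_mono) (use Z in auto)
    also have "\<dots> \<le> (\<Sum>x\<in>Z. emeasure dV (ball x d))" using Z by (intro emeasure_subadditive_finite) auto
    also have "\<dots> = (\<Sum>x\<in>Z. ennreal (d ^ (2 * CARD('n))))"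
      using d by (intro sum.cong refl emeasure_dV_ball) simp
    also have "\<dots> = ennreal (real N * d ^ (2 * CARD('n)))"
      using Z dp by (simp add: ennreal_mult ennreal_of_nat_eq_real_of_nat)
    also have "\<dots> < ennreal V" using lt d by (intro ennreal_lessI) (auto intro: le_less_trans[rotated])
    finally show False using V by simp
  qed
  then obtain y where y: "y \<in> S" "\<And>x. x \<in> Z \<Longrightarrow> d \<le> norm (x - y)" by (force simp: dist_norm)
  have "y \<notin> Z" using y(2)[of y] d by auto
  show ?case
  proof (intro exI[of _ "insert y Z"] conjI)
    show "card (insert y Z) = Suc N" using Z \<open>y \<notin> Z\<close> by simp
    show "\<forall>x\<in>insert y Z. \<forall>z\<in>insert y Z. x \<noteq> z \<longrightarrow> d \<le> norm (x - z)"
      using Z(4) y(2) by (auto simp: norm_minus_commute)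
  qed (use Z y in auto)
qed

lemma power_superadditive:
  fixes u v :: real
  assumes "u \<ge> 0" "v \<ge> 0" "m \<ge> 1"
  shows "u ^ m + v ^ m \<le> (u + v) ^ m"
  using assms(3)
proof (induction m rule: dec_induct)
  case (step m)
  have "u ^ Suc m + v ^ Suc m \<le> u * (u ^ m + v ^ m) + v * (u ^ m + v ^ m)"
    using assms by (simp add: algebra_simps)
  also have "\<dots> = (u + v) * (u ^ m + v ^ m)" by (simp add: algebra_simps)
  also have "\<dots> \<le> (u + v) * (u + v) ^ m" using assms step by (intro mult_left_mono) auto
  finally show ?case by simp
qed simp

text \<open>The volumes of the two balls differ enough by (2r - 1)^m \<ge> r^m + (r - 1)^m. The
  radii are shifted by 1 because shells are measured in 1 + |z|.\<close>

lemma emeasure_shell: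
  fixes r :: real
  assumes r: "r \<ge> 1"
  shows "ennreal (r ^ (2 * CARD('n::finite))) \<le> emeasure dV (ball (0 :: complex ^ 'n) (2 * r - 1) - ball 0 (r - 1))"
proof -
  let ?m = "2 * CARD('n)"
  let ?B = "ball (0 :: complex ^ 'n)"
  have "ennreal (r ^ ?m + (r - 1) ^ ?m) \<le> ennreal ((2 * r - 1) ^ ?m)"
    using power_superadditive[of r "r - 1" ?m] r card_ge_1[where 'n='n] by (intro ennreal_leI) (simp add: algebra_simps)
  also have "\<dots> = emeasure dV (?B (2 * r - 1))" using r by (intro emeasure_dV_ball[symmetric]) simp
  also have "\<dots> \<le> emeasure dV ((?B (2 * r - 1) - ?B (r - 1)) \<union> ?B (r - 1))" by (intro emeasure_mono) auto
  also have "\<dots> \<le> emeasure dV (?B (2 * r - 1) - ?B (r - 1)) + emeasure dV (?B (r - 1))"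
    by (intro emeasure_subadditive) auto
  also have "emeasure dV (?B (r - 1)) = ennreal ((r - 1) ^ ?m)" using r by (intro emeasure_dV_ball) simp
  finally have "ennreal (r ^ ?m) + ennreal ((r - 1) ^ ?m) \<le> emeasure dV (?B (2 * r - 1) - ?B (r - 1)) + ennreal ((r - 1) ^ ?m)"
    using r by simp
  then show ?thesis
    unfolding add.commute[of _ "ennreal ((r - 1) ^ ?m)"] ennreal_add_left_cancel_le by simp
qed

text \<open>Takes the place of Khinchine's inequality. On B i only the i-th term has to be recovered
  from the signed sums, which \<open>sum_signs_ge\<close> does at the cost of a factor 2. As the
  sets B i are disjoint, these local estimates add up to one integral over the whole space for each
  sign pattern.\<close>

lemma sign_averaging:
  fixes F :: "'i \<Rightarrow> complex ^ 'n::finite \<Rightarrow> complex"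
  assumes l: "l \<ge> 1" and \<alpha>: "\<alpha> > 0" and q: "q \<ge> 1" "q \<noteq> \<infinity>" and C: "C \<ge> 0" and G: "G \<ge> 0"
    and K: "\<And>f :: complex ^ 'n \<Rightarrow> complex. f \<in> L_space p l \<beta> \<rho> \<Longrightarrow> (\<forall>z. integrable dV (bergman_integrand l \<alpha> f z)) \<and>
        bergman_projection l \<alpha> f \<in> L_space q l \<gamma> \<eta> \<and> L_norm q l \<gamma> \<eta> (bergman_projection l \<alpha> f) \<le> C * L_norm p l \<beta> \<rho> f"
    and Z: "finite Z" and F: "\<And>i. i \<in> Z \<Longrightarrow> F i \<in> L_space p l \<beta> \<rho>"
    and FT: "\<And>T. (\<lambda>w. \<Sum>i\<in>Z. (if i \<in> T then - 1 else 1) * F i w) \<in> L_space p l \<beta> \<rho>"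
      "\<And>T. L_norm p l \<beta> \<rho> (\<lambda>w. \<Sum>i\<in>Z. (if i \<in> T then - 1 else 1) * F i w) \<le> G"
    and B: "disjoint_family_on B Z" "\<And>i. i \<in> Z \<Longrightarrow> B i \<in> sets lebesgue"
  shows "(\<Sum>i\<in>Z. \<integral>\<^sup>+z. ennreal (indicator (B i) z * (norm (bergman_projection l \<alpha> (F i) z) * wt l \<gamma> \<eta> z) powr enn2real q) \<partial>dV)
    \<le> ennreal (2 * (C * G) powr enn2real q)"
proof -
  define Q where "Q = enn2real q"
  have Q: "Q \<ge> 1" using enn2real_ge_1[OF q] by (simp add: Q_def)
  define fT where "fT T = (\<lambda>w. \<Sum>i\<in>Z. (if i \<in> T then - 1 else 1) * F i w)" for T
  define h where "h i z = norm (bergman_projection l \<alpha> (F i) z) * wt l \<gamma> \<eta> z" for i z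
  define H where "H T z = norm (bergman_projection l \<alpha> (fT T) z) * wt l \<gamma> \<eta> z" for T z
  have Pm: "bergman_projection l \<alpha> f \<in> borel_measurable lebesgue" if "f \<in> L_space p l \<beta> \<rho>" for f :: "complex ^ 'n \<Rightarrow> complex"
    using K[OF that] by (simp add: L_space_iff)
  have hm [measurable]: "i \<in> Z \<Longrightarrow> h i \<in> borel_measurable lebesgue" for i
    unfolding h_def[abs_def] by (intro weight_measurable_dV Pm F)
  have Hm [measurable]: "H T \<in> borel_measurable lebesgue" for T
    unfolding H_def[abs_def] fT_def by (intro weight_measurable_dV Pm FT)
  note B(2)[measurable]
  have lin: "bergman_projection l \<alpha> (fT T) z = (\<Sum>i\<in>Z. (if i \<in> T then - 1 else 1) * bergman_projection l \<alpha> (F i) z)" for T z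
  proof -
    have "bergman_integrand l \<alpha> (fT T) z = (\<lambda>w. \<Sum>i\<in>Z. (if i \<in> T then - 1 else 1) * bergman_integrand l \<alpha> (F i) z w)"
      by (rule ext) (simp add: bergman_integrand_def fT_def sum_distrib_right mult.assoc)
    moreover have "integrable dV (\<lambda>w. (if i \<in> T then - 1 else 1) * bergman_integrand l \<alpha> (F i) z w)" if "i \<in> Z" for i
      using K[OF F[OF that]] by (intro integrable_mult_right) blast
    ultimately show ?thesis
      unfolding bergman_projection_def by (simp add: Bochner_Integration.integral_sum)
  qed
  have pt: "2 ^ card Z * h i z powr Q \<le> 2 * (\<Sum>T\<in>Pow Z. H T z powr Q)" if "i \<in> Z" for i z
  proof -
    define W where "W = wt l \<gamma> \<eta> z powr Q"
    have W: "W \<ge> 0" by (simp add: W_def)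
    have "2 ^ card Z * norm (bergman_projection l \<alpha> (F i) z) powr Q \<le> 2 * (\<Sum>T\<in>Pow Z. norm (bergman_projection l \<alpha> (fT T) z) powr Q)"
      unfolding lin using Q by (intro sum_signs_ge Z that) auto
    from mult_right_mono[OF this W] show ?thesis
      unfolding h_def H_def by (simp add: powr_mult W_def sum_distrib_right mult.assoc)
  qed
  define N :: real where "N = 2 ^ card Z"
  have N: "N > 0" by (simp add: N_def)
  \<comment> \<open>By disjointness the estimate is not multiplied by the number of terms.\<close>
  have dj: "(\<Sum>i\<in>Z. indicator (B i) z) \<le> (1 :: ennreal)" for z
  proof -
    have "(\<Sum>i\<in>Z. indicator (B i) z) = (indicator (\<Union>i\<in>Z. B i) z :: ennreal)"
      by (rule indicator_UN_disjoint[OF Z B(1), symmetric])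
    then show ?thesis by (simp add: indicator_def)
  qed
  have HT: "(\<integral>\<^sup>+z. ennreal (H T z powr Q) \<partial>dV) \<le> ennreal ((C * G) powr Q)" for T
  proof -
    have T: "fT T \<in> L_space p l \<beta> \<rho>" "L_norm p l \<beta> \<rho> (fT T) \<le> G" unfolding fT_def by (rule FT)+
    have f: "Lp_finite q (H T)" using K[OF T(1)] by (simp add: L_space_iff H_def[abs_def])
    have "Lp_norm q (H T) \<le> C * L_norm p l \<beta> \<rho> (fT T)" using K[OF T(1)] by (simp add: L_norm_eq H_def[abs_def])
    also have "\<dots> \<le> C * G" using T C by (intro mult_left_mono)
    finally have "Lp_norm q (H T) powr Q \<le> (C * G) powr Q" using Q by (intro powr_mono2) (auto simp: Lp_norm_nonneg)
    then show ?thesis using Lp_integral[OF q f] by (simp add: Q_def ennreal_leI)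
  qed
  have "ennreal N * (\<Sum>i\<in>Z. \<integral>\<^sup>+z. ennreal (indicator (B i) z * h i z powr Q) \<partial>dV)
    = (\<integral>\<^sup>+z. (\<Sum>i\<in>Z. ennreal N * ennreal (indicator (B i) z * h i z powr Q)) \<partial>dV)"
  proof (subst nn_integral_sum)
    show "(\<lambda>z. ennreal N * ennreal (indicator (B i) z * h i z powr Q)) \<in> borel_measurable dV" if "i \<in> Z" for i
      using that by simp
    show "ennreal N * (\<Sum>i\<in>Z. \<integral>\<^sup>+z. ennreal (indicator (B i) z * h i z powr Q) \<partial>dV)
      = (\<Sum>i\<in>Z. \<integral>\<^sup>+z. ennreal N * ennreal (indicator (B i) z * h i z powr Q) \<partial>dV)"
      unfolding sum_distrib_left by (intro sum.cong refl nn_integral_cmult[symmetric]) simp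
  qed
  also have "\<dots> \<le> (\<integral>\<^sup>+z. (\<Sum>T\<in>Pow Z. 2 * ennreal (H T z powr Q)) \<partial>dV)"
  proof (intro nn_integral_mono)
    fix z
    define X where "X = 2 * (\<Sum>T\<in>Pow Z. H T z powr Q)"
    have "ennreal N * ennreal (indicator (B i) z * h i z powr Q) \<le> indicator (B i) z * ennreal X" if "i \<in> Z" for i
    proof -
      have "N * (indicator (B i) z * h i z powr Q) \<le> indicator (B i) z * X"
        using pt[OF that, of z] by (simp add: N_def X_def indicator_def)
      then have "ennreal N * ennreal (indicator (B i) z * h i z powr Q) \<le> ennreal (indicator (B i) z * X)"
        using N by (simp add: ennreal_leI flip: ennreal_mult)
      then show ?thesis by (auto simp: indicator_def)
    qed
    then have "(\<Sum>i\<in>Z. ennreal N * ennreal (indicator (B i) z * h i z powr Q)) \<le> (\<Sum>i\<in>Z. indicator (B i) z) * ennreal X"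
      unfolding sum_distrib_right by (rule sum_mono)
    also have "\<dots> \<le> 1 * ennreal X" by (intro mult_right_mono dj) simp
    also have "\<dots> = (\<Sum>T\<in>Pow Z. 2 * ennreal (H T z powr Q))"
      by (simp add: X_def sum_distrib_left ennreal_mult flip: sum_ennreal)
    finally show "(\<Sum>i\<in>Z. ennreal N * ennreal (indicator (B i) z * h i z powr Q)) \<le> (\<Sum>T\<in>Pow Z. 2 * ennreal (H T z powr Q))" .
  qed
  also have "\<dots> = (\<Sum>T\<in>Pow Z. 2 * (\<integral>\<^sup>+z. ennreal (H T z powr Q) \<partial>dV))"
    by (simp add: nn_integral_sum nn_integral_cmult)
  also have "\<dots> \<le> (\<Sum>T\<in>Pow Z. 2 * ennreal ((C * G) powr Q))" by (intro sum_mono mult_left_mono HT) simp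
  also have "\<dots> = ennreal N * ennreal (2 * (C * G) powr Q)"
    using Z by (simp add: card_Pow N_def ennreal_mult ennreal_power[symmetric] flip: ennreal_numeral)
  finally have *: "ennreal N * (\<Sum>i\<in>Z. \<integral>\<^sup>+z. ennreal (indicator (B i) z * h i z powr Q) \<partial>dV) \<le> ennreal N * ennreal (2 * (C * G) powr Q)" .
  have NN: "ennreal (1 / N) * ennreal N = 1" using N by (simp flip: ennreal_mult)
  have "ennreal (1 / N) * (ennreal N * X) = X" for X by (simp add: mult.assoc[symmetric] NN)
  then show ?thesis using mult_left_mono[OF *, of "ennreal (1 / N)"] by (simp add: h_def Q_def)
qed

text \<open>
  The tubes around points of the shell \<open>r \<le> 1 + |\<zeta>| \<le> 2 r\<close> have radius about \<open>r powr (1 - l)\<close>,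
  so that about \<open>r powr (2 n l)\<close> disjoint ones fit in.
\<close>

lemma disjoint_tubes:
  fixes l A :: real
  assumes l: "l \<ge> 1" and A: "A > 0"
  obtains r :: "nat \<Rightarrow> real" and Z :: "nat \<Rightarrow> (complex ^ 'n::finite) set" and D :: real where
    "D > 0" "\<And>j. r j > 1" "\<And>j. finite (Z j)" "\<And>j \<zeta>. \<zeta> \<in> Z j \<Longrightarrow> \<zeta> \<noteq> 0 \<and> r j \<le> 1 + norm \<zeta> \<and> 1 + norm \<zeta> \<le> 2 * r j"
    "\<And>j. real (card (Z j)) \<le> r j powr (2 * real CARD('n) * l) / D"
    "\<And>j. r j powr (2 * real CARD('n) * l) / D \<le> 2 * real (card (Z j))"
    "\<And>i j \<zeta> \<xi>. \<zeta> \<in> Z i \<Longrightarrow> \<xi> \<in> Z j \<Longrightarrow> (i, \<zeta>) \<noteq> (j, \<xi>) \<Longrightarrow> tube l A \<zeta> \<inter> tube l A \<xi> = {}"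
proof -
  let ?m = "2 * real CARD('n)"
  \<comment> \<open>A shell spans a factor 2 while consecutive radii grow by the factor 4, and every
    radius is at least X. So points of different shells are at least 2 A apart, and no tube has a
    radius above A.\<close>
  define X where "X = 2 * A + 2"
  define r where "r j = X * 4 ^ j" for j :: nat
  have rX: "r j \<ge> X" for j using A by (simp add: r_def X_def)
  have r1: "r j > 1" for j using rX[of j] A by (simp add: X_def)
  define D where "D = (2 * A) powr ?m"
  have D: "D > 0" using A by (simp add: D_def)
  \<comment> \<open>The number of points for which \<open>separated_set_exists\<close> still finds
    room. The quotient is at least 1 since r j \<ge> 2 A, so rounding down loses at most a factor
    2.\<close>
  define N where "N j = nat \<lfloor>r j powr (?m * l) / D\<rfloor>" for j
  have big: "r j powr (?m * l) / D \<ge> 1" for j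
  proof -
    have "2 * A \<le> r j powr 1" using rX[of j] A r1[of j] by (simp add: X_def)
    also have "\<dots> \<le> r j powr l" using r1[of j] l by (intro powr_mono) auto
    finally have "(2 * A) powr ?m \<le> (r j powr l) powr ?m" using A by (intro powr_mono2) auto
    then show ?thesis using D by (simp add: D_def powr_powr mult.commute)
  qed
  have N1: "real (N j) \<le> r j powr (?m * l) / D" for j using big[of j] by (simp add: N_def)
  have N2: "r j powr (?m * l) / D \<le> 2 * real (N j)" for j
  proof -
    have "\<lfloor>r j powr (?m * l) / D\<rfloor> \<ge> 1" using big[of j] by (simp add: le_floor_iff)
    then have "real (N j) = real_of_int \<lfloor>r j powr (?m * l) / D\<rfloor>" "real (N j) \<ge> 1" by (auto simp: N_def)
    then show ?thesis by linarith
  qed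
  \<comment> \<open>An upper bound for the radii of the tubes centred in shell j; centres at
    distance 2 \<delta> have disjoint tubes.\<close>
  define \<delta> where "\<delta> j = A * r j powr (1 - l)" for j
  have \<delta>: "\<delta> j > 0" "\<delta> j \<le> A" for j
  proof -
    show "\<delta> j > 0" using A r1[of j] by (simp add: \<delta>_def)
    have "r j powr (1 - l) \<le> r j powr 0" using r1[of j] l by (intro powr_mono) auto
    then show "\<delta> j \<le> A" using A r1[of j] by (simp add: \<delta>_def)
  qed
  let ?S = "\<lambda>j. ball (0 :: complex ^ 'n) (2 * r j - 1) - ball 0 (r j - 1)"
  have "\<exists>Z\<subseteq>?S j. finite Z \<and> card Z = N j \<and> (\<forall>x\<in>Z. \<forall>y\<in>Z. x \<noteq> y \<longrightarrow> 2 * \<delta> j \<le> norm (x - y))" for j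
  proof (rule separated_set_exists)
    show "2 * \<delta> j > 0" using \<delta>(1)[of j] by simp
    show "ennreal (r j ^ (2 * CARD('n))) \<le> emeasure dV (?S j)" using r1[of j] by (intro emeasure_shell) simp
    have "(2 * \<delta> j) ^ (2 * CARD('n)) = (2 * \<delta> j) powr ?m" using powr_realpow[of "2 * \<delta> j" "2 * CARD('n)"] \<delta>(1)[of j] by simp
    also have "\<dots> = D * r j powr (?m * (1 - l))"
    proof -
      have "2 * \<delta> j = (2 * A) * r j powr (1 - l)" by (simp add: \<delta>_def)
      then show ?thesis unfolding D_def by (simp only: powr_mult powr_powr mult.commute[of "1 - l"])
    qed
    finally have e: "(2 * \<delta> j) ^ (2 * CARD('n)) = D * r j powr (?m * (1 - l))" .
    have "real (N j) * (2 * \<delta> j) ^ (2 * CARD('n)) \<le> r j powr (?m * l) / D * (D * r j powr (?m * (1 - l)))"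
      unfolding e using D by (intro mult_right_mono N1) auto
    also have "\<dots> = r j powr (?m * l) * r j powr (?m * (1 - l))" using D by simp
    also have "\<dots> = r j powr ?m" by (simp add: powr_add[symmetric] algebra_simps)
    also have "\<dots> = r j ^ (2 * CARD('n))" using powr_realpow[of "r j" "2 * CARD('n)"] r1[of j] by simp
    finally show "real (N j) * (2 * \<delta> j) ^ (2 * CARD('n)) \<le> r j ^ (2 * CARD('n))" .
  qed simp
  then obtain Z where Z: "\<And>j. Z j \<subseteq> ?S j" "\<And>j. finite (Z j)" "\<And>j. card (Z j) = N j"
    "\<And>j x y. x \<in> Z j \<Longrightarrow> y \<in> Z j \<Longrightarrow> x \<noteq> y \<Longrightarrow> 2 * \<delta> j \<le> norm (x - y)"
    by metis
  have sh: "r j \<le> 1 + norm \<zeta> \<and> 1 + norm \<zeta> \<le> 2 * r j" if "\<zeta> \<in> Z j" for j \<zeta>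
    using Z(1)[of j] that by (auto simp: dist_norm not_less)
  have rad: "norm (w - \<zeta>) < \<delta> j" if "\<zeta> \<in> Z j" "w \<in> tube l A \<zeta>" for j \<zeta> w
  proof -
    have rp: "r j powr (l - 1) > 0" using r1[of j] by simp
    have "r j powr (l - 1) * norm (w - \<zeta>) \<le> (1 + norm \<zeta>) powr (l - 1) * norm (w - \<zeta>)"
      using sh[OF that(1)] r1[of j] l by (intro mult_right_mono powr_mono2) auto
    also have "\<dots> < A" using that(2) by (simp add: tube_def)
    finally have "norm (w - \<zeta>) < A / r j powr (l - 1)" using rp by (simp add: pos_less_divide_eq mult.commute)
    then show ?thesis using powr_minus_divide[of "r j" "l - 1"] by (simp add: \<delta>_def)
  qed
  have sep': "2 * A \<le> norm (\<zeta> - \<xi>)" if "\<zeta> \<in> Z i" "\<xi> \<in> Z j" "i < j" for i j \<zeta> \<xi>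
  proof -
    have "(4::real) ^ Suc i \<le> 4 ^ j" using that by (intro power_increasing) auto
    then have "4 * r i \<le> r j" using A mult_left_mono[of "4 ^ Suc i" "4 ^ j" X] by (simp add: r_def X_def mult_ac)
    moreover have "norm \<xi> \<le> norm \<zeta> + norm (\<zeta> - \<xi>)" by (metis norm_triangle_sub norm_minus_commute)
    ultimately show ?thesis using sh[OF that(1)] sh[OF that(2)] rX[of i] by (simp add: X_def)
  qed
  have sep: "\<delta> i + \<delta> j \<le> norm (\<zeta> - \<xi>)" if "\<zeta> \<in> Z i" "\<xi> \<in> Z j" "(i, \<zeta>) \<noteq> (j, \<xi>)" for i j \<zeta> \<xi>
  proof (cases i j rule: linorder_cases)
    case less
    then show ?thesis using sep'[OF that(1,2)] \<delta>(2)[of i] \<delta>(2)[of j] by linarith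
  next
    case equal
    then show ?thesis using Z(4)[of \<zeta> i \<xi>] that by simp
  next
    case greater
    then show ?thesis using sep'[OF that(2,1)] \<delta>(2)[of i] \<delta>(2)[of j] by (simp add: norm_minus_commute)
  qed
  show ?thesis
  proof (rule that[of D r Z, OF D r1 Z(2)])
    show "\<zeta> \<noteq> 0 \<and> r j \<le> 1 + norm \<zeta> \<and> 1 + norm \<zeta> \<le> 2 * r j" if "\<zeta> \<in> Z j" for j \<zeta>
      using sh[OF that] r1[of j] by auto
    show "real (card (Z j)) \<le> r j powr (?m * l) / D" "r j powr (?m * l) / D \<le> 2 * real (card (Z j))" for j
      using N1[of j] N2[of j] by (simp_all add: Z(3))
    show "tube l A \<zeta> \<inter> tube l A \<xi> = {}" if "\<zeta> \<in> Z i" "\<xi> \<in> Z j" "(i, \<zeta>) \<noteq> (j, \<xi>)" for i j \<zeta> \<xi>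
    proof (rule ccontr)
      assume "tube l A \<zeta> \<inter> tube l A \<xi> \<noteq> {}"
      then obtain w where w: "w \<in> tube l A \<zeta>" "w \<in> tube l A \<xi>" by blast
      have "norm (\<zeta> - \<xi>) \<le> norm (w - \<zeta>) + norm (w - \<xi>)"
        using norm_triangle_ineq4[of "w - \<xi>" "w - \<zeta>"] by (simp add: algebra_simps)
      then show False using sep[OF that] rad[OF that(1) w(1)] rad[OF that(2) w(2)] by linarith
    qed
  qed
qed

section \<open>Growth comparison for the test functions\<close>

lemma maps_boundedly_bound:
  assumes "maps_boundedly TYPE('n::finite) l \<alpha> p \<beta> \<rho> q \<gamma> \<eta>"
  obtains C where "C \<ge> 0" "\<And>f :: complex ^ 'n \<Rightarrow> complex. f \<in> L_space p l \<beta> \<rho> \<Longrightarrow> (\<forall>z. integrable dV (bergman_integrand l \<alpha> f z)) \<and>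
        bergman_projection l \<alpha> f \<in> L_space q l \<gamma> \<eta> \<and> L_norm q l \<gamma> \<eta> (bergman_projection l \<alpha> f) \<le> C * L_norm p l \<beta> \<rho> f"
proof -
  obtain C where C: "\<And>f :: complex ^ 'n \<Rightarrow> complex. f \<in> L_space p l \<beta> \<rho> \<Longrightarrow> (\<forall>z. integrable dV (bergman_integrand l \<alpha> f z)) \<and>
        bergman_projection l \<alpha> f \<in> L_space q l \<gamma> \<eta> \<and> L_norm q l \<gamma> \<eta> (bergman_projection l \<alpha> f) \<le> C * L_norm p l \<beta> \<rho> f"
    using assms unfolding maps_boundedly_def by blast
  have "C * L_norm p l \<beta> \<rho> f \<le> \<bar>C\<bar> * L_norm p l \<beta> \<rho> f" for f :: "complex ^ 'n \<Rightarrow> complex"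
    by (intro mult_right_mono) (auto simp: L_norm_eq Lp_norm_nonneg)
  then show ?thesis using C that[of "\<bar>C\<bar>"] by (meson abs_ge_zero order_trans)
qed

text \<open>A test function with 1 + |\<zeta>| = N lives on a tube of volume about N^(-s). Hoelder's
  inequality on that tube compares N^(\<eta>-\<rho>-s) with N^(-s(1-1/q)-s/p) for all N. The
  conclusion is valid for every pair p, q, and \<open>maps_boundedly_gap\<close> uses it in this
  generality.\<close>

lemma sharp_exponent_le:
  fixes l \<alpha> \<beta> \<rho> \<eta> :: real
  assumes l: "l \<ge> 1" and \<alpha>: "\<alpha> > 0" and \<beta>: "\<beta> < 2 * \<alpha>" and p: "p \<ge> 1" and q: "q \<ge> 1"
    and bd: "maps_boundedly TYPE('n::finite) l \<alpha> p \<beta> \<rho> q (\<alpha>\<^sup>2 / (2 * \<alpha> - \<beta>)) \<eta>"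
  shows "\<rho> - \<eta> \<ge> 2 * real CARD('n) * (l - 1) * (recip p - recip q)"
proof -
  let ?m = "2 * real CARD('n)"
  define s where "s = ?m * (l - 1)"
  define g where "g = \<alpha>\<^sup>2 / (2 * \<alpha> - \<beta>)"
  define a where "a = g powr (1 / (2 * l))"
  define b where "b = (2 * \<alpha> - \<beta>) powr (1 / (2 * l))"
  have ab: "a > 0" "b > 0" using \<alpha> \<beta> by (simp_all add: a_def b_def g_def)
  obtain A c M where AcM: "A > 0" "c > 0" "M > 0"
    and F: "\<And>(\<zeta> :: complex ^ 'n) w. norm (test_fun l \<beta> \<rho> b A \<zeta> w) * wt l \<beta> \<rho> w \<le> M * indicator {w. b *\<^sub>R w \<in> tube l A \<zeta>} w"
    and PF: "\<And>\<zeta> :: complex ^ 'n. \<zeta> \<noteq> 0 \<Longrightarrow> ennreal (c * (1 + norm \<zeta>) powr (\<eta> - \<rho> - s)) \<le>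
       (\<integral>\<^sup>+z. ennreal (indicator {z. a *\<^sub>R z \<in> tube l A \<zeta>} z * (norm (bergman_projection l \<alpha> (test_fun l \<beta> \<rho> b A \<zeta>) z) * wt l g \<eta> z)) \<partial>dV)"
    using bergman_test_fun[OF l \<alpha> \<beta>, where 'n='n] unfolding s_def g_def a_def b_def by blast
  obtain K where K: "K \<ge> 0" "\<And>f :: complex ^ 'n \<Rightarrow> complex. f \<in> L_space p l \<beta> \<rho> \<Longrightarrow> (\<forall>z. integrable dV (bergman_integrand l \<alpha> f z)) \<and>
        bergman_projection l \<alpha> f \<in> L_space q l g \<eta> \<and> L_norm q l g \<eta> (bergman_projection l \<alpha> f) \<le> K * L_norm p l \<beta> \<rho> f"
    using maps_boundedly_bound[OF bd] unfolding g_def by blast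
  define v where "v e R = (A / e) powr ?m * R powr (- s)" for e R :: real
  have v0: "v e R > 0" if "e > 0" "R > 0" for e R using that AcM by (simp add: v_def)
  define B where "B = ((A / a) powr ?m) powr (1 - recip q) * (K * (M * ((A / b) powr ?m) powr recip p)) / c"
  have "\<eta> - \<rho> + s * (recip p - recip q) \<le> 0"
  proof (rule exponent_nonpos_of_bounded)
    fix N :: nat assume N: "N \<ge> 2"
    obtain \<zeta> :: "complex ^ 'n" where \<zeta>: "norm \<zeta> = real N - 1" using vector_choose_size[of "real N - 1"] N by auto
    have nz: "\<zeta> \<noteq> 0" using \<zeta> N by auto
    have RN: "1 + norm \<zeta> = real N" by (simp add: \<zeta>)
    have R0: "real N > 0" using N by simp
    define f where "f = test_fun l \<beta> \<rho> b A \<zeta>"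
    have fm: "f \<in> borel_measurable lebesgue" unfolding f_def by (rule measurable_completion) (simp add: test_fun_measurable[OF l])
    let ?Sa = "{z. a *\<^sub>R z \<in> tube l A \<zeta>}" and ?Sb = "{z. b *\<^sub>R z \<in> tube l A \<zeta>}"
    have Sm: "?Sa \<in> sets lebesgue" "?Sb \<in> sets lebesgue" unfolding tube_preimage[OF ab(1)] tube_preimage[OF ab(2)] by simp_all
    have ea: "emeasure dV ?Sa = ennreal (v a (real N))" "emeasure dV ?Sb = ennreal (v b (real N))"
      using emeasure_tube[OF ab(1) AcM(1), of l \<zeta>] emeasure_tube[OF ab(2) AcM(1), of l \<zeta>] RN by (simp_all add: v_def s_def)
    have fL: "Lp_finite p (\<lambda>w. norm (f w) * wt l \<beta> \<rho> w)" "Lp_norm p (\<lambda>w. norm (f w) * wt l \<beta> \<rho> w) \<le> M * v b (real N) powr recip p"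
    proof -
      have nn: "norm (f w) * wt l \<beta> \<rho> w \<ge> 0" for w using wt_pos[of l \<beta> \<rho> w] by simp
      have le: "norm (f w) * wt l \<beta> \<rho> w \<le> (\<Sum>i\<in>{()}. M * 1 * indicator ?Sb w)" for w using F[of \<zeta> w] by (simp add: f_def)
      have M0: "M \<ge> 0" using AcM by simp
      note * = Lp_disjoint_sum[where Z="{()}" and S="\<lambda>_. ?Sb" and a="\<lambda>_. 1", OF p weight_measurable_dV[OF fm] nn _ Sm(2) _ _ M0 v0[OF ab(2) R0] le]
      show "Lp_finite p (\<lambda>w. norm (f w) * wt l \<beta> \<rho> w)" by (rule *(1)) (simp_all add: disjoint_family_on_def ea)
      show "Lp_norm p (\<lambda>w. norm (f w) * wt l \<beta> \<rho> w) \<le> M * v b (real N) powr recip p" by (rule *(2)) (simp_all add: disjoint_family_on_def ea)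
    qed
    have fS: "f \<in> L_space p l \<beta> \<rho>" using fL fm by (simp add: L_space_iff)
    define h where "h z = norm (bergman_projection l \<alpha> f z) * wt l g \<eta> z" for z
    have h: "Lp_finite q h" "h \<in> borel_measurable lebesgue" "Lp_norm q h \<le> K * L_norm p l \<beta> \<rho> f"
      using K(2)[OF fS] weight_measurable_dV[of "bergman_projection l \<alpha> f" l g \<eta>] by (auto simp: L_space_iff L_norm_eq h_def[abs_def])
    have hb: "Lp_norm q h \<le> K * (M * v b (real N) powr recip p)"
      using h(3) mult_left_mono[OF fL(2) K(1)] by (simp add: L_norm_eq)
    have "ennreal (c * real N powr (\<eta> - \<rho> - s)) \<le> (\<integral>\<^sup>+z. ennreal (indicator ?Sa z * h z) \<partial>dV)"
      using PF[OF nz] by (simp add: h_def f_def RN)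
    also have "\<dots> \<le> ennreal (v a (real N) powr (1 - recip q) * Lp_norm q h)"
    proof (rule set_integral_le_Lp[OF q h(2) _ Sm(1) ea(1) v0[OF ab(1) R0] h(1)])
      show "h z \<ge> 0" for z using wt_pos[of l g \<eta> z] by (simp add: h_def)
    qed
    also have "\<dots> \<le> ennreal (v a (real N) powr (1 - recip q) * (K * (M * v b (real N) powr recip p)))"
      using hb by (intro ennreal_leI mult_left_mono) auto
    finally have "c * real N powr (\<eta> - \<rho> - s) \<le> v a (real N) powr (1 - recip q) * (K * (M * v b (real N) powr recip p))"
      using K AcM by (simp add: ennreal_le_iff)
    also have "\<dots> = c * (B * real N powr (- s * (1 - recip q) - s * recip p))"
    proof -
      have vp: "v e (real N) powr t = ((A / e) powr ?m) powr t * real N powr (- s * t)" for e t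
        by (simp only: v_def powr_mult powr_powr)
      have "- s * (1 - recip q) - s * recip p = - s * (1 - recip q) + - s * recip p" by simp
      then have "real N powr (- s * (1 - recip q) - s * recip p) = real N powr (- s * (1 - recip q)) * real N powr (- s * recip p)"
        by (simp only: powr_add)
      then show ?thesis unfolding vp B_def using AcM by simp
    qed
    finally have "real N powr (\<eta> - \<rho> - s) \<le> B * real N powr (- s * (1 - recip q) - s * recip p)" using AcM by simp
    then have "real N powr (\<eta> - \<rho> - s) * real N powr (s * (1 - recip q) + s * recip p)
        \<le> B * real N powr (- s * (1 - recip q) - s * recip p) * real N powr (s * (1 - recip q) + s * recip p)"
      by (intro mult_right_mono) auto
    then have "real N powr (\<eta> - \<rho> - s + (s * (1 - recip q) + s * recip p)) \<le> B * real N powr 0"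
      unfolding mult.assoc powr_add[symmetric] by simp
    then show "real N powr (\<eta> - \<rho> + s * (recip p - recip q)) \<le> B" using R0 by (simp add: algebra_simps)
  qed
  then show ?thesis by (simp add: s_def)
qed

lemma powr_comparable:
  fixes r R t :: real
  assumes "0 < r" "r \<le> R" "R \<le> 2 * r"
  shows "2 powr (- \<bar>t\<bar>) * r powr t \<le> R powr t"
proof (cases "t \<ge> 0")
  case True
  have "2 powr (- \<bar>t\<bar>) * r powr t \<le> 2 powr 0 * r powr t" by (intro mult_right_mono powr_mono) auto
  also have "\<dots> \<le> R powr t" using assms True by (simp add: powr_mono2)
  finally show ?thesis .
next
  case False
  then have "2 powr (- \<bar>t\<bar>) * r powr t = (2 * r) powr t" by (simp add: powr_mult)
  also have "\<dots> \<le> R powr t" using assms False by (intro powr_mono2') auto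
  finally show ?thesis .
qed

text \<open>The shells are normalized to contribute equally. For finite p each adds at most Y to the
  p-th power of the norm of a signed sum, up to a constant; if the condition fails, each adds at
  least k to the q-th powers of the projections. Hence J k is bounded by a constant times J^(q/p)
  for all J, with q/p read as 0 for p = \<infinity>, which is impossible for q < p.\<close>

lemma sharp_exponent_less:
  fixes l \<alpha> \<beta> \<rho> \<eta> :: real
  assumes l: "l \<ge> 1" and \<alpha>: "\<alpha> > 0" and \<beta>: "\<beta> < 2 * \<alpha>" and p: "p \<ge> 1" and q: "q \<ge> 1" and qp: "q < p"
    and bd: "maps_boundedly TYPE('n::finite) l \<alpha> p \<beta> \<rho> q (\<alpha>\<^sup>2 / (2 * \<alpha> - \<beta>)) \<eta>"
  shows "\<rho> - \<eta> > 2 * real CARD('n) * (recip q - recip p)"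
proof (rule ccontr)
  let ?m = "2 * real CARD('n)"
  assume "\<not> \<rho> - \<eta> > ?m * (recip q - recip p)"
  then have le: "\<rho> - \<eta> \<le> ?m * (recip q - recip p)" by simp
  define s where "s = ?m * (l - 1)"
  define g where "g = \<alpha>\<^sup>2 / (2 * \<alpha> - \<beta>)"
  define a where "a = g powr (1 / (2 * l))"
  define b where "b = (2 * \<alpha> - \<beta>) powr (1 / (2 * l))"
  have ab: "a > 0" "b > 0" using \<alpha> \<beta> by (simp_all add: a_def b_def g_def)
  obtain A c M where AcM: "A > 0" "c > 0" "M > 0"
    and F: "\<And>(\<zeta> :: complex ^ 'n) w. norm (test_fun l \<beta> \<rho> b A \<zeta> w) * wt l \<beta> \<rho> w \<le> M * indicator {w. b *\<^sub>R w \<in> tube l A \<zeta>} w"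
    and PF: "\<And>\<zeta> :: complex ^ 'n. \<zeta> \<noteq> 0 \<Longrightarrow> ennreal (c * (1 + norm \<zeta>) powr (\<eta> - \<rho> - s)) \<le>
       (\<integral>\<^sup>+z. ennreal (indicator {z. a *\<^sub>R z \<in> tube l A \<zeta>} z * (norm (bergman_projection l \<alpha> (test_fun l \<beta> \<rho> b A \<zeta>) z) * wt l g \<eta> z)) \<partial>dV)"
    using bergman_test_fun[OF l \<alpha> \<beta>, where 'n='n] unfolding s_def g_def a_def b_def by blast
  obtain K where K: "K \<ge> 0" "\<And>f :: complex ^ 'n \<Rightarrow> complex. f \<in> L_space p l \<beta> \<rho> \<Longrightarrow> (\<forall>z. integrable dV (bergman_integrand l \<alpha> f z)) \<and>
        bergman_projection l \<alpha> f \<in> L_space q l g \<eta> \<and> L_norm q l g \<eta> (bergman_projection l \<alpha> f) \<le> K * L_norm p l \<beta> \<rho> f"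
    using maps_boundedly_bound[OF bd] unfolding g_def by blast
  have qf: "q \<noteq> \<infinity>" using qp by auto
  define Q where "Q = enn2real q"
  have Q: "Q \<ge> 1" using enn2real_ge_1[OF q qf] by (simp add: Q_def)
  have rq: "recip q = 1 / Q" using recip_eq[OF q qf] by (simp add: Q_def)
  have rp0: "recip p \<ge> 0" by (simp add: recip_def)
  have lt: "Q * recip p < 1"
  proof (cases "p = \<infinity>")
    case True
    show ?thesis unfolding True recip_top by simp
  next
    case False
    then have "Q < enn2real p" using qp qf unfolding Q_def by (simp add: enn2real_less_iff less_top)
    then show ?thesis using recip_eq[OF p False] Q by simp
  qed
  obtain r :: "nat \<Rightarrow> real" and Z :: "nat \<Rightarrow> (complex ^ 'n) set" and D where D: "D > 0" and r1: "\<And>j. r j > 1"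
    and Zf: "\<And>j. finite (Z j)" and Zs: "\<And>j \<zeta>. \<zeta> \<in> Z j \<Longrightarrow> \<zeta> \<noteq> 0 \<and> r j \<le> 1 + norm \<zeta> \<and> 1 + norm \<zeta> \<le> 2 * r j"
    and Zc: "\<And>j. real (card (Z j)) \<le> r j powr (?m * l) / D" "\<And>j. r j powr (?m * l) / D \<le> 2 * real (card (Z j))"
    and Zd: "\<And>i j \<zeta> \<xi>. \<zeta> \<in> Z i \<Longrightarrow> \<xi> \<in> Z j \<Longrightarrow> (i, \<zeta>) \<noteq> (j, \<xi>) \<Longrightarrow> tube l A \<zeta> \<inter> tube l A \<xi> = {}"
    by (rule disjoint_tubes[OF l AcM(1), where 'n='n]) blast
  \<comment> \<open>A shell has about r^(2nl) tubes of volume about r^(-s), in total r^(2n); this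
    factor removes that power from the p-th power of the norm.\<close>
  define u where "u j = r j powr (- (?m * recip p))" for j
  have u: "u j > 0" "u j \<le> 1" for j
  proof -
    show "u j > 0" using r1[of j] by (simp add: u_def)
    have "u j \<le> r j powr 0" unfolding u_def using r1[of j] rp0 by (intro powr_mono) auto
    then show "u j \<le> 1" using r1[of j] by simp
  qed
  define S where "S e i = {z. e *\<^sub>R z \<in> tube l A (snd i)}" for e and i :: "nat \<times> (complex ^ 'n)"
  have Sm: "S e i \<in> sets lebesgue" if "e > 0" for e i unfolding S_def tube_preimage[OF that] by simp
  define v where "v e R = (A / e) powr ?m * R powr (- s)" for e R :: real
  have v0: "v e R > 0" if "e > 0" "R > 0" for e R using that AcM by (simp add: v_def)
  have eS: "emeasure dV (S e i) = ennreal (v e (1 + norm (snd i)))" if "e > 0" for e i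
    using emeasure_tube[OF that AcM(1), of l "snd i"] by (simp add: v_def s_def S_def)
  define F' where "F' i w = of_real (u (fst i)) * test_fun l \<beta> \<rho> b A (snd i) w" for i :: "nat \<times> (complex ^ 'n)" and w
  have tm [measurable]: "test_fun l \<beta> \<rho> b A \<zeta> \<in> borel_measurable lebesgue" for \<zeta> :: "complex ^ 'n"
    by (rule measurable_completion) (simp add: test_fun_measurable[OF l])
  define I where "I J = (SIGMA j:{..<J}. Z j)" for J :: nat
  have If: "finite (I J)" for J using Zf by (simp add: I_def)
  have Idj: "disjoint_family_on (S e) (I J)" for e J
    using Zd by (fastforce simp: disjoint_family_on_def S_def I_def)
  have sumI: "(\<Sum>i\<in>I J. \<phi> (fst i)) = (\<Sum>j<J. real (card (Z j)) * \<phi> j)" for J and \<phi> :: "nat \<Rightarrow> real"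
    using sum.Sigma[of "{..<J}" Z "\<lambda>j _. \<phi> j"] Zf by (simp add: I_def case_prod_unfold)
  define Y where "Y = (A / b) powr ?m / D"
  have Y: "Y > 0" using AcM ab D by (simp add: Y_def)
  \<comment> \<open>The exponent of 1 + |\<zeta>| in the lower bound for the q-th power over one
    tube: (\<eta> - \<rho> - s) Q from the test function and - s (1 - Q) from the volume in
    \<open>jensen_set\<close>.\<close>
  define e where "e = Q * (\<eta> - \<rho>) - s"
  define k where "k = c powr Q * ((A / a) powr ?m) powr (1 - Q) * 2 powr (- \<bar>e\<bar>) / (2 * D)"
  have k: "k > 0" using AcM ab D by (simp add: k_def)
  have upper: "real J * k \<le> 2 * (K * (M * (real J * Y) powr recip p)) powr Q" if J: "J \<ge> 1" for J
  proof -
    have norms: "Lp_finite p (\<lambda>w. norm (\<Sum>i\<in>I'. \<epsilon> i * F' i w) * wt l \<beta> \<rho> w)"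
      "Lp_norm p (\<lambda>w. norm (\<Sum>i\<in>I'. \<epsilon> i * F' i w) * wt l \<beta> \<rho> w) \<le> M * (real J * Y) powr recip p"
      "(\<lambda>w. \<Sum>i\<in>I'. \<epsilon> i * F' i w) \<in> borel_measurable lebesgue"
      if I': "I' \<subseteq> I J" and \<epsilon>: "\<And>i. norm (\<epsilon> i :: complex) = 1" for \<epsilon> I'
    proof -
      have fI': "finite I'" using I' If[of J] by (rule finite_subset)
      show fm: "(\<lambda>w. \<Sum>i\<in>I'. \<epsilon> i * F' i w) \<in> borel_measurable lebesgue" unfolding F'_def by measurable
      have bound: "norm (\<Sum>i\<in>I'. \<epsilon> i * F' i w) * wt l \<beta> \<rho> w \<le> (\<Sum>i\<in>I'. M * u (fst i) * indicator (S b i) w)" for w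
      proof -
        have "norm (\<Sum>i\<in>I'. \<epsilon> i * F' i w) * wt l \<beta> \<rho> w \<le> (\<Sum>i\<in>I'. norm (\<epsilon> i * F' i w)) * wt l \<beta> \<rho> w"
          using wt_pos[of l \<beta> \<rho> w] by (intro mult_right_mono norm_sum) simp
        also have "\<dots> = (\<Sum>i\<in>I'. u (fst i) * (norm (test_fun l \<beta> \<rho> b A (snd i) w) * wt l \<beta> \<rho> w))"
          using u(1) by (simp add: sum_distrib_right norm_mult \<epsilon> F'_def less_imp_le mult.assoc)
        also have "\<dots> \<le> (\<Sum>i\<in>I'. u (fst i) * (M * indicator (S b i) w))"
          unfolding S_def using u(1) by (intro sum_mono mult_left_mono F) (simp add: less_imp_le)
        finally show ?thesis by (simp add: mult_ac)
      qed
      have vol: "(\<Sum>i\<in>I'. ennreal (u (fst i) powr enn2real p) * emeasure dV (S b i)) \<le> ennreal (real J * Y)" if pf: "p \<noteq> \<infinity>"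
      proof -
        have P: "enn2real p \<ge> 1" by (rule enn2real_ge_1[OF p pf])
        have "(\<Sum>i\<in>I'. ennreal (u (fst i) powr enn2real p) * emeasure dV (S b i)) \<le> (\<Sum>i\<in>I J. ennreal (u (fst i) powr enn2real p) * emeasure dV (S b i))"
          using I' If[of J] by (intro sum_mono2) auto
        also have "\<dots> \<le> (\<Sum>i\<in>I J. ennreal (r (fst i) powr (- ?m) * ((A / b) powr ?m * r (fst i) powr (- s))))"
        proof (intro sum_mono)
          fix i assume "i \<in> I J"
          then have i: "snd i \<in> Z (fst i)" by (auto simp: I_def)
          have "u (fst i) powr enn2real p = r (fst i) powr (- ?m)" using recip_eq[OF p pf] P by (simp add: u_def powr_powr)
          moreover have "v b (1 + norm (snd i)) \<le> (A / b) powr ?m * r (fst i) powr (- s)"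
            unfolding v_def using Zs[OF i] r1[of "fst i"] l by (intro mult_left_mono powr_mono2') (auto simp: s_def)
          ultimately show "ennreal (u (fst i) powr enn2real p) * emeasure dV (S b i) \<le> ennreal (r (fst i) powr (- ?m) * ((A / b) powr ?m * r (fst i) powr (- s)))"
            unfolding eS[OF ab(2)]
by (simp add: ennreal_mult'[symmetric] ennreal_leI mult_left_mono del: ennreal_mult ennreal_mult'')
        qed
        also have "\<dots> = ennreal (\<Sum>i\<in>I J. r (fst i) powr (- ?m) * ((A / b) powr ?m * r (fst i) powr (- s)))"
          by (rule sum_ennreal) simp
        also have "\<dots> \<le> ennreal (real J * Y)"
        proof (intro ennreal_leI)
          have "(\<Sum>i\<in>I J. r (fst i) powr (- ?m) * ((A / b) powr ?m * r (fst i) powr (- s)))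
            = (\<Sum>j<J. real (card (Z j)) * (r j powr (- ?m) * ((A / b) powr ?m * r j powr (- s))))"
            by (rule sumI)
          also have "\<dots> \<le> (\<Sum>j<J. Y)"
          proof (intro sum_mono)
            fix j
            have "real (card (Z j)) * (r j powr (- ?m) * ((A / b) powr ?m * r j powr (- s))) \<le> r j powr (?m * l) / D * (r j powr (- ?m) * ((A / b) powr ?m * r j powr (- s)))"
              by (intro mult_right_mono Zc) auto
            also have "\<dots> = (r j powr (?m * l) * r j powr (- ?m) * r j powr (- s)) * Y" by (simp add: Y_def)
            also have "r j powr (?m * l) * r j powr (- ?m) * r j powr (- s) = 1"
              using r1[of j] by (simp add: s_def algebra_simps flip: powr_add)
            finally show "real (card (Z j)) * (r j powr (- ?m) * ((A / b) powr ?m * r j powr (- s))) \<le> Y" by simp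
          qed
          finally show "(\<Sum>i\<in>I J. r (fst i) powr (- ?m) * ((A / b) powr ?m * r (fst i) powr (- s))) \<le> real J * Y" by simp
        qed
        finally show ?thesis .
      qed
      have dj: "disjoint_family_on (S b) I'" by (rule disjoint_family_on_mono[OF I' Idj])
      have nn: "norm (\<Sum>i\<in>I'. \<epsilon> i * F' i w) * wt l \<beta> \<rho> w \<ge> 0" for w using wt_pos[of l \<beta> \<rho> w] by simp
      have JY: "real J * Y > 0" using J Y by simp
      have M0: "M \<ge> 0" using AcM by simp
      note * = Lp_disjoint_sum[where a="\<lambda>i. u (fst i)", OF p weight_measurable_dV[OF fm] nn fI' Sm[OF ab(2)] dj u(1) M0 JY bound vol u(2)]
      show "Lp_finite p (\<lambda>w. norm (\<Sum>i\<in>I'. \<epsilon> i * F' i w) * wt l \<beta> \<rho> w)" by (rule *(1))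
      show "Lp_norm p (\<lambda>w. norm (\<Sum>i\<in>I'. \<epsilon> i * F' i w) * wt l \<beta> \<rho> w) \<le> M * (real J * Y) powr recip p" by (rule *(2))
    qed
    have FT: "(\<lambda>w. \<Sum>i\<in>I J. (if i \<in> T then - 1 else 1) * F' i w) \<in> L_space p l \<beta> \<rho>"
      "L_norm p l \<beta> \<rho> (\<lambda>w. \<Sum>i\<in>I J. (if i \<in> T then - 1 else 1) * F' i w) \<le> M * (real J * Y) powr recip p" for T
      unfolding L_space_iff L_norm_eq using norms[of "I J" "\<lambda>i. if i \<in> T then - 1 else 1"] by simp_all
    have F1: "F' i \<in> L_space p l \<beta> \<rho>" if "i \<in> I J" for i
      unfolding L_space_iff using norms[of "{i}" "\<lambda>_. 1"] that by simp
    have Bm: "S a i \<in> sets lebesgue" for i by (rule Sm[OF ab(1)])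
    have low: "ennreal (r (fst i) powr (- (?m * l)) * (2 * D * k))
      \<le> (\<integral>\<^sup>+z. ennreal (indicator (S a i) z * (norm (bergman_projection l \<alpha> (F' i) z) * wt l g \<eta> z) powr Q) \<partial>dV)" if i: "i \<in> I J" for i
    proof -
      let ?R = "1 + norm (snd i)" and ?r = "r (fst i)"
      have iZ: "snd i \<in> Z (fst i)" using i by (auto simp: I_def)
      have R: "?R > 0" by (simp add: add_pos_nonneg)
      define h where "h z = norm (bergman_projection l \<alpha> (F' i) z) * wt l g \<eta> z" for z
      have hm [measurable]: "h \<in> borel_measurable lebesgue"
        unfolding h_def[abs_def] using K(2)[OF F1[OF i]] by (intro weight_measurable_dV) (simp add: L_space_iff)
      define h0 where "h0 z = norm (bergman_projection l \<alpha> (test_fun l \<beta> \<rho> b A (snd i)) z) * wt l g \<eta> z" for z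
      have hh: "h z = u (fst i) * h0 z" for z
      proof -
        have "bergman_integrand l \<alpha> (F' i) z = (\<lambda>w. of_real (u (fst i)) * bergman_integrand l \<alpha> (test_fun l \<beta> \<rho> b A (snd i)) z w)"
          by (rule ext) (simp add: bergman_integrand_def F'_def mult.assoc)
        then have "bergman_projection l \<alpha> (F' i) z = of_real (u (fst i)) * bergman_projection l \<alpha> (test_fun l \<beta> \<rho> b A (snd i)) z"
          unfolding bergman_projection_def by (simp only: integral_mult_right_zero)
        then show ?thesis using u(1)[of "fst i"] by (simp add: h_def h0_def norm_mult)
      qed
      have h00: "h0 z \<ge> 0" for z using wt_pos[of l g \<eta> z] by (simp add: h0_def)
      have [measurable]: "h0 \<in> borel_measurable lebesgue"
      proof -
        have "h0 = (\<lambda>z. h z / u (fst i))" using u(1)[of "fst i"] by (auto simp: hh)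
        then show ?thesis by simp
      qed
      define x where "x = c * ?R powr (\<eta> - \<rho> - s)"
      have x: "x \<ge> 0" using AcM by (simp add: x_def)
      have "ennreal (x powr Q * v a ?R powr (1 - Q)) \<le> (\<integral>\<^sup>+z. ennreal (indicator (S a i) z * h0 z powr Q) \<partial>dV)"
      proof (rule jensen_set[OF Q _ h00 Bm eS[OF ab(1)] v0[OF ab(1) R] _ x])
        show "ennreal x \<le> (\<integral>\<^sup>+z. ennreal (indicator (S a i) z * h0 z) \<partial>dV)"
          using PF[of "snd i"] Zs[OF iZ] by (simp add: x_def h0_def S_def)
      qed simp
      then have "ennreal (u (fst i) powr Q) * ennreal (x powr Q * v a ?R powr (1 - Q)) \<le> ennreal (u (fst i) powr Q) * (\<integral>\<^sup>+z. ennreal (indicator (S a i) z * h0 z powr Q) \<partial>dV)"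
        by (intro mult_left_mono) auto
      also have "\<dots> = (\<integral>\<^sup>+z. ennreal (indicator (S a i) z * h z powr Q) \<partial>dV)"
        using Bm by (subst nn_integral_cmult[symmetric]) (simp_all add: hh powr_mult mult_ac flip: ennreal_mult)
      finally have 1: "ennreal (u (fst i) powr Q * (x powr Q * v a ?R powr (1 - Q))) \<le> (\<integral>\<^sup>+z. ennreal (indicator (S a i) z * h z powr Q) \<partial>dV)"
        by (simp add: ennreal_mult)
      have "x powr Q * v a ?R powr (1 - Q) = c powr Q * ((A / a) powr ?m) powr (1 - Q) * (?R powr ((\<eta> - \<rho> - s) * Q) * ?R powr (- s * (1 - Q)))"
        unfolding x_def v_def by (simp only: powr_mult powr_powr mult_ac)
      also have "?R powr ((\<eta> - \<rho> - s) * Q) * ?R powr (- s * (1 - Q)) = ?R powr e"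
        by (simp add: e_def algebra_simps flip: powr_add)
      finally have 2: "x powr Q * v a ?R powr (1 - Q) = c powr Q * ((A / a) powr ?m) powr (1 - Q) * ?R powr e" .
      have "c powr Q * ((A / a) powr ?m) powr (1 - Q) * (2 powr (- \<bar>e\<bar>) * ?r powr e) \<le> c powr Q * ((A / a) powr ?m) powr (1 - Q) * ?R powr e"
        using Zs[OF iZ] r1[of "fst i"] by (intro mult_left_mono powr_comparable) auto
      then have 3: "2 * D * k * ?r powr e \<le> x powr Q * v a ?R powr (1 - Q)" unfolding 2 k_def using D by (simp add: mult_ac)
      \<comment> \<open>Here the negated condition enters: each tube yields at least about r^(-2nl),
        the reciprocal of the number of tubes in its shell.\<close>
      have "- (?m * l) \<le> e - ?m * recip p * Q"
      proof -
        have "Q * (\<rho> - \<eta>) \<le> Q * (?m * (1 / Q - recip p))" using le Q unfolding rq by (intro mult_left_mono) auto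
        also have "\<dots> = ?m - ?m * recip p * Q" using Q by (simp add: field_simps)
        finally show ?thesis by (simp add: e_def s_def algebra_simps)
      qed
      then have "?r powr (- (?m * l)) \<le> ?r powr (e - ?m * recip p * Q)" using r1[of "fst i"] by (intro powr_mono) auto
      also have "\<dots> = u (fst i) powr Q * ?r powr e" by (simp add: u_def powr_powr powr_add[symmetric] algebra_simps)
      finally have "?r powr (- (?m * l)) * (2 * D * k) \<le> u (fst i) powr Q * ?r powr e * (2 * D * k)"
        using D k by (intro mult_right_mono) auto
      also have "\<dots> = u (fst i) powr Q * (2 * D * k * ?r powr e)" by (simp only: mult_ac)
      also have "\<dots> \<le> u (fst i) powr Q * (x powr Q * v a ?R powr (1 - Q))" by (intro mult_left_mono 3) auto
      finally show ?thesis using 1 unfolding h_def[symmetric] by (meson ennreal_leI order_trans)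
    qed
    have "ennreal (real J * k) \<le> ennreal (\<Sum>i\<in>I J. r (fst i) powr (- (?m * l)) * (2 * D * k))"
    proof (intro ennreal_leI)
      have "real J * k = (\<Sum>j<J. k)" by simp
      also have "\<dots> \<le> (\<Sum>j<J. real (card (Z j)) * (r j powr (- (?m * l)) * (2 * D * k)))"
      proof (intro sum_mono)
        fix j
        have "k = (r j powr (?m * l) / D) * (r j powr (- (?m * l)) * (D * k))"
          using D r1[of j] by (simp add: powr_minus)
        also have "\<dots> \<le> (2 * real (card (Z j))) * (r j powr (- (?m * l)) * (D * k))"
          using D k by (intro mult_right_mono Zc) auto
        finally show "k \<le> real (card (Z j)) * (r j powr (- (?m * l)) * (2 * D * k))" by (simp add: mult_ac)
      qed
      also have "\<dots> = (\<Sum>i\<in>I J. r (fst i) powr (- (?m * l)) * (2 * D * k))"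
        by (rule sumI[symmetric])
      finally show "real J * k \<le> (\<Sum>i\<in>I J. r (fst i) powr (- (?m * l)) * (2 * D * k))" .
    qed
    also have "\<dots> = (\<Sum>i\<in>I J. ennreal (r (fst i) powr (- (?m * l)) * (2 * D * k)))"
      using D k by (intro sum_ennreal[symmetric]) simp
    also have "\<dots> \<le> (\<Sum>i\<in>I J. \<integral>\<^sup>+z. ennreal (indicator (S a i) z * (norm (bergman_projection l \<alpha> (F' i) z) * wt l g \<eta> z) powr Q) \<partial>dV)"
      by (intro sum_mono low)
    also have "\<dots> \<le> ennreal (2 * (K * (M * (real J * Y) powr recip p)) powr Q)"
      unfolding Q_def using AcM by (intro sign_averaging[OF l \<alpha> q qf K(1) _ K(2) If F1 FT Idj Bm]) auto
    finally show ?thesis by (simp add: ennreal_le_iff)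
  qed
  have "1 - Q * recip p \<le> 0"
  proof (rule exponent_nonpos_of_bounded)
    fix J :: nat assume J: "J \<ge> 2"
    have "real J * k \<le> 2 * (K * (M * (real J * Y) powr recip p)) powr Q" using upper[of J] J by simp
    also have "\<dots> = (2 * (K * (M * Y powr recip p)) powr Q) * real J powr (Q * recip p)"
      by (simp add: powr_mult powr_powr mult_ac)
    finally have "real J \<le> (2 * (K * (M * Y powr recip p)) powr Q) / k * real J powr (Q * recip p)"
      using k by (simp add: field_simps)
    then have "real J / real J powr (Q * recip p) \<le> (2 * (K * (M * Y powr recip p)) powr Q) / k"
      using J by (simp add: pos_divide_le_eq)
    then show "real J powr (1 - Q * recip p) \<le> (2 * (K * (M * Y powr recip p)) powr Q) / k"
      using J by (simp add: powr_diff)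
  qed
  then show False using lt by simp
qed

lemma maps_boundedly_gap:
  assumes l: "l \<ge> 1" and \<alpha>: "\<alpha> > 0" and \<beta>: "\<beta> < 2 * \<alpha>" and p: "p \<ge> 1" and q: "q \<ge> 1"
    and bd: "maps_boundedly TYPE('n::finite) l \<alpha> p \<beta> \<rho> q \<gamma> \<eta>"
  shows "\<alpha>\<^sup>2 / (2 * \<alpha> - \<beta>) \<le> \<gamma>"
proof (rule ccontr)
  assume "\<not> \<alpha>\<^sup>2 / (2 * \<alpha> - \<beta>) \<le> \<gamma>"
  then have lt: "\<gamma> < \<alpha>\<^sup>2 / (2 * \<alpha> - \<beta>)" by simp
  \<comment> \<open>One more than the largest exponent that \<open>sharp_exponent_le\<close>
    permits; the exponential gap gives boundedness even there.\<close>
  define \<eta>' where "\<eta>' = \<rho> - 2 * real CARD('n) * (l - 1) * (recip p - recip q) + 1"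
  obtain C where C: "C > 0" "\<And>z :: complex ^ 'n. wt l (\<alpha>\<^sup>2 / (2 * \<alpha> - \<beta>)) \<eta>' z \<le> C * wt l \<gamma> \<eta> z"
    using wt_exponential_gap[OF l lt, where 'n='n] by blast
  have "maps_boundedly TYPE('n) l \<alpha> p \<beta> \<rho> q (\<alpha>\<^sup>2 / (2 * \<alpha> - \<beta>)) \<eta>'"
    using maps_boundedly_mono[OF bd q _ C(2)] C(1) by simp
  from sharp_exponent_le[OF l \<alpha> \<beta> p q this] show False by (simp add: \<eta>'_def)
qed

section \<open>Divergence for \<open>\<beta> \<ge> 2\<alpha>\<close>\<close>

text \<open>Pairing with \<open>cinner w \<zeta> ^ N\<close> on a ball of radius L singles out the
  N-th Taylor coefficient and gives \<kappa> L^(2N+2n). If the integral were finite, the pairing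
  would be at most of order L^(2N): N powers of L from the monomial and N from undoing the weight.
  Large L is then contradictory.\<close>

lemma bH_weight_not_integrable:
  fixes \<zeta> :: "complex ^ 'n::finite"
  assumes l: "l \<ge> 1" and \<zeta>: "\<zeta> \<noteq> 0"
  shows "(\<integral>\<^sup>+w. ennreal (norm (bH CARD('n) l (cinner \<zeta> w)) * (1 + norm w) powr (- real N)) \<partial>dV) = \<infinity>"
proof (rule ccontr)
  let ?n = "CARD('n)"
  note n = card_ge_1[where 'n='n]
  note [measurable] = bH_measurable[OF n l] bHr_measurable[OF n l]
  let ?\<Phi> = "\<lambda>w :: complex ^ 'n. ennreal (norm (bH ?n l (cinner \<zeta> w)) * (1 + norm w) powr (- real N))"
  assume "(\<integral>\<^sup>+w. ?\<Phi> w \<partial>dV) \<noteq> \<infinity>"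
  then obtain I where I: "(\<integral>\<^sup>+w. ?\<Phi> w \<partial>dV) = ennreal I" "I \<ge> 0"
    by (cases "\<integral>\<^sup>+w. ?\<Phi> w \<partial>dV") auto
  have \<Phi>m: "?\<Phi> \<in> borel_measurable dV" by (intro borel_measurable_dV) measurable
  define \<kappa> where "\<kappa> = bh ?n l N * ball_moment \<zeta> N"
  have "ball_moment \<zeta> N > 0"
  proof -
    have "ball_moment \<zeta> N * fact (N + ?n) > 0" unfolding ball_moment_eq using \<zeta> by simp
    then show ?thesis by (simp add: zero_less_mult_iff)
  qed
  then have \<kappa>: "\<kappa> > 0" using bh_pos[OF n l, of N] by (simp add: \<kappa>_def)
  have "2 * real ?n \<le> 0"
  proof (rule exponent_nonpos_of_bounded)
    fix L' :: nat assume L': "L' \<ge> 2"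
    define L where "L = real L'"
    have L: "L \<ge> 2" using L' by (simp add: L_def)
    \<comment> \<open>A radial cut-off preserves the orthogonality of the powers and makes every
      integral finite.\<close>
    define g where "g x = (indicator {x. \<bar>x\<bar> < L} x :: real)" for x :: real
    have gm: "g \<in> borel_measurable borel" unfolding g_def[abs_def] by measurable
    have g0: "g x \<ge> 0" for x by (simp add: g_def)
    have gw: "g (norm w) = indicator (ball 0 L) w" for w :: "complex ^ 'n" by (simp add: g_def indicator_def)
    have dec: "integrable dV (\<lambda>w :: complex ^ 'n. u w * g (norm w))"
      if u: "u \<in> borel_measurable borel" and b: "\<And>w. norm w < L \<Longrightarrow> \<bar>u w\<bar> \<le> b" for u :: "complex ^ 'n \<Rightarrow> real" and b
    proof (rule integrable_polynomial_decay)
      show "(\<lambda>w. u w * g (norm w)) \<in> borel_measurable borel" using u gm by measurable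
      fix w :: "complex ^ 'n"
      have b0: "b \<ge> 0" using b[of 0] L by simp
      show "norm (u w * g (norm w)) \<le> (b * (1 + L) powr (2 * real ?n + 1)) * (1 + norm w) powr (- (2 * real ?n + 1))"
      proof (cases "norm w < L")
        case True
        have w1: "1 + norm w > 0" by (simp add: add_pos_nonneg)
        have "norm (u w * g (norm w)) \<le> b * 1" using b[OF True] True by (simp add: g_def)
        also have "1 = (1 + norm w) powr (2 * real ?n + 1) * (1 + norm w) powr (- (2 * real ?n + 1))"
          using w1 by (simp flip: powr_add)
        also have "b * \<dots> \<le> b * ((1 + L) powr (2 * real ?n + 1) * (1 + norm w) powr (- (2 * real ?n + 1)))"
          using b0 True by (intro mult_left_mono mult_right_mono powr_mono2) auto
        finally show ?thesis by (simp add: mult.assoc)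
      qed (use b0 in \<open>simp add: g_def\<close>)
    qed
    have mom: "(\<integral>w. norm (cinner w \<zeta>) ^ (2 * N) * g (norm w) \<partial>dV) = L powr (2 * (real N + real ?n)) * ball_moment \<zeta> N"
    proof -
      have "ball (0 :: complex ^ 'n) L \<in> sets borel" by simp
      then have "(\<lambda>w. norm (cinner w \<zeta>) ^ (2 * N) * indicator (ball 0 L) w :: real) \<in> borel_measurable borel" by measurable
      then show ?thesis
        using ball_moment_scale[of L \<zeta> N] L unfolding gw
        by (intro integral_eq_nn_integral[THEN trans] borel_measurable_dV) (auto simp: ball_moment_nonneg intro!: AE_I2)
    qed
    have "(\<integral>w. cinner w \<zeta> ^ N * bH ?n l (cinner \<zeta> w) * of_real (g (norm w)) \<partial>dV)
      = of_real (bh ?n l N) * (cinner \<zeta> \<zeta> / of_real ((norm \<zeta>)\<^sup>2)) ^ N * of_real (\<integral>w. norm (cinner w \<zeta>) ^ (2 * N) * g (norm w) \<partial>dV)"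
    proof (rule integral_bH_moment[OF l gm g0 \<zeta>])
      show "integrable dV (\<lambda>w :: complex ^ 'n. norm w ^ (2 * N) * g (norm w))"
        by (rule dec[where b="L ^ (2 * N)"]) (auto intro: power_mono)
      show "integrable dV (\<lambda>w :: complex ^ 'n. norm w ^ N * bHr ?n l (norm \<zeta> * norm w) * g (norm w))"
      proof (rule dec[where b="L ^ N * bHr ?n l (norm \<zeta> * L)"])
        fix w :: "complex ^ 'n" assume w: "norm w < L"
        have "norm w ^ N * bHr ?n l (norm \<zeta> * norm w) \<le> L ^ N * bHr ?n l (norm \<zeta> * L)"
          using w L by (intro mult_mono power_mono bHr_mono n l mult_left_mono bHr_nonneg) auto
        moreover have "norm w ^ N * bHr ?n l (norm \<zeta> * norm w) \<ge> 0" by (intro mult_nonneg_nonneg bHr_nonneg n l) auto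
        ultimately show "\<bar>norm w ^ N * bHr ?n l (norm \<zeta> * norm w)\<bar> \<le> L ^ N * bHr ?n l (norm \<zeta> * L)" by simp
      qed measurable
    qed
    also have "cinner \<zeta> \<zeta> / of_real ((norm \<zeta>)\<^sup>2) = 1" using \<zeta> by (simp add: cinner_self)
    finally have eq: "norm (\<integral>w. cinner w \<zeta> ^ N * bH ?n l (cinner \<zeta> w) * of_real (g (norm w)) \<partial>dV) = \<kappa> * L powr (2 * (real N + real ?n))"
      unfolding mom using \<kappa> by (simp add: \<kappa>_def norm_mult ball_moment_nonneg bh_nonneg[OF n l])
    define B where "B = (L * norm \<zeta>) ^ N * (1 + L) ^ N"
    have B: "B \<ge> 0" using L by (simp add: B_def)
    have "(\<integral>\<^sup>+w. ennreal (norm (cinner w \<zeta> ^ N * bH ?n l (cinner \<zeta> w) * of_real (g (norm w)))) \<partial>dV) \<le> (\<integral>\<^sup>+w. ennreal B * ?\<Phi> w \<partial>dV)"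
    proof (intro nn_integral_mono)
      fix w :: "complex ^ 'n"
      let ?h = "norm (bH ?n l (cinner \<zeta> w))"
      have "norm (cinner w \<zeta> ^ N * bH ?n l (cinner \<zeta> w) * of_real (g (norm w))) \<le> B * (?h * (1 + norm w) powr (- real N))"
      proof (cases "norm w < L")
        case True
        have w1: "1 + norm w > 0" by (simp add: add_pos_nonneg)
        have "norm (cinner w \<zeta>) ^ N \<le> (L * norm \<zeta>) ^ N"
          using True by (intro power_mono order_trans[OF norm_cinner_le] mult_right_mono) auto
        moreover have "1 \<le> (1 + L) ^ N * (1 + norm w) powr (- real N)"
        proof -
          have "1 = (1 + norm w) ^ N * (1 + norm w) powr (- real N)" using w1 by (simp add: powr_minus powr_realpow)
          also have "\<dots> \<le> (1 + L) ^ N * (1 + norm w) powr (- real N)" using True by (intro mult_right_mono power_mono) auto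
          finally show ?thesis .
        qed
        ultimately have "norm (cinner w \<zeta>) ^ N * 1 * ?h \<le> (L * norm \<zeta>) ^ N * ((1 + L) ^ N * (1 + norm w) powr (- real N)) * ?h"
          using L by (intro mult_mono) auto
        then show ?thesis using True by (simp add: B_def g_def norm_mult norm_power mult_ac)
      qed (use B in \<open>simp add: g_def\<close>)
      then show "ennreal (norm (cinner w \<zeta> ^ N * bH ?n l (cinner \<zeta> w) * of_real (g (norm w)))) \<le> ennreal B * ?\<Phi> w"
        using B by (simp add: ennreal_leI flip: ennreal_mult)
    qed
    also have "\<dots> = ennreal (B * I)" using \<Phi>m I B by (simp add: nn_integral_cmult ennreal_mult)
    finally have "\<kappa> * L powr (2 * (real N + real ?n)) \<le> B * I"
      unfolding eq[symmetric] using B I by (intro norm_integral_le) auto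
    also have "\<dots> \<le> ((L * norm \<zeta>) ^ N * (2 * L) ^ N) * I"
      unfolding B_def using L I by (intro mult_right_mono mult_left_mono power_mono) auto
    also have "\<dots> = (norm \<zeta> ^ N * 2 ^ N * I) * L powr (2 * real N)"
      using L by (simp add: power_mult_distrib powr_realpow[symmetric] powr_add[symmetric])
    also have "L powr (2 * (real N + real ?n)) = L powr (2 * real ?n) * L powr (2 * real N)"
      by (simp add: powr_add[symmetric] algebra_simps)
    finally have "\<kappa> * L powr (2 * real ?n) * L powr (2 * real N) \<le> (norm \<zeta> ^ N * 2 ^ N * I) * L powr (2 * real N)"
      by (simp only: mult.assoc)
    then have "\<kappa> * L powr (2 * real ?n) \<le> norm \<zeta> ^ N * 2 ^ N * I" using L by (simp only: mult_le_cancel_right) auto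
    then show "real L' powr (2 * real ?n) \<le> norm \<zeta> ^ N * 2 ^ N * I / \<kappa>"
      using \<kappa> by (simp add: L_def pos_le_divide_eq mult.commute)
  qed
  then show False using n by simp
qed

lemma maps_boundedly_exponent_less:
  fixes l \<alpha> \<beta> \<rho> :: real
  assumes l: "l \<ge> 1" and \<alpha>: "\<alpha> > 0" and p: "p \<ge> 1" and bd: "maps_boundedly TYPE('n::finite) l \<alpha> p \<beta> \<rho> q \<gamma> \<eta>"
  shows "\<beta> < 2 * \<alpha>"
proof (rule ccontr)
  let ?n = "CARD('n)"
  assume "\<not> \<beta> < 2 * \<alpha>"
  then have \<beta>: "2 * \<alpha> \<le> \<beta>" by simp
  note n = card_ge_1[where 'n='n]
  note [measurable] = bH_measurable[OF n l]
  \<comment> \<open>So large that the weighted modulus of f is integrable and at most 1; then f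
    belongs to the space for every p.\<close>
  define N where "N = nat \<lceil>\<rho> + 2 * real ?n + 1\<rceil>"
  have N: "\<rho> - real N \<le> - (2 * real ?n + 1)" unfolding N_def by linarith
  define f where "f w = complex_of_real (exp (\<beta> / 2 * norm w powr (2 * l)) * (1 + norm w) powr (- real N))" for w :: "complex ^ 'n"
  have fm [measurable]: "f \<in> borel_measurable borel" unfolding f_def[abs_def] by measurable
  have w1: "1 + norm w > 0" "1 + norm w \<ge> 1" for w :: "complex ^ 'n" by (simp_all add: add_pos_nonneg)
  define F where "F w = norm (f w) * wt l \<beta> \<rho> w" for w
  have F: "F w = (1 + norm w) powr (\<rho> - real N)" for w
  proof -
    have "F w = (exp (\<beta> / 2 * norm w powr (2 * l)) * exp (- (\<beta> / 2) * norm w powr (2 * l))) * ((1 + norm w) powr (- real N) * (1 + norm w) powr \<rho>)"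
      by (simp add: F_def f_def wt_def norm_mult mult_ac)
    also have "exp (\<beta> / 2 * norm w powr (2 * l)) * exp (- (\<beta> / 2) * norm w powr (2 * l)) = 1" by (simp flip: exp_add)
    finally show ?thesis by (simp flip: powr_add)
  qed
  have Fle: "F w \<le> (1 + norm w) powr (- (2 * real ?n + 1))" for w unfolding F using w1[of w] N by (intro powr_mono) auto
  have F0: "0 < F w" "F w \<le> 1" for w
  proof -
    show "0 < F w" unfolding F using w1(1)[of w] by simp
    have "F w \<le> (1 + norm w) powr 0" unfolding F using w1[of w] N by (intro powr_mono) auto
    then show "F w \<le> 1" using w1(1)[of w] by simp
  qed
  have "f \<in> L_space p l \<beta> \<rho>"
    unfolding L_space_iff F_def[symmetric]
  proof
    show "f \<in> borel_measurable lebesgue" by (rule measurable_completion) simp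
    show "Lp_finite p F"
    proof (cases "p = \<infinity>")
      case True
      have "F \<in> borel_measurable lebesgue" unfolding F_def[abs_def] by (rule measurable_completion) simp
      then show ?thesis unfolding True using F0 by (intro Lp_infty_of_bound(1)[where B=1]) auto
    next
      case False
      have P: "enn2real p \<ge> 1" by (rule enn2real_ge_1[OF p False])
      have "(\<integral>\<^sup>+w. ennreal (F w powr enn2real p) \<partial>dV) \<le> (\<integral>\<^sup>+w. ennreal ((1 + norm (w :: complex ^ 'n)) powr (- (2 * real ?n + 1))) \<partial>dV)"
      proof (intro nn_integral_mono ennreal_leI)
        fix w
        have "F w powr enn2real p \<le> F w powr 1" using P F0[of w] by (intro powr_mono') auto
        then show "F w powr enn2real p \<le> (1 + norm w) powr (- (2 * real ?n + 1))" using Fle[of w] F0[of w] by simp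
      qed
      also have "\<dots> < \<infinity>" by (rule nn_integral_polynomial_decay) simp
      finally show ?thesis using False by (simp add: Lp_finite_def)
    qed
  qed
  then have int: "integrable dV (bergman_integrand l \<alpha> f z)" for z using bd unfolding maps_boundedly_def by blast
  obtain \<zeta> :: "complex ^ 'n" where "norm \<zeta> = 1" using vector_choose_size[of 1] by auto
  then have \<zeta>: "\<zeta> \<noteq> 0" by auto
  define c where "c = \<alpha> powr (1 / l)"
  have c: "c > 0" using \<alpha> by (simp add: c_def)
  define k where "k = \<alpha> powr (real ?n / l)"
  have k: "k > 0" using \<alpha> by (simp add: k_def)
  \<comment> \<open>Evaluation at \<zeta> / c removes the scaling by \<alpha>^(1/l) inside
    H.\<close>
  let ?z = "(1 / c) *\<^sub>R \<zeta>"
  have cz: "of_real c * cinner ?z w = cinner \<zeta> w" for w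
    using c by (simp add: cinner_scaleR_left)
  let ?\<Phi> = "\<lambda>w :: complex ^ 'n. norm (bH ?n l (cinner \<zeta> w)) * (1 + norm w) powr (- real N)"
  have "(\<integral>\<^sup>+w. ennreal (?\<Phi> w) \<partial>dV) \<le> (\<integral>\<^sup>+w. ennreal (1 / k) * ennreal (norm (bergman_integrand l \<alpha> f ?z w)) \<partial>dV)"
  proof (intro nn_integral_mono)
    fix w :: "complex ^ 'n"
    \<comment> \<open>For \<beta> \<ge> 2 \<alpha> the growth of f outweighs the whole exponential
      weight, and only the polynomial factor is left against H.\<close>
    have "1 \<le> exp (\<beta> / 2 * norm w powr (2 * l)) * exp (- \<alpha> * norm w powr (2 * l))"
    proof -
      have "0 \<le> (\<beta> / 2 - \<alpha>) * norm w powr (2 * l)" using \<beta> by simp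
      then show ?thesis by (simp flip: exp_add add: algebra_simps)
    qed
    then have "?\<Phi> w * 1 \<le> ?\<Phi> w * (exp (\<beta> / 2 * norm w powr (2 * l)) * exp (- \<alpha> * norm w powr (2 * l)))"
      by (intro mult_left_mono) auto
    also have "\<dots> = 1 / k * norm (bergman_integrand l \<alpha> f ?z w)"
      unfolding bergman_integrand_def bergman_kernel_eq[OF l \<alpha>] c_def[symmetric] k_def[symmetric] cz
      using k by (simp add: f_def norm_mult mult_ac)
    finally show "ennreal (?\<Phi> w) \<le> ennreal (1 / k) * ennreal (norm (bergman_integrand l \<alpha> f ?z w))"
      using k by (simp add: ennreal_leI flip: ennreal_mult)
  qed
  also have "\<dots> = ennreal (1 / k) * (\<integral>\<^sup>+w. ennreal (norm (bergman_integrand l \<alpha> f ?z w)) \<partial>dV)"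
  proof -
    have "f \<in> borel_measurable lebesgue" by (rule measurable_completion) simp
    then have [measurable]: "bergman_integrand l \<alpha> f ?z \<in> borel_measurable lebesgue"
      by (rule bergman_integrand_measurable(2)[OF l \<alpha>])
    have "(\<lambda>w. ennreal (norm (bergman_integrand l \<alpha> f ?z w))) \<in> borel_measurable lebesgue" by measurable
    then show ?thesis by (intro nn_integral_cmult) simp
  qed
  also have "\<dots> < \<infinity>"
    using int[of ?z] by (simp add: integrable_iff_bounded ennreal_mult_less_top)
  finally show False using bH_weight_not_integrable[OF l \<zeta>, of N] by simp
qed

theorem theorem1p1:
  fixes l \<alpha> \<beta> \<gamma> \<rho> \<eta> :: real and p q :: ennreal
  assumes "l \<ge> 1" and "\<alpha> > 0" and "\<beta> > 0" and "\<gamma> > 0" and "p \<ge> 1" and "q \<ge> 1"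
  shows "maps_boundedly TYPE('n::finite) l \<alpha> p \<beta> \<rho> q \<gamma> \<eta> \<longleftrightarrow>
    2 * \<alpha> - \<beta> \<noteq> 0 \<and>
    (0 < \<alpha>\<^sup>2 / (2 * \<alpha> - \<beta>) \<and> \<alpha>\<^sup>2 / (2 * \<alpha> - \<beta>) < \<gamma> \<or>
     \<alpha>\<^sup>2 / (2 * \<alpha> - \<beta>) = \<gamma> \<and> p \<le> q \<and>
       \<rho> - \<eta> \<ge> 2 * real CARD('n) * (l - 1) * (recip p - recip q) \<or>
     \<alpha>\<^sup>2 / (2 * \<alpha> - \<beta>) = \<gamma> \<and> q < p \<and>
       \<rho> - \<eta> > 2 * real CARD('n) * (recip q - recip p))"
    (is "?B \<longleftrightarrow> _ \<and> ?R")
proof (cases "\<beta> < 2 * \<alpha>")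
  case False
  have "?B = False" using maps_boundedly_exponent_less[OF assms(1,2,5)] False by blast
  \<comment> \<open>For \<beta> > 2 \<alpha> the quotient is negative, so it is neither positive nor
    equal to \<gamma>; the case \<beta> = 2 \<alpha> is excluded by the first conjunct.\<close>
  moreover have "\<not> (2 * \<alpha> - \<beta> \<noteq> 0 \<and> ?R)"
  proof
    assume "2 * \<alpha> - \<beta> \<noteq> 0 \<and> ?R"
    then have "\<alpha>\<^sup>2 / (2 * \<alpha> - \<beta>) > 0" "2 * \<alpha> - \<beta> < 0" using False \<open>\<gamma> > 0\<close> by auto
    then show False using assms(2) by (simp add: zero_less_divide_iff)
  qed
  ultimately show ?thesis by simp
next
  case True
  have g: "\<alpha>\<^sup>2 / (2 * \<alpha> - \<beta>) > 0" "2 * \<alpha> - \<beta> \<noteq> 0" using True assms(2) by simp_all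
  consider "\<gamma> < \<alpha>\<^sup>2 / (2 * \<alpha> - \<beta>)" | "\<alpha>\<^sup>2 / (2 * \<alpha> - \<beta>) < \<gamma>" | "\<alpha>\<^sup>2 / (2 * \<alpha> - \<beta>) = \<gamma>" by linarith
  then show ?thesis
  proof cases
    case 1
    then have "\<not> ?B" using maps_boundedly_gap[OF assms(1,2) True assms(5,6)] by force
    then show ?thesis using 1 by simp
  next
    case 2
    have ?B by (rule maps_boundedly_sufficient[OF assms(1,2,5,6) True 2])
    then show ?thesis using 2 g by simp
  next
    case 3
    have nec: "\<rho> - \<eta> \<ge> 2 * real CARD('n) * (l - 1) * (recip p - recip q)"
      "q < p \<Longrightarrow> \<rho> - \<eta> > 2 * real CARD('n) * (recip q - recip p)" if ?B
      using sharp_exponent_le[OF assms(1,2) True assms(5,6)] sharp_exponent_less[OF assms(1,2) True assms(5,6)] that unfolding 3 by blast+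
    have suf: ?B if "p \<le> q \<and> \<rho> - \<eta> \<ge> 2 * real CARD('n) * (l - 1) * (recip p - recip q) \<or> q < p \<and> \<rho> - \<eta> > 2 * real CARD('n) * (recip q - recip p)"
      using maps_boundedly_sharp[OF assms(1,2) True assms(5,6)] that unfolding 3 by blast
    show ?thesis
    proof
      assume ?B
      then show "2 * \<alpha> - \<beta> \<noteq> 0 \<and> ?R" using nec g 3 by (cases "p \<le> q") (auto simp: not_le)
    next
      assume "2 * \<alpha> - \<beta> \<noteq> 0 \<and> ?R"
      then show ?B using suf 3 by auto
    qed
  qed
qed

end
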